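(* Let $0\le\lambda\le1$, let $\sigma$ be a state (density operator) on $L_2(\mathbb{R})$, and let $\mathcal{P}_\lambda:\mathcal{B}(L_2(\mathbb{R}))\to\mathcal{B}(L_2(\mathbb{R}))$, $\mathcal{P}_\lambda(x)=\mathrm{Tr}_2[(1\otimes\sigma)U_\lambda^*(x\otimes1)U_\lambda]$, be the Bosonic beam-splitter channel. Let $\partial=(\partial_a,\partial_{a^*})$ with $\partial_a(x)=[a,x]$, $\partial_{a^*}(x)=[a^*,x]$. Then $\partial\mathcal{P}_\lambda=\sqrt{\lambda}\,(\mathcal{P}_\lambda\otimes\mathrm{id}_2)\,\partial$ on Schwartz operators, i.e. $[a,\mathcal{P}_\lambda(x)]=\sqrt\lambda\,\mathcal{P}_\lambda([a,x])$ and $[a^*,\mathcal{P}_\lambda(x)]=\sqrt\lambda\,\mathcal{P}_\lambda([a^*,x])$. Therefore: (i) for any Schwartz operator $x$, $\|\partial\mathcal{P}_\lambda(x)\|\le\sqrt\lambda\,\|\partial x\|$, where $\|\partial x\|=\max\{\|[a,x]\|,\|[a^*,x]\|\}=:\|x\|_L$. In particular $(\mathcal{B}(L_2(\mathbb{R})),\mathcal{B}_L,\mathcal{P}_\lambda)$ has coarse Ricci curvature lower bounded by $1-\sqrt\lambda$. (ii) for any state $\rho$ and any Schwartz operator $x$, $\|\partial\mathcal{P}_\lambda(x)\|_\rho^2\le\lambda\,\|\partial x\|^2_{\mathcal{P}_\lambda^\dagger(\rho)}$. In particular, $(\mathcal{B}(L_2(\mathbb{R})),\mathcal{B}_\partial,\mathcal{P}_\lambda)$,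 whose transportation cost is $\frac12W_{\partial,2}^2$, has coarse Ricci curvature lower bounded by $1-\lambda$.
   Context: $a$ is the annihilation operator $(a\psi)(x)=(x\psi(x)+\psi'(x))/\sqrt2$ on $L_2(\mathbb{R})$, $a^*$ its adjoint; on $L_2(\mathbb{R})\otimes L_2(\mathbb{R})$, $a$ and $b$ denote the annihilation operators of the first and second mode, and $U_\lambda=\exp\big((a^*b-b^*a)\arccos\sqrt\lambda\big)$, so that $U_\lambda^*aU_\lambda=\sqrt\lambda a+\sqrt{1-\lambda}b$, $U_\lambda^*bU_\lambda=-\sqrt{1-\lambda}a+\sqrt\lambda b$. $\mathrm{Tr}_2$ is the partial trace over the second mode; $\mathcal{P}_\lambda^\dagger(\rho)=\rho\circ\mathcal{P}_\lambda$. A Schwartz operator is $x=\int_{\mathbb{R}^2}f(z)e^{i(za+\bar za^* )}dz\,d\bar z$ with $f$ a Schwartz function on $\mathbb{C}\cong\mathbb{R}^2$. A triple with transportation cost $\mathcal{T}$ has coarse Ricci curvature lower bound $\kappa$ if $\mathcal{T}(\omega_1\circ\mathcal{P},\omega_2\circ\mathcal{P})\le(1-\kappa)\mathcal{T}(\omega_1,\omega_2)$ for normal states with $\mathcal{T}(\omega_1,\omega_2)<\infty$ (and $\omega_1\circ E=\omega_2\circ E$, $E$ being the conditional expectation onto the decoherence-free subalgebra $\bigcap_{n\ge1}\{x:\mathcal{P}^n(x^*x)=\mathcal{P}^n(x)^*\mathcal{P}^n(x),\ \mathcal{P}^n(xx^* )=\mathcal{P}^n(x)\mathcal{P}^n(x)^*\}$).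 For $\mathcal{B}_L$ the cost is $W_L(\omega_1,\omega_2)=\sup\{(\omega_1-\omega_2)(x):x=x^*\text{ bounded},\ \|x\|_L\le1\}$. Fix an inverse temperature $\beta>0$. For a state $\rho$, let $\Lambda_\rho(V_1,V_2)=\big(\int_0^1e^{-\beta(\frac12-s)}\rho^sV_1\rho^{1-s}ds,\ \int_0^1e^{\beta(\frac12-s)}\rho^sV_2\rho^{1-s}ds\big)$ and $\|\mathbf V\|_\rho^2=\langle\mathbf V,\Lambda_\rho\mathbf V\rangle$ for the Hilbert–Schmidt inner product. The quantum Wasserstein 2-distance is $W_{\partial,2}(\omega_1,\omega_2)=\inf_\gamma\int_0^1\|\dot\gamma(t)\|_{g,\gamma(t)}dt$ over absolutely continuous curves of states from $\omega_1$ to $\omega_2$, with $\|y\|_{g,\rho}^2=\inf\{\langle\mathbf V,\Lambda_\rho\mathbf V\rangle: y=\partial^*(\Lambda_\rho\mathbf V)\}$, where $\partial^*(V_1,V_2)=[a^*,V_1]+[a,V_2]$. The relation $\mathcal{B}_\partial$ is the one whose transportation cost is $\mathcal{T}_{\mathcal{B}_\partial}=\frac12W_{\partial,2}^2$. *)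

theory Defs
  imports "HOL-Analysis.Analysis"
begin

section \<open>The Hilbert space of square-integrable functions\<close>

definition square_integrable :: "('a::euclidean_space \<Rightarrow> complex) \<Rightarrow> bool" where
  "square_integrable f \<longleftrightarrow>
     f \<in> borel_measurable lborel \<and> integrable lborel (\<lambda>x. (cmod (f x))\<^sup>2)"

definition l2_eq :: "('a::euclidean_space \<Rightarrow> complex) \<Rightarrow> ('a \<Rightarrow> complex) \<Rightarrow> bool" where
  "l2_eq f g \<longleftrightarrow> square_integrable f \<and> square_integrable g \<and> (AE x in lborel. f x = g x)"

lemma square_integrable_zero: "square_integrable (\<lambda>x. 0)"
  by (simp add: square_integrable_def)

lemma integrable_cnj_mult:
  assumes "square_integrable f" "square_integrable g"
  shows "integrable lborel (\<lambda>x. cnj (f x) * g x)"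
proof (rule Bochner_Integration.integrable_bound)
  show "integrable lborel (\<lambda>x. (cmod (f x))\<^sup>2 + (cmod (g x))\<^sup>2)"
    using assms by (auto simp: square_integrable_def)
  show "(\<lambda>x. cnj (f x) * g x) \<in> borel_measurable lborel"
    using assms by (auto simp: square_integrable_def intro!: borel_measurable_times
        borel_measurable_continuous_on[OF continuous_on_cnj[OF continuous_on_id]])
  have "a * b \<le> a\<^sup>2 + b\<^sup>2" if "0 \<le> a" "0 \<le> b" for a b :: real
    using sum_squares_bound[of a b] mult_nonneg_nonneg[OF that] by linarith
  then show "AE x in lborel. norm (cnj (f x) * g x) \<le> norm ((cmod (f x))\<^sup>2 + (cmod (g x))\<^sup>2)"
    by (intro AE_I2) (simp add: norm_mult)
qed

lemma square_integrable_add: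
  assumes "square_integrable f" "square_integrable g"
  shows "square_integrable (\<lambda>x. f x + g x)"
  unfolding square_integrable_def
proof (rule conjI, goal_cases)
  case 1
  show ?case using assms by (auto simp: square_integrable_def)
next
  case 2
  show ?case
  proof (rule Bochner_Integration.integrable_bound)
    show "integrable lborel (\<lambda>x. 2 * (cmod (f x))\<^sup>2 + 2 * (cmod (g x))\<^sup>2)"
      using assms by (auto simp: square_integrable_def)
    show "(\<lambda>x. (cmod (f x + g x))\<^sup>2) \<in> borel_measurable lborel"
      using assms by (auto simp: square_integrable_def)
    have "(cmod (a + b))\<^sup>2 \<le> 2 * (cmod a)\<^sup>2 + 2 * (cmod b)\<^sup>2" for a b
    proof -
      have "(cmod (a + b))\<^sup>2 \<le> (cmod a + cmod b)\<^sup>2"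
        by (intro power_mono norm_triangle_ineq) simp
      also have "\<dots> \<le> 2 * (cmod a)\<^sup>2 + 2 * (cmod b)\<^sup>2"
        using sum_squares_bound[of "cmod a" "cmod b"] by (simp add: power2_sum)
      finally show ?thesis .
    qed
    then show "AE x in lborel. norm ((cmod (f x + g x))\<^sup>2)
        \<le> norm (2 * (cmod (f x))\<^sup>2 + 2 * (cmod (g x))\<^sup>2)"
      by (intro AE_I2) simp
  qed
qed

lemma square_integrable_mult:
  assumes "square_integrable f"
  shows "square_integrable (\<lambda>x. c * f x)"
  using assms by (auto simp: square_integrable_def norm_mult power_mult_distrib)

lemma square_integrable_tensor:
  fixes f :: "'a::euclidean_space \<Rightarrow> complex" and g :: "'b::euclidean_space \<Rightarrow> complex"
  assumes "square_integrable f" "square_integrable g"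
  shows "square_integrable (\<lambda>(x, y). f x * g y)"
proof -
  have [measurable]: "f \<in> borel_measurable lborel" "g \<in> borel_measurable lborel"
    using assms by (auto simp: square_integrable_def)
  have m: "(\<lambda>(x, y). f x * g y) \<in> borel_measurable (lborel \<Otimes>\<^sub>M lborel)"
    by measurable
  have "integrable (lborel \<Otimes>\<^sub>M lborel) (\<lambda>(x, y). (cmod (f x))\<^sup>2 * (cmod (g y))\<^sup>2)"
    using assms by (intro lborel_pair.Fubini_integrable) (auto simp: square_integrable_def)
  then have "integrable (lborel \<Otimes>\<^sub>M lborel) (\<lambda>z. (cmod (case z of (x, y) \<Rightarrow> f x * g y))\<^sup>2)"
    by (simp add: case_prod_unfold norm_mult power_mult_distrib)
  then show ?thesis
    using m by (simp add: square_integrable_def lborel_prod)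
qed

lemma AE_lborel_fst:
  fixes P :: "'a::euclidean_space \<Rightarrow> bool"
  assumes "AE x in lborel. P x"
  shows "AE z in (lborel :: ('a \<times> 'b::euclidean_space) measure). P (fst z)"
proof -
  obtain N where N: "{x. \<not> P x} \<subseteq> N" "N \<in> sets lborel" "emeasure lborel N = 0"
    using assms by (auto elim!: AE_E)
  have "emeasure (lborel \<Otimes>\<^sub>M (lborel :: 'b measure)) (N \<times> UNIV) = emeasure lborel N * emeasure lborel (UNIV :: 'b set)"
    using N by (intro lborel.emeasure_pair_measure_Times) auto
  then have "N \<times> (UNIV :: 'b set) \<in> null_sets lborel"
    using N by (auto simp: null_sets_def lborel_prod[symmetric])
  then show ?thesis
    by (rule AE_I') (use N in auto)
qed

lemma AE_lborel_snd:
  fixes P :: "'b::euclidean_space \<Rightarrow> bool"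
  assumes "AE x in lborel. P x"
  shows "AE z in (lborel :: ('a::euclidean_space \<times> 'b) measure). P (snd z)"
proof -
  obtain N where N: "{x. \<not> P x} \<subseteq> N" "N \<in> sets lborel" "emeasure lborel N = 0"
    using assms by (auto elim!: AE_E)
  have "emeasure ((lborel :: 'a measure) \<Otimes>\<^sub>M lborel) (UNIV \<times> N) = emeasure lborel (UNIV :: 'a set) * emeasure lborel N"
    using N by (intro lborel.emeasure_pair_measure_Times) auto
  then have "(UNIV :: 'a set) \<times> N \<in> null_sets lborel"
    using N by (auto simp: null_sets_def lborel_prod[symmetric])
  then show ?thesis
    by (rule AE_I') (use N in auto)
qed

quotient_type (overloaded) 'a l2 = "'a::euclidean_space \<Rightarrow> complex" / partial: l2_eq
proof (rule part_equivpI)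
  show "\<exists>f::'a \<Rightarrow> complex. l2_eq f f"
    using square_integrable_zero by (auto simp: l2_eq_def)
  show "symp (l2_eq :: ('a \<Rightarrow> complex) \<Rightarrow> _)"
    by (rule sympI) (auto simp: l2_eq_def)
  show "transp (l2_eq :: ('a \<Rightarrow> complex) \<Rightarrow> _)"
    by (rule transpI) (auto simp: l2_eq_def elim: AE_mp)
qed

class scaleC =
  fixes scaleC :: "complex \<Rightarrow> 'a \<Rightarrow> 'a" (infixr \<open>*\<^sub>C\<close> 75)

instantiation l2 :: (euclidean_space) scaleC
begin
lift_definition scaleC_l2 :: "complex \<Rightarrow> 'a l2 \<Rightarrow> 'a l2" is "\<lambda>c f x. c * f x"
  by (auto simp: l2_eq_def square_integrable_mult)
instance ..
end

lift_definition cinner :: "'a::euclidean_space l2 \<Rightarrow> 'a l2 \<Rightarrow> complex"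
  is "\<lambda>f g. LINT x|lborel. cnj (f x) * g x"
  by (intro integral_cong_AE) (auto simp: l2_eq_def square_integrable_def
      intro!: borel_measurable_times borel_measurable_continuous_on[OF continuous_on_cnj[OF continuous_on_id]])

instantiation l2 :: (euclidean_space) ab_group_add
begin
lift_definition zero_l2 :: "'a l2" is "\<lambda>x. 0"
  by (simp add: l2_eq_def square_integrable_zero)
lift_definition plus_l2 :: "'a l2 \<Rightarrow> 'a l2 \<Rightarrow> 'a l2" is "\<lambda>f g x. f x + g x"
  by (auto simp: l2_eq_def square_integrable_add)
lift_definition uminus_l2 :: "'a l2 \<Rightarrow> 'a l2" is "\<lambda>f x. - f x"
  using square_integrable_mult[where c = "-1"] by (auto simp: l2_eq_def)
definition minus_l2 :: "'a l2 \<Rightarrow> 'a l2 \<Rightarrow> 'a l2" where "minus_l2 \<psi> \<phi> = \<psi> + - \<phi>"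
instance
proof
  fix a b c :: "'a l2"
  show "a + b + c = a + (b + c)"
    by transfer (auto simp: l2_eq_def square_integrable_add add.assoc)
  show "a + b = b + a"
    by transfer (auto simp: l2_eq_def square_integrable_add add.commute)
  show "0 + a = a"
    by transfer (auto simp: l2_eq_def square_integrable_add)
  show "- a + a = 0"
    by transfer (auto simp: l2_eq_def square_integrable_zero)
  show "a - b = a + - b"
    by (rule minus_l2_def)
qed
end

lemma cinner_add_right: "cinner \<phi> (\<psi> + \<eta>) = cinner \<phi> \<psi> + cinner \<phi> \<eta>"
  by transfer (auto simp: l2_eq_def integrable_cnj_mult distrib_left)

lemma cinner_scaleC_right: "cinner \<phi> (c *\<^sub>C \<psi>) = c * cinner \<phi> \<psi>"
  by transfer (simp add: mult.left_commute)

lemma cinner_commute: "cinner \<phi> \<psi> = cnj (cinner \<psi> \<phi>)"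
proof (transfer, goal_cases)
  case (1 f g)
  have "(LINT x|lborel. cnj (f x) * g x) = (LINT x|lborel. cnj (cnj (g x) * f x))"
    by (simp add: mult.commute)
  also have "\<dots> = cnj (LINT x|lborel. cnj (g x) * f x)"
    by (rule Bochner_Integration.integral_cnj)
  finally show ?case .
qed

lemma Re_cinner_self:
  fixes f :: "'a::euclidean_space \<Rightarrow> complex"
  assumes "square_integrable f"
  shows "(LINT x|lborel. cnj (f x) * f x) = complex_of_real (LINT x|lborel. (cmod (f x))\<^sup>2)"
proof -
  have "cnj (f x) * f x = complex_of_real ((cmod (f x))\<^sup>2)" for x
    by (metis complex_norm_square mult.commute)
  then show ?thesis by (simp only: integral_complex_of_real)
qed

instantiation l2 :: (euclidean_space) real_inner
begin
definition scaleR_l2 :: "real \<Rightarrow> 'a l2 \<Rightarrow> 'a l2" where "scaleR_l2 r \<psi> = complex_of_real r *\<^sub>C \<psi>"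
definition inner_l2 :: "'a l2 \<Rightarrow> 'a l2 \<Rightarrow> real" where "inner_l2 \<phi> \<psi> = Re (cinner \<phi> \<psi>)"
definition norm_l2 :: "'a l2 \<Rightarrow> real" where "norm_l2 \<psi> = sqrt (inner \<psi> \<psi>)"
definition sgn_l2 :: "'a l2 \<Rightarrow> 'a l2" where "sgn_l2 \<psi> = scaleR (inverse (norm \<psi>)) \<psi>"
definition dist_l2 :: "'a l2 \<Rightarrow> 'a l2 \<Rightarrow> real" where "dist_l2 \<phi> \<psi> = norm (\<phi> - \<psi>)"
definition uniformity_l2 :: "('a l2 \<times> 'a l2) filter" where
  "uniformity_l2 = (INF e\<in>{0<..}. principal {(x, y). dist x y < e})"
definition open_l2 :: "'a l2 set \<Rightarrow> bool" where
  "open_l2 U = (\<forall>x\<in>U. eventually (\<lambda>(x', y). x' = x \<longrightarrow> y \<in> U) uniformity)"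
instance
proof
  fix \<phi> \<psi> \<eta> :: "'a l2" and r s :: real
  show "r *\<^sub>R (\<phi> + \<psi>) = r *\<^sub>R \<phi> + r *\<^sub>R \<psi>" unfolding scaleR_l2_def
    by transfer (auto simp: l2_eq_def square_integrable_add square_integrable_mult distrib_left)
  show "(r + s) *\<^sub>R \<phi> = r *\<^sub>R \<phi> + s *\<^sub>R \<phi>" unfolding scaleR_l2_def
    by transfer (auto simp: l2_eq_def square_integrable_add square_integrable_mult distrib_right)
  show "r *\<^sub>R s *\<^sub>R \<phi> = (r * s) *\<^sub>R \<phi>" unfolding scaleR_l2_def
    by transfer (auto simp: l2_eq_def square_integrable_mult mult.assoc)
  show "1 *\<^sub>R \<phi> = \<phi>" unfolding scaleR_l2_def
    by transfer (auto simp: l2_eq_def)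
  show "inner \<phi> \<psi> = inner \<psi> \<phi>" unfolding inner_l2_def by (subst cinner_commute) simp
  show "inner (\<phi> + \<psi>) \<eta> = inner \<phi> \<eta> + inner \<psi> \<eta>" unfolding inner_l2_def
    by (subst (1 2 3) cinner_commute) (simp add: cinner_add_right)
  show "inner (r *\<^sub>R \<phi>) \<psi> = r * inner \<phi> \<psi>" unfolding inner_l2_def scaleR_l2_def
    by (subst (1 2) cinner_commute) (simp add: cinner_scaleC_right)
  show "0 \<le> inner \<phi> \<phi>" unfolding inner_l2_def
    by transfer (simp add: l2_eq_def Re_cinner_self)
  show "inner \<phi> \<phi> = 0 \<longleftrightarrow> \<phi> = 0" unfolding inner_l2_def
  proof (transfer, goal_cases)
    case (1 f)
    then have "square_integrable f" by (simp add: l2_eq_def)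
    then show ?case
      by (simp add: Re_cinner_self l2_eq_def square_integrable_zero
          integral_nonneg_eq_0_iff_AE square_integrable_def)
  qed
qed (simp_all add: norm_l2_def sgn_l2_def dist_l2_def uniformity_l2_def open_l2_def)
end

text \<open>The Hilbert space tensor product is realised as the space over the product.\<close>

lift_definition tensor :: "'a::euclidean_space l2 \<Rightarrow> 'b::euclidean_space l2 \<Rightarrow> ('a \<times> 'b) l2"
    (infixr \<open>\<otimes>\<close> 70)
  is "\<lambda>f g (x, y). f x * g y"
proof -
  fix f f' :: "'a \<Rightarrow> complex" and g g' :: "'b \<Rightarrow> complex"
  assume a: "l2_eq f f'" "l2_eq g g'"
  have "AE z in lborel. f (fst z) = f' (fst z)" "AE z in lborel. g (snd z) = g' (snd z)"
    using a by (auto simp: l2_eq_def intro!: AE_lborel_fst AE_lborel_snd)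
  then have "AE z in lborel. (case z of (x, y) \<Rightarrow> f x * g y) = (case z of (x, y) \<Rightarrow> f' x * g' y)"
    by eventually_elim (simp add: case_prod_unfold)
  then show "l2_eq (\<lambda>(x, y). f x * g y) (\<lambda>(x, y). f' x * g' y)"
    using a by (simp add: l2_eq_def square_integrable_tensor)
qed


section \<open>Bounded operators\<close>

lemma scaleC_l2_simps:
  fixes \<phi> \<psi> :: "'a::euclidean_space l2"
  shows "c *\<^sub>C (\<phi> + \<psi>) = c *\<^sub>C \<phi> + c *\<^sub>C \<psi>"
    and "c *\<^sub>C (0 :: 'a l2) = 0"
    and "c *\<^sub>C d *\<^sub>C \<psi> = (c * d) *\<^sub>C \<psi>"
    and "r *\<^sub>R c *\<^sub>C \<psi> = c *\<^sub>C r *\<^sub>R \<psi>"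
    and "c *\<^sub>C (- \<psi>) = - (c *\<^sub>C \<psi>)"
proof -
  show add: "c *\<^sub>C (\<phi> + \<psi>) = c *\<^sub>C \<phi> + c *\<^sub>C \<psi>" for \<phi> \<psi> :: "'a l2"
    by transfer (auto simp: l2_eq_def square_integrable_add square_integrable_mult distrib_left)
  show zero: "c *\<^sub>C (0 :: 'a l2) = 0"
    by transfer (simp add: l2_eq_def square_integrable_zero)
  show assoc: "c *\<^sub>C d *\<^sub>C \<psi> = (c * d) *\<^sub>C \<psi>" for c d
    by transfer (simp add: l2_eq_def square_integrable_mult mult.assoc)
  show "r *\<^sub>R c *\<^sub>C \<psi> = c *\<^sub>C r *\<^sub>R \<psi>"
    by (simp add: scaleR_l2_def assoc mult.commute)
  show "c *\<^sub>C (- \<psi>) = - (c *\<^sub>C \<psi>)"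
    using add[of "- \<psi>" \<psi>] by (simp add: zero eq_neg_iff_add_eq_0)
qed

lemma scaleC_l2_diff: "c *\<^sub>C (\<phi> - \<psi>) = c *\<^sub>C \<phi> - c *\<^sub>C (\<psi> :: 'a::euclidean_space l2)"
  using scaleC_l2_simps(1)[of c \<phi> "- \<psi>"] by (simp add: scaleC_l2_simps(5))

lemma norm_scaleC_l2: "norm (c *\<^sub>C \<psi>) = cmod c * norm (\<psi> :: 'a::euclidean_space l2)"
proof -
  have "cinner (c *\<^sub>C \<psi>) \<psi> = cnj c * cinner \<psi> \<psi>"
    using cinner_commute[of "c *\<^sub>C \<psi>" \<psi>] cinner_commute[of \<psi> \<psi>]
    by (metis cinner_scaleC_right complex_cnj_mult)
  then have "cinner (c *\<^sub>C \<psi>) (c *\<^sub>C \<psi>) = c * cnj c * cinner \<psi> \<psi>"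
    by (simp add: cinner_scaleC_right)
  also have "\<dots> = complex_of_real ((cmod c)\<^sup>2) * cinner \<psi> \<psi>"
    by (simp only: complex_norm_square)
  finally have "inner (c *\<^sub>C \<psi>) (c *\<^sub>C \<psi>) = (cmod c)\<^sup>2 * inner \<psi> \<psi>"
    by (simp add: inner_l2_def)
  then show ?thesis by (simp add: norm_l2_def real_sqrt_mult)
qed

definition blinfun_scaleC :: "complex \<Rightarrow> 'a::euclidean_space l2 \<Rightarrow>\<^sub>L 'a l2" where
  "blinfun_scaleC c = Blinfun (\<lambda>\<psi>. c *\<^sub>C \<psi>)"

lemma blinfun_scaleC_apply [simp]: "blinfun_apply (blinfun_scaleC c) \<psi> = c *\<^sub>C \<psi>"
proof -
  have "bounded_linear (\<lambda>\<psi> :: 'a l2. c *\<^sub>C \<psi>)"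
    by (rule bounded_linear_intro[where K = "cmod c"])
       (auto simp: scaleC_l2_simps norm_scaleC_l2 mult.commute)
  then show ?thesis
    by (simp add: blinfun_scaleC_def bounded_linear_Blinfun_apply)
qed

typedef (overloaded) 'a bop =
  "{T :: 'a::euclidean_space l2 \<Rightarrow>\<^sub>L 'a l2. \<forall>c \<psi>. blinfun_apply T (c *\<^sub>C \<psi>) = c *\<^sub>C blinfun_apply T \<psi>}"
  morphisms blinfun_of_bop Abs_bop
proof
  show "id_blinfun \<in> {T :: 'a l2 \<Rightarrow>\<^sub>L 'a l2. \<forall>c \<psi>. blinfun_apply T (c *\<^sub>C \<psi>) = c *\<^sub>C blinfun_apply T \<psi>}"
    by simp
qed

setup_lifting type_definition_bop

definition bop_apply :: "'a::euclidean_space bop \<Rightarrow> 'a l2 \<Rightarrow> 'a l2" (infixr \<open>\<cdot>\<close> 75)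
  where "T \<cdot> \<psi> = blinfun_apply (blinfun_of_bop T) \<psi>"

instantiation bop :: (euclidean_space) "{real_normed_algebra, monoid_mult, scaleC}"
begin
lift_definition zero_bop :: "'a bop" is 0
  by (simp add: scaleC_l2_simps)
lift_definition plus_bop :: "'a bop \<Rightarrow> 'a bop \<Rightarrow> 'a bop" is "(+)"
  by (simp add: scaleC_l2_simps blinfun.add_left)
lift_definition uminus_bop :: "'a bop \<Rightarrow> 'a bop" is uminus
  by (simp add: scaleC_l2_simps blinfun.minus_left)
lift_definition minus_bop :: "'a bop \<Rightarrow> 'a bop \<Rightarrow> 'a bop" is "(-)"
  by (simp add: scaleC_l2_diff blinfun.diff_left)
lift_definition scaleR_bop :: "real \<Rightarrow> 'a bop \<Rightarrow> 'a bop" is scaleR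
  by (simp add: scaleC_l2_simps blinfun.scaleR_left)
lift_definition scaleC_bop :: "complex \<Rightarrow> 'a bop \<Rightarrow> 'a bop"
  is "\<lambda>c T. blinfun_scaleC c o\<^sub>L T"
  by (simp add: scaleC_l2_simps mult.commute)
lift_definition one_bop :: "'a bop" is id_blinfun
  by simp
lift_definition times_bop :: "'a bop \<Rightarrow> 'a bop \<Rightarrow> 'a bop" is "(o\<^sub>L)"
  by simp
lift_definition norm_bop :: "'a bop \<Rightarrow> real" is norm .
lift_definition dist_bop :: "'a bop \<Rightarrow> 'a bop \<Rightarrow> real" is dist .
definition sgn_bop :: "'a bop \<Rightarrow> 'a bop" where "sgn_bop T = scaleR (inverse (norm T)) T"
definition uniformity_bop :: "('a bop \<times> 'a bop) filter" where
  "uniformity_bop = (INF e\<in>{0<..}. principal {(x, y). dist x y < e})"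
definition open_bop :: "'a bop set \<Rightarrow> bool" where
  "open_bop U = (\<forall>x\<in>U. eventually (\<lambda>(x', y). x' = x \<longrightarrow> y \<in> U) uniformity)"
instance
proof
  fix a b c :: "'a bop" and r s :: real
  show "a + b + c = a + (b + c)" by transfer simp
  show "a + b = b + a" by transfer simp
  show "0 + a = a" by transfer simp
  show "- a + a = 0" by transfer simp
  show "a - b = a + - b" by transfer simp
  show "r *\<^sub>R (a + b) = r *\<^sub>R a + r *\<^sub>R b" by transfer (rule scaleR_add_right)
  show "(r + s) *\<^sub>R a = r *\<^sub>R a + s *\<^sub>R a" by transfer (rule scaleR_add_left)
  show "r *\<^sub>R s *\<^sub>R a = (r * s) *\<^sub>R a" by transfer simp
  show "1 *\<^sub>R a = a" by transfer simp
  show "a * b * c = a * (b * c)" by transfer (auto intro: blinfun_eqI)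
  show "(a + b) * c = a * c + b * c" by transfer (auto intro!: blinfun_eqI simp: blinfun.bilinear_simps)
  show "a * (b + c) = a * b + a * c" by transfer (auto intro!: blinfun_eqI simp: blinfun.bilinear_simps)
  show "r *\<^sub>R a * b = r *\<^sub>R (a * b)" by transfer (auto intro!: blinfun_eqI simp: blinfun.bilinear_simps)
  show "a * r *\<^sub>R b = r *\<^sub>R (a * b)" by transfer (auto intro!: blinfun_eqI simp: blinfun.bilinear_simps)
  show "1 * a = a" by transfer (auto intro!: blinfun_eqI)
  show "a * 1 = a" by transfer (auto intro!: blinfun_eqI)
  show "norm (a * b) \<le> norm a * norm b" by transfer (rule norm_blinfun_compose)
  show "norm (a + b) \<le> norm a + norm b" by transfer (rule norm_triangle_ineq)
  show "norm (r *\<^sub>R a) = \<bar>r\<bar> * norm a" by transfer simp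
  show "norm a = 0 \<longleftrightarrow> a = 0" by transfer simp
  show "dist a b = norm (a - b)" by transfer (rule dist_norm)
qed (simp_all add: sgn_bop_def uniformity_bop_def open_bop_def)
end

definition bop_adj :: "'a::euclidean_space bop \<Rightarrow> 'a bop" where
  "bop_adj T = (THE S. \<forall>\<phi> \<psi>. cinner \<phi> (T \<cdot> \<psi>) = cinner (S \<cdot> \<phi>) \<psi>)"

definition pos_op :: "'a::euclidean_space bop \<Rightarrow> bool" where
  "pos_op T \<longleftrightarrow> (\<forall>\<psi>. Im (cinner \<psi> (T \<cdot> \<psi>)) = 0 \<and> 0 \<le> Re (cinner \<psi> (T \<cdot> \<psi>)))"

definition abs_op :: "'a::euclidean_space bop \<Rightarrow> 'a bop" where
  "abs_op T = (THE S. pos_op S \<and> S * S = bop_adj T * T)"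

definition is_onb :: "'a::euclidean_space l2 set \<Rightarrow> bool" where
  "is_onb E \<longleftrightarrow> (\<forall>e\<in>E. \<forall>f\<in>E. cinner e f = (if e = f then 1 else 0)) \<and>
     (\<forall>\<psi>. (\<forall>e\<in>E. cinner e \<psi> = 0) \<longrightarrow> \<psi> = 0)"

text \<open>
  A bounded operator is of trace class iff its diagonal series converges unconditionally in every
  orthonormal basis; the sum is then independent of the basis.
\<close>

definition has_trace :: "'a::euclidean_space bop \<Rightarrow> complex \<Rightarrow> bool" where
  "has_trace T c \<longleftrightarrow> (\<forall>E. is_onb E \<longrightarrow> ((\<lambda>e. cinner e (T \<cdot> e)) has_sum c) E)"

definition trace_class :: "'a::euclidean_space bop \<Rightarrow> bool" where
  "trace_class T \<longleftrightarrow> (\<exists>c. has_trace T c)"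

definition trace :: "'a::euclidean_space bop \<Rightarrow> complex" where
  "trace T = (THE c. has_trace T c)"

definition trace_norm :: "'a::euclidean_space bop \<Rightarrow> real" where
  "trace_norm T = Re (trace (abs_op T))"

definition density_op :: "'a::euclidean_space bop \<Rightarrow> bool" where
  "density_op \<rho> \<longleftrightarrow> pos_op \<rho> \<and> has_trace \<rho> 1"

text \<open>
  Functional calculus for a positive operator whose eigenvectors span the space, in particular
  for a density operator. Since \<^term>\<open>0 powr s = 0\<close> for every \<open>s\<close>, the power with exponent
  \<open>0\<close> is the support projection.
\<close>

definition op_powr :: "'a::euclidean_space bop \<Rightarrow> real \<Rightarrow> 'a bop" where
  "op_powr \<rho> s = (THE T. \<forall>r \<psi>. \<rho> \<cdot> \<psi> = r *\<^sub>R \<psi> \<longrightarrow> T \<cdot> \<psi> = (r powr s) *\<^sub>R \<psi>)"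

definition tensor_op :: "'a::euclidean_space bop \<Rightarrow> 'b::euclidean_space bop \<Rightarrow> ('a \<times> 'b) bop" where
  "tensor_op S T = (THE R. \<forall>\<phi> \<psi>. R \<cdot> (\<phi> \<otimes> \<psi>) = (S \<cdot> \<phi>) \<otimes> (T \<cdot> \<psi>))"

text \<open>
  The partial trace is needed for operators \<open>(1 \<otimes> \<sigma>) Y\<close> with \<open>\<sigma>\<close> of trace class and \<open>Y\<close> bounded,
  which need not be of trace class themselves; hence the definition by matrix elements.
\<close>

definition partial_trace2 :: "('a::euclidean_space \<times> 'b::euclidean_space) bop \<Rightarrow> 'a bop" where
  "partial_trace2 Z = (THE T. \<forall>\<phi> \<psi> E. is_onb E \<longrightarrow>
     ((\<lambda>e. cinner (\<phi> \<otimes> e) (Z \<cdot> (\<psi> \<otimes> e))) has_sum cinner \<phi> (T \<cdot> \<psi>)) E)"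


section \<open>Unbounded operators\<close>

text \<open>Unbounded operators are represented by their graphs.\<close>

type_synonym 'a uop = "('a l2 \<times> 'a l2) set"

definition uop_add :: "'a::euclidean_space uop \<Rightarrow> 'a uop \<Rightarrow> 'a uop" where
  "uop_add A B = {(\<psi>, \<phi> + \<eta>) |\<psi> \<phi> \<eta>. (\<psi>, \<phi>) \<in> A \<and> (\<psi>, \<eta>) \<in> B}"

definition uop_scale :: "complex \<Rightarrow> 'a::euclidean_space uop \<Rightarrow> 'a uop" where
  "uop_scale c A = {(\<psi>, c *\<^sub>C \<phi>) |\<psi> \<phi>. (\<psi>, \<phi>) \<in> A}"

definition uop_comp :: "'a::euclidean_space uop \<Rightarrow> 'a uop \<Rightarrow> 'a uop" where
  "uop_comp A B = B O A"

definition uop_adj :: "'a::euclidean_space uop \<Rightarrow> 'a uop" where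
  "uop_adj A = {(\<phi>, \<eta>). \<forall>(\<psi>, \<xi>)\<in>A. cinner \<phi> \<xi> = cinner \<eta> \<psi>}"

text \<open>
  The exponential of an operator \<open>A\<close> whose closure generates a strongly continuous one-parameter
  group \<open>U\<close> is \<open>U 1\<close>.
\<close>

definition is_c0_group :: "(real \<Rightarrow> 'a::euclidean_space bop) \<Rightarrow> bool" where
  "is_c0_group U \<longleftrightarrow> U 0 = 1 \<and> (\<forall>s t. U (s + t) = U s * U t) \<and>
     (\<forall>\<psi>. continuous_on UNIV (\<lambda>t. U t \<cdot> \<psi>))"

definition generator :: "(real \<Rightarrow> 'a::euclidean_space bop) \<Rightarrow> 'a uop" where
  "generator U = {(\<psi>, \<phi>). ((\<lambda>t. (U t \<cdot> \<psi> - \<psi>) /\<^sub>R t) \<longlongrightarrow> \<phi>) (at 0)}"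

definition uop_exp :: "'a::euclidean_space uop \<Rightarrow> 'a bop" where
  "uop_exp A = (THE T. \<exists>U. is_c0_group U \<and> generator U = closure A \<and> T = U 1)"

text \<open>
  \<open>has_comm A x y\<close>: the commutator \<open>[A, x]\<close> is defined on the domain of \<open>A\<close> and extends to the
  bounded operator \<open>y\<close>.
\<close>

definition has_comm :: "'a::euclidean_space uop \<Rightarrow> 'a bop \<Rightarrow> 'a bop \<Rightarrow> bool" where
  "has_comm A x y \<longleftrightarrow> (\<forall>(\<psi>, \<phi>)\<in>A. (x \<cdot> \<psi>, x \<cdot> \<phi> + y \<cdot> \<psi>) \<in> A)"

definition bounded_comm :: "'a::euclidean_space uop \<Rightarrow> 'a bop \<Rightarrow> bool" where
  "bounded_comm A x \<longleftrightarrow> (\<exists>y. has_comm A x y)"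

definition comm :: "'a::euclidean_space uop \<Rightarrow> 'a bop \<Rightarrow> 'a bop" where
  "comm A x = (THE y. has_comm A x y)"


section \<open>Bosonic modes and the beam splitter\<close>

text \<open>
  The annihilation operator on its maximal domain: \<open>f\<close> is locally absolutely continuous with
  derivative \<open>f'\<close>. As \<open>f\<close> and \<open>x f + f'\<close> are square-integrable, \<open>f'\<close> is locally
  Lebesgue integrable.
\<close>

definition annihilation :: "real uop" where
  "annihilation = {(abs_l2 f, abs_l2 (\<lambda>x. (complex_of_real x * f x + f' x) / sqrt 2))
     |(f :: real \<Rightarrow> complex) (f' :: real \<Rightarrow> complex).
     square_integrable f \<and> square_integrable (\<lambda>x. (complex_of_real x * f x + f' x) / sqrt 2) \<and>
     (\<forall>x y. x \<le> y \<longrightarrow> (f' has_integral (f y - f x)) {x..y})}"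

abbreviation creation :: "real uop" where
  "creation \<equiv> uop_adj annihilation"

definition mode1 :: "(real \<times> real) uop" where
  "mode1 = closure (span {(\<psi> \<otimes> \<phi>, \<eta> \<otimes> \<phi>) |\<psi> \<phi> \<eta>. (\<psi>, \<eta>) \<in> annihilation})"

definition mode2 :: "(real \<times> real) uop" where
  "mode2 = closure (span {(\<phi> \<otimes> \<psi>, \<phi> \<otimes> \<eta>) |\<psi> \<phi> \<eta>. (\<psi>, \<eta>) \<in> annihilation})"

definition beam_unitary :: "real \<Rightarrow> (real \<times> real) bop" where
  "beam_unitary lam = uop_exp (uop_scale (complex_of_real (arccos (sqrt lam)))
     (uop_add (uop_comp (uop_adj mode1) mode2)
        (uop_scale (- 1) (uop_comp (uop_adj mode2) mode1))))"

definition beam_splitter :: "real \<Rightarrow> real bop \<Rightarrow> real bop \<Rightarrow> real bop" where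
  "beam_splitter lam \<sigma> x = partial_trace2
     (tensor_op 1 \<sigma> * bop_adj (beam_unitary lam) * tensor_op x 1 * beam_unitary lam)"

definition weyl :: "complex \<Rightarrow> real bop" where
  "weyl z = uop_exp (uop_scale \<i> (uop_add (uop_scale z annihilation) (uop_scale (cnj z) creation)))"

text \<open>
  \<open>D i j\<close> is the partial derivative of order \<open>i\<close> in the real and \<open>j\<close> in the imaginary part.
\<close>

definition schwartz_fun :: "(complex \<Rightarrow> complex) \<Rightarrow> bool" where
  "schwartz_fun f \<longleftrightarrow> (\<exists>D :: nat \<Rightarrow> nat \<Rightarrow> complex \<Rightarrow> complex. D 0 0 = f \<and>
     (\<forall>i j z. (D i j has_derivative
        (\<lambda>h. Re h *\<^sub>R D (Suc i) j z + Im h *\<^sub>R D i (Suc j) z)) (at z)) \<and>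
     (\<forall>i j k. bounded (range (\<lambda>z. (1 + cmod z) ^ k *\<^sub>R D i j z))))"

text \<open>
  The operator-valued integral is understood weakly. Replacing the complex area element by the
  planar Lebesgue measure only rescales \<open>f\<close>.
\<close>

definition schwartz_op :: "real bop \<Rightarrow> bool" where
  "schwartz_op x \<longleftrightarrow> (\<exists>f. schwartz_fun f \<and>
     (\<forall>\<phi> \<psi>. has_bochner_integral lborel (\<lambda>z. f z * cinner \<phi> (weyl z \<cdot> \<psi>)) (cinner \<phi> (x \<cdot> \<psi>))))"

definition grad :: "real bop \<Rightarrow> real bop \<times> real bop" where
  "grad x = (comm annihilation x, comm creation x)"

definition lip_norm :: "real bop \<Rightarrow> ereal" where
  "lip_norm x = (if bounded_comm annihilation x \<and> bounded_comm creation x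
     then ereal (max (norm (comm annihilation x)) (norm (comm creation x))) else \<infinity>)"


section \<open>Normal states and coarse Ricci curvature\<close>

definition state_of :: "'a::euclidean_space bop \<Rightarrow> 'a bop \<Rightarrow> complex" where
  "state_of \<rho> x = trace (\<rho> * x)"

definition normal_state :: "('a::euclidean_space bop \<Rightarrow> complex) \<Rightarrow> bool" where
  "normal_state \<omega> \<longleftrightarrow> (\<exists>\<rho>. density_op \<rho> \<and> \<omega> = state_of \<rho>)"

definition density_of :: "('a::euclidean_space bop \<Rightarrow> complex) \<Rightarrow> 'a bop" where
  "density_of \<omega> = (THE \<rho>. density_op \<rho> \<and> \<omega> = state_of \<rho>)"

definition predual :: "('a::euclidean_space bop \<Rightarrow> 'a bop) \<Rightarrow> 'a bop \<Rightarrow> 'a bop" where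
  "predual P \<rho> = density_of (state_of \<rho> \<circ> P)"

definition df_subalgebra :: "('a::euclidean_space bop \<Rightarrow> 'a bop) \<Rightarrow> 'a bop set" where
  "df_subalgebra P = (\<Inter>n\<in>{1..}. {x.
     (P ^^ n) (bop_adj x * x) = bop_adj ((P ^^ n) x) * (P ^^ n) x \<and>
     (P ^^ n) (x * bop_adj x) = (P ^^ n) x * bop_adj ((P ^^ n) x)})"

definition cond_exp_onto :: "'a::euclidean_space bop set \<Rightarrow> ('a bop \<Rightarrow> 'a bop) \<Rightarrow> bool" where
  "cond_exp_onto N E \<longleftrightarrow> linear E \<and> (\<forall>c x. E (c *\<^sub>C x) = c *\<^sub>C E x) \<and>
     range E \<subseteq> N \<and> (\<forall>x\<in>N. E x = x) \<and> (\<forall>x. pos_op x \<longrightarrow> pos_op (E x)) \<and>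
     (\<forall>a\<in>N. \<forall>b\<in>N. \<forall>x. E (a * x * b) = a * E x * b)"

text \<open>
  A conditional expectation onto the decoherence-free subalgebra need not be unique. It suffices
  that \<open>\<omega>1\<close> and \<open>\<omega>2\<close> agree after composition with one of them (and nothing is required if there
  is none), so that the curvature bound below holds for any choice of \<open>E\<close>.
\<close>

definition same_df_part ::
  "('a::euclidean_space bop \<Rightarrow> 'a bop) \<Rightarrow> ('a bop \<Rightarrow> complex) \<Rightarrow> ('a bop \<Rightarrow> complex) \<Rightarrow> bool" where
  "same_df_part P \<omega>1 \<omega>2 \<longleftrightarrow> ((\<exists>E. cond_exp_onto (df_subalgebra P) E) \<longrightarrow>
     (\<exists>E. cond_exp_onto (df_subalgebra P) E \<and> \<omega>1 \<circ> E = \<omega>2 \<circ> E))"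

definition coarse_ricci_ge ::
  "(('a::euclidean_space bop \<Rightarrow> complex) \<Rightarrow> ('a bop \<Rightarrow> complex) \<Rightarrow> ereal) \<Rightarrow>
   ('a bop \<Rightarrow> 'a bop) \<Rightarrow> real \<Rightarrow> bool" where
  "coarse_ricci_ge T P \<kappa> \<longleftrightarrow> (\<forall>\<omega>1 \<omega>2. normal_state \<omega>1 \<and> normal_state \<omega>2 \<and>
     T \<omega>1 \<omega>2 < \<infinity> \<and> same_df_part P \<omega>1 \<omega>2 \<longrightarrow>
     T (\<omega>1 \<circ> P) (\<omega>2 \<circ> P) \<le> ereal (1 - \<kappa>) * T \<omega>1 \<omega>2)"

definition cost_lip :: "(real bop \<Rightarrow> complex) \<Rightarrow> (real bop \<Rightarrow> complex) \<Rightarrow> ereal" where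
  "cost_lip \<omega>1 \<omega>2 = (SUP x\<in>{x. bop_adj x = x \<and> lip_norm x \<le> 1}. ereal (Re (\<omega>1 x - \<omega>2 x)))"


section \<open>The quantum Wasserstein distance of order two\<close>

definition weighted_mean :: "real \<Rightarrow> 'a::euclidean_space bop \<Rightarrow> 'a bop \<Rightarrow> 'a bop" where
  "weighted_mean c \<rho> V = (THE T. \<forall>\<phi> \<psi>.
     ((\<lambda>s. exp (c * (1/2 - s)) *\<^sub>R cinner \<phi> (op_powr \<rho> s \<cdot> V \<cdot> op_powr \<rho> (1 - s) \<cdot> \<psi>))
        has_integral cinner \<phi> (T \<cdot> \<psi>)) {0..1})"

definition Lam :: "real \<Rightarrow> 'a::euclidean_space bop \<Rightarrow> 'a bop \<times> 'a bop \<Rightarrow> 'a bop \<times> 'a bop" where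
  "Lam \<beta> \<rho> V = (weighted_mean (- \<beta>) \<rho> (fst V), weighted_mean \<beta> \<rho> (snd V))"

definition hs_inner :: "'a::euclidean_space bop \<times> 'a bop \<Rightarrow> 'a bop \<times> 'a bop \<Rightarrow> complex" where
  "hs_inner V W = trace (bop_adj (fst V) * fst W) + trace (bop_adj (snd V) * snd W)"

definition local_norm_sq :: "real \<Rightarrow> 'a::euclidean_space bop \<Rightarrow> 'a bop \<times> 'a bop \<Rightarrow> real" where
  "local_norm_sq \<beta> \<rho> V = Re (hs_inner V (Lam \<beta> \<rho> V))"

text \<open>
  The form of \<open>\<partial>* (Y1, Y2) = [a*, Y1] + [a, Y2]\<close> at \<open>(\<phi>, \<psi>)\<close>, where \<open>\<phi>a = a \<phi>\<close>, \<open>\<phi>c = a* \<phi>\<close>, and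
  likewise for \<open>\<psi>\<close>. It is defined on the domain of \<open>a\<close> and \<open>a*\<close> without regularity of \<open>Y\<close>.
\<close>

definition dstar_form :: "real bop \<times> real bop \<Rightarrow> real l2 \<Rightarrow> real l2 \<Rightarrow> real l2 \<Rightarrow>
    real l2 \<Rightarrow> real l2 \<Rightarrow> real l2 \<Rightarrow> complex" where
  "dstar_form Y \<phi> \<phi>a \<phi>c \<psi> \<psi>a \<psi>c =
     (cinner \<phi>a (fst Y \<cdot> \<psi>) - cinner \<phi> (fst Y \<cdot> \<psi>c)) +
     (cinner \<phi>c (snd Y \<cdot> \<psi>) - cinner \<phi> (snd Y \<cdot> \<psi>a))"

text \<open>
  In infinite dimension the infimum in the definition of the tangent norm ranges over the Hilbert
  space completion of the pairs of bounded operators with respect to the local norm. An element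
  of the completion is given by a Cauchy sequence \<open>V\<close>, its norm is the limit \<open>r\<close> of the norms, and
  \<open>y = \<partial>* (\<Lambda> V)\<close> holds in the sense of forms.
\<close>

definition tangent_norm :: "real \<Rightarrow> real bop \<Rightarrow> real bop \<Rightarrow> ennreal" where
  "tangent_norm \<beta> \<rho> y = Inf {ennreal r |r V.
     (\<forall>e>0. \<exists>N. \<forall>m\<ge>N. \<forall>n\<ge>N. local_norm_sq \<beta> \<rho> (V m - V n) < e) \<and>
     (\<lambda>n. sqrt (local_norm_sq \<beta> \<rho> (V n))) \<longlonglongrightarrow> r \<and>
     (\<forall>\<phi> \<phi>a \<phi>c \<psi> \<psi>a \<psi>c. (\<phi>, \<phi>a) \<in> annihilation \<and> (\<phi>, \<phi>c) \<in> creation \<and>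
        (\<psi>, \<psi>a) \<in> annihilation \<and> (\<psi>, \<psi>c) \<in> creation \<longrightarrow>
        (\<lambda>n. dstar_form (Lam \<beta> \<rho> (V n)) \<phi> \<phi>a \<phi>c \<psi> \<psi>a \<psi>c) \<longlonglongrightarrow> cinner \<phi> (y \<cdot> \<psi>))}"

definition abs_continuous_curve :: "(real \<Rightarrow> 'a::euclidean_space bop) \<Rightarrow> bool" where
  "abs_continuous_curve \<gamma> \<longleftrightarrow> (\<forall>e>0. \<exists>d>0. \<forall>(n::nat) s t.
     (\<forall>i<n. 0 \<le> s i \<and> s i \<le> t i \<and> t i \<le> 1) \<and>
     (\<forall>i<n. \<forall>j<n. i \<noteq> j \<longrightarrow> {s i<..<t i} \<inter> {s j<..<t j} = {}) \<and>
     (\<Sum>i<n. t i - s i) < d \<longrightarrow>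
     (\<Sum>i<n. trace_norm (\<gamma> (t i) - \<gamma> (s i))) < e)"

definition has_tangent :: "(real \<Rightarrow> 'a::euclidean_space bop) \<Rightarrow> real \<Rightarrow> 'a bop \<Rightarrow> bool" where
  "has_tangent \<gamma> t y \<longleftrightarrow> trace_class y \<and>
     ((\<lambda>s. trace_norm ((\<gamma> s - \<gamma> t) /\<^sub>R (s - t) - y)) \<longlongrightarrow> 0) (at t within {0..1})"

definition W2 :: "real \<Rightarrow> real bop \<Rightarrow> real bop \<Rightarrow> ennreal" where
  "W2 \<beta> \<rho>1 \<rho>2 = Inf {\<integral>\<^sup>+t\<in>{0..1}. tangent_norm \<beta> (\<gamma> t) (y t) \<partial>lborel |\<gamma> y.
     (\<forall>t\<in>{0..1}. density_op (\<gamma> t)) \<and> \<gamma> 0 = \<rho>1 \<and> \<gamma> 1 = \<rho>2 \<and> abs_continuous_curve \<gamma> \<and>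
     (AE t in lborel. t \<in> {0..1} \<longrightarrow> has_tangent \<gamma> t (y t))}"

definition cost_W2 :: "real \<Rightarrow> (real bop \<Rightarrow> complex) \<Rightarrow> (real bop \<Rightarrow> complex) \<Rightarrow> ereal" where
  "cost_W2 \<beta> \<omega>1 \<omega>2 = ereal (1/2) * (enn2ereal (W2 \<beta> (density_of \<omega>1) (density_of \<omega>2)))\<^sup>2"

end

theory Submission
  imports Defs "HOL-Probability.Levy"
begin

text \<open>Nelson's theorem on analytic vectors gives the Weyl operators and the beam splitter unitary as strongly
 continuous groups acting on Hermite functions, and the rotation of the ladder operators by the unitary yields
 \<open>[a, P x] = sqrt lam P [a, x]\<close>. As \<open>P\<close> is a Kraus map, it contracts the operator norm, and by a monotonicity
 theorem of Lieb type the weighted means, which gives both gradient estimates. Dually, a tangent vector of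
 the image curve is represented, by the Riesz theorem in the completion of the local inner product, through
 pairing with commutators \<open>P [a, x]\<close>; a cut-off of one factor makes this pairing available for the
 unbounded \<open>a\<close>.\<close>

text \<open>The factor \<open>sqrt lam\<close> has one source: conjugated by the beam splitter, the
  first annihilation operator is \<open>sqrt lam\<close> times the first mode minus
  \<open>sqrt (1 - lam)\<close> times the second, and the second mode commutes with
  \<open>tensor_op x 1\<close>. Such identities are proved as sesquilinear forms on finite
  combinations of Hermite functions, because \<open>P x\<close> is not known beforehand to preserve
  the domain of an unbounded operator; a core argument then turns them into commutators. Adjoint,
  modulus, partial trace, weighted mean and exponential are definite descriptions, and trace class
  is defined by diagonals in all bases, so each object must first be shown to exist; this is why
  compactness and the spectral theorem are derived from the diagonal series. The monotonicity
  theorem uses neither operator convexity nor finite dimension: it is real interpolation between two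
  quadratic forms, with sums over matrix entries in two unrelated eigenbases. The case
  \<open>lam = 0\<close> stands apart, as dividing by \<open>sqrt lam\<close> is impossible; there
  the images of all states coincide.\<close>

notation bop_apply (infixr "$$" 75)

notation scaleC (infixr "*:" 75)

notation scaleR (infixr "*." 75)

notation LIMSEQ ("((_)/ ----> (_))" [60, 60] 60)

abbreviation (input) ip :: "'a::euclidean_space l2 => 'a l2 => complex" where "ip == cinner"

abbreviation (input) "cor == complex_of_real"

abbreviation (input) "rt n == sqrt (real n)"

abbreviation (input) sqi :: "('a::euclidean_space => complex) => bool" where "sqi == square_integrable"

abbreviation (input) "ann == annihilation"

abbreviation (input) "cre == creation"

abbreviation (input) "BU == beam_unitary"

abbreviation (input) ent :: "(nat => 'a::euclidean_space l2) => 'a bop => nat => nat => real" where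
 "ent e X i j == (cmod (cinner (e i) (bop_apply X (e j))))^2"

section \<open>The Hilbert space\<close>

lemma ip_add_left: "ip (ph + ps) et = ip ph et + ip ps et"
 by (subst (1 2 3) cinner_commute) (simp add: cinner_add_right)

lemma ip_scaleCl: "ip (c *: ph) ps = cnj c * ip ph ps"
 by (subst (1 2) cinner_commute) (simp add: cinner_scaleC_right)

lemma scaleC_one_l2 [simp]: "1 *: ps = (ps :: 'a::euclidean_space l2)"
 using scaleR_one[of ps] by (simp add: scaleR_l2_def del: scaleR_one)

lemma scaleC_add_l2: "(c + d) *: ps = c *: ps + d *: (ps :: 'a::euclidean_space l2)"
 by transfer (auto simp: l2_eq_def square_integrable_add square_integrable_mult distrib_right)

lemma scaleC_zero_left_l2 [simp]: "0 *: ps = (0 :: 'a::euclidean_space l2)"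
 by transfer (simp add: l2_eq_def square_integrable_zero)

lemma scaleC_minus_left_l2: "(- c) *: ps = - (c *: (ps :: 'a::euclidean_space l2))"
 using scaleC_add_l2[of "-c" c ps] by (simp add: eq_neg_iff_add_eq_0)

lemma scaleC_minus_one_l2: "(- 1) *: ps = - (ps :: 'a::euclidean_space l2)"
 by (simp add: scaleC_minus_left_l2)

lemma ip_zero_right [simp]: "ip ph 0 = 0"
 using cinner_scaleC_right[of ph 0 0] by simp

lemma ip_zero_left [simp]: "ip 0 ph = 0"
 using ip_scaleCl[of 0 0 ph] by simp

lemma ip_minus_right: "ip ph (- ps) = - ip ph ps"
 using cinner_scaleC_right[of ph "-1" ps] by (simp add: scaleC_minus_one_l2)

lemma ip_minus_left: "ip (- ph) ps = - ip ph ps"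
 using ip_scaleCl[of "-1" ph ps] by (simp add: scaleC_minus_one_l2)

lemma ip_diff_right: "ip ph (ps - et) = ip ph ps - ip ph et"
 using cinner_add_right[of ph ps "- et"] by (simp add: ip_minus_right)

lemma ip_diff_left: "ip (ph - ps) et = ip ph et - ip ps et"
 using ip_add_left[of ph "- ps" et] by (simp add: ip_minus_left)

lemma ip_scaleRr: "ip ph (r *. ps) = of_real r * ip ph ps"
 by (simp add: scaleR_l2_def cinner_scaleC_right)

lemma ip_scaleR_left: "ip (r *. ph) ps = of_real r * ip ph ps"
 by (simp add: scaleR_l2_def ip_scaleCl)

lemmas ip_simps = cinner_add_right ip_add_left ip_diff_right ip_diff_left
 ip_minus_right ip_minus_left cinner_scaleC_right ip_scaleCl
 ip_scaleRr ip_scaleR_left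

lemma ip_sum_right: "ip ph (sum f I) = (\<Sum>i\<in>I. ip ph (f i))"
 by (induction I rule: infinite_finite_induct) (simp_all add: cinner_add_right)

lemma ip_sum_left: "ip (sum f I) ph = (\<Sum>i\<in>I. ip (f i) ph)"
 by (induction I rule: infinite_finite_induct) (simp_all add: ip_add_left)

lemma ip_self: "ip ps ps = cor ((norm ps)^2)"
proof -
 have "ip ps ps = cnj (ip ps ps)" by (rule cinner_commute)
 hence "Im (ip ps ps) = 0" by (metis complex_cnj_cancel_iff complex.sel(2) cnj.simps(2) equal_neg_zero)
 moreover have "(norm ps)^2 = Re (ip ps ps)"
  using dot_square_norm[of ps] by (simp add: inner_l2_def)
 ultimately show ?thesis by (simp add: complex_eq_iff)
qed

lemma Re_ip_self: "Re (ip ps ps) = (norm ps)^2"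
 by (simp add: ip_self del: of_real_power)

text \<open>Rotating \<open>ps\<close> by the phase \<open>c\<close> makes the product real and
  nonnegative, after which the Cauchy-Schwarz inequality of the real inner product applies.\<close>

lemma norm_ip: "cmod (ip ph ps) <= norm ph * norm ps"
proof (cases "ip ph ps = 0")
 case False
 define c where "c = cnj (sgn (ip ph ps))"
 have c1: "cmod c = 1" using False by (simp add: c_def norm_sgn)
 have "c * ip ph ps = of_real (cmod (ip ph ps))"
  using False by (simp add: c_def sgn_eq divide_simps) (metis complex_norm_square mult.commute power2_eq_square of_real_mult)
 hence "ip ph (c *: ps) = of_real (cmod (ip ph ps))" by (simp add: cinner_scaleC_right)
 hence "cmod (ip ph ps) = inner ph (c *: ps)" by (simp add: inner_l2_def)
 also have "... <= norm ph * norm (c *: ps)" by (rule norm_cauchy_schwarz)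
 finally show ?thesis by (simp add: norm_scaleC_l2 c1)
qed simp

interpretation cinner: bounded_bilinear ip
proof
 show "EX K. ALL a b. norm (ip a b) <= norm a * norm b * K"
  by (intro exI[of _ 1]) (auto intro: norm_ip)
qed (simp_all add: ip_simps scaleR_conv_of_real)

interpretation scaleC_l2: bounded_bilinear "scaleC :: complex => 'a l2 => 'a::euclidean_space l2"
proof
 show "EX K. ALL a b. norm (a *: (b :: 'a l2)) <= norm a * norm b * K"
  by (intro exI[of _ 1]) (simp add: norm_scaleC_l2)
qed (simp_all add: scaleC_l2_simps scaleC_add_l2 scaleR_l2_def scaleR_conv_of_real mult.commute)

lemma ip_eqI: "(!!ph. ip ph ps = ip ph et) ==> ps = et"
proof -
 assume "!!ph. ip ph ps = ip ph et"
 hence "ip (ps - et) (ps - et) = 0" by (simp add: ip_diff_right)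
 thus ?thesis by (simp add: ip_self)
qed

section \<open>Representatives and completeness of the space of square-integrable functions\<close>

lemma l2_cases:
 fixes ps :: "'a::euclidean_space l2"
 obtains f where "sqi f" "ps = abs_l2 f"
proof -
 have "l2_eq (rep_l2 ps) (rep_l2 ps)" by (rule Quotient3_rep_reflp[OF Quotient3_l2])
 moreover have "abs_l2 (rep_l2 ps) = ps" by (rule Quotient3_abs_rep[OF Quotient3_l2])
 ultimately show ?thesis using that by (auto simp: l2_eq_def)
qed

lemma l2_eq_self [simp]: "l2_eq f f \<longleftrightarrow> sqi f"
 by (auto simp: l2_eq_def)

lemma abs_l2_eq_iff:
 "sqi f ==> sqi g ==> abs_l2 f = abs_l2 g \<longleftrightarrow> (AE x in lborel. f x = g x)"
 using Quotient3_rel[OF Quotient3_l2, of f g] by (auto simp: l2_eq_def)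

lemma norm_abs_l2:
 assumes "sqi f"
 shows "(norm (abs_l2 f))^2 = (LINT x|lborel. (cmod (f x))^2)"
proof -
 have "ip (abs_l2 f) (abs_l2 f) = (LINT x|lborel. cnj (f x) * f x)"
  using assms by (simp add: cinner.abs_eq)
 thus ?thesis using assms by (simp add: Re_cinner_self ip_self del: of_real_power)
qed

lemma nn_integral_l2:
 assumes "sqi f"
 shows "(\<integral>\<^sup>+x. ennreal ((cmod (f x))^2) \<partial>lborel) = ennreal ((norm (abs_l2 f))^2)"
 using assms by (simp add: norm_abs_l2 square_integrable_def nn_integral_eq_integral)

lemma sqiI:
 fixes f :: "'a::euclidean_space => complex"
 assumes "f:borel_measurable lborel" "(\<integral>\<^sup>+x. ennreal ((cmod (f x))^2) \<partial>lborel) < \<infinity>"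
 shows "sqi f"
 using assms by (auto simp: square_integrable_def intro!: integrableI_nonneg)

lemma sqi_diff:
 "sqi f ==> sqi g ==> sqi (%x. f x - g x)"
 using square_integrable_add[of f "%x. (-1) * g x"] square_integrable_mult[of g "-1"] by simp

lemma abs_l2_diff:
 assumes "sqi f" "sqi g"
 shows "abs_l2 f - abs_l2 g = abs_l2 (%x. f x - g x)"
 using assms square_integrable_mult[of g "-1"]
 by (simp add: minus_l2_def uminus_l2.abs_eq plus_l2.abs_eq)

lemma abs_l2_add:
 assumes "sqi f" "sqi g"
 shows "abs_l2 f + abs_l2 g = abs_l2 (%x. f x + g x)"
 using assms by (simp add: plus_l2.abs_eq)

text \<open>Minkowski's inequality for partial sums of moduli, the uniform bound behind the majorant
  in the completeness proof.\<close>

lemma sqi_norm_sum: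
 fixes g :: "nat => 'a::euclidean_space => complex"
 assumes "!!k. sqi (g k)"
 shows "sqi (%x. cor (\<Sum>k<n. cmod (g k x))) &
  norm (abs_l2 (%x. cor (\<Sum>k<n. cmod (g k x)))) <= (\<Sum>k<n. norm (abs_l2 (g k)))"
proof (induction n)
 case 0
 thus ?case by (simp add: square_integrable_zero flip: zero_l2_def)
next
 case (Suc n)
 have g: "sqi (%x. cor (cmod (g n x)))"
  using assms[of n] by (auto simp: square_integrable_def)
 have "norm (abs_l2 (%x. cor (cmod (g n x)))) = norm (abs_l2 (g n))"
  using norm_abs_l2[OF g] norm_abs_l2[OF assms[of n]]
  by (intro power2_eq_imp_eq[OF _ norm_ge_zero norm_ge_zero]) simp
 hence "norm (abs_l2 (%x. cor (\<Sum>k<n. cmod (g k x))) + abs_l2 (%x. cor (cmod (g n x))))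
   <= (\<Sum>k<Suc n. norm (abs_l2 (g k)))"
  using Suc by (intro order.trans[OF norm_triangle_ineq]) simp
 thus ?case using Suc g square_integrable_add[OF _ g]
  by (simp add: abs_l2_add)
qed

text \<open>Riesz-Fischer: along a subsequence with geometrically small increments the sum of moduli
  is square integrable by monotone convergence, so the representatives converge almost everywhere;
  Fatou's lemma shows that the pointwise limit is also the norm limit.\<close>

instance l2 :: (euclidean_space) banach
proof
 fix X :: "nat => 'a l2"
 assume X: "Cauchy X"
 have "EX N. ALL m>=N. ALL n>=N. dist (X m) (X n) < (1/2) ^ k" for k :: nat
  using X by (auto simp: Cauchy_def)
 then obtain N where N: "!!k m n. m >= N k ==> n >= N k ==> dist (X m) (X n) < (1/2) ^ k"
  by metis
 \<comment> \<open>The cumulative sum with \<open>+ 1\<close> makes \<open>r\<close> strictly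
   increasing while keeping \<open>r k\<close> beyond the threshold \<open>N k\<close>.\<close>
 define r where "r = (%k. \<Sum>j\<le>k. N j + 1)"
 have r_ge: "r k >= N k" for k
 proof -
  have "N k + 1 <= r k" unfolding r_def by (rule member_le_sum) auto
  thus ?thesis by simp
 qed
 have r_mono: "strict_mono r" by (rule strict_monoI_Suc) (simp add: r_def)
 have "ALL k. EX f. sqi f & X (r k) = abs_l2 f" by (meson l2_cases)
 then obtain f where f: "!!k. sqi (f k)" and Xf: "!!k. X (r k) = abs_l2 (f k)" by metis
 have [measurable]: "f k:borel_measurable lborel" for k using f by (simp add: square_integrable_def)
 define g where "g = (%k x. f (Suc k) x - f k x)"
 have g: "sqi (g k)" for k unfolding g_def by (intro sqi_diff f)
 have [measurable]: "g k:borel_measurable lborel" for k using g by (simp add: square_integrable_def)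
 have ng: "norm (abs_l2 (g k)) < (1/2) ^ k" for k
 proof -
  have "abs_l2 (g k) = X (r (Suc k)) - X (r k)" by (simp add: Xf g_def abs_l2_diff f)
  thus ?thesis
   using N[where k=k and m="r (Suc k)" and n="r k"] r_ge[of k] strict_monoD[OF r_mono, of k "Suc k"] by (simp add: dist_norm)
 qed
 \<comment> \<open>The bound is the square of the geometric sum \<open>2\<close>.\<close>
 have b: "(\<integral>\<^sup>+x. ennreal ((\<Sum>k<n. cmod (g k x))^2) \<partial>lborel) <= 4" for n
 proof -
  have "(\<Sum>k<n. norm (abs_l2 (g k))) <= (\<Sum>k<n. (1/2) ^ k)"
   by (intro sum_mono less_imp_le ng)
  also have "... <= 2" by (simp add: sum_gp_strict)
  finally have "norm (abs_l2 (%x. cor (\<Sum>k<n. cmod (g k x)))) <= 2"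
   using sqi_norm_sum[where g=g and n=n, OF g] by simp
  hence "(norm (abs_l2 (%x. cor (\<Sum>k<n. cmod (g k x)))))^2 <= 2\<^sup>2"
   by (intro power_mono) auto
  hence "(norm (abs_l2 (%x. cor (\<Sum>k<n. cmod (g k x)))))^2 <= 4" by simp
  hence "ennreal ((norm (abs_l2 (%x. cor (\<Sum>k<n. cmod (g k x)))))^2) <= ennreal 4"
   by (rule ennreal_leI)
  thus ?thesis using nn_integral_l2[of "%x. cor (\<Sum>k<n. cmod (g k x))"]
    sqi_norm_sum[where g=g and n=n, OF g] by (simp del: of_real_sum)
 qed
 have "(\<integral>\<^sup>+x. (SUP n. ennreal ((\<Sum>k<n. cmod (g k x))^2)) \<partial>lborel)
   = (SUP n. \<integral>\<^sup>+x. ennreal ((\<Sum>k<n. cmod (g k x))^2) \<partial>lborel)"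
 proof (rule nn_integral_monotone_convergence_SUP)
  have "(\<Sum>k<n. cmod (g k x))^2 <= (\<Sum>k<Suc n. cmod (g k x))^2" for n x
   by (intro power_mono sum_nonneg) auto
  thus "incseq (%n x. ennreal ((\<Sum>k<n. cmod (g k x))^2))"
   by (intro incseq_SucI le_funI ennreal_leI)
 qed measurable
 also have "... <= 4" by (intro SUP_least b)
 also have "(4::ennreal) < \<infinity>" by simp
 finally have "AE x in lborel. (SUP n. ennreal ((\<Sum>k<n. cmod (g k x))^2)) ~= \<infinity>"
  by (intro nn_integral_PInf_AE) auto
 hence conv: "AE x in lborel. convergent (%n. f n x)"
 proof eventually_elim
  case (elim x)
  then obtain B where B: "0 <= B" "(SUP n. ennreal ((\<Sum>k<n. cmod (g k x))^2)) = ennreal B"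
   by (cases "SUP n. ennreal ((\<Sum>k<n. cmod (g k x))^2)") (auto simp: infinity_ennreal_def)
  have "(\<Sum>k<n. cmod (g k x))^2 <= B" for n
  proof -
   have "ennreal ((\<Sum>k<n. cmod (g k x))^2) <= ennreal B" unfolding B(2)[symmetric] by (rule SUP_upper) simp
   thus ?thesis using B by simp
  qed
  hence "(\<Sum>k<n. cmod (g k x)) <= sqrt B" for n by (simp add: real_le_rsqrt)
  hence "summable (%k. cmod (g k x))" by (intro bounded_imp_summable[of _ "sqrt B"]) (auto simp: lessThan_Suc_atMost[symmetric] simp del: sum.lessThan_Suc)
  hence "summable (%k. g k x)" by (rule summable_norm_cancel)
  hence "convergent (%n. (\<Sum>k<n. g k x) + f 0 x)"
   by (intro convergent_add convergent_const) (simp add: summable_iff_convergent)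
  moreover have "(\<Sum>k<n. g k x) + f 0 x = f n x" for n
   using sum_lessThan_telescope[of "%k. f k x" n] by (simp add: g_def)
  ultimately show "convergent (%n. f n x)" by simp
 qed
 \<comment> \<open>Off the convergence set \<open>lim\<close> is unspecified, yet \<open>F\<close>
   stays measurable; only values almost everywhere enter.\<close>
 define F where "F = (%x. lim (%n. f n x))"
 have [measurable]: "F:borel_measurable lborel" unfolding F_def by measurable
 have dF: "sqi (%x. F x - f k x) & norm (abs_l2 (%x. F x - f k x)) <= (1/2) ^ k" for k
 proof -
  have "(\<integral>\<^sup>+x. ennreal ((cmod (F x - f k x))^2) \<partial>lborel)
    = (\<integral>\<^sup>+x. liminf (%n. ennreal ((cmod (f n x - f k x))^2)) \<partial>lborel)"
  proof (rule nn_integral_cong_AE, use conv in eventually_elim)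
   case (elim x)
   hence "(%n. f n x) ----> F x" unfolding F_def by (simp add: convergent_LIMSEQ_iff)
   hence "(%n. ennreal ((cmod (f n x - f k x))^2)) ----> ennreal ((cmod (F x - f k x))^2)"
    by (intro tendsto_intros)
   thus ?case by (rule lim_imp_Liminf[OF trivial_limit_sequentially, symmetric])
  qed
  also have "... <= liminf (%n. \<integral>\<^sup>+x. ennreal ((cmod (f n x - f k x))^2) \<partial>lborel)"
   by (rule nn_integral_liminf) measurable
  also have "... <= liminf (%n. ennreal (((1/2)^k)^2))"
  proof (rule Liminf_mono, rule eventually_sequentiallyI[of k])
   fix n assume "k <= n"
   hence "r k <= r n" using r_mono by (simp add: strict_mono_less_eq)
   hence "norm (X (r n) - X (r k)) <= (1/2)^k" using N[where k=k and m="r n" and n="r k"] r_ge[of k] by (simp add: dist_norm less_imp_le)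
   hence "(norm (abs_l2 (%x. f n x - f k x)))^2 <= ((1/2)^k)^2"
    by (intro power_mono) (auto simp: Xf abs_l2_diff f)
   thus "(\<integral>\<^sup>+x. ennreal ((cmod (f n x - f k x))^2) \<partial>lborel) <= ennreal (((1/2)^k)^2)"
    by (subst nn_integral_l2) (auto intro!: sqi_diff f ennreal_leI)
  qed
  also have "... = ennreal (((1/2)^k)^2)" by (simp add: Liminf_const)
  finally have le: "(\<integral>\<^sup>+x. ennreal ((cmod (F x - f k x))^2) \<partial>lborel) <= ennreal (((1/2)^k)^2)" .
  hence si: "sqi (%x. F x - f k x)"
   by (intro sqiI) (auto intro: order.strict_trans1)
  have "(norm (abs_l2 (%x. F x - f k x)))^2 <= ((1/2)^k)^2"
   using le unfolding nn_integral_l2[OF si] by simp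
  hence "norm (abs_l2 (%x. F x - f k x)) <= (1/2)^k" by (simp add: power2_le_iff_abs_le)
  with si show ?thesis by blast
 qed
 have F: "sqi F" using square_integrable_add[OF conjunct1[OF dF[of 0]] f[of 0]] by simp
 have nF: "norm (abs_l2 F - X (r k)) <= (1/2)^k" for k
  using dF[of k] by (simp add: Xf abs_l2_diff F f)
 have "(%k. X (r k)) ----> abs_l2 F"
 proof (rule LIM_zero_cancel, rule Lim_null_comparison[OF _ LIMSEQ_power_zero[of "1/2::real"]])
  show "\<forall>\<^sub>F k in sequentially. norm (X (r k) - abs_l2 F) <= (1/2)^k"
   using nF by (simp add: norm_minus_commute)
 qed simp
 thus "convergent X" using Cauchy_converges_subseq[OF X r_mono] by (auto simp: convergent_def o_def)
qed

text \<open>The form need not be definite and the space need not be complete, so that the lemma also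
 yields Cauchy sequences representing elements of an abstract completion.\<close>

lemma semi_inner_riesz:
 fixes b :: "'v::real_vector => 'v => real" and l :: "'v => real"
 assumes b_add: "!!x y z. b (x + y) z = b x z + b y z"
  and b_scale: "!!r x z. b (r *. x) z = r * b x z"
  and b_sym: "!!x y. b x y = b y x" and b_pos: "!!x. 0 <= b x x"
  and l_add: "!!x y. l (x + y) = l x + l y" and l_scale: "!!r x. l (r *. x) = r * l x"
  and bound: "!!x. abs (l x) <= C * sqrt (b x x)" and C: "0 <= C"
 obtains w r where "ALL e>0. EX N. ALL m>=N. ALL n>=N. b (w m - w n) (w m - w n) < e"
  and "!!x. (%n. b (w n) x) ----> l x"
  and "(%n. sqrt (b (w n) (w n))) ----> r" "0 <= r" "r <= C"
proof -
 have b_add2: "b z (x + y) = b z x + b z y" for x y z using b_add[of x y z] b_sym by metis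
 have b_scale2: "b z (r *. x) = r * b z x" for r x z using b_scale[of r x z] b_sym by metis
 have b_diff: "b (x - y) z = b x z - b y z" for x y z
  using b_add[of x "(-1) *. y" z] b_scale[of "-1" y z] by simp
 have b_diff2: "b z (x - y) = b z x - b z y" for x y z using b_diff[of x y z] b_sym by metis
 have l_diff: "l (x - y) = l x - l y" for x y
  using l_add[of x "(-1) *. y"] l_scale[of "-1" y] by simp
 \<comment> \<open>A representing vector would minimise this quadratic functional; a minimising
   sequence takes its place.\<close>
 define J where "J = (%x. b x x - 2 * l x)"
 have J_ge: "- C\<^sup>2 <= J x" for x
 proof -
  have "0 <= (sqrt (b x x) - C)^2" by simp
  hence "2 * (C * sqrt (b x x)) <= b x x + C\<^sup>2"
   using b_pos[of x] by (simp add: power2_diff mult_ac)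
  thus ?thesis using bound[of x] by (simp add: J_def)
 qed
 define m where "m = Inf (range J)"
 have bdd: "bdd_below (range J)" using J_ge by (intro bdd_belowI[of _ "- C\<^sup>2"]) auto
 have m_le: "m <= J x" for x unfolding m_def by (intro cInf_lower bdd) auto
 have "EX x. J x < m + inverse (real (Suc n))" for n
  using cInf_lessD[of "range J" "m + inverse (real (Suc n))"] by (auto simp: m_def)
 then obtain w where w: "!!n. J (w n) < m + inverse (real (Suc n))" by metis
 have J_lim: "(%n. J (w n)) ----> m"
 proof (rule tendsto_sandwich[OF _ _ tendsto_const])
  show "(%n. m + inverse (real (Suc n))) ----> m"
   using tendsto_add[OF tendsto_const LIMSEQ_inverse_real_of_nat, of m] by simp
 qed (use w m_le in "auto intro!: always_eventually less_imp_le")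
 \<comment> \<open>The parallelogram law at the midpoint shows that minimising sequences are
   Cauchy.\<close>
 have close: "b (x - y) (x - y) <= 2 * (J x - m) + 2 * (J y - m)" for x y
 proof -
  have "b (x - y) (x - y) + 4 * J ((1/2) *. (x + y)) = 2 * J x + 2 * J y"
   using b_sym[of x y] by (simp add: J_def b_diff b_diff2 b_add b_add2 b_scale b_scale2 l_scale l_add algebra_simps)
  thus ?thesis using m_le[of "(1/2) *. (x + y)"] by (simp add: algebra_simps)
 qed
 have cauchy: "ALL e>0. EX N. ALL m>=N. ALL n>=N. b (w m - w n) (w m - w n) < e"
 proof (intro allI impI)
  fix e :: real assume e: "0 < e"
  then obtain N where N: "!!n. n >= N ==> (abs (J (w n) - m)) < e / 4"
   using LIMSEQ_D[OF J_lim, of "e/4"] by auto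
  have "b (w i - w j) (w i - w j) < e" if "N <= i" "N <= j" for i j
  proof -
   have "b (w i - w j) (w i - w j) <= 2 * (J (w i) - m) + 2 * (J (w j) - m)" by (rule close)
   thus ?thesis using N[OF that(1)] N[OF that(2)] by argo
  qed
  thus "EX N. ALL m>=N. ALL n>=N. b (w m - w n) (w m - w n) < e" by blast
 qed
 have near: "(b (w n) x - l x)^2 <= (J (w n) - m) * (b x x + 1)" for n x
 proof -
  define c where "c = b (w n) x - l x"
  \<comment> \<open>The minimiser of the quadratic in the step length, with \<open>b x x\<close>
    enlarged by \<open>1\<close> so that no degenerate direction leads to division by zero.\<close>
  define t where "t = - c / (b x x + 1)"
  have p: "0 < b x x + 1" using b_pos[of x] by simp
  have "m <= J (w n + t *. x)" by (rule m_le)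
  also have "J (w n + t *. x) = J (w n) + t * t * b x x + 2 * t * c"
   using b_sym[of x "w n"] by (simp add: J_def b_add b_add2 b_scale b_scale2 l_add l_scale c_def algebra_simps)
  also have "... <= J (w n) + t * t * (b x x + 1) + 2 * t * c" by (simp add: distrib_left)
  also have "... = J (w n) - c\<^sup>2 / (b x x + 1)"
   using p by (simp add: t_def power2_eq_square)
  finally have "c\<^sup>2 / (b x x + 1) <= J (w n) - m" by simp
  thus ?thesis using p by (simp add: c_def pos_divide_le_eq)
 qed
 have conv: "(%n. b (w n) x) ----> l x" for x
 proof -
  have "(%n. (J (w n) - m) * (b x x + 1)) ----> (m - m) * (b x x + 1)" by (intro tendsto_intros J_lim)
  hence "(%n. (b (w n) x - l x)^2) ----> 0"
   using near by (intro Lim_null_comparison[of "%n. (b (w n) x - l x)^2" "%n. (J (w n) - m) * (b x x + 1)"]) auto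
  from tendsto_real_sqrt[OF this] have "(%n. b (w n) x - l x) ----> 0"
   by (simp add: tendsto_rabs_zero_iff)
  thus ?thesis by (rule LIM_zero_cancel)
 qed
 have "Cauchy (%n. l (w n))"
 proof (rule metric_CauchyI)
  fix e :: real assume e: "0 < e"
  hence "0 < (e / (C + 1))^2" using C by simp
  then obtain N where N: "!!i j. i >= N ==> j >= N ==> b (w i - w j) (w i - w j) < (e / (C + 1))^2"
   using cauchy by meson
  have "dist (l (w i)) (l (w j)) < e" if "N <= i" "N <= j" for i j
  proof -
   have "sqrt (b (w i - w j) (w i - w j)) < e / (C + 1)"
    using N[OF that] e C by (intro real_less_lsqrt) auto
   hence "(C + 1) * sqrt (b (w i - w j) (w i - w j)) < e" using C by (simp add: pos_less_divide_eq mult.commute)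
   moreover have "abs (l (w i - w j)) <= (C + 1) * sqrt (b (w i - w j) (w i - w j))"
    using bound[of "w i - w j"] b_pos[of "w i - w j"] by (simp add: distrib_right add_increasing2)
   ultimately show ?thesis by (simp add: l_diff dist_real_def)
  qed
  thus "EX M. ALL m>=M. ALL n>=M. dist (l (w m)) (l (w n)) < e" by blast
 qed
 then obtain s where s: "(%n. l (w n)) ----> s" using Cauchy_convergent_iff convergent_def by blast
 have "(%n. J (w n) + 2 * l (w n)) ----> m + 2 * s" by (intro tendsto_intros J_lim s)
 hence bw: "(%n. b (w n) (w n)) ----> m + 2 * s" by (simp add: J_def)
 hence r: "(%n. sqrt (b (w n) (w n))) ----> sqrt (m + 2 * s)" by (rule tendsto_real_sqrt)
 have r0: "0 <= m + 2 * s" using b_pos by (intro LIMSEQ_le_const[OF bw]) auto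
 \<comment> \<open>Testing the sequence against itself shows that
   \<open>b (w n) (w n) - l (w n)\<close> tends to \<open>0\<close>, hence \<open>m = - s\<close>.
   The squared limit norm is therefore \<open>s\<close>, the limit of \<open>l (w n)\<close>, and
   \<open>s\<close> is at most \<open>C\<close> times the limit norm.\<close>
 have "(%n. (J (w n) - m) * (b (w n) (w n) + 1)) ----> (m - m) * (m + 2 * s + 1)"
  by (intro tendsto_intros J_lim bw)
 hence "(%n. (b (w n) (w n) - l (w n))^2) ----> 0"
  using near by (intro Lim_null_comparison[of "%n. (b (w n) (w n) - l (w n))^2" "%n. (J (w n) - m) * (b (w n) (w n) + 1)"]) auto
 moreover have "(%n. (b (w n) (w n) - l (w n))^2) ----> (m + 2 * s - s)^2" by (intro tendsto_intros bw s)
 ultimately have "m + 2 * s - s = 0" using LIMSEQ_unique by fastforce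
 moreover have "s <= C * sqrt (m + 2 * s)"
  by (rule LIMSEQ_le[OF s tendsto_mult_left[OF r]]) (use bound abs_le_D1 in blast)
 ultimately have "(sqrt (m + 2 * s))^2 <= C * sqrt (m + 2 * s)" using r0 by simp
 hence "sqrt (m + 2 * s) * sqrt (m + 2 * s) <= C * sqrt (m + 2 * s)" unfolding power2_eq_square .
 hence "sqrt (m + 2 * s) <= C"
  using C r0 mult_right_le_imp_le[of "sqrt (m + 2 * s)" "sqrt (m + 2 * s)" C]
  by (cases "sqrt (m + 2 * s) = 0") (auto simp: less_le)
 thus ?thesis using that[OF cauchy conv r] r0 by simp
qed

text \<open>The real statement is applied to \<open>Re F\<close>, and completeness supplies the
  limit of the minimising sequence. \<open>F\<close> is antilinear because it is represented in the
  antilinear first argument of \<open>cinner\<close>.\<close>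

lemma riesz_l2:
 fixes F :: "'a::euclidean_space l2 => complex"
 assumes add: "!!ph ps. F (ph + ps) = F ph + F ps" and scale: "!!c ph. F (c *: ph) = cnj c * F ph"
  and bound: "!!ph. cmod (F ph) <= K * norm ph" and K: "0 <= K"
 shows "EX et. (ALL ph. ip ph et = F ph) & norm et <= K"
proof -
 obtain w r where w: "ALL e>0. EX N. ALL m>=N. ALL n>=N. inner (w m - w n) (w m - w n) < e"
  and conv: "!!x. (%n. inner (w n) x) ----> Re (F x)"
  and r: "(%n. sqrt (inner (w n) (w n))) ----> r" "0 <= r" "r <= K"
 proof (rule semi_inner_riesz[of "inner :: 'a l2 => 'a l2 => real" "%x. Re (F x)" K])
  show "abs (Re (F x)) <= K * sqrt (inner x x)" for x
   using bound[of x] abs_Re_le_cmod[of "F x"] by (simp add: norm_eq_sqrt_inner)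
  show "Re (F (r *. x)) = r * Re (F x)" for r x using scale[of "of_real r" x] by (simp add: scaleR_l2_def)
 qed (auto simp: inner_simps inner_commute add K)
 have "Cauchy w"
 proof (rule metric_CauchyI)
  fix e :: real assume "0 < e"
  hence "0 < e\<^sup>2" by simp
  then obtain N where "!!i j. i >= N ==> j >= N ==> (norm (w i - w j))^2 < e\<^sup>2"
   using w by (metis dot_square_norm)
  thus "EX M. ALL m>=M. ALL n>=M. dist (w m) (w n) < e"
   using \<open>0 < e\<close> by (auto simp: dist_norm intro!: exI[of _ N] power2_less_imp_less[of _ e])
 qed
 then obtain et where et: "w ----> et" using Cauchy_convergent_iff convergent_def by blast
 have Re: "inner et x = Re (F x)" for x
  using LIMSEQ_unique[OF tendsto_inner[OF et tendsto_const] conv] .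
 have "ip ph et = F ph" for ph
 proof (rule complex_eqI)
  show "Re (ip ph et) = Re (F ph)" using Re[of ph] inner_commute[of et ph] by (simp add: inner_l2_def)
  \<comment> \<open>By antilinearity the imaginary part of \<open>F ph\<close> is the real part of
    \<open>F (\<i> *: ph)\<close>.\<close>
  show "Im (ip ph et) = Im (F ph)"
   using Re[of "\<i> *: ph"] inner_commute[of et "\<i> *: ph"] by (simp add: inner_l2_def ip_scaleCl scale)
 qed
 moreover have "norm et <= K"
  using LIMSEQ_unique[OF tendsto_norm[OF et] r(1)[folded norm_eq_sqrt_inner]] r(3) by simp
 ultimately show ?thesis by blast
qed

subsection \<open>Bounded operators\<close>

lemma bop_apply_add: "T$$(ph + ps) = T$$ph + T$$ps"
 and bop_apply_diff: "T$$(ph - ps) = T$$ph - T$$ps"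
 and bop_apply_minus: "T$$(- ps) = - (T$$ps)"
 and bop_apply_zero [simp]: "T$$0 = 0"
 and bop_apply_scaleR: "T$$(r *. ps) = r *. (T$$ps)"
 by (simp_all add: bop_apply_def blinfun.bilinear_simps)

lemma bop_apply_scaleC: "T$$(c *: ps) = c *: (T$$ps)"
 unfolding bop_apply_def using blinfun_of_bop[of T] by simp

lemma bop_apply_sum: "T$$(sum f I) = (\<Sum>i\<in>I. T$$f i)"
 by (simp add: bop_apply_def blinfun.sum_right)

lemma bop_plus_apply: "(S + T)$$ps = S$$ps + T$$ps"
 by (simp add: bop_apply_def plus_bop.rep_eq blinfun.bilinear_simps)
lemma bop_minus_apply: "(S - T)$$ps = S$$ps - T$$ps"
 by (simp add: bop_apply_def minus_bop.rep_eq blinfun.bilinear_simps)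
lemma bop_uminus_apply: "(- T)$$ps = - (T$$ps)"
 by (simp add: bop_apply_def uminus_bop.rep_eq blinfun.bilinear_simps)
lemma bop_zero_apply [simp]: "0$$ps = 0"
 by (simp add: bop_apply_def zero_bop.rep_eq)
lemma bop_one_apply [simp]: "1$$ps = ps"
 by (simp add: bop_apply_def one_bop.rep_eq)
lemma bop_times: "(S * T)$$ps = S$$T$$ps"
 by (simp add: bop_apply_def times_bop.rep_eq)
lemma bop_scaleR_apply: "(r *. T)$$ps = r *. (T$$ps)"
 by (simp add: bop_apply_def scaleR_bop.rep_eq blinfun.bilinear_simps)
lemma bop_scaleC_apply: "(c *: T)$$ps = c *: (T$$ps)"
 by (simp add: bop_apply_def scaleC_bop.rep_eq)

lemma bop_sum_apply: "(sum f I)$$ps = (\<Sum>i\<in>I. f i$$ps)"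
 by (induction I rule: infinite_finite_induct) (simp_all add: bop_plus_apply)

lemmas bop_simps = bop_apply_add bop_apply_diff bop_apply_minus bop_apply_scaleR bop_apply_scaleC
 bop_plus_apply bop_minus_apply bop_uminus_apply bop_times bop_scaleR_apply bop_scaleC_apply

lemma bop_eqI: "(!!ps. S$$ps = T$$ps) ==> S = T"
 unfolding bop_apply_def by (metis blinfun_eqI blinfun_of_bop_inject)

lemma bop_eqI_form: "(!!ph ps. ip ph (S$$ps) = ip ph (T$$ps)) ==> S = T"
 by (intro bop_eqI ip_eqI)

lemma norm_bop_apply: "norm (T$$ps) <= norm T * norm ps"
 unfolding bop_apply_def norm_bop.rep_eq by (rule norm_blinfun)

lemma norm_bop_leI: "0 <= K ==> (!!ps. norm (T$$ps) <= K * norm ps) ==> norm T <= K"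
 unfolding bop_apply_def norm_bop.rep_eq by (rule norm_blinfun_bound)

lemma norm_le_by_ip:
 assumes "!!ph. cmod (ip ph ps) <= K * norm ph" "0 <= K"
 shows "norm ps <= K"
proof (cases "ps = 0")
 case False
 have "norm ps * norm ps <= K * norm ps"
  using assms(1)[of ps] by (simp add: ip_self power2_eq_square norm_mult)
 thus ?thesis using False by simp
qed (use assms in simp)

lemma bounded_linear_bop: "bounded_linear (%ps. T$$ps)"
 unfolding bop_apply_def by (rule blinfun.bounded_linear_right)

lemmas tendsto_bop = bounded_linear.tendsto[OF bounded_linear_bop]

lemma bop_exists:
 fixes f :: "'a::euclidean_space l2 => 'a l2"
 assumes "!!ph ps. f (ph + ps) = f ph + f ps" "!!c ps. f (c *: ps) = c *: f ps"
  and "!!ps. norm (f ps) <= K * norm ps"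
 shows "EX T. ALL ps. T$$ps = f ps"
proof -
 have bl: "bounded_linear f"
  using assms by (intro bounded_linear_intro[where K=K]) (auto simp: scaleR_l2_def mult.commute)
 hence "blinfun_of_bop (Abs_bop (Blinfun f)) = Blinfun f"
  by (intro Abs_bop_inverse) (simp add: bounded_linear_Blinfun_apply assms)
 hence "Abs_bop (Blinfun f)$$ps = f ps" for ps
  unfolding bop_apply_def using bl by (simp add: bounded_linear_Blinfun_apply)
 thus ?thesis by blast
qed

text \<open>Bounded sesquilinear forms and operators correspond to each other; operators given by
  weakly convergent sums or integrals are obtained from here, together with a norm bound.\<close>

lemma bop_of_form:
 fixes B :: "'a::euclidean_space l2 => 'a l2 => complex"
 assumes "!!ph ph' ps. B (ph + ph') ps = B ph ps + B ph' ps" "!!c ph ps. B (c *: ph) ps = cnj c * B ph ps"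
  and "!!ph ps ps'. B ph (ps + ps') = B ph ps + B ph ps'" "!!c ph ps. B ph (c *: ps) = c * B ph ps"
  and bound: "!!ph ps. cmod (B ph ps) <= K * norm ph * norm ps" and K: "0 <= K"
 shows "EX T. (ALL ph ps. ip ph (T$$ps) = B ph ps) & norm T <= K"
proof -
 have "EX et. (ALL ph. ip ph et = B ph ps) & norm et <= K * norm ps" for ps
  by (intro riesz_l2) (use bound[of _ ps] K in "auto simp: assms(1,2) mult_ac")
 then obtain f where f: "!!ph ps. ip ph (f ps) = B ph ps" "!!ps. norm (f ps) <= K * norm ps" by metis
 have "EX T. ALL ps. T$$ps = f ps"
  using f(2) by (intro bop_exists[where K=K] ip_eqI) (simp_all add: f(1) assms ip_simps)
 then obtain T where T: "!!ps. T$$ps = f ps" by blast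
 have "norm T <= K" using K f(2) by (intro norm_bop_leI) (simp_all add: T)
 thus ?thesis using f(1) T by (intro exI[of _ T]) simp
qed

lemma bop_adj_exists: "EX S. ALL ph ps. ip (S$$ph) ps = ip ph (T$$ps)"
proof -
 have "cmod (ip (T$$ph) ps) <= norm T * norm ph * norm ps" for ph ps
  using norm_ip[of "T$$ph" ps] mult_right_mono[OF norm_bop_apply[of T ph] norm_ge_zero[of ps]] by simp
 hence "EX S. (ALL ph ps. ip ph (S$$ps) = ip (T$$ph) ps) & norm S <= norm T"
  by (intro bop_of_form) (auto simp: bop_simps ip_simps)
 thus ?thesis by (metis cinner_commute)
qed

lemma ip_adjl: "ip (bop_adj T$$ph) ps = ip ph (T$$ps)"
proof -
 obtain S where S: "ALL ph ps. ip ph (T$$ps) = ip (S$$ph) ps" using bop_adj_exists[of T] by metis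
 have "bop_adj T = S" unfolding bop_adj_def
 proof (rule the_equality)
  fix S' assume "ALL ph ps. ip ph (T$$ps) = ip (S'$$ph) ps"
  thus "S' = S" using S by (intro bop_eqI ip_eqI) (metis cinner_commute)
 qed (use S in blast)
 thus ?thesis using S by simp
qed

lemma ip_adjr: "ip ph (bop_adj T$$ps) = ip (T$$ph) ps"
 by (metis ip_adjl cinner_commute)

lemma bop_adj_eqI: "(!!ph ps. ip ph (S$$ps) = ip (T$$ph) ps) ==> bop_adj T = S"
 by (rule bop_eqI_form) (simp add: ip_adjr)

lemma bop_adj_adj [simp]: "bop_adj (bop_adj T) = T"
 by (rule bop_adj_eqI) (simp add: ip_adjl)

lemma bop_adj_simps:
 "bop_adj (S + T) = bop_adj S + bop_adj T" "bop_adj (S - T) = bop_adj S - bop_adj T"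
 "bop_adj (S * T) = bop_adj T * bop_adj S" "bop_adj (c *: T) = cnj c *: bop_adj T"
 "bop_adj (r *. T) = r *. bop_adj T" "bop_adj 1 = (1 :: 'a::euclidean_space bop)"
 "bop_adj 0 = (0 :: 'a bop)"
 by (rule bop_adj_eqI; simp add: bop_simps ip_simps ip_adjr)+

lemma norm_bop_adj_le: "norm (bop_adj T) <= norm T"
proof (rule norm_bop_leI)
 fix ps show "norm (bop_adj T$$ps) <= norm T * norm ps"
 proof (rule norm_le_by_ip)
  fix ph
  show "cmod (ip ph (bop_adj T$$ps)) <= norm T * norm ps * norm ph"
   using norm_ip[of "T$$ph" ps] mult_right_mono[OF norm_bop_apply[of T ph] norm_ge_zero[of ps]]
   by (simp add: ip_adjr mult_ac)
 qed simp
qed simp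

lemma norm_bop_adj [simp]: "norm (bop_adj T) = norm T"
 using norm_bop_adj_le[of T] norm_bop_adj_le[of "bop_adj T"] by simp

subsection \<open>Orthonormal families\<close>

text \<open>Families instead of sets, so that index shifts and pairs of indices can be used;
  \<open>is_onb\<close> is the case of the identity family.\<close>

definition ortho_on :: "('i => 'a::euclidean_space l2) => 'i set => bool" where
 "ortho_on h I \<longleftrightarrow> (ALL i:I. ALL j:I. ip (h i) (h j) = (if i = j then 1 else 0))"

definition onb_on :: "('i => 'a::euclidean_space l2) => 'i set => bool" where
 "onb_on h I \<longleftrightarrow> ortho_on h I & (ALL ps. (ALL i:I. ip (h i) ps = 0) --> ps = 0)"

lemma is_onb_iff: "is_onb E \<longleftrightarrow> onb_on (%e. e) E"
 by (auto simp: is_onb_def onb_on_def ortho_on_def)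

lemma onb_ortho: "onb_on h I ==> ortho_on h I"
 by (simp add: onb_on_def)

lemma onb_on_eqI: "onb_on h I ==> (!!i. i:I ==> ip (h i) ph = ip (h i) ps) ==> ph = ps"
 unfolding onb_on_def using ip_diff_right[of "h _" ph ps] by (metis eq_iff_diff_eq_0)

lemma onb_on_eqI_left: "onb_on h I ==> (!!i. i:I ==> ip ph (h i) = ip ps (h i)) ==> ph = ps"
 by (rule onb_on_eqI[of h I]) (metis cinner_commute)+

lemma orthoD:
 "ortho_on h I ==> i:I ==> j:I ==> ip (h i) (h j) = (if i = j then 1 else 0)"
 by (simp add: ortho_on_def)

lemma norm_ortho: "ortho_on h I ==> i:I ==> norm (h i) = 1"
 using orthoD[of h I i i] ip_self[of "h i"]
 by (metis norm_ge_zero of_real_eq_1_iff power2_eq_1_iff  le_minus_one_simps(3))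

lemma ortho_on_subset: "ortho_on h I ==> J \<subseteq> I ==> ortho_on h J"
 unfolding ortho_on_def by (meson subsetD)

lemma ip_ortho_sum:
 assumes "ortho_on h I" "finite F" "F \<subseteq> I" "j:I"
 shows "ip (h j) (\<Sum>i\<in>F. c i *: h i) = (if j:F then c j else 0)"
proof -
 have "ip (h j) (\<Sum>i\<in>F. c i *: h i) = (\<Sum>i\<in>F. if i = j then c j else 0)"
  unfolding ip_sum_right using assms
  by (intro sum.cong) (auto simp: cinner_scaleC_right orthoD)
 thus ?thesis using assms by (simp add: sum.delta)
qed

lemma norm_ortho_residual:
 assumes "ortho_on h I" "finite F" "F \<subseteq> I"
 shows "(norm (ps - (\<Sum>i\<in>F. ip (h i) ps *: h i)))^2 = (norm ps)^2 - (\<Sum>i\<in>F. (cmod (ip (h i) ps))^2)"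
proof -
 define S where "S = (\<Sum>i\<in>F. ip (h i) ps *: h i)"
 have a: "ip S ps = (\<Sum>i\<in>F. of_real ((cmod (ip (h i) ps))^2))"
  unfolding S_def ip_sum_left ip_scaleCl
  by (intro sum.cong) (auto simp: complex_norm_square mult.commute simp del: of_real_power)
 have b: "ip ps S = (\<Sum>i\<in>F. of_real ((cmod (ip (h i) ps))^2))"
  by (subst cinner_commute) (simp add: a)
 have c: "ip S S = ip S ps"
  unfolding S_def ip_sum_left ip_scaleCl
  using assms by (intro sum.cong refl) (simp add: ip_ortho_sum[OF assms] subsetD)
 have "ip (ps - S) (ps - S) = ip ps ps - ip ps S"
  by (simp add: ip_simps c)
 hence "cor ((norm (ps - S))^2) = of_real ((norm ps)^2 - (\<Sum>i\<in>F. (cmod (ip (h i) ps))^2))"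
  unfolding ip_self b by simp
 thus ?thesis unfolding of_real_eq_iff S_def .
qed

lemma bessel_finite:
 assumes "ortho_on h I" "finite F" "F \<subseteq> I"
 shows "(\<Sum>i\<in>F. (cmod (ip (h i) ps))^2) <= (norm ps)^2"
 using norm_ortho_residual[OF assms, of ps] zero_le_power2[of "norm (ps - (\<Sum>i\<in>F. ip (h i) ps *: h i))"]
 by argo

section \<open>Unordered sums: bounds, domination and Cauchy-Schwarz\<close>

lemma nonneg_summI:
 fixes f :: "'i => real"
 assumes "!!i. i:I ==> 0 <= f i" "!!F. finite F ==> F \<subseteq> I ==> sum f F <= B"
 shows "f summable_on I" "infsum f I <= B"
proof -
 have "bdd_above (sum f ` {F. F \<subseteq> I & finite F})" using assms by (intro bdd_aboveI[of _ B]) auto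
 thus s: "f summable_on I" using assms(1) by (intro nonneg_bdd_above_summable_on)
 show "infsum f I <= B" using assms(2) by (intro infsum_le_finite_sums s)
qed

lemma norm_sum_comp:
 assumes "g summable_on A" "!!x. x:A ==> norm (f x) <= g x"
 shows "(%x. norm (f x)) summable_on A"
 using assms by (rule Infinite_Sum.abs_summable_on_comparison_test')

lemma sum_comp:
 fixes f :: "'i => 'b::banach"
 assumes "g summable_on A" "!!x. x:A ==> norm (f x) <= g x"
 shows "f summable_on A"
 by (rule abs_summable_summable[OF norm_sum_comp[OF assms]])

text \<open>Tonelli's criterion for absolute summability over a product, in the form that later
  exchanges of sums require: summable rows whose totals are dominated.\<close>

lemma SigmaI_norm:
 fixes f :: "'i \<times> 'j => 'b::banach"
 assumes "!!x. x:A ==> (%y. norm (f (x, y))) summable_on B"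
  and "!!x. x:A ==> (\<Sum>\<^sub>\<infinity>y\<in>B. norm (f (x, y))) <= g x" and "g summable_on A"
 shows "(%p. norm (f p)) summable_on (A \<times> B)"
proof -
 have "(%x. norm (\<Sum>\<^sub>\<infinity>y\<in>B. norm (f (x, y)))) summable_on A"
  by (rule norm_sum_comp[OF assms(3)]) (use assms(2) in "simp add: infsum_nonneg")
 thus ?thesis using assms(1) by (subst Infinite_Sum.abs_summable_on_Sigma_iff) simp
qed

lemma bessel_summ:
 assumes "ortho_on h I"
 shows "(%i. (cmod (ip (h i) ps))^2) summable_on I" "(\<Sum>\<^sub>\<infinity>i\<in>I. (cmod (ip (h i) ps))^2) <= (norm ps)^2"
 using nonneg_summI[of I "%i. (cmod (ip (h i) ps))^2" "(norm ps)^2"] bessel_finite[OF assms] by auto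

lemma cs_summ:
 fixes a b :: "'i => real"
 assumes a: "(%i. (a i)^2) summable_on I" "(\<Sum>\<^sub>\<infinity>i\<in>I. (a i)^2) <= A\<^sup>2"
  and b: "(%i. (b i)^2) summable_on I" "(\<Sum>\<^sub>\<infinity>i\<in>I. (b i)^2) <= B\<^sup>2" and AB: "0 <= A" "0 <= B"
 shows "(%i. abs (a i * b i)) summable_on I" (is ?A) "(\<Sum>\<^sub>\<infinity>i\<in>I. abs (a i * b i)) <= A * B" (is ?B)
proof -
 have "(\<Sum>i\<in>F. abs (a i * b i)) <= A * B" if F: "finite F" "F \<subseteq> I" for F
 proof -
  have "(\<Sum>i\<in>F. abs (a i * b i)) <= L2_set a F * L2_set b F"
   using L2_set_mult_ineq[of a b F] by (simp add: abs_mult)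
  also have "... <= A * B"
  proof (intro mult_mono)
   show "L2_set a F <= A" unfolding L2_set_def using F AB a
    by (intro real_le_lsqrt sum_nonneg order.trans[OF finite_sum_le_infsum[of _ I]]) auto
   show "L2_set b F <= B" unfolding L2_set_def using F AB b
    by (intro real_le_lsqrt sum_nonneg order.trans[OF finite_sum_le_infsum[of _ I]]) auto
  qed (use AB in "auto intro: L2_set_nonneg")
  finally show ?thesis .
 qed
 thus ?A ?B
  using nonneg_summI[of I "%i. abs (a i * b i)" "A * B"] by auto
qed

lemma cmod_ip_commute: "cmod (ip ph ps) = cmod (ip ps ph)"
 by (subst cinner_commute) simp

text \<open>The coefficients define an antilinear functional, bounded by Cauchy-Schwarz, and the
  Riesz theorem turns it into a vector; the weak expansion comes with the construction.\<close>

lemma riesz_fischer: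
 fixes h :: "'i => 'a::euclidean_space l2"
 assumes h: "ortho_on h I" and c: "(%i. (cmod (c i))^2) summable_on I"
 obtains et where "!!i. i:I ==> ip (h i) et = c i"
  and "!!ph. ((%i. ip ph (h i) * c i) has_sum ip ph et) I"
  and "norm et <= sqrt (\<Sum>\<^sub>\<infinity>i\<in>I. (cmod (c i))^2)"
proof -
 define K where "K = sqrt (\<Sum>\<^sub>\<infinity>i\<in>I. (cmod (c i))^2)"
 have K: "0 <= K" "(\<Sum>\<^sub>\<infinity>i\<in>I. (cmod (c i))^2) <= K\<^sup>2" by (auto simp: K_def infsum_nonneg)
 have s: "(%i. norm (ip ph (h i) * c i)) summable_on I"
  "(\<Sum>\<^sub>\<infinity>i\<in>I. norm (ip ph (h i) * c i)) <= norm ph * K" for ph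
  using cs_summ[OF bessel_summ[OF h, of ph] c K(2) norm_ge_zero K(1)]
  by (simp_all add: norm_mult abs_mult cmod_ip_commute[of ph])
 have sm: "(%i. ip ph (h i) * c i) summable_on I" for ph using s(1) by (rule abs_summable_summable)
 define F where "F = (%ph. \<Sum>\<^sub>\<infinity>i\<in>I. ip ph (h i) * c i)"
 have "EX et. (ALL ph. ip ph et = F ph) & norm et <= K"
 proof (rule riesz_l2)
  show "F (ph + ps) = F ph + F ps" for ph ps
   unfolding F_def ip_add_left distrib_right by (rule infsum_add[OF sm sm])
  show "F (x *: ph) = cnj x * F ph" for x ph
   unfolding F_def ip_scaleCl mult.assoc by (rule infsum_cmult_right') 
  show "cmod (F ph) <= K * norm ph" for ph
   using norm_infsum_bound[of "%i. ip ph (h i) * c i" I] s(2)[of ph] s(1)[of ph] unfolding F_def by (simp add: mult.commute)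
 qed (rule K)
 then obtain et where et: "!!ph. ip ph et = F ph" "norm et <= K" by blast
 have *: "((%i. ip ph (h i) * c i) has_sum ip ph et) I" for ph
  unfolding et F_def using sm by simp
 have "ip (h j) et = c j" if "j:I" for j
 proof -
  have "((%i. ip (h j) (h i) * c i) has_sum c j) I"
   using that h by (intro has_sum_finite_neutralI[of "{j}"]) (auto simp: orthoD)
  thus ?thesis using *[of "h j"] has_sum_unique by blast
 qed
 thus ?thesis using that * et(2) unfolding K_def by blast
qed

lemma onb_parseval:
 assumes h: "onb_on h I"
 shows "((%i. ip ph (h i) * ip (h i) ps) has_sum ip ph ps) I"
proof -
 obtain et where et: "!!i. i:I ==> ip (h i) et = ip (h i) ps"
  "!!ph. ((%i. ip ph (h i) * ip (h i) ps) has_sum ip ph et) I"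
  using riesz_fischer[OF onb_ortho[OF h] bessel_summ(1)[OF onb_ortho[OF h], of ps]] by metis
 have "et = ps" using et(1) by (rule onb_on_eqI[OF h])
 thus ?thesis using et(2) by simp
qed

lemma onb_norm:
 assumes h: "onb_on h I"
 shows "((%i. (cmod (ip (h i) ps))^2) has_sum (norm ps)^2) I"
proof -
 have "((%i. Re (ip ps (h i) * ip (h i) ps)) has_sum Re (ip ps ps)) I"
  by (intro has_sum_Re onb_parseval[OF h])
 moreover have "Re (ip ps (h i) * ip (h i) ps) = (cmod (ip (h i) ps))^2" for i
  by (subst cinner_commute) (metis complex_norm_square mult.commute Re_complex_of_real)
 ultimately show ?thesis by (simp add: Re_ip_self)
qed

lemma onb_expand:
 assumes h: "onb_on h I"
 shows "((%i. ip (h i) ps *: h i) has_sum ps) I"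
proof -
 let ?S = "%F. \<Sum>i\<in>F. ip (h i) ps *: h i"
 have lim: "((%F. (norm ps)^2 - (\<Sum>i\<in>F. (cmod (ip (h i) ps))^2)) \<longlongrightarrow> (norm ps)^2 - (norm ps)^2) (finite_subsets_at_top I)"
  using onb_norm[OF h, of ps] unfolding has_sum_def by (intro tendsto_intros)
 have ev: "\<forall>\<^sub>F F in finite_subsets_at_top I. (norm ps)^2 - (\<Sum>i\<in>F. (cmod (ip (h i) ps))^2) = (norm (?S F - ps))^2"
  by (rule eventually_finite_subsets_at_top_weakI)
   (simp add: norm_ortho_residual[OF onb_ortho[OF h], symmetric] norm_minus_commute)
 have "((%F. (norm (?S F - ps))^2) \<longlongrightarrow> 0) (finite_subsets_at_top I)"
  using lim tendsto_cong[OF ev] by simp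
 from tendsto_real_sqrt[OF this] have "((%F. norm (?S F - ps)) \<longlongrightarrow> 0) (finite_subsets_at_top I)" by simp
 hence "((%F. ?S F - ps) \<longlongrightarrow> 0) (finite_subsets_at_top I)" by (rule tendsto_norm_zero_cancel)
 thus ?thesis unfolding has_sum_def by (rule LIM_zero_cancel)
qed

lemma onb_abs_summ:
 assumes h: "ortho_on h I"
 shows "(%i. cmod (ip ph (h i)) * cmod (ip (h i) ps)) summable_on I"
  "(\<Sum>\<^sub>\<infinity>i\<in>I. cmod (ip ph (h i)) * cmod (ip (h i) ps)) <= norm ph * norm ps"
 using cs_summ[OF bessel_summ[OF h, of ph] bessel_summ[OF h, of ps] norm_ge_zero norm_ge_zero]
 by (simp_all add: abs_mult cmod_ip_commute[of ph])

text \<open>Zorn's lemma with a side condition \<open>P\<close>. It serves three times: with a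
  trivial condition for extending to a basis, for vectors with a large diagonal element, and for
  eigenvectors.\<close>

lemma maximal_ortho_set:
 fixes F :: "'a::euclidean_space l2 set"
 assumes "ortho_on (%e. e) F" "!!e. e:F ==> P e"
 obtains M where "F \<subseteq> M" "ortho_on (%e. e) M" "!!e. e:M ==> P e"
  "!!u. norm u = 1 ==> (!!e. e:M ==> ip e u = 0) ==> \<not> P u"
proof -
 let ?A = "{E. F \<subseteq> E & ortho_on (%e. e) E & (ALL e:E. P e)}"
 have "EX M:?A. ALL X:?A. M \<subseteq> X --> X = M"
 proof (rule subset_Zorn_nonempty)
  fix C assume C: "C ~= {}" "subset.chain ?A C"
  have "ortho_on (%e. e) (\<Union>C)"
   unfolding ortho_on_def
  proof (intro ballI)
   fix x y assume "x:\<Union>C" "y:\<Union>C"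
   then obtain X Y where XY: "X:C" "Y:C" "x:X" "y:Y" by blast
   moreover have "X \<subseteq> Y \<or> Y \<subseteq> X" using C(2) XY(1,2) by (simp add: subset_chain_def)
   ultimately obtain Z where "Z:C" "x:Z" "y:Z" by blast
   thus "ip x y = (if x = y then 1 else 0)"
    using C(2) orthoD[of "%e. e" Z] unfolding subset_chain_def by auto
  qed
  moreover have "F \<subseteq> \<Union>C"
  proof -
   obtain X where "X:C" using C(1) by blast
   hence "F \<subseteq> X" using C(2) by (auto simp: subset_chain_def)
   thus ?thesis using \<open>X:C\<close> by blast
  qed
  moreover have "ALL e:\<Union>C. P e" using C(2) by (auto simp: subset_chain_def)
  ultimately show "\<Union>C:?A" by blast
 qed (use assms in auto)
 then obtain M where MA: "M:?A" and mx: "ALL X:?A. M \<subseteq> X --> X = M" ..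
 have M: "F \<subseteq> M" "ortho_on (%e. e) M" "ALL e:M. P e" using MA by simp_all
 show ?thesis
 proof (rule that[of M])
  fix u assume u: "norm u = 1" and perp: "!!e. e:M ==> ip e u = 0"
  show "\<not> P u"
  proof
   assume "P u"
   have "ip u u = 1" using u by (simp add: ip_self)
   moreover have "ip u e = 0" if "e:M" for e using perp[OF that] cinner_commute[of u e] by simp
   ultimately have "ortho_on (%e. e) (insert u M)"
    using M(2) perp unfolding ortho_on_def by auto
   hence "insert u M = M" using mx \<open>P u\<close> M by (simp add: subset_insertI subset_insertI2)
   thus False using perp[of u] \<open>ip u u = 1\<close> by auto
  qed
 qed (use M in auto)
qed

lemma onb_extend:
 fixes F :: "'a::euclidean_space l2 set"
 assumes "ortho_on (%e. e) F"
 obtains E where "F \<subseteq> E" "is_onb E"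
proof -
 obtain M where M: "F \<subseteq> M" "ortho_on (%e. e) M"
  and max: "!!u. norm u = 1 ==> (!!e. e:M ==> ip e u = 0) ==> \<not> True"
  using maximal_ortho_set[OF assms, of "%_. True"] by metis
 have "ps = 0" if ps: "ALL e:M. ip e ps = 0" for ps
 proof (rule ccontr)
  assume "ps ~= 0"
  thus False using max[of "(1 / norm ps) *. ps"] ps by (simp add: ip_scaleRr)
 qed
 hence "is_onb M" using M(2) unfolding is_onb_iff onb_on_def by blast
 thus ?thesis using that M(1) by blast
qed

lemma onb_exists: obtains E where "is_onb (E :: 'a::euclidean_space l2 set)"
 using onb_extend[of "{}"] unfolding ortho_on_def by blast

lemma bop_eqI_onb:
 assumes "onb_on h I" "!!i. i:I ==> S$$h i = T$$h i"
 shows "S = T"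
proof (rule bop_eqI, rule ip_eqI)
 fix ps ph
 have "bop_adj S$$ph = bop_adj T$$ph"
  by (rule onb_on_eqI_left[OF assms(1)]) (simp add: ip_adjl assms(2))
 thus "ip ph (S$$ps) = ip ph (T$$ps)" by (metis ip_adjl)
qed

section \<open>Trace class operators\<close>

subsection \<open>Spectral decomposition\<close>

text \<open>Complex polarisation: the directions \<open>ph + ps\<close> and
  \<open>ph + \<i> *: ps\<close> separate the two mixed terms.\<close>

lemma bop_zeroI:
 assumes "!!ps. ip ps (D$$ps) = 0" shows "D = 0"
proof (rule bop_eqI_form)
 fix ph ps
 have "ip (ph + ps) (D$$(ph + ps)) = 0" "ip (ph + \<i> *: ps) (D$$(ph + \<i> *: ps)) = 0"
  by (rule assms)+
 hence "ip ph (D$$ps) + ip ps (D$$ph) = 0" "ip ph (D$$ps) - ip ps (D$$ph) = 0"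
  by (simp_all add: bop_simps ip_simps assms right_diff_distrib[symmetric])
 thus "ip ph (D$$ps) = ip ph (0$$ps)" by (simp add: eq_neg_iff_add_eq_0[symmetric])
qed

lemma real_form_sa:
 assumes "!!ps. Im (ip ps (T$$ps)) = 0" shows "bop_adj T = T"
proof -
 have "ip ps ((bop_adj T - T)$$ps) = 0" for ps
 proof -
  have "ip (T$$ps) ps = ip ps (T$$ps)"
   using assms[of ps] cinner_commute[of "T$$ps" ps] by (simp add: complex_eq_iff)
  thus ?thesis by (simp add: bop_simps ip_simps ip_adjr)
 qed
 thus ?thesis using bop_zeroI by fastforce
qed

lemma pos_op_sa: "pos_op T ==> bop_adj T = T"
 by (rule real_form_sa) (simp add: pos_op_def)

text \<open>A quantitative substitute for compactness: up to \<open>ep\<close>, the quadratic form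
  is controlled by finitely many coefficients. This is what convergence of diagonals yields
  directly, and it suffices to find eigenvectors.\<close>

definition form_compact :: "'a::euclidean_space bop => bool" where
 "form_compact T \<longleftrightarrow> (ALL ep>0. EX F K. finite F & 0 <= K &
  (ALL x. cmod (ip x (T$$x)) <= ep * (norm x)^2 + K * (\<Sum>f\<in>F. (cmod (ip f x))^2)))"

lemma summ_finite_large:
 fixes f :: "'i => real"
 assumes "f summable_on E" "!!e. e:E ==> 0 <= f e" "0 < ep" "M \<subseteq> E" "!!e. e:M ==> ep < f e"
 shows "finite M"
proof (rule ccontr)
 assume "infinite M"
 obtain n :: nat where n: "infsum f E / ep < real n" using reals_Archimedean2 by blast
 obtain B where B: "finite B" "card B = n" "B \<subseteq> M" using infinite_arbitrarily_large[OF \<open>infinite M\<close>] by blast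
 have "real n * ep <= sum f B" using B assms(5) sum_bounded_below[of B ep f] by (auto simp: less_imp_le subset_iff)
 also have "... <= infsum f E" using B assms by (intro finite_sum_le_infsum) auto
 finally show False using n \<open>0 < ep\<close> by (simp add: pos_divide_less_eq)
qed

text \<open>A maximal orthonormal set on which the diagonal exceeds \<open>ep\<close> is finite, since it extends to a
 basis in which the diagonal series converges.\<close>

lemma tc_form_compact:
 assumes "has_trace T c" shows "form_compact T"
 unfolding form_compact_def
proof (intro allI impI)
 fix ep :: real assume ep: "0 < ep"
 have "ortho_on (%e. e) ({} :: 'a l2 set)" by (simp add: ortho_on_def)
 then obtain M where M: "ortho_on (%e. e) M" "!!e. e:M ==> ep / 2 < cmod (ip e (T$$e))"
  and max: "!!u. norm u = 1 ==> (!!e. e:M ==> ip e u = 0) ==> \<not> ep / 2 < cmod (ip u (T$$u))"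
  using maximal_ortho_set[of "{}" "%e. ep / 2 < cmod (ip e (T$$e))"] by (metis empty_iff)
 obtain E where E: "M \<subseteq> E" "is_onb E" using onb_extend[OF M(1)] .
 have "(%e. ip e (T$$e)) summable_on E"
  using assms E(2) unfolding has_trace_def by (meson has_sum_imp_summable)
 hence "(%e. cmod (ip e (T$$e))) summable_on E" by (simp add: summable_on_iff_abs_summable_on_complex)
 hence finM: "finite M"
  by (rule summ_finite_large[where ep = "ep / 2"]) (use M E ep in auto)
 \<comment> \<open>A unit vector orthogonal to \<open>M\<close> has diagonal element at most
   \<open>ep / 2\<close>, as otherwise it could be adjoined to \<open>M\<close>.\<close>
 have perp: "cmod (ip y (T$$y)) <= ep / 2 * (norm y)^2" if y: "!!e. e:M ==> ip e y = 0" for y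
 proof (cases "y = 0")
  case False
  have "cmod (ip ((1 / norm y) *. y) (T$$((1 / norm y) *. y))) <= ep / 2"
   using max[of "(1 / norm y) *. y"] y False by (simp add: ip_scaleRr)
  hence "cmod (ip y (T$$y)) / (norm y * norm y) <= ep / 2"
   by (simp add: bop_simps ip_simps norm_mult norm_divide)
  thus ?thesis using False by (simp add: divide_le_eq power2_eq_square)
 qed simp
 have "cmod (ip x (T$$x)) <= ep * (norm x)^2 + (2 * (norm T)^2 / ep) * (\<Sum>f\<in>M. (cmod (ip f x))^2)" for x
 proof -
  define q where "q = (\<Sum>i\<in>M. ip i x *: i)"
  define y where "y = x - q"
  have q: "ip e q = ip e x" if "e:M" for e
   unfolding q_def using ip_ortho_sum[OF M(1) finM order_refl that, of "%i. ip i x"] that by simp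
  have y: "ip e y = 0" if "e:M" for e using q[OF that] by (simp add: y_def ip_diff_right)
  have "ip q y = 0" unfolding q_def by (simp add: ip_sum_left ip_scaleCl y)
  hence "ip y q = 0" using cinner_commute[of y q] by simp
  hence "ip x x = ip y y + ip q q"
   using \<open>ip q y = 0\<close> unfolding y_def by (simp add: ip_simps algebra_simps)
  hence pyth: "(norm x)^2 = (norm y)^2 + (norm q)^2"
   unfolding ip_self of_real_add[symmetric] of_real_eq_iff .
  have ny: "(norm y)^2 = (norm x)^2 - (\<Sum>f\<in>M. (cmod (ip f x))^2)"
   unfolding y_def q_def by (rule norm_ortho_residual[OF M(1) finM order_refl])
  have nq: "(norm q)^2 = (\<Sum>f\<in>M. (cmod (ip f x))^2)" using pyth ny by simp
  have "norm y <= norm x" using pyth by (intro power2_le_imp_le[of "norm y" "norm x"]) auto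
  have "ip x (T$$x) = ip y (T$$y) + ip q (T$$y) + ip x (T$$q)"
   by (simp add: y_def bop_simps ip_simps)
  hence "cmod (ip x (T$$x)) <= cmod (ip y (T$$y)) + cmod (ip q (T$$y)) + cmod (ip x (T$$q))"
   by (metis norm_triangle_ineq add_right_mono order_trans)
  also have "cmod (ip q (T$$y)) <= norm q * (norm T * norm x)"
   using \<open>norm y <= norm x\<close>
   by (intro order_trans[OF norm_ip] mult_left_mono order_trans[OF norm_bop_apply]) auto
  also have "cmod (ip x (T$$q)) <= norm x * (norm T * norm q)"
   by (intro order_trans[OF norm_ip] mult_left_mono norm_bop_apply) auto
  also have "cmod (ip y (T$$y)) <= ep / 2 * (norm x)^2"
  proof -
   have "cmod (ip y (T$$y)) <= ep / 2 * (norm y)^2" by (rule perp) (rule y)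
   also have "... <= ep / 2 * (norm x)^2" using pyth ep by (intro mult_left_mono) auto
   finally show ?thesis .
  qed
  finally have 1: "cmod (ip x (T$$x)) <= ep / 2 * (norm x)^2 + 2 * (norm q * norm T * norm x)"
   by (simp add: mult_ac)
  \<comment> \<open>Completing this square absorbs the cross term into the other half of
    \<open>ep\<close>; hence the constant \<open>2 * (norm T)^2 / ep\<close>.\<close>
  have "0 <= (ep * norm x - 2 * norm T * norm q)^2 / (2 * ep)" using ep by simp
  also have "... = ep / 2 * (norm x)^2 + (2 * (norm T)^2 / ep) * (norm q)^2 - 2 * (norm q * norm T * norm x)"
   using ep by (simp add: field_simps power2_eq_square)
  finally show ?thesis using 1 unfolding nq[symmetric] by argo
 qed
 thus "EX F K. finite F & 0 <= K &
  (ALL x. cmod (ip x (T$$x)) <= ep * (norm x)^2 + K * (\<Sum>f\<in>F. (cmod (ip f x))^2))"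
  using finM ep by (intro exI[of _ M] exI[of _ "2 * (norm T)^2 / ep"]) simp
qed

lemma convergent_coefficients_subseq:
 fixes x :: "nat => 'a::euclidean_space l2"
 assumes "finite F" "!!n. norm (x n) <= B"
 shows "EX r. strict_mono r & (ALL f:F. convergent (%n. ip f (x (r n))))"
 using assms(1)
proof (induction F rule: finite_induct)
 case empty
 show ?case by (intro exI[of _ id]) (simp add: strict_mono_def)
next
 case (insert g F)
 then obtain r where r: "strict_mono r" "!!f. f:F ==> convergent (%n. ip f (x (r n)))" by blast
 have "bounded (range (%n. ip g (x (r n))))"
 proof (rule boundedI)
  fix y assume "y:range (%n. ip g (x (r n)))"
  thus "norm y <= norm g * B" using assms(2) by (auto intro!: order_trans[OF norm_ip] mult_left_mono)
 qed
 then obtain l s where s: "strict_mono s" "((%n. ip g (x (r n))) \<circ> s) ----> l"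
  using bounded_imp_convergent_subsequence by blast
 show ?case
 proof (intro exI[of _ "r \<circ> s"] conjI ballI)
  fix f assume "f:insert g F"
  thus "convergent (%n. ip f (x ((r \<circ> s) n)))"
  proof
   assume "f = g" thus ?thesis using s(2) by (auto simp: convergent_def o_def)
  next
   assume "f:F"
   thus ?thesis using r(2)[of f] convergent_subseq_convergent[OF _ s(1)] by (fastforce simp: o_def)
  qed
 qed (rule strict_mono_o[OF r(1) s(1)])
qed

text \<open>Let \<open>m\<close> be the supremum of the quadratic form on unit vectors orthogonal to
  \<open>E\<close>. Since \<open>m - T\<close> is nonnegative there, a maximising sequence is
  asymptotically annihilated by \<open>m - T\<close>; compactness of the form makes a subsequence
  converge, and its limit is an eigenvector for \<open>m\<close>.\<close>

lemma top_eigenvector: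
 fixes T :: "'a::euclidean_space bop" and E :: "'a l2 set"
 assumes sa: "bop_adj T = T" and fc: "form_compact T"
  and inv: "!!x. (ALL e:E. ip e x = 0) ==> (ALL e:E. ip e (T$$x) = 0)"
  and x0: "ALL e:E. ip e x0 = 0" "norm x0 = 1" "0 < Re (ip x0 (T$$x0))"
 shows "EX x r. norm x = 1 & (ALL e:E. ip e x = 0) & T$$x = (r::real) *. x"
proof -
 define M where "M = {x. ALL e:E. ip e x = 0}"
 define U where "U = (%x. Re (ip x (T$$x))) ` {x\<in>M. norm x = 1}"
 define m where "m = Sup U"
 have M_lin: "x + y:M" "x - y:M" "r *. x:M" "T$$x:M" if "x:M" "y:M" for x y r
  using that inv[of x] unfolding M_def by (auto simp: ip_simps)
 have bdd: "bdd_above U" unfolding U_def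
 proof (rule bdd_aboveI2)
  fix x :: "'a l2" assume "x:{x\<in>M. norm x = 1}"
  thus "Re (ip x (T$$x)) <= norm T"
   using complex_Re_le_cmod[of "ip x (T$$x)"] norm_ip[of x "T$$x"] norm_bop_apply[of T x] by simp
 qed
 have "x0:M" using x0 by (simp add: M_def)
 have "Re (ip x0 (T$$x0)) <= m" unfolding m_def
  by (rule cSup_upper[OF _ bdd]) (use x0 \<open>x0:M\<close> in "auto simp: U_def")
 hence m0: "0 < m" using x0(3) by simp
 have le_m: "Re (ip x (T$$x)) <= m * (norm x)^2" if "x:M" for x
 proof (cases "x = 0")
  case False
  have "Re (ip ((1 / norm x) *. x) (T$$((1 / norm x) *. x))) <= m" unfolding m_def
   by (rule cSup_upper[OF _ bdd]) (use that False M_lin(3)[OF that that] in "auto simp: U_def")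
  hence "Re (ip x (T$$x)) / (norm x * norm x) <= m"
   by (simp add: bop_simps ip_simps)
  thus ?thesis using False by (simp add: divide_le_eq power2_eq_square)
 qed simp
 have "EX x. x:M & norm x = 1 & m - inverse (real (Suc n)) < Re (ip x (T$$x))" for n
 proof -
  have "U ~= {}" using \<open>x0:M\<close> x0 by (auto simp: U_def)
  then obtain y where "y:U" "m - inverse (real (Suc n)) < y"
   using less_cSupD[of U "m - inverse (real (Suc n))"] by (auto simp: m_def)
  thus ?thesis by (auto simp: U_def)
 qed
 then obtain x where x: "!!n. x n:M" "!!n. norm (x n) = 1" "!!n. m - inverse (real (Suc n)) < Re (ip (x n) (T$$x n))"
  by metis
 define z where "z = (%n. m *. x n - T$$x n)"
 define L where "L = m + norm T"
 have L0: "0 < L" using m0 by (simp add: L_def add_pos_nonneg)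
 have z_le: "(norm (z n))^2 <= L * inverse (real (Suc n))" for n
 proof -
  define v where "v = m *. z n - T$$z n"
  \<comment> \<open>Nonnegativity of \<open>m - T\<close> is tested after one gradient step of
    length \<open>1 / L\<close>. This bounds the squared norm of \<open>(m - T) x\<close> by
    \<open>L\<close> times the quadratic form without square roots of operators.\<close>
  define w where "w = x n - (1 / L) *. z n"
  have zM: "z n:M" unfolding z_def by (rule M_lin(2)[OF M_lin(3)[OF x(1) x(1)] M_lin(4)[OF x(1) x(1)]])
  have wM: "w:M" unfolding w_def by (rule M_lin(2)[OF x(1) M_lin(3)[OF zM zM]])
  have "norm v <= abs m * norm (z n) + norm T * norm (z n)" unfolding v_def
   by (rule order_trans[OF norm_triangle_ineq4]) (simp add: norm_bop_apply)
  hence "norm v <= L * norm (z n)" using m0 by (simp add: L_def distrib_right)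
  hence v: "Re (ip (z n) v) <= L * (norm (z n))^2"
   using order_trans[OF complex_Re_le_cmod order_trans[OF norm_ip mult_left_mono[OF _ norm_ge_zero]], of v "L * norm (z n)" "z n"]
   by (simp add: power2_eq_square mult_ac)
  have xv: "ip (x n) v = ip (z n) (z n)"
  proof -
   have "ip (z n) (z n) = ip (m *. x n - T$$x n) (z n)" by (simp add: z_def)
   thus ?thesis using ip_adjl[of T "x n" "z n", unfolded sa] by (simp add: v_def ip_simps)
  qed
  have mw: "m *. w - T$$w = z n - (1 / L) *. v" by (simp add: w_def v_def z_def bop_simps algebra_simps)
  have "Re (ip (x n) (z n)) = m - Re (ip (x n) (T$$x n))" by (simp add: z_def ip_simps Re_ip_self x(2))
  hence "Re (ip w (m *. w - T$$w)) = m - Re (ip (x n) (T$$x n)) - 2 * ((norm (z n))^2 / L) + (1 / L)^2 * Re (ip (z n) v)"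
   unfolding mw by (simp add: w_def ip_simps xv Re_ip_self power2_eq_square diff_divide_distrib)
  moreover have "0 <= Re (ip w (m *. w - T$$w))" using le_m[OF wM] by (simp add: ip_simps Re_ip_self)
  moreover have "(1 / L)^2 * Re (ip (z n) v) <= (1 / L)^2 * (L * (norm (z n))^2)" by (intro mult_left_mono v) simp
  moreover have "(1 / L)^2 * (L * (norm (z n))^2) = (norm (z n))^2 / L" using L0 by (simp add: power2_eq_square)
  ultimately have "(norm (z n))^2 / L <= inverse (real (Suc n))" using x(3)[of n] by argo
  thus ?thesis using L0 by (simp add: divide_le_eq mult.commute)
 qed
 have "(%n. L * inverse (real (Suc n))) ----> L * 0" by (intro tendsto_mult_left LIMSEQ_inverse_real_of_nat)
 hence "(%n. (norm (z n))^2) ----> 0"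
  using z_le by (intro Lim_null_comparison[of "%n. (norm (z n))^2" "%n. L * inverse (real (Suc n))"]) auto
 from tendsto_real_sqrt[OF this] have "(%n. norm (z n)) ----> 0" by simp
 hence z0: "z ----> 0" by (rule tendsto_norm_zero_cancel)
 obtain F K where FK: "finite F" "0 <= K"
  "!!x. cmod (ip x (T$$x)) <= m / 2 * (norm x)^2 + K * (\<Sum>f\<in>F. (cmod (ip f x))^2)"
  using fc m0 unfolding form_compact_def by (meson half_gt_zero)
 obtain r where r: "strict_mono r" "!!f. f:F ==> convergent (%n. ip f (x (r n)))"
  using convergent_coefficients_subseq[of F x 1] FK(1) x(2) by auto
 \<comment> \<open>With \<open>ep = m / 2\<close>, half of \<open>m * (norm d)^2\<close> survives,
   so differences of approximate eigenvectors are controlled by finitely many coefficients.\<close>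
 have key: "m / 2 * (norm d)^2 <= norm d * norm (m *. d - T$$d) + K * (\<Sum>f\<in>F. (cmod (ip f d))^2)" for d
 proof -
  have "m * (norm d)^2 = Re (ip d (m *. d - T$$d)) + Re (ip d (T$$d))"
   by (simp add: ip_simps Re_ip_self)
  also have "... <= norm d * norm (m *. d - T$$d) + (m / 2 * (norm d)^2 + K * (\<Sum>f\<in>F. (cmod (ip f d))^2))"
   by (intro add_mono order_trans[OF complex_Re_le_cmod] norm_ip FK)
  finally show ?thesis by argo
 qed
 have "Cauchy (%n. x (r n))"
 proof (rule metric_CauchyI)
  fix e :: real assume e: "0 < e"
  define dl where "dl = m * e\<^sup>2 / 16"
  have dl: "0 < dl" using m0 e by (simp add: dl_def)
  have "(%n. z (r n)) ----> 0" using LIMSEQ_subseq_LIMSEQ[OF z0 r(1)] by (simp add: o_def)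
  then obtain N1 where N1: "!!n. n >= N1 ==> norm (z (r n)) < dl / 2" using LIMSEQ_D[of "%n. z (r n)" 0 "dl/2"] dl by auto
  \<comment> \<open>The two \<open>+ 1\<close> exclude division by zero when \<open>K\<close> is
    zero or \<open>F\<close> is empty.\<close>
  define et where "et = sqrt (dl / ((K + 1) * (real (card F) + 1)))"
  have et: "0 < et" using dl FK(2) by (simp add: et_def)
  have "ALL f:F. EX N. ALL i>=N. ALL j>=N. cmod (ip f (x (r i)) - ip f (x (r j))) < et"
   using r(2) et by (metis Cauchy_convergent_iff CauchyD)
  then obtain N2 where N2: "!!f i j. f:F ==> i >= N2 f ==> j >= N2 f ==> cmod (ip f (x (r i)) - ip f (x (r j))) < et"
   by metis
  define N where "N = N1 + (\<Sum>f\<in>F. N2 f)"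
  have N2_le: "N2 f <= N" if "f:F" for f using member_le_sum[of f F N2] that FK(1) by (simp add: N_def)
  have "dist (x (r i)) (x (r j)) < e" if ij: "N <= i" "N <= j" for i j
  proof -
   define d where "d = x (r i) - x (r j)"
   have d2: "norm d <= 2" using norm_triangle_ineq4[of "x (r i)" "x (r j)"] x(2) by (simp add: d_def)
   have "m *. d - T$$d = z (r i) - z (r j)" by (simp add: d_def z_def bop_simps scaleR_diff_right)
   hence "norm (m *. d - T$$d) <= dl"
    using norm_triangle_ineq4[of "z (r i)" "z (r j)"] N1[of i] N1[of j] ij by (simp add: N_def)
   hence 1: "norm d * norm (m *. d - T$$d) <= 2 * dl" using d2 by (intro mult_mono) auto
   have "(\<Sum>f\<in>F. (cmod (ip f d))^2) <= real (card F) * et\<^sup>2"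
   proof (rule sum_bounded_above)
    fix f assume "f:F"
    hence "cmod (ip f d) <= et"
     using N2[of f i j] N2_le[of f] ij by (simp add: d_def ip_diff_right less_imp_le)
    thus "(cmod (ip f d))^2 <= et\<^sup>2" by (intro power_mono) auto
   qed
   hence "K * (\<Sum>f\<in>F. (cmod (ip f d))^2) <= (K + 1) * ((real (card F) + 1) * et\<^sup>2)"
    using FK(2) by (intro mult_mono) (auto simp: distrib_right add_increasing2 intro!: sum_nonneg)
   also have "... = dl" using dl FK(2) by (simp add: et_def)
   finally have "m / 2 * (norm d)^2 <= 3 * dl" using key[of d] 1 by argo
   also have "... < m / 2 * e\<^sup>2" using m0 e by (simp add: dl_def)
   finally have "(norm d)^2 < e\<^sup>2" using m0 by simp
   thus ?thesis using e by (simp add: d_def dist_norm power2_less_imp_less)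
  qed
  thus "EX M. ALL i>=M. ALL j>=M. dist (x (r i)) (x (r j)) < e" by blast
 qed
 then obtain y where y: "(%n. x (r n)) ----> y" using Cauchy_convergent_iff convergent_def by blast
 have "(%n. z (r n)) ----> m *. y - T$$y" unfolding z_def by (intro tendsto_intros tendsto_bop y)
 moreover have "(%n. z (r n)) ----> 0" using LIMSEQ_subseq_LIMSEQ[OF z0 r(1)] by (simp add: o_def)
 ultimately have "m *. y - T$$y = 0" by (rule LIMSEQ_unique)
 moreover have "norm y = 1" using tendsto_norm[OF y] x(2) by (simp add: LIMSEQ_const_iff)
 moreover have "ip e y = 0" if "e:E" for e
 proof -
  have "(%n. ip e (x (r n))) ----> ip e y" by (intro cinner.tendsto tendsto_const y)
  thus ?thesis using x(1) that by (simp add: M_def LIMSEQ_const_iff)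
 qed
 ultimately show ?thesis by (intro exI[of _ y] exI[of _ m]) simp
qed

lemma form_compact_uminus: "form_compact T ==> form_compact (- T)"
 by (simp add: form_compact_def bop_simps ip_simps)

text \<open>A maximal orthonormal set of eigenvectors is a basis. On its invariant complement the
  quadratic form vanishes, as otherwise \<open>T\<close> or \<open>- T\<close> has a further
  eigenvector there; a vanishing form forces \<open>T$$x = 0\<close>, so any remaining vector would
  be an eigenvector for \<open>0\<close>.\<close>

theorem spectral_onb:
 fixes T :: "'a::euclidean_space bop"
 assumes sa: "bop_adj T = T" and fc: "form_compact T"
 obtains E r where "is_onb E" "!!e. e:E ==> T$$e = (r e :: real) *. e"
proof -
 have "ortho_on (%e. e) ({} :: 'a l2 set)" by (simp add: ortho_on_def)
 then obtain M where M: "ortho_on (%e. e) M" "!!e. e:M ==> EX r::real. T$$e = r *. e"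
  and max: "!!u. norm u = 1 ==> (!!e. e:M ==> ip e u = 0) ==> \<not> (EX r::real. T$$u = r *. u)"
  using maximal_ortho_set[of "{}" "%e. EX r::real. T$$e = r *. e"] by (metis empty_iff)
 have inv: "ALL e:M. ip e (T$$x) = 0" if "ALL e:M. ip e x = 0" for x
 proof
  fix e assume "e:M"
  then obtain r :: real where "T$$e = r *. e" using M(2) by blast
  thus "ip e (T$$x) = 0" using that \<open>e:M\<close> ip_adjl[of T e x] by (simp add: sa ip_scaleR_left)
 qed
 have zero: "Re (ip x (T$$x)) = 0" if x: "ALL e:M. ip e x = 0" for x
 proof (rule ccontr)
  assume nz: "Re (ip x (T$$x)) ~= 0"
  hence "x ~= 0" by auto
  define u where "u = (1 / norm x) *. x"
  have u: "norm u = 1" "ALL e:M. ip e u = 0" using \<open>x ~= 0\<close> x by (auto simp: u_def ip_scaleRr)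
  have "Re (ip u (T$$u)) = Re (ip x (T$$x)) / (norm x * norm x)"
   by (simp add: u_def bop_simps ip_simps)
  hence "Re (ip u (T$$u)) ~= 0" using nz \<open>x ~= 0\<close> by simp
  then consider "0 < Re (ip u (T$$u))" | "0 < Re (ip u ((- T)$$u))"
   by (auto simp: bop_simps ip_simps neq_iff)
  hence "EX x r. norm x = 1 & (ALL e:M. ip e x = 0) & T$$x = (r::real) *. x"
  proof cases
   case 1
   show ?thesis by (rule top_eigenvector[OF sa fc _ u(2,1) 1]) (rule inv)
  next
   case 2
   have "bop_adj (- T) = - T" using bop_adj_simps(5)[of "-1" T] sa by simp
   hence "EX x r. norm x = 1 & (ALL e:M. ip e x = 0) & (- T)$$x = (r::real) *. x"
    by (rule top_eigenvector[OF _ form_compact_uminus[OF fc] _ u(2,1) 2])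
     (use inv in "auto simp: bop_uminus_apply ip_minus_right")
   thus ?thesis by (metis bop_uminus_apply minus_equation_iff scaleR_minus_left)
  qed
  thus False using max by blast
 qed
 have "x = 0" if x: "ALL e:M. ip e x = 0" for x
 proof (rule ccontr)
  assume "x ~= 0"
  have "ALL e:M. ip e (x + T$$x) = 0" using x inv[OF x] by (simp add: cinner_add_right)
  from zero[OF this] zero[OF x] zero[OF inv[OF x]]
  have "Re (ip x (T$$T$$x)) + (norm (T$$x))^2 = 0"
   by (simp add: bop_simps ip_simps Re_ip_self)
  moreover have "Re (ip x (T$$T$$x)) = (norm (T$$x))^2"
   using ip_adjl[of T x "T$$x"] by (simp add: sa Re_ip_self[symmetric])
  ultimately have "T$$x = 0" by simp
  hence "T$$((1 / norm x) *. x) = 0 *. ((1 / norm x) *. x)" by (simp add: bop_simps)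
  thus False using max[of "(1 / norm x) *. x"] \<open>x ~= 0\<close> x by (auto simp: ip_scaleRr)
 qed
 hence "is_onb M" using M(1) unfolding is_onb_iff onb_on_def by blast
 moreover obtain r where "!!e. e:M ==> T$$e = (r e :: real) *. e" using M(2) by metis
 ultimately show ?thesis using that by blast
qed

subsection \<open>Nuclear representations\<close>

text \<open>\<open>T\<close> is the weak sum of the rank one operators built from \<open>u k\<close>
  and \<open>v k\<close>, with summable products of norms. The index type is arbitrary because
  eigenbases, disjoint sums and Kraus families all produce such representations.\<close>

definition nuclear_on ::
 "'a::euclidean_space bop => ('i => 'a l2) => ('i => 'a l2) => 'i set => bool" where
 "nuclear_on T u v I \<longleftrightarrow> (%k. norm (u k) * norm (v k)) summable_on I &
  (ALL ph ps. ((%k. ip ph (u k) * ip (v k) ps) has_sum ip ph (T$$ps)) I)"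

text \<open>Indexing by \<open>nat\<close> avoids quantifying over an index type.\<close>

definition nuclear :: "'a::euclidean_space bop => bool" where
 "nuclear T \<longleftrightarrow> (EX u v :: nat => 'a l2. nuclear_on T u v UNIV)"

lemma nuclear_onD:
 assumes "nuclear_on T u v I"
 shows "(%k. norm (u k) * norm (v k)) summable_on I"
  and "((%k. ip ph (u k) * ip (v k) ps) has_sum ip ph (T$$ps)) I"
 using assms by (auto simp: nuclear_on_def)

text \<open>A summable family has only countably many nonzero terms; these are enumerated and all
  other positions are filled with \<open>0\<close>.\<close>

lemma nuclear_on_nat:
 fixes T :: "'a::euclidean_space bop"
 assumes "nuclear_on T u v I"
 obtains u' v' :: "nat => 'a l2" where "nuclear_on T u' v' UNIV"
  "(\<Sum>\<^sub>\<infinity>k. norm (u' k) * norm (v' k)) = (\<Sum>\<^sub>\<infinity>k\<in>I. norm (u k) * norm (v k))"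
proof -
 define J where "J = {i\<in>I. norm (u i) * norm (v i) ~= 0}"
 have cJ: "countable J" unfolding J_def
  using summable_countable_real[OF nuclear_onD(1)[OF assms]] by simp
 define N where "N = to_nat_on J ` J"
 define g where "g = from_nat_into J"
 have bij: "bij_betw g N J"
  unfolding N_def g_def using cJ
  by (intro bij_betwI[of _ _ _ "to_nat_on J"]) (auto simp: from_nat_into_to_nat_on)
 define u' where "u' = (%n. if n:N then u (g n) else 0)"
 define v' where "v' = (%n. if n:N then v (g n) else 0)"
 have tr: "((%n. f (u' n) (v' n)) has_sum S) UNIV"
  if f: "((%i. f (u i) (v i)) has_sum S) I" and z: "!!x y. x = 0 \<or> y = 0 ==> f x y = 0"
  for f :: "'a l2 => 'a l2 => 'c::{topological_comm_monoid_add,t2_space}" and S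
 proof -
  have "((%i. f (u i) (v i)) has_sum S) J"
   using f by (subst has_sum_cong_neutral[where T=I and g="%i. f (u i) (v i)"]) (auto simp: J_def intro!: z)
  hence "((%n. f (u (g n)) (v (g n))) has_sum S) N"
   using has_sum_reindex_bij_betw[OF bij, of "%i. f (u i) (v i)"] by simp
  thus ?thesis
   by (subst has_sum_cong_neutral[where T=N and g="%n. f (u (g n)) (v (g n))"]) (auto simp: u'_def v'_def intro!: z)
 qed
 have n: "((%k. norm (u' k) * norm (v' k)) has_sum (\<Sum>\<^sub>\<infinity>k\<in>I. norm (u k) * norm (v k))) UNIV"
  by (rule tr[of "%x y. norm x * norm y", OF has_sum_infsum[OF nuclear_onD(1)[OF assms]]]) auto
 have "nuclear_on T u' v' UNIV" unfolding nuclear_on_def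
 proof (intro conjI allI)
  show "(%k. norm (u' k) * norm (v' k)) summable_on UNIV" using n by (rule has_sum_imp_summable)
  show "((%k. ip ph (u' k) * ip (v' k) ps) has_sum ip ph (T$$ps)) UNIV" for ph ps
   by (rule tr[of "%x y. ip ph x * ip y ps", OF nuclear_onD(2)[OF assms]]) auto
 qed
 thus ?thesis using that infsumI[OF n] by blast
qed

lemma nuclear_on_imp_nuclear: "nuclear_on T u v I ==> nuclear T"
 unfolding nuclear_def by (erule nuclear_on_nat) blast

lemma nuclear_on_exists:
 fixes u v :: "'i => 'a::euclidean_space l2"
 assumes "(%k. norm (u k) * norm (v k)) summable_on I"
 shows "EX T. nuclear_on T u v I"
proof -
 define K where "K = (\<Sum>\<^sub>\<infinity>k\<in>I. norm (u k) * norm (v k))"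
 have K: "0 <= K" unfolding K_def by (intro infsum_nonneg) simp
 have hK: "((%k. norm ph * norm ps * (norm (u k) * norm (v k))) has_sum norm ph * norm ps * K) I" for ph ps :: "'a l2"
  unfolding K_def by (intro has_sum_cmult_right has_sum_infsum assms)
 have le: "cmod (ip ph (u k) * ip (v k) ps) <= norm ph * norm ps * (norm (u k) * norm (v k))" for ph ps k
  using mult_mono[OF norm_ip[of ph "u k"] norm_ip[of "v k" ps]] by (simp add: norm_mult mult_ac)
 have sm: "(%k. ip ph (u k) * ip (v k) ps) summable_on I" for ph ps
  by (rule sum_comp[OF has_sum_imp_summable[OF hK]]) (rule le)
 define B where "B = (%ph ps. \<Sum>\<^sub>\<infinity>k\<in>I. ip ph (u k) * ip (v k) ps)"
 have "EX T. (ALL ph ps. ip ph (T$$ps) = B ph ps) & norm T <= K"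
 proof (rule bop_of_form)
  show "B (ph + ph') ps = B ph ps + B ph' ps" for ph ph' ps
   unfolding B_def ip_add_left distrib_right by (rule infsum_add[OF sm sm])
  show "B ph (ps + ps') = B ph ps + B ph ps'" for ph ps ps'
   unfolding B_def cinner_add_right distrib_left by (rule infsum_add[OF sm sm])
  show "B (c *: ph) ps = cnj c * B ph ps" for c ph ps
   unfolding B_def ip_scaleCl mult.assoc by (rule infsum_cmult_right')
  show "B ph (c *: ps) = c * B ph ps" for c ph ps
   unfolding B_def cinner_scaleC_right mult.left_commute[of _ c] by (rule infsum_cmult_right')
  show "cmod (B ph ps) <= K * norm ph * norm ps" for ph ps
   using norm_infsum_le[OF has_sum_infsum[OF sm] hK le, of ph ps] by (simp add: B_def mult_ac)
 qed (rule K)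
 thus ?thesis unfolding nuclear_on_def using assms sm by (metis B_def has_sum_infsum)
qed

lemma trace_eqI: "has_trace T c ==> trace T = c"
 unfolding trace_def
proof (rule the_equality)
 fix d assume "has_trace T c" "has_trace T d"
 moreover obtain E where "is_onb (E :: 'a l2 set)" using onb_exists .
 ultimately show "d = c" unfolding has_trace_def by (blast intro: has_sum_unique)
qed

text \<open>The double sum over \<open>k\<close> and a basis is absolutely summable. Summed first
  over the basis it no longer depends on it; summed first over \<open>k\<close> it is the diagonal
  series. So all bases give the same trace.\<close>

lemma nuclear_on_trace_aux:
 assumes T: "nuclear_on T u v I"
 shows "((%k. ip (v k) (u k)) has_sum trace T) I" (is ?A) and "has_trace T (trace T)"
proof -
 have main: "EX S. ((%k. ip (v k) (u k)) has_sum S) I & ((%e. ip e (T$$e)) has_sum S) E"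
  if E: "is_onb E" for E
 proof -
  have oE: "onb_on (%e. e) E" using E by (simp add: is_onb_iff)
  define f where "f = (%(k, e). ip (v k) e * ip e (u k))"
  have inner: "(%e. norm (f (k, e))) summable_on E" "(\<Sum>\<^sub>\<infinity>e\<in>E. norm (f (k, e))) <= norm (u k) * norm (v k)" for k
   using onb_abs_summ[OF onb_ortho[OF oE], of "v k" "u k"]
   by (simp_all add: f_def norm_mult mult.commute[of "norm (u k)"])
  have "(%p. norm (f p)) summable_on I \<times> E"
   by (rule SigmaI_norm[OF inner nuclear_onD(1)[OF T]])
  hence "f summable_on I \<times> E" by (rule abs_summable_summable)
  then obtain S where S: "(f has_sum S) (I \<times> E)" using has_sum_infsum by blast
  have a: "((%k. ip (v k) (u k)) has_sum S) I"
   by (rule has_sum_SigmaD[OF S]) (simp add: f_def onb_parseval[OF oE])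
  have "((%(e,k). f (k, e)) has_sum S) (E \<times> I)" using S by (simp add: has_sum_swap[of f])
  hence b: "((%e. ip e (T$$e)) has_sum S) E"
   by (rule has_sum_SigmaD) (use nuclear_onD(2)[OF T] in \<open>simp add: f_def mult.commute[of "ip (v _) _"]\<close>)
  show ?thesis using a b by blast
 qed
 obtain E where "is_onb (E :: 'a l2 set)" using onb_exists .
 then obtain S where S: "((%k. ip (v k) (u k)) has_sum S) I" using main by blast
 have "has_trace T S" unfolding has_trace_def using main S has_sum_unique by blast
 moreover from this have "trace T = S" by (rule trace_eqI)
 ultimately show ?A "has_trace T (trace T)" using S by simp_all
qed

lemma nuclear_has_trace: "nuclear T ==> has_trace T (trace T)"
 unfolding nuclear_def using nuclear_on_trace_aux by blast

lemma nuclear_trace_onb: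
 assumes "nuclear T" "onb_on h I"
 shows "((%i. ip (h i) (T$$h i)) has_sum trace T) I"
proof -
 have inj: "inj_on h I"
 proof (rule inj_onI)
  fix i j assume ij: "i:I" "j:I" "h i = h j"
  thus "i = j" using orthoD[OF onb_ortho[OF assms(2)], of i j]
    orthoD[OF onb_ortho[OF assms(2)], of i i] by (auto split: if_splits)
 qed
 have "is_onb (h ` I)" unfolding is_onb_def
 proof (intro conjI ballI allI impI)
  fix e f assume "e:h ` I" "f:h ` I"
  thus "ip e f = (if e = f then 1 else 0)"
   using orthoD[OF onb_ortho[OF assms(2)]] inj by (auto simp: inj_on_eq_iff)
 next
  fix ps assume "ALL e:h ` I. ip e ps = 0"
  thus "ps = 0" using assms(2) by (auto simp: onb_on_def)
 qed
 hence "((%e. ip e (T$$e)) has_sum trace T) (h ` I)"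
  using nuclear_has_trace[OF assms(1)] by (simp add: has_trace_def)
 thus ?thesis by (simp add: has_sum_reindex[OF inj] o_def)
qed

lemma nuclear_on_mult_left:
 assumes "nuclear_on T u v I" shows "nuclear_on (B * T) (%k. B$$u k) v I"
 unfolding nuclear_on_def
proof (intro conjI allI)
 have "(%k. norm B * (norm (u k) * norm (v k))) summable_on I"
  by (intro summable_on_cmult_right nuclear_onD(1)[OF assms])
 hence "(%k. norm (norm (B$$u k) * norm (v k))) summable_on I"
  by (rule norm_sum_comp)
   (use mult_right_mono[OF norm_bop_apply norm_ge_zero] in "simp add: mult.assoc[symmetric]")
 thus "(%k. norm (B$$u k) * norm (v k)) summable_on I" by simp
 show "((%k. ip ph (B$$u k) * ip (v k) ps) has_sum ip ph ((B * T)$$ps)) I" for ph ps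
  using nuclear_onD(2)[OF assms, of "bop_adj B$$ph" ps] by (simp add: ip_adjl bop_times)
qed

lemma nuclear_on_adj:
 assumes "nuclear_on T u v I" shows "nuclear_on (bop_adj T) v u I"
 unfolding nuclear_on_def
proof (intro conjI allI)
 show "(%k. norm (v k) * norm (u k)) summable_on I" using nuclear_onD(1)[OF assms] by (simp add: mult.commute)
 fix ph ps
 have "((%k. cnj (ip ps (u k) * ip (v k) ph)) has_sum cnj (ip ps (T$$ph))) I"
  by (subst has_sum_cnj_iff) (rule nuclear_onD(2)[OF assms])
 moreover have "cnj (ip ps (u k) * ip (v k) ph) = ip ph (v k) * ip (u k) ps" for k
  using cinner_commute[of ph "v k"] cinner_commute[of "u k" ps] by simp
 moreover have "cnj (ip ps (T$$ph)) = ip ph (bop_adj T$$ps)"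
  using cinner_commute[of "T$$ph" ps] by (simp add: ip_adjr)
 ultimately show "((%k. ip ph (v k) * ip (u k) ps) has_sum ip ph (bop_adj T$$ps)) I" by simp
qed

lemma nuclear_on_mult_right:
 assumes "nuclear_on T u v I" shows "nuclear_on (T * B) u (%k. bop_adj B$$v k) I"
 using nuclear_on_adj[OF nuclear_on_mult_left[OF nuclear_on_adj[OF assms], of "bop_adj B"]]
 by (simp add: bop_adj_simps)

lemma nuclear_trace_mult:
 assumes "nuclear_on T u v I"
 shows "((%k. ip (v k) (B$$u k)) has_sum trace (B * T)) I"
  and "((%k. ip (v k) (B$$u k)) has_sum trace (T * B)) I"
 using nuclear_on_trace_aux(1)[OF nuclear_on_mult_left[OF assms, of B]]
  nuclear_on_trace_aux(1)[OF nuclear_on_mult_right[OF assms, of B]] by (simp_all add: ip_adjl)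

lemma nuclear_mult_left: "nuclear T ==> nuclear (B * T)"
 unfolding nuclear_def using nuclear_on_mult_left by blast
lemma nuclear_mult_right: "nuclear T ==> nuclear (T * B)"
 unfolding nuclear_def using nuclear_on_mult_right by blast
lemma nuclear_adj: "nuclear T ==> nuclear (bop_adj T)"
 unfolding nuclear_def using nuclear_on_adj by blast

lemma trace_commute: "nuclear T ==> trace (T * B) = trace (B * T)"
proof -
 assume "nuclear T"
 then obtain u v :: "nat => 'a l2" where "nuclear_on T u v UNIV" unfolding nuclear_def by auto
 thus ?thesis using has_sum_unique[OF nuclear_trace_mult(2) nuclear_trace_mult(1)] by metis
qed

lemma nuclear_on_add:
 assumes S: "nuclear_on S u v I" and T: "nuclear_on T u' v' J"
 shows "nuclear_on (S + T) (case_sum u u') (case_sum v v') (Inl ` I \<union> Inr ` J)"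
proof -
 have tr: "((%k. f (case_sum u u' k) (case_sum v v' k)) has_sum (s + t)) (Inl ` I \<union> Inr ` J)"
  if "((%k. f (u k) (v k)) has_sum s) I" "((%k. f (u' k) (v' k)) has_sum t) J"
  for f :: "_ => _ => 'z::real_normed_vector" and s t
  using that by (intro has_sum_Un_disjoint) (auto simp: has_sum_reindex o_def)
 show ?thesis unfolding nuclear_on_def
 proof (intro conjI allI)
  show "(%k. norm (case_sum u u' k) * norm (case_sum v v' k)) summable_on Inl ` I \<union> Inr ` J"
   using tr[of "%x y. norm x * norm y", OF has_sum_infsum[OF nuclear_onD(1)[OF S]] has_sum_infsum[OF nuclear_onD(1)[OF T]]]
   by (rule has_sum_imp_summable)
  show "((%k. ip ph (case_sum u u' k) * ip (case_sum v v' k) ps) has_sum ip ph ((S + T)$$ps)) (Inl ` I \<union> Inr ` J)" for ph ps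
   using tr[of "%x y. ip ph x * ip y ps", OF nuclear_onD(2)[OF S] nuclear_onD(2)[OF T]]
   by (simp add: bop_simps ip_simps)
 qed
qed

lemma nuclear_add: "nuclear S ==> nuclear T ==> nuclear (S + T)"
proof -
 assume "nuclear S" "nuclear T"
 then obtain u v u' v' :: "nat => 'a l2" where "nuclear_on S u v UNIV" "nuclear_on T u' v' UNIV"
  unfolding nuclear_def by auto
 from nuclear_on_imp_nuclear[OF nuclear_on_add[OF this]] show ?thesis .
qed

lemma nuclear_on_scaleC:
 assumes "nuclear_on T u v I" shows "nuclear_on (c *: T) (%k. c *: u k) v I"
 unfolding nuclear_on_def
proof (intro conjI allI)
 show "(%k. norm (c *: u k) * norm (v k)) summable_on I"
  using summable_on_cmult_right[OF nuclear_onD(1)[OF assms], of "cmod c"] by (simp add: norm_scaleC_l2 mult.assoc)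
 show "((%k. ip ph (c *: u k) * ip (v k) ps) has_sum ip ph ((c *: T)$$ps)) I" for ph ps
  using has_sum_cmult_right[OF nuclear_onD(2)[OF assms, of ph ps], of c] by (simp add: bop_simps ip_simps mult.assoc)
qed

lemma nuclear_scaleC: "nuclear T ==> nuclear (c *: T)"
 unfolding nuclear_def using nuclear_on_scaleC by blast

lemma bop_scaleR_scaleC: "r *. T = cor r *: (T :: 'a::euclidean_space bop)"
 by (rule bop_eqI) (simp add: bop_simps scaleR_l2_def)

lemma bop_minus_scaleC: "- T = (-1) *: (T :: 'a::euclidean_space bop)"
 by (rule bop_eqI) (simp add: bop_simps scaleC_minus_left_l2)

lemma nuclear_scaleR: "nuclear T ==> nuclear (r *. T)"
 by (simp add: bop_scaleR_scaleC nuclear_scaleC)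
lemma nuclear_minus: "nuclear T ==> nuclear (- T)"
 by (simp add: bop_minus_scaleC nuclear_scaleC)
lemma nuclear_diff: "nuclear S ==> nuclear T ==> nuclear (S - T)"
 using nuclear_add[OF _ nuclear_minus] by fastforce
lemma nuclear_zero: "nuclear 0"
 unfolding nuclear_def nuclear_on_def by (intro exI[of _ "%_. 0"]) simp

lemma trace_add: "nuclear S ==> nuclear T ==> trace (S + T) = trace S + trace T"
proof (rule trace_eqI, unfold has_trace_def, intro allI impI)
 fix E :: "'a l2 set"
 assume "nuclear S" "nuclear T" "is_onb E"
 thus "((%e. ip e ((S + T)$$e)) has_sum trace S + trace T) E"
  using nuclear_has_trace[of S] nuclear_has_trace[of T]
  by (auto simp: bop_simps ip_simps has_trace_def intro!: has_sum_add)
qed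

lemma trace_scaleC: "nuclear T ==> trace (c *: T) = c * trace T"
 using nuclear_has_trace[of T]
 by (intro trace_eqI) (auto simp: has_trace_def bop_simps ip_simps intro!: has_sum_cmult_right)

lemma trace_scaleR: "nuclear T ==> trace (r *. T) = of_real r * trace T"
 by (simp add: bop_scaleR_scaleC trace_scaleC)
lemma trace_minus: "nuclear T ==> trace (- T) = - trace T"
 by (simp add: bop_minus_scaleC trace_scaleC)
lemma trace_diff: "nuclear S ==> nuclear T ==> trace (S - T) = trace S - trace T"
 using trace_add[of S "- T"] by (simp add: nuclear_minus trace_minus)
lemma sa_eigen_nuclear:
 assumes E: "is_onb E" and eig: "!!e. e:E ==> T$$e = (r e :: real) *. e" and sa: "bop_adj T = T"
  and sm: "(%e. abs (r e)) summable_on E"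
 shows "nuclear_on T (%e. r e *. e) (%e. e) E"
 unfolding nuclear_on_def
proof (intro conjI allI)
 have oE: "onb_on (%e. e) E" using E by (simp add: is_onb_iff)
 have n1: "norm e = 1" if "e:E" for e using norm_ortho[OF onb_ortho[OF oE] that] .
 show "(%e. norm (r e *. e) * norm e) summable_on E"
  using sm by (rule summable_on_cong[THEN iffD1, rotated]) (simp add: n1)
 fix ph ps
 have "((%e. ip ph e * ip e (T$$ps)) has_sum ip ph (T$$ps)) E" by (rule onb_parseval[OF oE])
 moreover have "ip ph e * ip e (T$$ps) = ip ph (r e *. e) * ip e ps" if "e:E" for e
  using ip_adjl[of T e ps] eig[OF that] by (simp add: sa ip_simps)
 ultimately show "((%e. ip ph (r e *. e) * ip e ps) has_sum ip ph (T$$ps)) E"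
  by (simp cong: has_sum_cong)
qed

text \<open>In an eigenbasis the diagonal consists of the eigenvalues, and unconditional convergence
  of a complex series is absolute convergence.\<close>

lemma sa_tc_nuclear:
 assumes sa: "bop_adj T = T" and tr: "has_trace T c"
 shows "nuclear T"
proof -
 obtain E r where E: "is_onb E" "!!e. e:E ==> T$$e = (r e :: real) *. e"
  using spectral_onb[OF sa tc_form_compact[OF tr]] by metis
 have "(%e. ip e (T$$e)) summable_on E" using tr E(1) unfolding has_trace_def by (meson has_sum_imp_summable)
 moreover have "ip e (T$$e) = of_real (r e)" if "e:E" for e
  using E that by (simp add: ip_scaleRr is_onb_def)
 ultimately have "(%e. cor (r e)) summable_on E" by (simp cong: summable_on_cong)
 hence "(%e. abs (r e)) summable_on E"
  using summable_on_iff_abs_summable_on_complex[of "%e. cor (r e)" E] by simp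
 thus ?thesis using sa_eigen_nuclear[OF E sa] nuclear_on_imp_nuclear by blast
qed

text \<open>Real and imaginary part inherit a trace from \<open>T\<close>, which reduces the claim
  to the self-adjoint case.\<close>

lemma tc_nuclear:
 assumes "trace_class T" shows "nuclear T"
proof -
 obtain c where c: "has_trace T c" using assms by (auto simp: trace_class_def)
 have cadj: "has_trace (bop_adj T) (cnj c)" unfolding has_trace_def
 proof (intro allI impI)
  fix E :: "'a l2 set" assume "is_onb E"
  hence "((%e. cnj (ip e (T$$e))) has_sum cnj c) E" using c by (simp add: has_trace_def)
  moreover have "cnj (ip e (T$$e)) = ip e (bop_adj T$$e)" for e
   using cinner_commute[of "T$$e" e] by (simp add: ip_adjr)
  ultimately show "((%e. ip e (bop_adj T$$e)) has_sum cnj c) E" by simp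
 qed
 have "has_trace (T + bop_adj T) (c + cnj c)"
  using c cadj by (auto simp: has_trace_def bop_simps ip_simps intro!: has_sum_add)
 hence A: "nuclear (T + bop_adj T)"
  by (rule sa_tc_nuclear[rotated]) (simp add: bop_adj_simps add.commute)
 have "has_trace (\<i> *: (T - bop_adj T)) (\<i> * (c + (- 1) * cnj c))"
  unfolding has_trace_def
 proof (intro allI impI)
  fix E :: "'a l2 set" assume E: "is_onb E"
  have "((%e. \<i> * (ip e (T$$e) + (- 1) * ip e (bop_adj T$$e))) has_sum \<i> * (c + (- 1) * cnj c)) E"
   using c cadj E unfolding has_trace_def by (intro has_sum_cmult_right has_sum_add) auto
  thus "((%e. ip e ((\<i> *: (T - bop_adj T))$$e)) has_sum \<i> * (c + (- 1) * cnj c)) E"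
   by (simp add: bop_simps ip_simps)
 qed
 moreover have "bop_adj (\<i> *: (T - bop_adj T)) = \<i> *: (T - bop_adj T)"
  by (rule bop_eqI) (simp add: bop_adj_simps bop_simps scaleC_l2_diff scaleC_minus_left_l2)
 ultimately have B: "nuclear (\<i> *: (T - bop_adj T))" using sa_tc_nuclear by blast
 have "T = (1/2) *: (T + bop_adj T) + (- \<i>/2) *: (\<i> *: (T - bop_adj T))"
  by (rule bop_eqI)
   (simp add: bop_simps scaleC_l2_simps scaleC_l2_diff scaleC_add_l2[symmetric])
 thus ?thesis using nuclear_add[OF nuclear_scaleC[OF A] nuclear_scaleC[OF B]] by metis
qed

lemma tc_iff_nuclear: "trace_class T \<longleftrightarrow> nuclear T"
 using tc_nuclear nuclear_has_trace unfolding trace_class_def by blast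

lemma density_nuc: "density_op rh ==> nuclear rh"
 using tc_nuclear unfolding density_op_def trace_class_def by blast

lemma density_op_trace: "density_op rh ==> trace rh = 1"
 unfolding density_op_def using trace_eqI by blast

lemma density_op_sa: "density_op rh ==> bop_adj rh = rh"
 unfolding density_op_def using pos_op_sa by blast

subsection \<open>The trace norm\<close>

text \<open>The nuclear series is split: its tail has small norm, and its head sees \<open>x\<close>
  only through finitely many coefficients. The Gram operator can thus be diagonalised before
  \<open>abs_op\<close> is known to exist.\<close>

lemma nuclear_gram_form_compact:
 assumes "nuclear T" shows "form_compact (bop_adj T * T)"
 unfolding form_compact_def
proof (intro allI impI)
 fix ep :: real assume ep: "0 < ep"
 obtain u v :: "nat => 'a l2" where T: "nuclear_on T u v UNIV" using assms by (auto simp: nuclear_def)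
 define w where "w = (%k. norm (u k) * norm (v k))"
 have w: "summable w" unfolding w_def using nuclear_onD(1)[OF T] by (rule summable_on_imp_summable)
 have w0: "0 <= w k" for k by (simp add: w_def)
 \<comment> \<open>The half compensates the factor \<open>2\<close> lost when the square of a sum is
   bounded by twice the sum of squares.\<close>
 define dl where "dl = sqrt (ep / 2)"
 have dl: "0 < dl" "2 * dl\<^sup>2 = ep" using ep by (simp_all add: dl_def)
 obtain N where "ALL n>=N. norm (\<Sum>i. w (i + n)) < dl" using suminf_exist_split[OF dl(1) w] by blast
 hence N: "(\<Sum>i. w (i + N)) <= dl" by (auto simp: less_imp_le abs_less_iff)
 define F where "F = v ` {..<N}"
 define K where "K = 2 * ((\<Sum>k<N. norm (u k)))^2"
 have "cmod (ip x ((bop_adj T * T)$$x)) <= ep * (norm x)^2 + K * (\<Sum>f\<in>F. (cmod (ip f x))^2)" for x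
 proof -
  define s where "s = sqrt (\<Sum>f\<in>F. (cmod (ip f x))^2)"
  have s0: "0 <= s" by (simp add: s_def sum_nonneg)
  have vs: "cmod (ip (v k) x) <= s" if "k < N" for k
   unfolding s_def using that
   by (intro real_le_rsqrt member_le_sum[where f="%f. (cmod (ip f x))^2"]) (auto simp: F_def)
  have "norm (T$$x) <= (\<Sum>k<N. norm (u k)) * s + dl * norm x"
  proof (rule norm_le_by_ip)
   fix ph
   have sums: "(%k. ip ph (u k) * ip (v k) x) sums ip ph (T$$x)"
    by (rule has_sum_imp_sums[OF nuclear_onD(2)[OF T]])
   have le: "norm (ip ph (u k) * ip (v k) x) <= norm ph * norm x * w k" for k
    using mult_mono[OF norm_ip[of ph "u k"] norm_ip[of "v k" x]] by (simp add: norm_mult w_def mult_ac)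
   have "ip ph (T$$x) = (\<Sum>k. ip ph (u (k + N)) * ip (v (k + N)) x) + (\<Sum>k<N. ip ph (u k) * ip (v k) x)"
    using suminf_split_initial_segment[OF sums_summable[OF sums], of N] sums_unique[OF sums] by simp
   hence "cmod (ip ph (T$$x)) <= cmod (\<Sum>k. ip ph (u (k + N)) * ip (v (k + N)) x) + cmod (\<Sum>k<N. ip ph (u k) * ip (v k) x)"
    by (simp add: norm_triangle_ineq)
   also have "cmod (\<Sum>k. ip ph (u (k + N)) * ip (v (k + N)) x) <= (\<Sum>k. norm ph * norm x * w (k + N))"
    by (rule norm_suminf_le[OF le]) (intro summable_mult summable_ignore_initial_segment w)
   also have "(\<Sum>k. norm ph * norm x * w (k + N)) = norm ph * norm x * (\<Sum>k. w (k + N))"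
    by (rule suminf_mult) (intro summable_ignore_initial_segment w)
   also have "... <= norm ph * norm x * dl" by (intro mult_left_mono N) simp
   also have "cmod (\<Sum>k<N. ip ph (u k) * ip (v k) x) <= (\<Sum>k<N. norm ph * norm (u k) * s)"
    by (rule order_trans[OF norm_sum], rule sum_mono) (auto simp: norm_mult intro!: mult_mono norm_ip vs)
   also have "... = norm ph * ((\<Sum>k<N. norm (u k)) * s)" by (simp add: sum_distrib_left sum_distrib_right mult_ac)
   finally show "cmod (ip ph (T$$x)) <= ((\<Sum>k<N. norm (u k)) * s + dl * norm x) * norm ph"
    by (simp add: algebra_simps)
  qed (use s0 dl in "auto intro!: add_nonneg_nonneg mult_nonneg_nonneg sum_nonneg")
  hence "(norm (T$$x))^2 <= ((\<Sum>k<N. norm (u k)) * s + dl * norm x)^2" by (intro power_mono) auto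
  also have "... <= 2 * (dl * norm x)^2 + 2 * ((\<Sum>k<N. norm (u k)) * s)^2"
   using sum_squares_bound[of "(\<Sum>k<N. norm (u k)) * s" "dl * norm x"] by (simp add: power2_sum)
  also have "... = ep * (norm x)^2 + K * s\<^sup>2" unfolding dl(2)[symmetric] K_def by (simp add: power_mult_distrib)
  also have "s\<^sup>2 = (\<Sum>f\<in>F. (cmod (ip f x))^2)" by (simp add: s_def sum_nonneg)
  finally show ?thesis by (simp add: bop_times ip_adjr ip_self norm_power)
 qed
 thus "EX F K. finite F & 0 <= K &
  (ALL x. cmod (ip x ((bop_adj T * T)$$x)) <= ep * (norm x)^2 + K * (\<Sum>f\<in>F. (cmod (ip f x))^2))"
  by (intro exI[of _ F] exI[of _ K]) (simp add: F_def K_def)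
qed

lemma has_sum_finite_sum:
 fixes f :: "'j => 'i => 'c::topological_comm_monoid_add"
 assumes "finite J" "!!j. j:J ==> (f j has_sum S j) A"
 shows "((%x. \<Sum>j\<in>J. f j x) has_sum (\<Sum>j\<in>J. S j)) A"
 using assms by (induction J rule: finite_induct) (auto intro!: has_sum_add)

text \<open>In an eigenbasis \<open>E\<close> of \<open>T\<^sup>* T\<close> the vectors \<open>T e\<close> are orthogonal, which yields the singular value
 decomposition; the trace norm is the least cost of a nuclear representation.\<close>

theorem trace_norm_nuclear:
 assumes T: "nuclear T"
 obtains E where "is_onb E" "nuclear_on T (%e. T$$e) (%e. e) E" "trace_norm T = (\<Sum>\<^sub>\<infinity>e\<in>E. norm (T$$e))"
  "(%e. norm (T$$e)) summable_on E"
  "!!(u::nat => 'a::euclidean_space l2) v. nuclear_on T u v UNIV ==> trace_norm T <= (\<Sum>\<^sub>\<infinity>k. norm (u k) * norm (v k))"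
proof -
 define Q where "Q = bop_adj T * T"
 have Qsa: "bop_adj Q = Q" by (simp add: Q_def bop_adj_simps)
 obtain E q where E: "is_onb E" and q: "!!e. e:E ==> Q$$e = (q e :: real) *. e"
  using spectral_onb[OF Qsa nuclear_gram_form_compact[OF T, folded Q_def]] by metis
 have oE: "onb_on (%e. e) E" using E by (simp add: is_onb_iff)
 have n1: "norm e = 1" if "e:E" for e using norm_ortho[OF onb_ortho[OF oE] that] .
 have TT: "ip (T$$e) (T$$f) = (if e = f then of_real (q e) else 0)" if "e:E" "f:E" for e f
 proof -
  have "ip (T$$e) (T$$f) = ip e (Q$$f)" by (simp add: Q_def bop_times ip_adjr)
  thus ?thesis using E that by (simp add: q ip_scaleRr is_onb_def)
 qed
 have qn: "q e = (norm (T$$e))^2" if "e:E" for e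
  using TT[OF that that] unfolding ip_self by (simp del: of_real_power)
 have fin: "(\<Sum>e\<in>J. norm (T$$e)) <= (\<Sum>\<^sub>\<infinity>k. norm (u k) * norm (v k))"
  if uv: "nuclear_on T u v UNIV" and J: "finite J" "J \<subseteq> E" for u v :: "nat => 'a l2" and J
 proof -
  \<comment> \<open>Basis vectors with \<open>T$$e = 0\<close> contribute nothing, and their images
    could not be normalised.\<close>
  define J' where "J' = {e\<in>J. T$$e ~= 0}"
  define f where "f = (%e. (1 / norm (T$$e)) *. (T$$e))"
  have J': "finite J'" "J' \<subseteq> E" using J by (auto simp: J'_def)
  have of: "ortho_on f J'" unfolding ortho_on_def
  proof (intro ballI)
   fix i j assume ij: "i:J'" "j:J'"
   hence "ip (T$$i) (T$$j) = (if i = j then of_real ((norm (T$$i))^2) else 0)"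
    using TT[of i j] subsetD[OF J'(2) ij(1)] subsetD[OF J'(2) ij(2)] qn[of i] by (simp del: of_real_power) auto
   moreover have "T$$i ~= 0" using ij by (simp add: J'_def)
   ultimately show "ip (f i) (f j) = (if i = j then 1 else 0)"
    by (auto simp: f_def ip_simps power2_eq_square)
  qed
  have oe: "ortho_on (%e. e) J'" by (rule ortho_on_subset[OF onb_ortho[OF oE] J'(2)])
  have "((%k. \<Sum>e\<in>J'. ip (f e) (u k) * ip (v k) e) has_sum (\<Sum>e\<in>J'. ip (f e) (T$$e))) UNIV"
   by (intro has_sum_finite_sum J'(1) nuclear_onD(2)[OF uv])
  moreover have "(\<Sum>e\<in>J'. ip (f e) (T$$e)) = of_real (\<Sum>e\<in>J'. norm (T$$e))"
   unfolding of_real_sum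
   by (intro sum.cong refl) (auto simp: f_def ip_simps ip_self power2_eq_square J'_def)
  ultimately have hs: "((%k. \<Sum>e\<in>J'. ip (f e) (u k) * ip (v k) e) has_sum of_real (\<Sum>e\<in>J'. norm (T$$e))) UNIV"
   by simp
  have "norm (of_real (\<Sum>e\<in>J'. norm (T$$e)) :: complex) <= (\<Sum>\<^sub>\<infinity>k. norm (u k) * norm (v k))"
  proof (rule norm_infsum_le[OF hs has_sum_infsum[OF nuclear_onD(1)[OF uv]]])
   fix k
   \<comment> \<open>Bessel's inequality for the normalised images \<open>f\<close> and for the
     basis bounds each term by \<open>norm (u k) * norm (v k)\<close>, so no nuclear representation
     is cheaper than the sum of singular values.\<close>
   have "cmod (\<Sum>e\<in>J'. ip (f e) (u k) * ip (v k) e) <= (\<Sum>e\<in>J'. (abs (cmod (ip (f e) (u k)))) * (abs (cmod (ip e (v k)))))"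
    by (rule order_trans[OF norm_sum]) (simp add: norm_mult cmod_ip_commute[of "v k"])
   also have "... <= L2_set (%e. cmod (ip (f e) (u k))) J' * L2_set (%e. cmod (ip e (v k))) J'"
    by (rule L2_set_mult_ineq)
   also have "... <= norm (u k) * norm (v k)"
    unfolding L2_set_def using bessel_finite[OF of J'(1) order_refl] bessel_finite[OF oe J'(1) order_refl]
    by (intro mult_mono real_le_lsqrt) (auto intro!: sum_nonneg)
   finally show "cmod (\<Sum>e\<in>J'. ip (f e) (u k) * ip (v k) e) <= norm (u k) * norm (v k)" .
  qed
  moreover have "(\<Sum>e\<in>J. norm (T$$e)) = (\<Sum>e\<in>J'. norm (T$$e))"
   unfolding J'_def using J(1) by (intro sum.mono_neutral_right) auto
  ultimately show ?thesis by (simp add: abs_of_nonneg sum_nonneg del: of_real_sum)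
 qed
 obtain u0 v0 :: "nat => 'a l2" where uv0: "nuclear_on T u0 v0 UNIV" using T by (auto simp: nuclear_def)
 have sm: "(%e. norm (T$$e)) summable_on E"
  using nonneg_summI(1)[of E "%e. norm (T$$e)"] fin[OF uv0] by auto
 have inf_le: "(\<Sum>\<^sub>\<infinity>e\<in>E. norm (T$$e)) <= (\<Sum>\<^sub>\<infinity>k. norm (u k) * norm (v k))" if "nuclear_on T u v UNIV" for u v :: "nat => 'a l2"
  using nonneg_summI(2)[of E "%e. norm (T$$e)"] fin[OF that] by auto
 define s where "s = (%e. norm (T$$e))"
 have "(%e. norm (s e *. e) * norm e) summable_on E"
  using sm by (rule summable_on_cong[THEN iffD1, rotated]) (simp add: n1 s_def)
 then obtain S where S: "nuclear_on S (%e. s e *. e) (%e. e) E"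
  using nuclear_on_exists[where u="%e. s e *. e" and v="%e. e" and I=E] by auto
 have Se: "S$$e = s e *. e" if "e:E" for e
 proof (rule ip_eqI)
  fix ph
  have "((%f. ip ph (s f *. f) * ip f e) has_sum ip ph (s e *. e)) E"
   using that E by (intro has_sum_finite_neutralI[of "{e}"]) (auto simp: is_onb_def)
  thus "ip ph (S$$e) = ip ph (s e *. e)"
   using nuclear_onD(2)[OF S, of ph e] has_sum_unique by blast
 qed
 have Sform: "((%e. of_real (s e * (cmod (ip e ps))^2)) has_sum ip ps (S$$ps)) E" for ps
 proof -
  have "ip ps (s e *. e) * ip e ps = of_real (s e * (cmod (ip e ps))^2)" for e
   using cinner_commute[of ps e] complex_norm_square[of "ip e ps"] by (simp add: ip_scaleRr mult_ac)
  thus ?thesis using nuclear_onD(2)[OF S, of ps ps] by simp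
 qed
 have Spos: "pos_op S" unfolding pos_op_def
 proof (intro allI conjI)
  fix ps
  have "((%e. Im (of_real (s e * (cmod (ip e ps))^2))) has_sum Im (ip ps (S$$ps))) E"
   by (rule has_sum_Im[OF Sform])
  hence "((%e. 0 :: real) has_sum Im (ip ps (S$$ps))) E" by simp
  thus "Im (ip ps (S$$ps)) = 0" using has_sum_0_simp has_sum_unique by blast
  show "0 <= Re (ip ps (S$$ps))"
   by (rule has_sum_nonneg[OF has_sum_Re[OF Sform]]) (simp add: s_def)
 qed
 have "abs_op T = S" unfolding abs_op_def
 proof (rule the_equality)
  show "pos_op S & S * S = bop_adj T * T"
   using Spos by (intro conjI bop_eqI_onb[OF oE])
    (auto simp: bop_times[of S S] Se bop_simps(4) q[unfolded Q_def] qn s_def power2_eq_square)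
 next
  fix S' assume S': "pos_op S' & S' * S' = bop_adj T * T"
  have S'sa: "bop_adj S' = S'" using S' pos_op_sa by blast
  show "S' = S"
  proof (rule bop_eqI_onb[OF oE])
   fix e assume e: "e:E"
   have SS: "S'$$S'$$e = (s e * s e) *. e"
    using S' q[OF e] qn[OF e] by (metis Q_def bop_times s_def power2_eq_square)
   show "S'$$e = S$$e"
   proof (cases "s e = 0")
    case True
    have "ip (S'$$e) (S'$$e) = ip e (S'$$S'$$e)" using ip_adjl[of S' e "S'$$e"] S'sa by simp
    hence "S'$$e = 0" using True by (simp add: SS ip_self)
    thus ?thesis using True e by (simp add: Se)
   next
    case False
    \<comment> \<open>Because \<open>S'$$S'$$e\<close> is \<open>s e * s e\<close> times
      \<open>e\<close>, this vector satisfies \<open>S'$$w = - (s e *. w)\<close>, which positivity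
      of \<open>S'\<close> allows only for \<open>w = 0\<close>. This is the uniqueness of the
      positive square root.\<close>
    define w where "w = S'$$e - s e *. e"
    have "S'$$w = - (s e *. w)" by (simp add: w_def bop_simps SS scaleR_diff_right)
    hence "Re (ip w (S'$$w)) = - (s e * (norm w)^2)" by (simp add: ip_simps Re_ip_self)
    moreover have "0 <= Re (ip w (S'$$w))" using S' by (simp add: pos_op_def)
    ultimately have "s e * (norm w)^2 <= 0" by simp
    moreover have "0 < s e" using False by (simp add: s_def)
    ultimately have "w = 0" by (simp add: mult_le_0_iff)
    thus ?thesis using e by (simp add: Se w_def)
   qed
  qed
 qed
 moreover have "trace S = of_real (\<Sum>\<^sub>\<infinity>e\<in>E. s e)"
 proof -
  have "((%e. ip e (s e *. e)) has_sum trace S) E" by (rule nuclear_on_trace_aux(1)[OF S])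
  moreover have "ip e (s e *. e) = of_real (s e)" if "e:E" for e
   using E that by (simp add: ip_scaleRr is_onb_def)
  ultimately have "((%e. of_real (s e)) has_sum trace S) E" by (simp cong: has_sum_cong)
  moreover have "((%e. cor (s e)) has_sum of_real (\<Sum>\<^sub>\<infinity>e\<in>E. s e)) E"
   using sm by (intro has_sum_of_real has_sum_infsum) (simp add: s_def)
  ultimately show ?thesis using has_sum_unique by blast
 qed
 ultimately have tn: "trace_norm T = (\<Sum>\<^sub>\<infinity>e\<in>E. norm (T$$e))" by (simp add: trace_norm_def s_def)
 have "nuclear_on T (%e. T$$e) (%e. e) E" unfolding nuclear_on_def
 proof (intro conjI allI)
  show "(%e. norm (T$$e) * norm e) summable_on E"
   using sm by (rule summable_on_cong[THEN iffD1, rotated]) (simp add: n1)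
  show "((%e. ip ph (T$$e) * ip e ps) has_sum ip ph (T$$ps)) E" for ph ps
   using onb_parseval[OF oE, of "bop_adj T$$ph" ps] by (simp add: ip_adjl)
 qed
 thus ?thesis using that E tn sm inf_le by simp
qed

lemma trace_norm_le:
 assumes "nuclear_on T u v I"
 shows "trace_norm T <= (\<Sum>\<^sub>\<infinity>k\<in>I. norm (u k) * norm (v k))"
proof -
 obtain u' v' :: "nat => 'a l2" where uv: "nuclear_on T u' v' UNIV"
  "(\<Sum>\<^sub>\<infinity>k. norm (u' k) * norm (v' k)) = (\<Sum>\<^sub>\<infinity>k\<in>I. norm (u k) * norm (v k))"
  using nuclear_on_nat[OF assms] by metis
 show ?thesis
 proof (rule trace_norm_nuclear[OF nuclear_on_imp_nuclear[OF assms]])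
  assume *: "!!(u::nat => 'a l2) v. nuclear_on T u v UNIV ==> trace_norm T <= (\<Sum>\<^sub>\<infinity>k. norm (u k) * norm (v k))"
  show ?thesis using *[OF uv(1)] uv(2) by simp
 qed
qed

lemma trace_norm_nonneg:
 assumes "nuclear T" shows "0 <= trace_norm T"
proof (rule trace_norm_nuclear[OF assms])
 fix E assume "trace_norm T = (\<Sum>\<^sub>\<infinity>e\<in>E. norm (T$$e))"
 thus ?thesis by (simp add: infsum_nonneg)
qed

section \<open>Weighted means\<close>

definition eigenbasis :: "'a::euclidean_space bop => (nat => 'a l2) => (nat => real) => bool" where
 "eigenbasis rh e r \<longleftrightarrow> density_op rh & onb_on e UNIV & (ALL k. rh$$e k = r k *. e k)"

lemma diagonal_op_exists:
 fixes h :: "'i => 'a::euclidean_space l2"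
 assumes h: "onb_on h UNIV" and d: "!!k. cmod (d k) <= B"
 shows "EX D. (ALL k ps. ip (h k) (D$$ps) = d k * ip (h k) ps) & (ALL ps. norm (D$$ps) <= B * norm ps)"
proof -
 have B: "0 <= B" using d[of undefined] norm_ge_zero order_trans by blast
 have "EX et. (ALL k. ip (h k) et = d k * ip (h k) ps) & norm et <= B * norm ps" for ps
 proof -
  have le: "(cmod (d k * ip (h k) ps))^2 <= B\<^sup>2 * (cmod (ip (h k) ps))^2" for k
   unfolding norm_mult power_mult_distrib using d by (intro mult_right_mono power_mono) auto
  have hs: "((%k. B\<^sup>2 * (cmod (ip (h k) ps))^2) has_sum B\<^sup>2 * (norm ps)^2) UNIV"
   by (intro has_sum_cmult_right onb_norm[OF h])
  have sm: "(%k. (cmod (d k * ip (h k) ps))^2) summable_on UNIV"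
   by (rule sum_comp[OF has_sum_imp_summable[OF hs]]) (use le in simp)
  obtain et where et: "!!k. ip (h k) et = d k * ip (h k) ps"
   "norm et <= sqrt (\<Sum>\<^sub>\<infinity>k. (cmod (d k * ip (h k) ps))^2)"
   using riesz_fischer[OF onb_ortho[OF h] sm] by (metis UNIV_I)
  have "(\<Sum>\<^sub>\<infinity>k. (cmod (d k * ip (h k) ps))^2) <= (B * norm ps)^2"
   unfolding power_mult_distrib[of B] infsumI[OF hs, symmetric]
   by (rule infsum_mono[OF sm has_sum_imp_summable[OF hs]]) (use le in auto)
  hence "norm et <= B * norm ps" using et(2) B by (meson order_trans real_le_lsqrt mult_nonneg_nonneg norm_ge_zero infsum_nonneg zero_le_power2)
  thus ?thesis using et(1) by blast
 qed
 then obtain f where f: "!!k ps. ip (h k) (f ps) = d k * ip (h k) ps" "!!ps. norm (f ps) <= B * norm ps"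
  by metis
 have "EX D. ALL ps. D$$ps = f ps"
  by (rule bop_exists[where K=B])
   (auto intro!: onb_on_eqI[OF h] simp: f cinner_add_right cinner_scaleC_right distrib_left)
 thus ?thesis using f by metis
qed

lemma eigenb:
 assumes "eigenbasis rh e r"
 shows "0 <= r k" "(r has_sum 1) UNIV" "r k <= 1" "ip (e k) (rh$$ps) = of_real (r k) * ip (e k) ps" (is ?A)
proof -
 have rh: "density_op rh" "pos_op rh" and e: "onb_on e UNIV" and eig: "!!k. rh$$e k = r k *. e k"
  using assms by (auto simp: eigenbasis_def density_op_def)
 have ee: "ip (e k) (e k) = 1" for k using orthoD[OF onb_ortho[OF e], of k k] by simp
 hence er: "ip (e k) (rh$$e k) = of_real (r k)" for k by (simp add: eig ip_scaleRr)
 have r0: "0 <= r k" for k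
 proof -
  have "0 <= Re (ip (e k) (rh$$e k))" using rh(2) unfolding pos_op_def by blast
  thus ?thesis by (simp add: er)
 qed
 thus "0 <= r k" .
 have "((%k. of_real (r k)) has_sum (trace rh)) UNIV"
  using nuclear_trace_onb[OF density_nuc[OF rh(1)] e] by (simp add: er)
 hence "((%k. Re (of_real (r k))) has_sum Re 1) UNIV"
  unfolding density_op_trace[OF rh(1)] by (rule has_sum_Re)
 thus r: "(r has_sum 1) UNIV" by simp
 show "r k <= 1" using finite_sum_le_has_sum[OF r, of "{k}"] r0 by simp
 show ?A
  using ip_adjl[of rh "e k" ps] density_op_sa[OF rh(1)] by (simp add: eig ip_scaleR_left)
qed

lemma eb_nuclear:
 assumes "eigenbasis rh e r"
 shows "nuclear_on rh (%k. r k *. e k) e UNIV"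
 unfolding nuclear_on_def
proof (intro conjI allI)
 have e: "onb_on e UNIV" using assms by (simp add: eigenbasis_def)
 have n1: "norm (e k) = 1" for k by (rule norm_ortho[OF onb_ortho[OF e]]) simp
 show "(%k. norm (r k *. e k) * norm (e k)) summable_on UNIV"
  using has_sum_imp_summable[OF eigenb(2)[OF assms]] eigenb(1)[OF assms] by (simp add: n1)
 show "((%k. ip ph (r k *. e k) * ip (e k) ps) has_sum ip ph (rh$$ps)) UNIV" for ph ps
  using onb_parseval[OF e, of ph "rh$$ps"] eigenb(4)[OF assms]
  by (simp add: ip_scaleRr mult.left_commute mult.assoc)
qed

lemma eb_trace_mult:
 assumes "eigenbasis rh e r"
 shows "((%k. of_real (r k) * ip (e k) (B$$e k)) has_sum trace (rh * B)) UNIV"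
 using nuclear_trace_mult(2)[OF eb_nuclear[OF assms], of B] by (simp add: bop_simps ip_simps)

text \<open>The description of \<open>op_powr\<close> speaks of all eigenvectors, so the diagonal
  operator is checked on each of them: its coefficients vanish at basis vectors with another
  eigenvalue. The eigenvalues lie in the unit interval, which keeps the powers bounded.\<close>

lemma op_powr_eigen:
 assumes eb: "eigenbasis rh e r" and s: "0 <= s"
 shows "ip (e k) (op_powr rh s$$ps) = of_real (r k powr s) * ip (e k) ps" (is ?A)
  and "ip (op_powr rh s$$ps) (e k) = of_real (r k powr s) * ip ps (e k)" (is ?B)
proof -
 have e: "onb_on e UNIV" and eig: "!!k. rh$$e k = r k *. e k" using eb by (auto simp: eigenbasis_def)
 have "cmod (of_real (r k powr s)) <= 1" for k
  using eigenb(1,3)[OF eb, of k] s by (auto simp: powr_le1)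
 then obtain D where D: "!!k ps. ip (e k) (D$$ps) = of_real (r k powr s) * ip (e k) ps"
  using diagonal_op_exists[OF e, of "%k. of_real (r k powr s)" 1] by metis
 have "op_powr rh s = D" unfolding op_powr_def
 proof (rule the_equality)
  show "ALL x ps. rh$$ps = x *. ps --> D$$ps = (x powr s) *. ps"
  proof (intro allI impI)
   fix x ps assume x: "rh$$ps = x *. ps"
   show "D$$ps = (x powr s) *. ps"
   proof (rule onb_on_eqI[OF e])
    fix k
    have "of_real (r k) * ip (e k) ps = of_real x * ip (e k) ps"
     using eigenb(4)[OF eb, of k ps] unfolding x ip_scaleRr by (rule sym)
    hence "r k = x \<or> ip (e k) ps = 0" by (metis mult_cancel_right of_real_eq_iff)
    thus "ip (e k) (D$$ps) = ip (e k) ((x powr s) *. ps)"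
     by (auto simp: D ip_scaleRr)
   qed
  qed
  fix T assume T: "ALL x ps. rh$$ps = x *. ps --> T$$ps = (x powr s) *. ps"
  show "T = D"
  proof (rule bop_eqI_onb[OF e])
   fix k
   have "D$$e k = (r k powr s) *. e k"
   proof (rule onb_on_eqI[OF e])
    fix i show "ip (e i) (D$$e k) = ip (e i) ((r k powr s) *. e k)"
     using orthoD[OF onb_ortho[OF e], of i k] by (auto simp: D ip_scaleRr)
   qed
   thus "T$$e k = D$$e k" using T eig by simp
  qed
 qed
 thus *: "ip (e k) (op_powr rh s$$ps) = of_real (r k powr s) * ip (e k) ps" for k ps by (simp add: D)
 show ?B
  by (subst (1 2) cinner_commute) (simp add: *)
qed

text \<open>The kernel is split according to which of \<open>r i\<close> and \<open>r j\<close> is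
  larger. Where \<open>r j\<close> dominates, the columns have norms of order \<open>r j\<close> and
  are summable; the other part is the adjoint of an operator of this kind.\<close>

lemma schur_nuclear:
 fixes e :: "nat => 'a::euclidean_space l2" and M :: "nat => nat => real"
 assumes e: "onb_on e UNIV" and r: "r summable_on UNIV" "!!k. 0 <= r k"
  and M: "!!i j. abs (M i j) <= C * max (r i) (r j)" and C: "0 <= C"
 shows "EX T. nuclear T & (ALL i j. ip (e i) (T$$e j) = of_real (M i j) * ip (e i) (V$$e j))"
proof -
 have n1: "norm (e k) = 1" for k by (rule norm_ortho[OF onb_ortho[OF e]]) simp
 have oo: "ip (e i) (e j) = (if i = j then 1 else 0)" for i j
  by (rule orthoD[OF onb_ortho[OF e]]) simp_all
 have "EX T. nuclear T & (ALL i j. ip (e i) (T$$e j) = of_real (N i j) * ip (e i) (W$$e j))"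
  if N: "!!i j. abs (N i j) <= C * r j" for N :: "nat => nat => real" and W
 proof -
  have "EX D. (ALL i ps. ip (e i) (D$$ps) = of_real (N i j) * ip (e i) ps) & (ALL ps. norm (D$$ps) <= C * r j * norm ps)" for j
   using N by (intro diagonal_op_exists[OF e]) simp
  then obtain D where D: "!!i j ps. ip (e i) (D j$$ps) = of_real (N i j) * ip (e i) ps"
   "!!j ps. norm (D j$$ps) <= C * r j * norm ps" by metis
  define w where "w = (%j. D j$$W$$e j)"
  have wn: "norm (w j) <= C * norm W * r j" for j
  proof -
   have "norm (w j) <= C * r j * norm (W$$e j)" unfolding w_def by (rule D)
   also have "... <= C * r j * norm W" using norm_bop_apply[of W "e j"] C r by (intro mult_left_mono) (auto simp: n1)
   finally show ?thesis by (simp add: mult_ac)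
  qed
  have "(%j. norm (w j)) summable_on UNIV"
   by (rule norm_sum_comp[OF summable_on_cmult_right[OF r(1)]]) (rule wn)
  then obtain T where T: "nuclear_on T w e UNIV" using nuclear_on_exists[of w e UNIV] by (auto simp: n1)
  have "ip (e i) (T$$e j) = of_real (N i j) * ip (e i) (W$$e j)" for i j
  proof -
   have "((%k. ip (e i) (w k) * ip (e k) (e j)) has_sum ip (e i) (w j)) UNIV"
    by (intro has_sum_finite_neutralI[of "{j}"]) (auto simp: oo)
   hence "ip (e i) (T$$e j) = ip (e i) (w j)"
    using nuclear_onD(2)[OF T, of "e i" "e j"] has_sum_unique by blast
   thus ?thesis by (simp add: w_def D)
  qed
  thus ?thesis using nuclear_on_imp_nuclear[OF T] by blast
 qed note main = this
 have "EX T. nuclear T & (ALL i j. ip (e i) (T$$e j) = of_real (if r i < r j then M i j else 0) * ip (e i) (V$$e j))"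
 proof (rule main)
  show "abs (if r i < r j then M i j else 0) <= C * r j" for i j using M[of i j] C r(2) by (auto simp: max_def)
 qed
 then obtain T1 where T1: "nuclear T1" "!!i j. ip (e i) (T1$$e j) = of_real (if r i < r j then M i j else 0) * ip (e i) (V$$e j)"
  by metis
 have "EX T. nuclear T & (ALL i j. ip (e i) (T$$e j) = of_real (if r i <= r j then M j i else 0) * ip (e i) (bop_adj V$$e j))"
 proof (rule main)
  show "abs (if r i <= r j then M j i else 0) <= C * r j" for i j using M[of j i] C r(2) by (auto simp: max_def split: if_splits)
 qed
 then obtain T2 where T2: "nuclear T2" "!!i j. ip (e i) (T2$$e j) = of_real (if r i <= r j then M j i else 0) * ip (e i) (bop_adj V$$e j)"
  by metis
 have T2': "ip (e i) (bop_adj T2$$e j) = of_real (if r j <= r i then M i j else 0) * ip (e i) (V$$e j)" for i j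
 proof -
  have "ip (e i) (bop_adj T2$$e j) = cnj (ip (e j) (T2$$e i))" by (subst cinner_commute) (simp add: ip_adjl)
  also have "... = of_real (if r j <= r i then M i j else 0) * cnj (ip (e j) (bop_adj V$$e i))" by (simp add: T2)
  also have "cnj (ip (e j) (bop_adj V$$e i)) = ip (e i) (V$$e j)"
   by (subst (2) cinner_commute) (simp add: ip_adjr)
  finally show ?thesis .
 qed
 have "ip (e i) ((T1 + bop_adj T2)$$e j) = of_real (M i j) * ip (e i) (V$$e j)" for i j
  by (simp add: bop_simps cinner_add_right T1(2) T2')
 thus ?thesis using nuclear_add[OF T1(1) nuclear_adj[OF T2(1)]] by blast
qed

subsection \<open>The mean kernel\<close>

text \<open>The Schur multiplier by which \<open>weighted_mean\<close> acts in an eigenbasis; for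
  \<open>c = 0\<close> and positive arguments it is the logarithmic mean.\<close>

definition mean_kernel :: "real => real => real => real" where
 "mean_kernel c a b = integral {0..1} (%s. exp (c * (1/2 - s)) * (a powr s * b powr (1 - s)))"

lemma continuous_mean_integrand:
 fixes a b c :: real
 assumes "0 <= a" "0 <= b"
 shows "continuous_on {0..1} (%s. exp (c * (1/2 - s)) * (a powr s * b powr (1 - s)))"
proof -
 have p: "continuous_on {0..1} (%s. a powr f s)" if "0 <= a" "continuous_on {0..1} f" for a :: real and f :: "real => real"
  using that by (cases "a = 0") (auto intro!: continuous_intros)
 show ?thesis using assms by (intro continuous_intros p) auto
qed

lemma powr_mult_le_max:
 fixes a b s :: real
 assumes "0 <= a" "0 <= b" "0 <= s" "s <= 1"
 shows "a powr s * b powr (1 - s) <= max a b"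
proof -
 have "a powr s * b powr (1 - s) <= max a b powr s * max a b powr (1 - s)"
  using assms by (intro mult_mono powr_mono2) auto
 also have "... = max a b" using assms by (cases "max a b = 0") (auto simp flip: powr_add)
 finally show ?thesis .
qed

lemma mean_integrand_bound:
 fixes a b c s :: real
 assumes "0 <= a" "0 <= b" "s:{0..1}"
 shows "0 <= exp (c * (1/2 - s)) * (a powr s * b powr (1 - s))" (is ?A)
  "exp (c * (1/2 - s)) * (a powr s * b powr (1 - s)) <= exp (abs c) * max a b" (is ?B)
proof -
 show ?A by simp
 have "abs (1/2 - s) <= 1" using assms(3) by (simp add: abs_le_iff)
 hence "abs (c * (1/2 - s)) <= abs c" unfolding abs_mult using mult_left_mono[of "abs (1/2 - s)" 1 "abs c"] by simp
 hence "c * (1/2 - s) <= abs c" by linarith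
 thus ?B
  using assms by (intro mult_mono powr_mult_le_max) auto
qed

lemma mean_kernel_has_integral:
 assumes "0 <= a" "0 <= b"
 shows "((%s. exp (c * (1/2 - s)) * (a powr s * b powr (1 - s))) has_integral mean_kernel c a b) {0..1}"
 unfolding mean_kernel_def
 by (intro integrable_integral integrable_continuous_real continuous_mean_integrand assms)

lemma mean_kernel_bounds:
 assumes "0 <= a" "0 <= b"
 shows "0 <= mean_kernel c a b" "mean_kernel c a b <= exp (abs c) * max a b" (is ?A)
proof -
 show "0 <= mean_kernel c a b"
  by (rule has_integral_nonneg[OF mean_kernel_has_integral[OF assms]]) simp
 show ?A
  using has_integral_le[OF mean_kernel_has_integral[OF assms, of c] has_integral_const_real[of "exp (abs c) * max a b" 0 1]]
   mean_integrand_bound(2)[OF assms] by simp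
qed

lemma has_integral_has_sum:
 fixes f :: "'i => real => 'b::banach"
 assumes cont: "!!x. x:X ==> continuous_on {a..b} (f x)"
  and le: "!!x s. x:X ==> s:{a..b} ==> norm (f x s) <= M x" and M: "M summable_on X"
  and S: "!!s. s:{a..b} ==> ((%x. f x s) has_sum S s) X"
  and I: "!!x. x:X ==> (f x has_integral I x) {a..b}" and J: "(I has_sum J) X"
 shows "(S has_integral J) {a..b}"
proof -
 have "uniform_limit {a..b} (%F s. \<Sum>x\<in>F. f x s) S (finite_subsets_at_top X)"
  by (rule Weierstrass_m_test_general'[OF le S M])
 \<comment> \<open>Intersecting with \<open>X\<close> makes the partial sums continuous for every
   index of the filter and not only eventually.\<close>
 hence ul: "uniform_limit {a..b} (%F s. \<Sum>x\<in>F \<inter> X. f x s) S (finite_subsets_at_top X)"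
  by (rule uniform_limit_cong[THEN iffD1, rotated -1])
   (auto intro!: eventually_finite_subsets_at_top_weakI simp: Int_absorb2)
 have "continuous_on {a..b} (%s. \<Sum>x\<in>F \<inter> X. f x s)" for F
  by (intro continuous_on_sum cont) simp
 then obtain I' J' where I': "!!F. ((%s. \<Sum>x\<in>F \<inter> X. f x s) has_integral I' F) {a..b}"
  and J': "(S has_integral J') {a..b}" "(I' \<longlongrightarrow> J') (finite_subsets_at_top X)"
  using uniform_limit_integral[OF ul] finite_subsets_at_top_neq_bot by metis
 have "I' F = (\<Sum>x\<in>F. I x)" if "finite F" "F \<subseteq> X" for F
 proof -
  have "((%s. \<Sum>x\<in>F. f x s) has_integral (\<Sum>x\<in>F. I x)) {a..b}"
   using that I by (intro has_integral_sum) auto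
  thus ?thesis using I'[of F] that has_integral_unique by (metis Int_absorb2)
 qed
 hence "\<forall>\<^sub>F F in finite_subsets_at_top X. I' F = sum I F" by (intro eventually_finite_subsets_at_top_weakI) auto
 hence "(sum I \<longlongrightarrow> J') (finite_subsets_at_top X)" using J'(2) tendsto_cong by blast
 hence "(I has_sum J') X" by (simp add: has_sum_def)
 hence "J' = J" using J has_sum_unique by blast
 thus ?thesis using J'(1) by simp
qed

section \<open>Absolute summability of weighted double series of matrix entries\<close>

lemma weighted_pair_summ:
 fixes r x :: "nat => real" and g h :: "nat => nat => real"
 assumes r: "r summable_on UNIV" "!!k. 0 <= r k" and x: "!!k. 0 <= x k" "!!k. x k <= B"
  and g: "!!i. g i summable_on UNIV" "!!i. infsum (g i) UNIV <= K" "!!i j. 0 <= g i j"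
 shows "(%(i, j). r i * x i * g i j) summable_on UNIV"
proof -
 have B: "0 <= B" using x order_trans by blast
 have K: "0 <= K" using g(2)[of 0] infsum_nonneg[of UNIV "g 0"] g(3) by force
 have "(%p. norm ((%(i, j). r i * x i * g i j) p)) summable_on UNIV \<times> UNIV"
 proof (rule SigmaI_norm)
  fix i
  have s: "(%j. r i * x i * g i j) summable_on UNIV" by (intro summable_on_cmult_right g)
  thus "(%y. norm ((%(i, j). r i * x i * g i j) (i, y))) summable_on UNIV"
   using r x g by (simp add: abs_mult)
  have "(\<Sum>\<^sub>\<infinity>y. norm ((%(i, j). r i * x i * g i j) (i, y))) = r i * x i * infsum (g i) UNIV"
   using r x g(3) by (simp add: abs_mult infsum_cmult_right')
  also have "... <= r i * B * K"
   using r x g B K by (intro mult_mono) (auto intro!: infsum_nonneg)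
  finally show "(\<Sum>\<^sub>\<infinity>y. norm ((%(i, j). r i * x i * g i j) (i, y))) <= r i * B * K" .
  show "(%i. r i * B * K) summable_on UNIV" using summable_on_cmult_left[OF r(1), of "B * K"] by (simp add: mult.assoc)
 qed
 moreover have "norm ((%(i, j). r i * x i * g i j) p) = (%(i, j). r i * x i * g i j) p" for p
  using r(2) x(1) g(3) by (simp add: case_prod_unfold)
 ultimately show ?thesis by simp
qed

lemma matrix_row_summ:
 fixes e :: "nat => 'a::euclidean_space l2"
 assumes "onb_on e UNIV"
 shows "(%j. cmod (ip et (e j)) * cmod (ip (e j) ps)) summable_on UNIV"
  "(\<Sum>\<^sub>\<infinity>j. cmod (ip et (e j)) * cmod (ip (e j) ps)) <= norm et * norm ps"
 using onb_abs_summ[OF onb_ortho[OF assms]] by blast+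

lemma cmod_matrix_swap: "cmod (ip (e i) (V$$e j)) = cmod (ip (e j) (bop_adj V$$e i))"
 by (metis ip_adjr cmod_ip_commute)

lemma norm_bop_onb: "onb_on e UNIV ==> norm (V$$e i) <= norm V"
 using norm_bop_apply[of V "e i"] norm_ortho[of e UNIV i] by (simp add: onb_on_def)

lemma max_pair_summ:
 fixes r :: "nat => real"
 assumes r: "!!k. 0 <= r k" and g: "!!i j. 0 <= g i j"
  and s: "(%(i, j). r i * g i j) summable_on UNIV" "(%(j, i). r j * g i j) summable_on UNIV"
 shows "(%(i, j). max (r i) (r j) * g i j) summable_on UNIV"
proof (rule sum_comp[OF summable_on_add[OF s(1)]])
 show "(%(i, j). r j * g i j) summable_on UNIV"
  using s(2) summable_on_swap[of "%(j, i). r j * g i j" UNIV UNIV] by (simp add: case_prod_unfold)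
 have "max (r i) (r j) * g i j <= (r i + r j) * g i j" for i j using r g by (intro mult_right_mono) auto
 thus "norm ((%(i, j). max (r i) (r j) * g i j) p) <= (%(i, j). r i * g i j) p + (%(i, j). r j * g i j) p" for p
  using r g by (cases p) (simp add: abs_mult le_max_iff_disj distrib_right)
qed

lemma pair_form_summ:
 fixes e :: "nat => 'a::euclidean_space l2"
 assumes e: "onb_on e UNIV" and r: "r summable_on UNIV" "!!k. 0 <= r k"
 shows "(%(i, j). max (r i) (r j) * (cmod (ip ph (e i)) * cmod (ip (e i) (V$$e j)) * cmod (ip (e j) ps))) summable_on UNIV"
proof -
 let ?a = "%i. cmod (ip ph (e i))" and ?b = "%j. cmod (ip (e j) ps)" and ?v = "%i j. cmod (ip (e i) (V$$e j))"
 have n1: "norm (e k) = 1" for k by (rule norm_ortho[OF onb_ortho[OF e]]) simp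
 have ab: "?a k <= norm ph" "?b k <= norm ps" for k
  using norm_ip[of ph "e k"] norm_ip[of "e k" ps] by (simp_all add: n1)
 have 1: "(%(i, j). r i * ?a i * (?v i j * ?b j)) summable_on UNIV"
 proof (rule weighted_pair_summ[OF r, where B="norm ph" and K="norm V * norm ps"])
  fix i
  have "?v i j = cmod (ip (bop_adj V$$e i) (e j))" for j by (simp add: ip_adjl)
  thus "(%j. ?v i j * ?b j) summable_on UNIV" "(\<Sum>\<^sub>\<infinity>j. ?v i j * ?b j) <= norm V * norm ps"
   using matrix_row_summ[OF e, of "bop_adj V$$e i" ps]
    mult_right_mono[OF norm_bop_onb[OF e, of "bop_adj V" i] norm_ge_zero[of ps]] by simp_all
 qed (use ab in auto)
 have 2: "(%(j, i). r j * ?b j * (?a i * ?v i j)) summable_on UNIV"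
 proof (rule weighted_pair_summ[OF r, where B="norm ps" and K="norm ph * norm V"])
  fix j
  show "(%i. ?a i * ?v i j) summable_on UNIV" "(\<Sum>\<^sub>\<infinity>i. ?a i * ?v i j) <= norm ph * norm V"
   using matrix_row_summ[OF e, of ph "V$$e j"]
    mult_left_mono[OF norm_bop_onb[OF e, of V j] norm_ge_zero[of ph]] by simp_all
 qed (use ab in auto)
 show ?thesis by (rule max_pair_summ[OF r(2)]) (use 1 2 in "simp_all add: mult_ac")
qed

lemma pair_product_summ:
 fixes e :: "nat => 'a::euclidean_space l2"
 assumes e: "onb_on e UNIV" and r: "r summable_on UNIV" "!!k. 0 <= r k"
 shows "(%(i, j). max (r i) (r j) * (cmod (ip (e i) (X$$e j)) * cmod (ip (e i) (V$$e j)))) summable_on UNIV"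
proof -
 let ?x = "%i j. cmod (ip (e i) (X$$e j))" and ?v = "%i j. cmod (ip (e i) (V$$e j))"
 have 1: "(%(i, j). r i * 1 * (?x i j * ?v i j)) summable_on UNIV"
 proof (rule weighted_pair_summ[OF r, where B=1 and K="norm X * norm V"])
  fix i
  have "?x i j = cmod (ip (bop_adj X$$e i) (e j))" "?v i j = cmod (ip (e j) (bop_adj V$$e i))" for j
   by (simp_all add: ip_adjl cmod_matrix_swap[of e i V])
  thus "(%j. ?x i j * ?v i j) summable_on UNIV" "(\<Sum>\<^sub>\<infinity>j. ?x i j * ?v i j) <= norm X * norm V"
   using matrix_row_summ[OF e, of "bop_adj X$$e i" "bop_adj V$$e i"]
    mult_mono[OF norm_bop_onb[OF e, of "bop_adj X" i] norm_bop_onb[OF e, of "bop_adj V" i]] by simp_all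
 qed auto
 have 2: "(%(j, i). r j * 1 * (?x i j * ?v i j)) summable_on UNIV"
 proof (rule weighted_pair_summ[OF r, where B=1 and K="norm X * norm V"])
  fix j
  have "?x i j = cmod (ip (X$$e j) (e i))" for i by (rule cmod_ip_commute)
  thus "(%i. ?x i j * ?v i j) summable_on UNIV" "(\<Sum>\<^sub>\<infinity>i. ?x i j * ?v i j) <= norm X * norm V"
   using matrix_row_summ[OF e, of "X$$e j" "V$$e j"]
    mult_mono[OF norm_bop_onb[OF e, of X j] norm_bop_onb[OF e, of V j]] by simp_all
 qed auto
 show ?thesis by (rule max_pair_summ[OF r(2)]) (use 1 2 in "simp_all add: mult_ac")
qed

text \<open>The candidate is the Schur product with \<open>mean_kernel\<close>. Expanding both
  powers in the eigenbasis turns the integrand into a double series, dominated uniformly in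
  \<open>s\<close> by \<open>max (r i) (r j)\<close> times matrix entries, which may be integrated
  term by term.\<close>

lemma weighted_mean_eigen:
 assumes eb: "eigenbasis rh e r"
 shows "nuclear (weighted_mean c rh V)" (is ?A)
  "ip (e i) (weighted_mean c rh V$$e j) = of_real (mean_kernel c (r i) (r j)) * ip (e i) (V$$e j)" (is ?B)
proof -
 have e: "onb_on e UNIV" using eb by (simp add: eigenbasis_def)
 have r: "r summable_on UNIV" "!!k. 0 <= r k"
  using eigenb(1,2)[OF eb] has_sum_imp_summable by blast+
 obtain T where T: "nuclear T" "!!i j. ip (e i) (T$$e j) = of_real (mean_kernel c (r i) (r j)) * ip (e i) (V$$e j)"
  using schur_nuclear[OF e r, of "%i j. mean_kernel c (r i) (r j)" "exp (abs c)" V] mean_kernel_bounds[OF r(2) r(2), of c] by auto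
 have main: "((%s. exp (c * (1/2 - s)) *. ip ph (op_powr rh s$$V$$op_powr rh (1 - s)$$ps))
    has_integral ip ph (T$$ps)) {0..1}" for ph ps
 proof -
  define z where "z = (%i j. ip ph (e i) * ip (e i) (V$$e j) * ip (e j) ps)"
  define g where "g = (%(i, j) s. (exp (c * (1/2 - s)) * (r i powr s * r j powr (1 - s))) *. z i j)"
  define M where "M = (%(i, j). exp (abs c) * (max (r i) (r j) * cmod (z i j)))"
  have M: "M summable_on UNIV"
   using summable_on_cmult_right[OF pair_form_summ[OF e r, of ph V ps], of "exp (abs c)"]
   by (simp add: M_def z_def norm_mult case_prod_unfold)
  have le: "norm (g p s) <= M p" if "s:{0..1}" for p s
   using mean_integrand_bound[OF r(2) r(2) that, of c] 
   by (auto simp: g_def M_def case_prod_unfold abs_mult mult.assoc[symmetric] intro!: mult_right_mono)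
  have gS: "((%p. g p s) has_sum exp (c * (1/2 - s)) *. ip ph (op_powr rh s$$V$$op_powr rh (1 - s)$$ps)) (UNIV \<times> UNIV)"
   if s: "s:{0..1}" for s
  proof (rule has_sum_SigmaI)
   let ?x = "exp (c * (1/2 - s))"
   fix i
   have "((%j. ip (bop_adj V$$e i) (e j) * ip (e j) (op_powr rh (1 - s)$$ps)) has_sum ip (bop_adj V$$e i) (op_powr rh (1 - s)$$ps)) UNIV"
    by (rule onb_parseval[OF e])
   from has_sum_cmult_right[OF this, of "of_real (?x * r i powr s) * ip ph (e i)"]
   show "((%j. g (i, j) s) has_sum (?x * r i powr s) *. (ip ph (e i) * ip (e i) (V$$op_powr rh (1 - s)$$ps))) UNIV"
    using s by (simp add: g_def z_def op_powr_eigen[OF eb] ip_adjl scaleR_conv_of_real mult_ac)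
   show "((%i. (?x * r i powr s) *. (ip ph (e i) * ip (e i) (V$$op_powr rh (1 - s)$$ps)))
     has_sum ?x *. ip ph (op_powr rh s$$V$$op_powr rh (1 - s)$$ps)) UNIV"
    using has_sum_scaleR[OF onb_parseval[OF e, of ph "op_powr rh s$$V$$op_powr rh (1 - s)$$ps"], of ?x] s
    by (simp add: op_powr_eigen[OF eb] scaleR_conv_of_real mult_ac)
   show "(%p. g p s) summable_on UNIV \<times> UNIV"
    by (rule sum_comp[of M]) (use M le s in auto)
  qed
  have I: "(g p has_integral (%(i, j). mean_kernel c (r i) (r j) *. z i j) p) {0..1}" for p
   unfolding g_def case_prod_unfold
   by (intro has_integral_scaleR_left mean_kernel_has_integral r)
  have J: "((%(i, j). mean_kernel c (r i) (r j) *. z i j) has_sum ip ph (T$$ps)) (UNIV \<times> UNIV)"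
  proof (rule has_sum_SigmaI)
   fix i
   have "((%j. ip (bop_adj T$$e i) (e j) * ip (e j) ps) has_sum ip (bop_adj T$$e i) ps) UNIV"
    by (rule onb_parseval[OF e])
   from has_sum_cmult_right[OF this, of "ip ph (e i)"]
   show "((%j. (%(i, j). mean_kernel c (r i) (r j) *. z i j) (i, j)) has_sum ip ph (e i) * ip (e i) (T$$ps)) UNIV"
    by (simp add: z_def T(2) ip_adjl scaleR_conv_of_real mult_ac)
   show "((%i. ip ph (e i) * ip (e i) (T$$ps)) has_sum ip ph (T$$ps)) UNIV" by (rule onb_parseval[OF e])
   show "(%(i, j). mean_kernel c (r i) (r j) *. z i j) summable_on UNIV \<times> UNIV"
   proof (rule sum_comp[of M])
    show "M summable_on UNIV \<times> UNIV" using M by simp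
    fix p
    show "norm (case p of (i, j) => mean_kernel c (r i) (r j) *. z i j) <= M p"
     using mean_kernel_bounds[OF r(2) r(2), of c]
     by (auto simp: M_def case_prod_unfold mult.assoc[symmetric] intro!: mult_right_mono)
   qed
  qed
  show ?thesis
  proof (rule has_integral_has_sum[where X="UNIV \<times> UNIV" and f=g and M=M])
   show "continuous_on {0..1} (g p)" for p
    unfolding g_def case_prod_unfold by (intro continuous_on_scaleR continuous_mean_integrand r continuous_on_const)
  qed (use le M gS I J in auto)
 qed
 have "weighted_mean c rh V = T" unfolding weighted_mean_def
 proof (rule the_equality)
  fix T' assume T': "ALL ph ps. ((%s. exp (c * (1/2 - s)) *. ip ph (op_powr rh s$$V$$op_powr rh (1 - s)$$ps))
    has_integral ip ph (T'$$ps)) {0..1}"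
  show "T' = T" by (rule bop_eqI_form) (rule has_integral_unique[OF T'[rule_format] main])
 qed (use main in blast)
 thus ?A ?B
  using T by simp_all
qed

text \<open>The sesquilinear form of one component of \<open>Lam\<close>;
  \<open>local_norm_sq\<close> is the sum of two of them, with \<open>c\<close> minus and plus the
  inverse temperature.\<close>

definition mean_form :: "real => 'a::euclidean_space bop => 'a bop => 'a bop => complex" where
 "mean_form c rh X V = trace (bop_adj X * weighted_mean c rh V)"

lemma mean_form_eigen:
 assumes eb: "eigenbasis rh e r"
 shows "((%(i, j). of_real (mean_kernel c (r i) (r j)) * (cnj (ip (e i) (X$$e j)) * ip (e i) (V$$e j)))
     has_sum mean_form c rh X V) UNIV"
proof -
 have e: "onb_on e UNIV" using eb by (simp add: eigenbasis_def)
 have r: "r summable_on UNIV" "!!k. 0 <= r k"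
  using eigenb(1,2)[OF eb] has_sum_imp_summable by blast+
 define T where "T = weighted_mean c rh V"
 note T = weighted_mean_eigen[where c=c and V=V, OF eb, folded T_def]
 define f where "f = (%(j, i). of_real (mean_kernel c (r i) (r j)) * (cnj (ip (e i) (X$$e j)) * ip (e i) (V$$e j)))"
 have "(f has_sum mean_form c rh X V) (UNIV \<times> UNIV)"
 proof (rule has_sum_SigmaI)
  fix j
  have "((%i. ip (X$$e j) (e i) * ip (e i) (T$$e j)) has_sum ip (X$$e j) (T$$e j)) UNIV"
   by (rule onb_parseval[OF e])
  thus "((%i. f (j, i)) has_sum ip (X$$e j) (T$$e j)) UNIV"
   using cinner_commute[of "X$$e j" "e _"] by (simp add: f_def T(2) mult_ac)
  show "((%j. ip (X$$e j) (T$$e j)) has_sum mean_form c rh X V) UNIV"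
   using nuclear_trace_onb[OF nuclear_mult_left[OF T(1), of "bop_adj X"] e]
   by (simp add: mean_form_def T_def bop_times ip_adjr)
  show "f summable_on UNIV \<times> UNIV"
  proof (rule sum_comp)
   show "(%p. exp (abs c) * (%(j, i). max (r i) (r j) * (cmod (ip (e i) (X$$e j)) * cmod (ip (e i) (V$$e j)))) p) summable_on UNIV \<times> UNIV"
    using pair_product_summ[OF e r, of X V]
     summable_on_swap[of "%(i, j). max (r i) (r j) * (cmod (ip (e i) (X$$e j)) * cmod (ip (e i) (V$$e j)))" UNIV UNIV]
    by (intro summable_on_cmult_right) (simp add: case_prod_unfold)
   fix p
   show "norm (f p) <= exp (abs c) * (%(j, i). max (r i) (r j) * (cmod (ip (e i) (X$$e j)) * cmod (ip (e i) (V$$e j)))) p"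
    using mean_kernel_bounds[OF r(2) r(2), of c]
    by (auto simp: f_def case_prod_unfold norm_mult mult.assoc[symmetric] intro!: mult_right_mono)
  qed
 qed
 thus ?thesis using has_sum_swap[where f=f and A=UNIV and B=UNIV] by (simp add: f_def case_prod_unfold)
qed

section \<open>Kraus maps\<close>

subsection \<open>Operators of rank one and uniqueness of densities\<close>

definition rank1 :: "'a::euclidean_space l2 => 'a l2 => 'a bop" where
 "rank1 ph ps = (SOME T. ALL xi. T$$xi = ip ps xi *: ph)"

lemma rank1_apply: "rank1 ph ps$$xi = ip ps xi *: ph"
proof -
 have "EX T. ALL xi. T$$xi = ip ps xi *: ph"
 proof (rule bop_exists)
  show "norm (ip ps xi *: ph) <= (norm ps * norm ph) * norm xi" for xi
   using mult_right_mono[OF norm_ip[of ps xi] norm_ge_zero[of ph]] by (simp add: norm_scaleC_l2 mult_ac)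
 qed (simp_all add: ip_simps scaleC_add_l2 scaleC_l2_simps)
 from someI_ex[OF this] show ?thesis unfolding rank1_def by blast
qed

lemma rank1_nuclear: "nuclear_on (rank1 ph ps) (%_. ph) (%_. ps) {()}"
 by (auto simp: nuclear_on_def rank1_apply cinner_scaleC_right mult.commute intro!: has_sum_finiteI)

lemma trace_rank1: "nuclear T ==> trace (T * rank1 ph ps) = ip ps (T$$ph)"
 using nuclear_trace_mult(1)[OF rank1_nuclear, of ps T ph] has_sum_finite[of "{()}" "%_. ip ps (T$$ph)"]
  has_sum_unique by fastforce

lemma rank1_adj: "bop_adj (rank1 ph ps) = rank1 ps ph"
 by (rule bop_adj_eqI) (simp add: rank1_apply ip_simps cinner_commute[of _ ps])

lemma nuclear_eqI_trace:
 assumes "nuclear S" "nuclear T" "!!x. trace (S * x) = trace (T * x)"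
 shows "S = T"
 by (rule bop_eqI_form) (use assms in "simp flip: trace_rank1")

lemma density_of_state_of: "density_op rh ==> density_of (state_of rh) = rh"
 unfolding density_of_def
 by (rule the_equality) (auto simp: state_of_def fun_eq_iff intro!: nuclear_eqI_trace density_nuc)

subsection \<open>The Heisenberg picture\<close>

text \<open>The quadratic form version of the statement that the operators
  \<open>bop_adj (K m) * K m\<close> sum to \<open>1\<close>; it makes \<open>kraus K\<close>
  unital.\<close>

definition kraus_family :: "('i => 'a::euclidean_space bop) => bool" where
 "kraus_family K \<longleftrightarrow> (ALL ps. ((%m. (norm (K m$$ps))^2) has_sum (norm ps)^2) UNIV)"

definition kraus :: "('i => 'a::euclidean_space bop) => 'a bop => 'a bop" where
 "kraus K x = (THE T. ALL ph ps. ((%m. ip (K m$$ph) (x$$K m$$ps)) has_sum ip ph (T$$ps)) UNIV)"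

lemma kraus_cs:
 assumes "kraus_family K"
 shows "(%m. norm (K m$$ph) * norm (K m$$ps)) summable_on UNIV" (is ?A)
  "(\<Sum>\<^sub>\<infinity>m. norm (K m$$ph) * norm (K m$$ps)) <= norm ph * norm ps" (is ?B)
proof -
 have hs: "((%m. (norm (K m$$ps))^2) has_sum (norm ps)^2) UNIV" for ps
  using assms by (simp add: kraus_family_def)
 show ?A ?B
  using cs_summ[OF has_sum_imp_summable[OF hs[of ph]] eq_refl[OF infsumI[OF hs[of ph]]]
    has_sum_imp_summable[OF hs[of ps]] eq_refl[OF infsumI[OF hs[of ps]]]]
  by (simp_all add: abs_mult)
qed

lemma kraus_exists:
 fixes K :: "'i => 'a::euclidean_space bop"
 assumes K: "kraus_family K"
 shows "EX T. (ALL ph ps. ((%m. ip (K m$$ph) (x$$K m$$ps)) has_sum ip ph (T$$ps)) UNIV) & norm T <= norm x"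
proof -
 let ?f = "%ph ps m. ip (K m$$ph) (x$$K m$$ps)"
 have le: "cmod (?f ph ps m) <= norm x * (norm (K m$$ph) * norm (K m$$ps))" for ph ps m
  using order_trans[OF norm_ip mult_left_mono[OF norm_bop_apply[of x "K m$$ps"] norm_ge_zero[of "K m$$ph"]]]
  by (simp add: mult_ac)
 have sm: "?f ph ps summable_on UNIV" for ph ps
  by (rule sum_comp[OF summable_on_cmult_right[OF kraus_cs(1)[OF K]]]) (rule le)
 define B where "B = (%ph ps. infsum (?f ph ps) UNIV)"
 have ex: "EX T. (ALL ph ps. ip ph (T$$ps) = B ph ps) & norm T <= norm x"
 proof (rule bop_of_form)
  show "B (ph + ph') ps = B ph ps + B ph' ps" for ph ph' ps
   unfolding B_def bop_simps ip_simps by (rule infsum_add[OF sm sm])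
  show "B ph (ps + ps') = B ph ps + B ph ps'" for ph ps ps'
   unfolding B_def bop_simps ip_simps by (rule infsum_add[OF sm sm])
  show "B (c *: ph) ps = cnj c * B ph ps" for c ph ps
   unfolding B_def bop_simps ip_simps by (rule infsum_cmult_right')
  show "B ph (c *: ps) = c * B ph ps" for c ph ps
   unfolding B_def bop_simps ip_simps by (rule infsum_cmult_right')
  show "cmod (B ph ps) <= norm x * norm ph * norm ps" for ph ps
  proof -
   have "cmod (B ph ps) <= norm x * (\<Sum>\<^sub>\<infinity>m. norm (K m$$ph) * norm (K m$$ps))"
    unfolding B_def
    by (rule norm_infsum_le[OF has_sum_infsum[OF sm] has_sum_cmult_right[OF has_sum_infsum[OF kraus_cs(1)[OF K]]]]) (rule le)
   also have "... <= norm x * (norm ph * norm ps)" by (intro mult_left_mono kraus_cs K) simp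
   finally show ?thesis by (simp add: mult.assoc)
  qed
 qed simp
 have hB: "((%m. ?f ph ps m) has_sum B ph ps) UNIV" for ph ps
  unfolding B_def by (rule has_sum_infsum[OF sm])
 from ex obtain T where "ALL ph ps. ip ph (T$$ps) = B ph ps" "norm T <= norm x" by blast
 thus ?thesis using hB by (intro exI[of _ T]) simp
qed

lemma kraus_form:
 fixes K :: "'i => 'a::euclidean_space bop"
 assumes K: "kraus_family K"
 shows "((%m. ip (K m$$ph) (x$$K m$$ps)) has_sum ip ph (kraus K x$$ps)) UNIV" (is ?A)
  and "norm (kraus K x) <= norm x" (is ?B)
proof -
 obtain T where T: "!!ph ps. ((%m. ip (K m$$ph) (x$$K m$$ps)) has_sum ip ph (T$$ps)) UNIV" "norm T <= norm x"
  using kraus_exists[OF K, of x] by blast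
 have "kraus K x = T" unfolding kraus_def
 proof (rule the_equality)
  fix S assume S: "ALL ph ps. ((%m. ip (K m$$ph) (x$$K m$$ps)) has_sum ip ph (S$$ps)) UNIV"
  show "S = T" by (rule bop_eqI_form) (rule has_sum_unique[OF S[rule_format] T(1)])
 qed (use T in blast)
 thus ?A ?B using T by simp_all
qed

lemma kraus_eqI:
 assumes "kraus_family K" "!!ph ps. ((%m. ip (K m$$ph) (x$$K m$$ps)) has_sum ip ph (T$$ps)) UNIV"
 shows "kraus K x = T"
 by (rule bop_eqI_form) (rule has_sum_unique[OF kraus_form(1)[OF assms(1)] assms(2)])

lemma kraus_add: "kraus_family K ==> kraus K (x + y) = kraus K x + kraus K y"
 by (rule kraus_eqI) (auto simp: bop_simps ip_simps intro!: has_sum_add kraus_form)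

lemma kraus_scaleC: "kraus_family K ==> kraus K (c *: x) = c *: kraus K x"
 by (rule kraus_eqI) (auto simp: bop_simps ip_simps intro!: has_sum_cmult_right kraus_form)

lemma kraus_scaleR: "kraus_family K ==> kraus K (c *. x) = c *. kraus K x"
 by (simp add: bop_scaleR_scaleC kraus_scaleC)

lemma kraus_adj: "kraus_family K ==> kraus K (bop_adj x) = bop_adj (kraus K x)"
proof (rule kraus_eqI)
 fix ph ps assume K: "kraus_family K"
 have "((%m. cnj (ip (K m$$ps) (x$$K m$$ph))) has_sum cnj (ip ps (kraus K x$$ph))) UNIV"
  by (subst has_sum_cnj_iff) (rule kraus_form(1)[OF K])
 thus "((%m. ip (K m$$ph) (bop_adj x$$K m$$ps)) has_sum ip ph (bop_adj (kraus K x)$$ps)) UNIV"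
  by (simp add: ip_adjr cinner_commute[symmetric])
qed

lemma kraus_one: "kraus_family K ==> kraus K 1 = 1"
proof -
 assume K: "kraus_family K"
 have "ip ps ((kraus K 1 - 1)$$ps) = 0" for ps
 proof -
  have "((%m. cor ((norm (K m$$ps))^2)) has_sum of_real ((norm ps)^2)) UNIV"
   using K unfolding kraus_family_def by (intro has_sum_of_real) blast
  hence "((%m. ip (K m$$ps) (1$$K m$$ps)) has_sum ip ps ps) UNIV" by (simp add: ip_self)
  hence "ip ps (kraus K 1$$ps) = ip ps ps" using kraus_form(1)[OF K] has_sum_unique by blast
  thus ?thesis by (simp add: bop_simps ip_simps)
 qed
 from bop_zeroI[OF this] show ?thesis by simp
qed

text \<open>Cauchy-Schwarz over the Kraus index separates the vectors \<open>K m$$ph\<close> from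
  \<open>x$$K m$$ps\<close>; the former have total squared norm \<open>(norm ph)^2\<close>, the
  latter give the right-hand side.\<close>

lemma kraus_kadison_schwarz:
 assumes K: "kraus_family K"
 shows "(norm (kraus K x$$ps))^2 <= Re (ip ps (kraus K (bop_adj x * x)$$ps))"
proof -
 define s where "s = Re (ip ps (kraus K (bop_adj x * x)$$ps))"
 have "((%m. Re (ip (K m$$ps) ((bop_adj x * x)$$K m$$ps))) has_sum s) UNIV"
  unfolding s_def by (rule has_sum_Re[OF kraus_form(1)[OF K]])
 hence hs: "((%m. (norm (x$$K m$$ps))^2) has_sum s) UNIV"
  by (simp add: bop_times ip_adjr Re_ip_self)
 have s0: "0 <= s" by (rule has_sum_nonneg[OF hs]) simp
 have "norm (kraus K x$$ps) <= sqrt s"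
 proof (rule norm_le_by_ip)
  fix ph
  have hp: "((%m. (norm (K m$$ph))^2) has_sum (norm ph)^2) UNIV" using K by (simp add: kraus_family_def)
  have cs: "(%m. abs (norm (K m$$ph) * norm (x$$K m$$ps))) summable_on UNIV"
   "(\<Sum>\<^sub>\<infinity>m. abs (norm (K m$$ph) * norm (x$$K m$$ps))) <= norm ph * sqrt s"
   using cs_summ[OF has_sum_imp_summable[OF hp] eq_refl[OF infsumI[OF hp]] has_sum_imp_summable[OF hs], of "sqrt s"]
    infsumI[OF hs] s0 by auto
  have "cmod (ip ph (kraus K x$$ps)) <= (\<Sum>\<^sub>\<infinity>m. abs (norm (K m$$ph) * norm (x$$K m$$ps)))"
   by (rule norm_infsum_le[OF kraus_form(1)[OF K] has_sum_infsum[OF cs(1)]]) (simp add: norm_ip abs_mult)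
  thus "cmod (ip ph (kraus K x$$ps)) <= sqrt s * norm ph" using cs(2) by (simp add: mult.commute)
 qed (use s0 in simp)
 hence "(norm (kraus K x$$ps))^2 <= (sqrt s)^2" by (intro power_mono) auto
 thus ?thesis using s0 by (simp add: s_def)
qed

subsection \<open>The Schroedinger picture\<close>

text \<open>The Schroedinger picture: the weak sum of
  \<open>K m * T * bop_adj (K m)\<close>.\<close>

definition kdual :: "('i => 'a::euclidean_space bop) => 'a bop => 'a bop" where
 "kdual K T = (THE S. ALL ph ps. ((%m. ip (bop_adj (K m)$$ph) (T$$bop_adj (K m)$$ps)) has_sum ip ph (S$$ps)) UNIV)"

text \<open>Every vector of a nuclear representation is pushed through every \<open>K m\<close>. By
  Cauchy-Schwarz over \<open>m\<close> the cost does not increase, which later gives contraction of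
  the trace norm.\<close>

lemma kdual_nuclear_on:
 fixes K :: "'i => 'a::euclidean_space bop" and u v :: "'k => 'a l2"
 assumes K: "kraus_family K" and T: "nuclear_on T u v I"
 shows "nuclear_on (kdual K T) (%(k, m). K m$$u k) (%(k, m). K m$$v k) (I \<times> UNIV)" (is ?A)
  and "((%m. ip (bop_adj (K m)$$ph) (T$$bop_adj (K m)$$ps)) has_sum ip ph (kdual K T$$ps)) UNIV" (is ?B)
  and "(\<Sum>\<^sub>\<infinity>(k, m)\<in>I \<times> UNIV. norm (K m$$u k) * norm (K m$$v k)) <= (\<Sum>\<^sub>\<infinity>k\<in>I. norm (u k) * norm (v k))"
proof -
 let ?n = "%(k, m). norm (K m$$u k) * norm (K m$$v k)"
 have "(%p. norm (?n p)) summable_on I \<times> UNIV"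
  by (rule SigmaI_norm[OF _ _ nuclear_onD(1)[OF T]])
   (use kraus_cs[OF K] in "simp_all add: abs_mult")
 hence sn: "?n summable_on I \<times> UNIV" by (rule abs_summable_summable)
 have "(%p. norm ((%(k, m). K m$$u k) p) * norm ((%(k, m). K m$$v k) p)) summable_on I \<times> UNIV"
  using sn by (simp add: case_prod_unfold)
 then obtain S where S: "nuclear_on S (%(k, m). K m$$u k) (%(k, m). K m$$v k) (I \<times> UNIV)"
  using nuclear_on_exists[of "%(k, m). K m$$u k" "%(k, m). K m$$v k" "I \<times> UNIV"] by blast
 have main: "((%m. ip (bop_adj (K m)$$ph) (T$$bop_adj (K m)$$ps)) has_sum ip ph (S$$ps)) UNIV" for ph ps
 proof -
  have "((%(k, m). ip ph (K m$$u k) * ip (K m$$v k) ps) has_sum ip ph (S$$ps)) (I \<times> UNIV)"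
   using nuclear_onD(2)[OF S, of ph ps] by (simp add: case_prod_unfold)
  hence "((%(m, k). ip ph (K m$$u k) * ip (K m$$v k) ps) has_sum ip ph (S$$ps)) (UNIV \<times> I)"
   using has_sum_swap[where A=I and B=UNIV and f="%(k, m). ip ph (K m$$u k) * ip (K m$$v k) ps"]
   by (simp add: case_prod_unfold)
  thus ?thesis
  proof (rule has_sum_SigmaD)
   fix m
   show "((%k. (%(m, k). ip ph (K m$$u k) * ip (K m$$v k) ps) (m, k)) has_sum
     ip (bop_adj (K m)$$ph) (T$$bop_adj (K m)$$ps)) I"
    using nuclear_onD(2)[OF T, of "bop_adj (K m)$$ph" "bop_adj (K m)$$ps"]
    by (simp add: ip_adjl ip_adjr)
  qed
 qed
 have "kdual K T = S" unfolding kdual_def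
 proof (rule the_equality)
  fix S' assume S': "ALL ph ps. ((%m. ip (bop_adj (K m)$$ph) (T$$bop_adj (K m)$$ps)) has_sum ip ph (S'$$ps)) UNIV"
  show "S' = S" by (rule bop_eqI_form) (rule has_sum_unique[OF S'[rule_format] main])
 qed (use main in blast)
 thus ?A ?B
  using S main by simp_all
 have "infsum ?n (I \<times> UNIV) = (\<Sum>\<^sub>\<infinity>k\<in>I. \<Sum>\<^sub>\<infinity>m. ?n (k, m))" by (rule infsum_Sigma_banach[OF sn, symmetric])
 also have "... <= (\<Sum>\<^sub>\<infinity>k\<in>I. norm (u k) * norm (v k))"
 proof (rule infsum_mono[OF _ nuclear_onD(1)[OF T]])
  show "(\<Sum>\<^sub>\<infinity>m. ?n (k, m)) <= norm (u k) * norm (v k)" for k using kraus_cs(2)[OF K] by simp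
  thus "(%k. \<Sum>\<^sub>\<infinity>m. ?n (k, m)) summable_on I"
   by (intro sum_comp[OF nuclear_onD(1)[OF T]]) (simp add: infsum_nonneg)
 qed
 finally show "infsum ?n (I \<times> UNIV) <= (\<Sum>\<^sub>\<infinity>k\<in>I. norm (u k) * norm (v k))" .
qed

lemma nuclearE:
 assumes "nuclear T"
 obtains u v :: "nat => 'a::euclidean_space l2" where "nuclear_on T u v UNIV"
 using assms unfolding nuclear_def by auto

lemma kdual_nuclear: "kraus_family K ==> nuclear T ==> nuclear (kdual K T)"
 by (erule nuclearE) (rule nuclear_on_imp_nuclear, rule kdual_nuclear_on(1))

lemma kdual_form:
 "kraus_family K ==> nuclear T ==>
  ((%m. ip (bop_adj (K m)$$ph) (T$$bop_adj (K m)$$ps)) has_sum ip ph (kdual K T$$ps)) UNIV"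
 by (erule nuclearE) (rule kdual_nuclear_on(2))

lemma kdual_eqI:
 assumes "kraus_family K" "nuclear T"
  "!!ph ps. ((%m. ip (bop_adj (K m)$$ph) (T$$bop_adj (K m)$$ps)) has_sum ip ph (S$$ps)) UNIV"
 shows "kdual K T = S"
 by (rule bop_eqI_form) (rule has_sum_unique[OF kdual_form[OF assms(1,2)] assms(3)])

lemma kdual_add: "kraus_family K ==> nuclear S ==> nuclear T ==> kdual K (S + T) = kdual K S + kdual K T"
 by (rule kdual_eqI) (auto simp: bop_simps ip_simps intro!: has_sum_add kdual_form nuclear_add)

lemma kdual_scaleR: "kraus_family K ==> nuclear T ==> kdual K (c *. T) = c *. kdual K T"
 by (rule kdual_eqI) (auto simp: bop_simps ip_simps intro!: has_sum_cmult_right kdual_form nuclear_scaleR)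

lemma kdual_diff: "kraus_family K ==> nuclear S ==> nuclear T ==> kdual K (S - T) = kdual K S - kdual K T"
 using kdual_add[of K S "(-1) *. T"] kdual_scaleR[of K T "-1"] nuclear_scaleR[of T "-1"] by simp

lemma trace_kdual:
 fixes K :: "'i => 'a::euclidean_space bop"
 assumes K: "kraus_family K" and T: "nuclear T"
 shows "trace (kdual K T * x) = trace (T * kraus K x)"
proof -
 obtain u v :: "nat => 'a l2" where uv: "nuclear_on T u v UNIV" using T by (rule nuclearE)
 have "((%(k, m). ip (K m$$v k) (x$$K m$$u k)) has_sum trace (kdual K T * x)) (UNIV \<times> UNIV)"
  using nuclear_trace_mult(2)[OF kdual_nuclear_on(1)[OF K uv], of x] by (simp add: case_prod_unfold)
 hence "((%k. ip (v k) (kraus K x$$u k)) has_sum trace (kdual K T * x)) UNIV"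
  by (rule has_sum_SigmaD) (use kraus_form(1)[OF K] in simp)
 thus ?thesis using nuclear_trace_mult(2)[OF uv, of "kraus K x"] has_sum_unique by blast
qed

lemma kdual_density:
 assumes K: "kraus_family K" and rh: "density_op rh"
 shows "density_op (kdual K rh)"
 unfolding density_op_def
proof
 note n = density_nuc[OF rh]
 have "trace (kdual K rh) = 1"
  using trace_kdual[OF K n, of 1] density_op_trace[OF rh] by (simp add: kraus_one[OF K])
 thus "has_trace (kdual K rh) 1" using nuclear_has_trace[OF kdual_nuclear[OF K n]] by simp
 have p: "Im (ip ps (rh$$ps)) = 0" "0 <= Re (ip ps (rh$$ps))" for ps
  using rh by (simp_all add: density_op_def pos_op_def)
 show "pos_op (kdual K rh)" unfolding pos_op_def
 proof (intro allI conjI)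
  fix ps
  show "Im (ip ps (kdual K rh$$ps)) = 0"
   using has_sum_Im[OF kdual_form[OF K n, of ps ps]] has_sum_unique[OF _ has_sum_0_simp] by (simp add: p)
  show "0 <= Re (ip ps (kdual K rh$$ps))"
   by (rule has_sum_nonneg[OF has_sum_Re[OF kdual_form[OF K n]]]) (rule p)
 qed
qed

lemma trace_norm_kdual:
 assumes K: "kraus_family K" and T: "nuclear T"
 shows "trace_norm (kdual K T) <= trace_norm T"
proof -
 obtain E where E: "is_onb E" and rep: "nuclear_on T (%e. T$$e) (%e. e) E" and tn: "trace_norm T = (\<Sum>\<^sub>\<infinity>e\<in>E. norm (T$$e))"
  using trace_norm_nuclear[OF T] by metis
 have "norm e = 1" if "e:E" for e
  using E that norm_ortho[of "%e. e" E e] by (simp add: is_onb_iff onb_on_def)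
 hence "(\<Sum>\<^sub>\<infinity>e\<in>E. norm (T$$e) * norm e) = trace_norm T" unfolding tn by (intro infsum_cong) simp
 thus ?thesis
  using trace_norm_le[OF kdual_nuclear_on(1)[OF K rep]] kdual_nuclear_on(3)[OF K rep]
  by (simp add: case_prod_unfold)
qed

lemma state_of_kraus: "kraus_family K ==> density_op rh ==> state_of rh \<circ> kraus K = state_of (kdual K rh)"
 by (simp add: fun_eq_iff state_of_def trace_kdual density_nuc)

lemma predual_kraus: "kraus_family K ==> density_op rh ==> predual (kraus K) rh = kdual K rh"
 by (simp add: predual_def state_of_kraus density_of_state_of kdual_density)

section \<open>Monotonicity of the weighted means\<close>

text \<open>The kernel below is the infimum of \<open>b (abs x)\<^sup>2 + t a (abs (1 - x))\<^sup>2\<close>: it is the K-functional of the quadratic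
 forms \<open>tr rh X\<^sup>* X\<close> and \<open>tr rh X X\<^sup>*\<close>, which a Kraus map contracts by the Kadison-Schwarz inequality. The
 powers \<open>a\<^sup>s b\<^sup>1\<^sup>-\<^sup>s\<close> are mixtures of these kernels.\<close>

definition K_kernel :: "real => real => real => real" where
 "K_kernel t a b = t * a * b / (b + t * a)"

lemma K_kernel_nonneg: "0 <= t ==> 0 <= a ==> 0 <= b ==> 0 <= K_kernel t a b"
 by (simp add: K_kernel_def)

lemma K_kernel_le: "0 <= t ==> 0 <= a ==> 0 <= b ==> K_kernel t a b <= b"
 unfolding K_kernel_def by (cases "b + t * a = 0") (auto simp: divide_le_eq mult_nonneg_nonneg algebra_simps add_pos_nonneg dest: le_neq_trans)

text \<open>After the triangle inequality and multiplication by \<open>b + t * a\<close>, the two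
  sides differ exactly by the square of \<open>b * cmod x - t * a * cmod y\<close>.\<close>

lemma K_kernel_decomp:
 fixes x y :: complex
 assumes "0 <= t" "0 <= a" "0 <= b"
 shows "K_kernel t a b * (cmod (x + y))^2 <= b * (cmod x)^2 + t * a * (cmod y)^2"
proof (cases "b + t * a = 0")
 case False
 hence p: "0 < b + t * a" using assms by (simp add: less_le add_nonneg_nonneg)
 have "t * a * b * (cmod (x + y))^2 <= t * a * b * (cmod x + cmod y)^2"
  using assms by (intro mult_left_mono power_mono norm_triangle_ineq) auto
 also have "... = (b * (cmod x)^2 + t * a * (cmod y)^2) * (b + t * a) - (b * cmod x - t * a * cmod y)^2"
  by (simp add: power2_eq_square algebra_simps)
 also have "... <= (b * (cmod x)^2 + t * a * (cmod y)^2) * (b + t * a)" by simp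
 finally show ?thesis using p by (simp add: K_kernel_def pos_divide_le_eq)
qed (use assms in "simp add: K_kernel_def")

text \<open>The share \<open>th\<close> balances \<open>b * (1 - th)\<close> against
  \<open>t * a * th\<close>, the equality case of the decomposition bound.\<close>

lemma K_kernel_optimal:
 fixes x :: complex
 assumes "0 <= t" "0 <= a" "0 <= b" and "th = b / (b + t * a)"
 shows "b * (cmod (x - of_real th * x))^2 + t * a * (cmod (of_real th * x))^2 = K_kernel t a b * (cmod x)^2"
proof (cases "b + t * a = 0")
 case False
 have "x - of_real th * x = of_real (1 - th) * x" by (simp add: algebra_simps)
 hence "cmod (x - of_real th * x) = abs (1 - th) * cmod x" by (simp only: norm_mult norm_of_real)
 moreover have "cmod (of_real th * x) = abs th * cmod x" by (simp only: norm_mult norm_of_real)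
 ultimately have "b * (cmod (x - of_real th * x))^2 + t * a * (cmod (of_real th * x))^2 = (b * (1 - th)^2 + t * a * th\<^sup>2) * (cmod x)^2"
  by (simp add: power_mult_distrib distrib_right)
 also have "b * (1 - th)^2 + t * a * th\<^sup>2 = K_kernel t a b"
 proof -
  define D where "D = b + t * a"
  have "1 - th = t * a / D" using False by (simp add: assms(4) D_def field_simps)
  moreover have "th = b / D" by (simp add: assms(4) D_def)
  ultimately have "b * (1 - th)^2 + t * a * th\<^sup>2 = (b * (t * a)^2 + t * a * b\<^sup>2) / D\<^sup>2"
   by (simp add: power_divide add_divide_distrib)
  also have "b * (t * a)^2 + t * a * b\<^sup>2 = t * a * b * D" by (simp add: D_def power2_eq_square algebra_simps)
  finally show ?thesis using False by (simp add: K_kernel_def D_def power2_eq_square)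
 qed
 finally show ?thesis .
qed (use assms in "auto simp: K_kernel_def add_nonneg_eq_0_iff")

lemma trace_gram:
 assumes eb: "eigenbasis rh e r"
 shows "((%k. r k * (norm (X$$e k))^2) has_sum Re (trace (rh * (bop_adj X * X)))) UNIV"
 using has_sum_Re[OF eb_trace_mult[OF eb, of "bop_adj X * X"]]
 by (simp add: bop_times ip_adjr ip_self del: of_real_power)

text \<open>Parseval expands \<open>norm (X$$e j)\<close> into matrix entries; the second identity
  is the first one for \<open>bop_adj X\<close>.\<close>

lemma trace_gram_pairs:
 assumes eb: "eigenbasis rh e r"
 shows "((%(i, j). r j * ent e X i j) has_sum Re (trace (rh * (bop_adj X * X)))) UNIV" (is ?A)
  and "((%(i, j). r i * ent e X i j) has_sum Re (trace (rh * (X * bop_adj X)))) UNIV" (is ?B)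
proof -
 have e: "onb_on e UNIV" using eb by (simp add: eigenbasis_def)
 note r = eigenb(1)[OF eb]
 have a: "((%(j, i). r j * ent e X i j) has_sum Re (trace (rh * (bop_adj X * X)))) (UNIV \<times> UNIV)" for X
 proof (rule has_sum_SigmaI[OF _ trace_gram[OF eb]])
  show i: "((%i. (%(j, i). r j * ent e X i j) (j, i)) has_sum r j * (norm (X$$e j))^2) UNIV" for j
   using has_sum_cmult_right[OF onb_norm[OF e, of "X$$e j"], of "r j"] by simp
  have "(%p. norm ((%(j, i). r j * ent e X i j) p)) summable_on (UNIV \<times> UNIV)"
  proof (rule SigmaI_norm[OF _ _ has_sum_imp_summable[OF trace_gram[OF eb, of X]]])
   fix j
   have n: "norm ((%(j, i). r j * ent e X i j) (j, i)) = (%(j, i). r j * ent e X i j) (j, i)" for i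
    using r by simp
   show "(%i. norm ((%(j, i). r j * ent e X i j) (j, i))) summable_on UNIV"
    unfolding n using has_sum_imp_summable[OF i] .
   show "(\<Sum>\<^sub>\<infinity>i. norm ((%(j, i). r j * ent e X i j) (j, i))) <= r j * (norm (X$$e j))^2"
    unfolding n using infsumI[OF i] by simp
  qed
  thus "(%(j, i). r j * ent e X i j) summable_on (UNIV \<times> UNIV)"
   by (rule abs_summable_summable)
 qed
 show ?A
  using a[of X] has_sum_swap[where A=UNIV and B=UNIV and f="%(j, i). r j * ent e X i j"]
  by (simp add: case_prod_unfold)
 show ?B
  using a[of "bop_adj X"] by (simp add: cmod_matrix_swap[of e _ X])
qed

lemma kraus_gram_le:
 assumes K: "kraus_family K" and eb: "eigenbasis rh e r"
 shows "Re (trace (rh * (bop_adj (kraus K X) * kraus K X))) <= Re (trace (kdual K rh * (bop_adj X * X)))"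
proof -
 have n: "nuclear rh" using eb density_nuc unfolding eigenbasis_def by blast
 have "((%k. r k * Re (ip (e k) (kraus K (bop_adj X * X)$$e k))) has_sum Re (trace (rh * kraus K (bop_adj X * X)))) UNIV"
  using has_sum_Re[OF eb_trace_mult[OF eb, of "kraus K (bop_adj X * X)"]] by simp
 from has_sum_mono[OF trace_gram[OF eb] this]
 show ?thesis unfolding trace_kdual[OF K n]
  using kraus_kadison_schwarz[OF K, of X] eigenb(1)[OF eb] by (simp add: mult_left_mono)
qed

lemma finite_matrix_exists:
 fixes e :: "nat => 'a::euclidean_space l2"
 assumes e: "onb_on e UNIV" and F: "finite F"
 shows "EX T. ALL i j. ip (e i) (T$$e j) = (if (i, j):F then c i j else 0)"
proof (intro exI allI)
 have oo: "ip (e i) (e j) = (if i = j then 1 else 0)" for i j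
  by (rule orthoD[OF onb_ortho[OF e]]) simp_all
 fix i j
 have "ip (e i) ((\<Sum>p\<in>F. c (fst p) (snd p) *: rank1 (e (fst p)) (e (snd p)))$$e j)
   = (\<Sum>p\<in>F. if p = (i, j) then c i j else 0)"
  unfolding bop_sum_apply ip_sum_right
  by (intro sum.cong) (auto simp: bop_simps ip_simps rank1_apply oo prod_eq_iff)
 thus "ip (e i) ((\<Sum>p\<in>F. c (fst p) (snd p) *: rank1 (e (fst p)) (e (snd p)))$$e j) = (if (i, j):F then c i j else 0)"
  using F by (simp add: sum.delta)
qed

lemma K_form_summ:
 assumes eb: "eigenbasis rh e r" and t: "0 <= t"
 shows "(%(i, j). K_kernel t (r i) (r j) * ent e X i j) summable_on UNIV"
 by (rule sum_comp[OF has_sum_imp_summable[OF trace_gram_pairs(1)[OF eb, of X]]])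
  (use K_kernel_le K_kernel_nonneg t eigenb(1)[OF eb] in "auto simp: abs_mult intro!: mult_right_mono")

text \<open>An almost optimal splitting of \<open>V\<close> is mapped by the channel to an
  admissible splitting of \<open>kraus K V\<close>, and both costs decrease by the Kadison-Schwarz
  inequality. The optimal share is restricted to finitely many matrix entries, which makes
  \<open>V1\<close> a bounded operator; all else is charged to \<open>V0\<close> at the cost
  \<open>g\<close>, whose tail is small.\<close>

lemma K_form_mono:
 assumes K: "kraus_family K" and eb: "eigenbasis rh e r" and eb': "eigenbasis (kdual K rh) e' r'" and t: "0 <= t"
 shows "(\<Sum>\<^sub>\<infinity>(i, j). K_kernel t (r i) (r j) * ent e (kraus K V) i j)
  <= (\<Sum>\<^sub>\<infinity>(i, j). K_kernel t (r' i) (r' j) * ent e' V i j)" (is "?L <= ?R")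
proof -
 note r = eigenb(1)[OF eb] and r' = eigenb(1)[OF eb']
 have e': "onb_on e' UNIV" using eb' by (simp add: eigenbasis_def)
 define g where "g = (%(i, j). r' j * ent e' V i j)"
 define k where "k = (%(i, j). K_kernel t (r' i) (r' j) * ent e' V i j)"
 have gs: "g summable_on UNIV" unfolding g_def by (rule has_sum_imp_summable[OF trace_gram_pairs(1)[OF eb']])
 have ks: "k summable_on UNIV" unfolding k_def by (rule K_form_summ[OF eb' t])
 have k0: "0 <= k p" for p using K_kernel_nonneg[OF t r' r'] by (simp add: k_def case_prod_unfold)
 have bound: "?L <= sum k F + (infsum g UNIV - sum g F)" if F: "finite F" for F
 proof -
  define th where "th = (%i j. r' j / (r' j + t * r' i))"
  obtain V1 where V1: "!!i j. ip (e' i) (V1$$e' j) = (if (i, j):F then of_real (th i j) * ip (e' i) (V$$e' j) else 0)"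
   using finite_matrix_exists[OF e' F, of "%i j. of_real (th i j) * ip (e' i) (V$$e' j)"] by blast
  define V0 where "V0 = V - V1"
  have V: "V = V0 + V1" by (simp add: V0_def)
  have sumL: "((%(i, j). r j * ent e (kraus K V0) i j + t * (r i * ent e (kraus K V1) i j))
    has_sum Re (trace (rh * (bop_adj (kraus K V0) * kraus K V0))) + t * Re (trace (rh * (kraus K V1 * bop_adj (kraus K V1))))) UNIV"
   using has_sum_add[OF trace_gram_pairs(1)[OF eb, of "kraus K V0"] has_sum_cmult_right[OF trace_gram_pairs(2)[OF eb, of "kraus K V1"], of t]]
   by (simp add: case_prod_unfold)
  have "?L <= Re (trace (rh * (bop_adj (kraus K V0) * kraus K V0))) + t * Re (trace (rh * (kraus K V1 * bop_adj (kraus K V1))))"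
  proof (rule has_sum_mono[OF has_sum_infsum[OF K_form_summ[OF eb t]] sumL])
   fix p :: "nat \<times> nat"
   show "(case p of (i, j) => K_kernel t (r i) (r j) * ent e (kraus K V) i j)
    <= (case p of (i, j) => r j * ent e (kraus K V0) i j + t * (r i * ent e (kraus K V1) i j))"
    using K_kernel_decomp[OF t r r] unfolding V kraus_add[OF K]
    by (auto simp: case_prod_unfold bop_simps ip_simps mult.assoc)
  qed
  also have "... <= Re (trace (kdual K rh * (bop_adj V0 * V0))) + t * Re (trace (kdual K rh * (V1 * bop_adj V1)))"
   using kraus_gram_le[OF K eb, of V0] kraus_gram_le[OF K eb, of "bop_adj V1"] t
   by (intro add_mono mult_left_mono) (simp_all add: kraus_adj[OF K])
  also have "... = sum k F + (infsum g UNIV - sum g F)"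
  proof (rule has_sum_unique)
   show "((%(i, j). r' j * ent e' V0 i j + t * (r' i * ent e' V1 i j))
     has_sum Re (trace (kdual K rh * (bop_adj V0 * V0))) + t * Re (trace (kdual K rh * (V1 * bop_adj V1)))) UNIV"
    using has_sum_add[OF trace_gram_pairs(1)[OF eb', of V0] has_sum_cmult_right[OF trace_gram_pairs(2)[OF eb', of V1], of t]]
    by (simp add: case_prod_unfold)
   \<comment> \<open>On \<open>F\<close> the splitting is optimal and costs \<open>k\<close>; off
     \<open>F\<close> nothing is split off and the cost is \<open>g\<close>.\<close>
   have feq: "(%(i, j). r' j * ent e' V0 i j + t * (r' i * ent e' V1 i j))
     = (%p. g p + (if p:F then k p - g p else 0))"
   proof (rule ext)
    fix p :: "nat \<times> nat"
    obtain i j where p: "p = (i, j)" by (cases p)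
    show "(case p of (i, j) => r' j * ent e' V0 i j + t * (r' i * ent e' V1 i j))
     = g p + (if p:F then k p - g p else 0)"
     using K_kernel_optimal[OF t r'[of i] r'[of j], of "th i j" "ip (e' i) (V$$e' j)"]
     by (auto simp: p V0_def bop_simps ip_simps V1 g_def k_def th_def mult.assoc)
   qed
   have "((%p. g p + (if p:F then k p - g p else 0)) has_sum infsum g UNIV + sum (%p. k p - g p) F) UNIV"
    using F by (intro has_sum_add has_sum_infsum[OF gs] has_sum_finite_neutralI[of F]) auto
   thus "((%(i, j). r' j * ent e' V0 i j + t * (r' i * ent e' V1 i j))
     has_sum sum k F + (infsum g UNIV - sum g F)) UNIV"
    unfolding feq by (simp add: sum_subtractf algebra_simps)
  qed
  finally show ?thesis .
 qed
 have "?L <= ?R + ep" if ep: "0 < ep" for ep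
 proof -
  obtain F where F: "finite F" "dist (sum g F) (infsum g UNIV) <= ep"
   using infsum_finite_approximation[OF gs ep] by auto
  have "sum k F <= infsum k UNIV" using F(1) ks k0 by (intro finite_sum_le_infsum) auto
  moreover have "infsum g UNIV - sum g F <= ep" using F(2) by (simp add: dist_real_def abs_le_iff)
  ultimately show ?thesis using bound[OF F(1)] by (simp add: k_def)
 qed
 thus ?thesis by (rule field_le_epsilon)
qed

text \<open>Extended nonnegative sums over enumerated pairs can be exchanged with integrals without
  summability conditions.\<close>

abbreviation (input) dsum :: "(nat => nat => real) => ennreal" where
 "dsum F == \<Sum>n. ennreal ((%(i, j). F i j) (prod_decode n))"

lemma pairs_ennreal:
 assumes "(f has_sum S) (UNIV :: (nat \<times> nat) set)" "!!p. 0 <= f p"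
 shows "(\<Sum>n. ennreal (f (prod_decode n))) = ennreal S"
proof -
 have "((%n. f (prod_decode n)) has_sum S) UNIV"
  using assms(1) has_sum_reindex_bij_betw[OF bij_prod_decode, of f S] by simp
 hence "(%n. f (prod_decode n)) sums S" by (rule has_sum_imp_sums)
 thus ?thesis using assms(2) by (intro suminf_ennreal_eq) auto
qed

text \<open>For \<open>0 < s < 1\<close> this is \<open>pi / sin (pi * s)\<close>; only that it is
  positive and finite is used, as it cancels.\<close>

definition powr_const :: "real => ennreal" where
 "powr_const s = (\<integral>\<^sup>+u. ennreal (u powr (- s) / (1 + u)) * indicator {0<..} u \<partial>lborel)"

lemma powr_const_finite:
 assumes "0 < s" "s < 1" shows "powr_const s < \<infinity>" (is ?A) "0 < powr_const s"
proof -
 let ?f = "%u. ennreal (u powr (- s) / (1 + u)) * indicator {0<..} u"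
 have n1: "(\<integral>\<^sup>+u. ennreal (u powr (- s)) * indicator {0..1} u \<partial>lborel) = ennreal (1 powr (- s + 1) / (- s + 1))"
  using assms by (intro nn_integral_has_integral_lebesgue' has_integral_powr_from_0) auto
 have n2: "(\<integral>\<^sup>+u. ennreal (u powr (- s - 1)) * indicator {1..} u \<partial>lborel) = ennreal (- (1 powr (- s - 1 + 1)) / (- s - 1 + 1))"
  using assms by (intro nn_integral_has_integral_lebesgue' has_integral_powr_to_inf) auto
 have "powr_const s <= (\<integral>\<^sup>+u. ennreal (u powr (- s)) * indicator {0..1} u + ennreal (u powr (- s - 1)) * indicator {1..} u \<partial>lborel)"
  unfolding powr_const_def
 proof (rule nn_integral_mono)
  fix u :: real
  consider "u <= 0" | "0 < u" "u <= 1" | "1 < u" by linarith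
  thus "?f u <= ennreal (u powr (- s)) * indicator {0..1} u + ennreal (u powr (- s - 1)) * indicator {1..} u"
  proof cases
   case 2
   have "ennreal (u powr (- s) / (1 + u)) <= ennreal (u powr (- s))"
    using 2 by (intro ennreal_leI) (simp add: divide_le_eq mult_le_cancel_left1)
   thus ?thesis using 2 by (simp add: add_increasing2)
  next
   case 3
   have "u powr (- s) / (1 + u) <= u powr (- s) / u" using 3 by (intro divide_left_mono) auto
   also have "... = u powr (- s - 1)" using 3 by (simp add: powr_diff)
   finally show ?thesis using 3 by (simp add: ennreal_leI)
  qed simp
 qed
 also have "... = ennreal (1 powr (- s + 1) / (- s + 1)) + ennreal (- (1 powr (- s - 1 + 1)) / (- s - 1 + 1))"
  by (subst nn_integral_add) (simp_all add: n1[simplified] n2[simplified])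
 also have "... < \<infinity>" by simp
 finally show ?A .
 show "0 < powr_const s"
 proof (rule ccontr)
  assume "\<not> 0 < powr_const s"
  hence "(\<integral>\<^sup>+u. ?f u \<partial>lborel) = 0" by (simp add: powr_const_def not_gr_zero)
  hence "AE u in lborel. ?f u = 0" by (subst (asm) nn_integral_0_iff_AE) auto
  hence "AE u in lborel. u ~: {0<..<1::real}"
   by eventually_elim (auto simp: indicator_def)
  hence "emeasure lborel {0<..<1::real} = 0" by (subst (asm) AE_iff_measurable[where N="{0<..<1}"]) auto
  thus False by (subst (asm) emeasure_lborel_Ioo) simp_all
 qed
qed

text \<open>Substituting \<open>t = b / a * u\<close> scales the two arguments out of the kernel and
  leaves \<open>powr_const\<close>. If \<open>a\<close> or \<open>b\<close> is \<open>0\<close>,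
  both sides vanish by the convention \<open>0 powr s = 0\<close>.\<close>

lemma powr_kernel_integral:
 assumes s: "0 < s" "s < 1" and ab: "0 <= a" "0 <= b" and x: "0 <= x"
 shows "(\<integral>\<^sup>+t. ennreal (t powr (- s - 1) * (K_kernel t a b * x)) * indicator {0<..} t \<partial>lborel)
  = ennreal (a powr s * b powr (1 - s) * x) * powr_const s"
proof (cases "a = 0 \<or> b = 0")
 case True
 thus ?thesis by (auto simp: K_kernel_def)
next
 case False
 hence a: "0 < a" and b: "0 < b" using ab by auto
 let ?f = "%t. ennreal (t powr (- s - 1) * (K_kernel t a b * x)) * indicator {0<..} t"
 have [measurable]: "(%t. K_kernel t a b):borel_measurable borel" unfolding K_kernel_def by measurable
 have "(\<integral>\<^sup>+t. ?f t \<partial>lborel) = abs (b / a) * (\<integral>\<^sup>+u. ?f (0 + b / a * u) \<partial>lborel)"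
  using a b by (intro nn_integral_real_affine) auto
 also have "... = (\<integral>\<^sup>+u. ennreal (b / a) * ?f (b / a * u) \<partial>lborel)"
  using a b by (subst nn_integral_cmult) auto
 also have "... = (\<integral>\<^sup>+u. ennreal (a powr s * b powr (1 - s) * x) * (ennreal (u powr (- s) / (1 + u)) * indicator {0<..} u) \<partial>lborel)"
 proof (rule nn_integral_cong)
  fix u :: real
  show "ennreal (b / a) * ?f (b / a * u) = ennreal (a powr s * b powr (1 - s) * x) * (ennreal (u powr (- s) / (1 + u)) * indicator {0<..} u)"
  proof (cases "0 < u")
   case True
   have p1: "(b / a * u) powr (- s - 1) = (b powr (- s) / b) / (a powr (- s) / a) * (u powr (- s) / u)"
    using a b True by (simp add: powr_mult powr_divide powr_diff mult_ac)
   have p2: "a powr s * b powr (1 - s) = b * b powr (- s) / a powr (- s)"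
    using a b by (simp add: powr_minus powr_diff field_simps)
   have "b + b / a * u * a = b * (1 + u)" using a by (simp add: field_simps)
   hence k: "K_kernel (b / a * u) a b = b * (u / (1 + u))" using a b by (simp add: K_kernel_def)
   have "b / a * ((b / a * u) powr (- s - 1) * (K_kernel (b / a * u) a b * x)) = a powr s * b powr (1 - s) * x * (u powr (- s) / (1 + u))"
   proof -
    define A B U where "A = a powr (- s)" and "B = b powr (- s)" and "U = u powr (- s)"
    have nz: "A ~= 0" "a ~= 0" "b ~= 0" "u ~= 0" "1 + u ~= 0" using a b True by (auto simp: A_def)
    have "b / a * (B / b / (A / a) * (U / u) * (b * (u / (1 + u)) * x)) = b * B / A * x * (U / (1 + u))"
     using nz by (simp add: divide_simps)
    thus ?thesis unfolding p1 p2 k A_def B_def U_def .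
   qed
   thus ?thesis using True a b x K_kernel_nonneg[of "b / a * u" a b]
    by (simp add: ennreal_mult[symmetric])
  qed (use a b in "simp add: indicator_def zero_less_mult_iff zero_less_divide_iff")
 qed
 also have "... = ennreal (a powr s * b powr (1 - s) * x) * powr_const s"
  unfolding powr_const_def by (rule nn_integral_cmult) measurable
 finally show ?thesis .
qed

text \<open>The kernel inequality is integrated over \<open>t\<close> against
  \<open>t powr (- s - 1)\<close>, which yields the powers times \<open>powr_const s\<close> on both
  sides.\<close>

lemma powr_form_mono:
 fixes V :: "'a::euclidean_space bop"
 assumes K: "kraus_family K" and eb: "eigenbasis rh e r" and eb': "eigenbasis (kdual K rh) e' r'" and s: "0 < s" "s < 1"
 shows "dsum (%i j. r i powr s * r j powr (1 - s) * ent e (kraus K V) i j)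
  <= dsum (%i j. r' i powr s * r' j powr (1 - s) * ent e' V i j)"
  (is "?L <= ?R")
proof -
 have conv: "dsum (%i j. r i powr s * r j powr (1 - s) * ent e X i j) * powr_const s
   = (\<integral>\<^sup>+t. ennreal (t powr (- s - 1)) * indicator {0<..} t *
     dsum (%i j. K_kernel t (r i) (r j) * ent e X i j) \<partial>lborel)"
  if eb: "eigenbasis rh e r" for rh e r and X :: "'a bop"
 proof -
  note r = eigenb(1)[OF eb]
  have [measurable]: "(%t. K_kernel t a b):borel_measurable borel" for a b unfolding K_kernel_def by measurable
  have "dsum (%i j. r i powr s * r j powr (1 - s) * ent e X i j) * powr_const s
   = (\<Sum>n. \<integral>\<^sup>+t. ennreal (t powr (- s - 1) * ((%(i, j). K_kernel t (r i) (r j) * ent e X i j) (prod_decode n))) * indicator {0<..} t \<partial>lborel)"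
   unfolding ennreal_suminf_multc[symmetric]
   by (intro suminf_cong) (simp add: case_prod_unfold powr_kernel_integral[OF s r r])
  also have "... = (\<integral>\<^sup>+t. (\<Sum>n. ennreal (t powr (- s - 1) * ((%(i, j). K_kernel t (r i) (r j) * ent e X i j) (prod_decode n))) * indicator {0<..} t) \<partial>lborel)"
   unfolding case_prod_unfold by (rule nn_integral_suminf[symmetric]) measurable
  also have "... = (\<integral>\<^sup>+t. ennreal (t powr (- s - 1)) * indicator {0<..} t *
     dsum (%i j. K_kernel t (r i) (r j) * ent e X i j) \<partial>lborel)"
   unfolding ennreal_suminf_cmult[symmetric]
   by (intro nn_integral_cong suminf_cong)
    (auto simp: case_prod_unfold indicator_def ennreal_mult K_kernel_nonneg r)
  finally show ?thesis .
 qed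
 have "?L * powr_const s <= ?R * powr_const s"
  unfolding conv[OF eb] conv[OF eb']
 proof (rule nn_integral_mono)
  fix t :: real
  show "ennreal (t powr (- s - 1)) * indicator {0<..} t *
     dsum (%i j. K_kernel t (r i) (r j) * ent e (kraus K V) i j)
   <= ennreal (t powr (- s - 1)) * indicator {0<..} t *
     dsum (%i j. K_kernel t (r' i) (r' j) * ent e' V i j)"
  proof (cases "0 < t")
   case True
   hence t: "0 <= t" by simp
   have pos: "0 <= (%(i, j). K_kernel t (r i) (r j) * ent e X i j) p"
    if "eigenbasis rh e r" for rh e r and X :: "'a bop" and p
    using K_kernel_nonneg[OF t eigenb(1)[OF that] eigenb(1)[OF that]] by (simp add: case_prod_unfold)
   show ?thesis
    unfolding pairs_ennreal[OF has_sum_infsum[OF K_form_summ[OF eb t]] pos[OF eb]]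
     pairs_ennreal[OF has_sum_infsum[OF K_form_summ[OF eb' t]] pos[OF eb']]
    by (intro mult_left_mono ennreal_leI K_form_mono[OF K eb eb' t]) simp
  qed simp
 qed
 thus ?thesis using powr_const_finite[OF s] 
  by (subst (asm) (1 2) mult.commute, subst (asm) ennreal_mult_le_mult_iff) auto
qed

text \<open>The inequality for powers is averaged over the exponent with a nonnegative weight. The
  exponents \<open>0\<close> and \<open>1\<close> are discarded as a null set, since the mixture of
  kernels requires an exponent strictly between them.\<close>

theorem mean_form_mono:
 fixes V :: "'a::euclidean_space bop"
 assumes K: "kraus_family K" and eb: "eigenbasis rh e r" and eb': "eigenbasis (kdual K rh) e' r'"
 shows "Re (mean_form c rh (kraus K V) (kraus K V)) <= Re (mean_form c (kdual K rh) V V)"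
proof -
 have conv: "ennreal (Re (mean_form c rh X X)) = (\<integral>\<^sup>+x. ennreal (exp (c * (1/2 - x))) * indicator {0..1} x *
   dsum (%i j. r i powr x * r j powr (1 - x) * ent e X i j) \<partial>lborel)" (is ?B)
  and nonneg: "0 <= Re (mean_form c rh X X)" (is ?A)
  if eb: "eigenbasis rh e r" for rh e r and X :: "'a bop"
 proof -
  note r = eigenb(1)[OF eb]
  have cc: "Re (of_real m * (cnj z * z)) = m * (cmod z)^2" for m z
   using complex_norm_square[of z] by (metis Re_complex_of_real mult.commute of_real_mult)
  have hs: "((%(i, j). mean_kernel c (r i) (r j) * ent e X i j) has_sum Re (mean_form c rh X X)) UNIV"
   using has_sum_Re[OF mean_form_eigen[OF eb, of c X X]] unfolding case_prod_unfold cc .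
  have pos: "0 <= (%(i, j). mean_kernel c (r i) (r j) * ent e X i j) p" for p
   using mean_kernel_bounds(1)[OF r r] by (simp add: case_prod_unfold)
  show ?A using has_sum_nonneg[OF hs] pos by blast
  have mk: "ennreal (mean_kernel c a b * y) = (\<integral>\<^sup>+x. ennreal (exp (c * (1/2 - x)) * (a powr x * b powr (1 - x)) * y) * indicator {0..1} x \<partial>lborel)"
   if "0 <= a" "0 <= b" "0 <= y" for a b y
   by (intro nn_integral_has_integral_lebesgue'[symmetric] has_integral_mult_left mean_kernel_has_integral that) (use that in auto)
  have "ennreal (Re (mean_form c rh X X)) = dsum (%i j. mean_kernel c (r i) (r j) * ent e X i j)"
   by (rule pairs_ennreal[OF hs pos, symmetric])
  also have "... = (\<Sum>n. \<integral>\<^sup>+x. ennreal (exp (c * (1/2 - x)) * (r (fst (prod_decode n)) powr x * r (snd (prod_decode n)) powr (1 - x))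
    * ent e X (fst (prod_decode n)) (snd (prod_decode n))) * indicator {0..1} x \<partial>lborel)"
   by (intro suminf_cong) (simp add: case_prod_unfold mk[OF r r])
  also have "... = (\<integral>\<^sup>+x. (\<Sum>n. ennreal (exp (c * (1/2 - x)) * (r (fst (prod_decode n)) powr x * r (snd (prod_decode n)) powr (1 - x))
    * ent e X (fst (prod_decode n)) (snd (prod_decode n))) * indicator {0..1} x) \<partial>lborel)"
   by (rule nn_integral_suminf[symmetric]) measurable
  also have "... = (\<integral>\<^sup>+x. ennreal (exp (c * (1/2 - x))) * indicator {0..1} x *
   dsum (%i j. r i powr x * r j powr (1 - x) * ent e X i j) \<partial>lborel)"
   unfolding ennreal_suminf_cmult[symmetric]
   by (intro nn_integral_cong suminf_cong)
    (auto simp: case_prod_unfold indicator_def ennreal_mult[symmetric] mult.assoc)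
  finally show ?B .
 qed
 have ae: "AE x in lborel. x ~= 0 & x ~= (1::real)"
  by (intro AE_conjI AE_lborel_singleton)
 have "ennreal (Re (mean_form c rh (kraus K V) (kraus K V))) <= ennreal (Re (mean_form c (kdual K rh) V V))"
  unfolding conv[OF eb] conv[OF eb']
 proof (rule nn_integral_mono_AE, use ae in eventually_elim)
  case (elim x)
  show ?case
  proof (cases "x:{0..1}")
   case True
   hence "0 < x" "x < 1" using elim by auto
   from powr_form_mono[OF K eb eb' this] show ?thesis by (intro mult_left_mono) auto
  qed simp
 qed
 thus ?thesis using nonneg[OF eb'] by simp
qed

section \<open>Hermite functions\<close>

subsection \<open>Gaussian integrals of polynomials\<close>

definition gmoment :: "nat => real" where
 "gmoment k = (LINT x|lborel. exp (- x\<^sup>2) * x ^ k)"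

lemma gmoment_even:
 "has_bochner_integral lborel (%x::real. exp (- x\<^sup>2) * x ^ (2 * k)) (sqrt pi * (fact (2 * k) / (2 ^ (2 * k) * fact k)))"
 using has_bochner_integral_even_function[OF gaussian_moment_even_pos[where k=k]] by simp

lemma gmoment_odd: "has_bochner_integral lborel (%x::real. exp (- x\<^sup>2) * x ^ (2 * k + 1)) 0"
 using gaussian_moment_odd_pos by (rule has_bochner_integral_odd_function) simp

lemma gmoment_integrable: "integrable lborel (%x::real. exp (- x\<^sup>2) * x ^ k)"
proof (cases "even k")
 case True
 then obtain j where "k = 2 * j" by auto
 thus ?thesis using gmoment_even[of j] by (auto simp: has_bochner_integral_iff)
next
 case False
 then obtain j where "k = 2 * j + 1" using oddE by blast
 thus ?thesis using gmoment_odd[of j] by (auto simp: has_bochner_integral_iff)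
qed

text \<open>Integration by parts, read off the closed form of the moments by parity. For
  \<open>k = 0\<close> both sides vanish, whatever the truncated index \<open>k - 1\<close>
  denotes.\<close>

lemma gmoment_rec: "real k * gmoment (k - 1) = 2 * gmoment (k + 1)"
proof (cases "even k")
 case True
 then obtain j where k: "k = 2 * j" by auto
 have o: "gmoment (2 * i + 1) = 0" for i
  using gmoment_odd[of i] unfolding gmoment_def by (rule has_bochner_integral_integral_eq)
 show ?thesis
 proof (cases j)
  case 0
  thus ?thesis using o[of 0] by (simp add: k)
 next
  case (Suc i)
  have "k - 1 = 2 * i + 1" using k Suc by simp
  thus ?thesis using o[of i] o[of j] k by simp
 qed
next
 case False
 then obtain j where k: "k = 2 * j + 1" using oddE by blast
 have e: "gmoment (2 * i) = sqrt pi * (fact (2 * i) / (2 ^ (2 * i) * fact i))" for i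
  using gmoment_even[of i] unfolding gmoment_def by (rule has_bochner_integral_integral_eq)
 define d where "d = real j + 1"
 have d: "d ~= 0" by (simp add: d_def add_nonneg_eq_0_iff)
 have f1: "fact (2 * Suc j) = (2 * d) * ((2 * real j + 1) * fact (2 * j))"
  by (simp add: algebra_simps d_def)
 have f2: "fact (Suc j) = d * (fact j :: real)" and f3: "(2::real) ^ (2 * Suc j) = 4 * 2 ^ (2 * j)"
  by (simp_all add: d_def algebra_simps)
 have "2 * (s * ((2 * d) * (c * F) / ((4 * P) * (d * G)))) = c * (s * (F / (P * G)))"
  if "P ~= 0" "G ~= 0" for s c F P G :: real
  using d that by (simp add: divide_simps)
 hence "2 * gmoment (2 * Suc j) = (2 * real j + 1) * gmoment (2 * j)"
  unfolding e f1 f2 f3 by simp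
 thus ?thesis by (simp add: k)
qed

definition gint :: "real poly => real" where
 "gint p = (LINT x|lborel. poly p x * exp (- x\<^sup>2))"

lemma gint_integrable:
 fixes p :: "real poly"
 shows "integrable lborel (%x. poly p x * exp (- x\<^sup>2))"
 unfolding poly_altdef sum_distrib_right
proof (intro Bochner_Integration.integrable_sum)
 fix i
 show "integrable lborel (%x. coeff p i * x ^ i * exp (- x\<^sup>2))"
  using integrable_mult_right[OF gmoment_integrable[of i], of "coeff p i"] by (simp add: mult_ac)
qed

lemma gint_add: "gint (p + q) = gint p + gint q"
 by (simp add: gint_def distrib_right gint_integrable)

lemma gint_diff: "gint (p - q) = gint p - gint q"
 by (simp add: gint_def left_diff_distrib gint_integrable)

lemma gint_smult: "gint (smult c p) = c * gint p"
 by (simp add: gint_def mult.assoc)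

lemma gint_monom: "gint (monom 1 k) = gmoment k"
 by (simp add: gint_def gmoment_def poly_monom mult.commute)

lemma poly_monom_induct:
 fixes p :: "real poly"
 assumes "!!c k. P (monom c k)" "!!p q. P p ==> P q ==> P (p + q)"
 shows "P p"
proof -
 have "P (\<Sum>i\<in>A. monom (coeff p i) i)" if "finite A" for A
  using that by (induction A rule: finite_induct) (use assms assms(1)[of 0] in auto)
 thus ?thesis using poly_as_sum_of_monoms[of p] by (metis finite_atMost)
qed

lemma gint_by_parts: "gint (pderiv p) = gint ([:0, 2:] * p)"
proof (induction p rule: poly_monom_induct)
 case (1 c k)
 have m: "monom c k = smult c (monom 1 k)" for c :: real and k by (simp add: smult_monom)
 have "gint (pderiv (monom c k)) = c * (real k * gmoment (k - 1))"
  unfolding pderiv_monom m[of "of_nat k * c"] gint_smult gint_monom by (simp add: mult_ac)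
 moreover have "[:0, 2:] * monom c k = smult (2 * c) (monom 1 (k + 1))"
  by (simp add: smult_monom monom_Suc[symmetric])
 ultimately show ?case unfolding gmoment_rec by (simp add: gint_smult gint_monom[of "k + 1", simplified])
next
 case (2 p q)
 thus ?case by (simp add: pderiv_add distrib_left gint_add del: mult_pCons_left)
qed

subsection \<open>Hermite polynomials, normalised\<close>

text \<open>The physicists' Hermite polynomials divided by
  \<open>sqrt (2 ^ n * fact n * sqrt pi)\<close>: the recurrence carries the normalisation along,
  and \<open>pi powr (- 1/4)\<close> normalises the Gaussian.\<close>

primrec hpoly :: "nat => real poly" where
 "hpoly 0 = [:pi powr (- 1/4):]"
| "hpoly (Suc n) = smult (1 / sqrt (2 * real (Suc n))) ([:0, 2:] * hpoly n - pderiv (hpoly n))"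

lemma hpoly_rec: "[:0, 2:] * hpoly n - pderiv (hpoly n) = smult (sqrt (2 * real (Suc n))) (hpoly (Suc n))"
 by (simp del: mult_pCons_left)

text \<open>The recurrence is differentiated; the product rule contributes \<open>2\<close> copies
  of the polynomial itself, which turns the factor \<open>s * s\<close> into
  \<open>t * t\<close>.\<close>

lemma pderiv_hpoly: "pderiv (hpoly (Suc n)) = smult (sqrt (2 * real (Suc n))) (hpoly n)"
proof (induction n)
 case 0
 show ?case by (simp add: pderiv_smult pderiv_diff pderiv_mult pderiv_pCons) (simp add: field_simps)
next
 case (Suc n)
 define s where "s = sqrt (2 * real (Suc n))"
 define t where "t = sqrt (2 * real (Suc (Suc n)))"
 have st: "s * s = 2 * real (Suc n)" "t * t = 2 + 2 * real (Suc n)" "t ~= 0" by (simp_all add: s_def t_def)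
 have d: "pderiv (hpoly (Suc n)) = smult s (hpoly n)" using Suc by (simp add: s_def)
 have "pderiv ([:0, 2:] * hpoly (Suc n) - pderiv (hpoly (Suc n)))
   = smult 2 (hpoly (Suc n)) + ([:0, 2:] * smult s (hpoly n) - smult s (pderiv (hpoly n)))"
  by (simp add: pderiv_diff pderiv_mult d pderiv_smult pderiv_pCons del: mult_pCons_left hpoly.simps(2))
 also have "[:0, 2:] * smult s (hpoly n) - smult s (pderiv (hpoly n)) = smult s (smult s (hpoly (Suc n)))"
  using hpoly_rec[of n] by (simp add: s_def smult_diff_right[symmetric] del: mult_pCons_left hpoly.simps(2) smult_smult)
 also have "smult 2 (hpoly (Suc n)) + smult s (smult s (hpoly (Suc n))) = smult (t * t) (hpoly (Suc n))"
  by (simp add: smult_add_left[symmetric] st del: hpoly.simps(2))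
 finally have "pderiv (smult t (hpoly (Suc (Suc n)))) = smult (t * t) (hpoly (Suc n))"
  unfolding hpoly_rec[of "Suc n", folded t_def] .
 hence "smult (1 / t) (pderiv (smult t (hpoly (Suc (Suc n))))) = smult (1 / t) (smult (t * t) (hpoly (Suc n)))" by simp
 hence "pderiv (hpoly (Suc (Suc n))) = smult t (hpoly (Suc n))"
  using st(3) by (simp add: pderiv_smult del: hpoly.simps(2))
 thus ?case unfolding t_def .
qed

text \<open>Under the Gaussian weight the raising step of the recurrence is adjoint to
  differentiation.\<close>

lemma gint_hpoly_Suc: "sqrt (2 * real (Suc n)) * gint (hpoly (Suc n) * q) = gint (hpoly n * pderiv q)"
proof -
 have "sqrt (2 * real (Suc n)) * gint (hpoly (Suc n) * q) = gint (([:0, 2:] * hpoly n - pderiv (hpoly n)) * q)"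
  unfolding hpoly_rec by (simp add: gint_smult[symmetric] del: hpoly.simps(2))
 also have "... = gint ([:0, 2:] * (hpoly n * q)) - gint (pderiv (hpoly n) * q)"
  by (simp add: left_diff_distrib gint_diff mult.assoc del: mult_pCons_left)
 also have "... = gint (pderiv (hpoly n * q)) - gint (pderiv (hpoly n) * q)" by (simp only: gint_by_parts)
 also have "... = gint (hpoly n * pderiv q)" by (simp add: pderiv_mult gint_add mult.commute)
 finally show ?thesis .
qed

lemma gint_hpoly: "gint (hpoly m * hpoly n) = (if m = n then 1 else 0)"
proof (induction m arbitrary: n)
 case 0
 show ?case
 proof (cases n)
  case 0
  have "gmoment 0 = sqrt pi" using gmoment_even[of 0] unfolding gmoment_def by (auto dest: has_bochner_integral_integral_eq)
  hence "gint [:c:] = c * sqrt pi" for c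
   using gint_smult[of c "monom 1 0"] gint_monom[of 0] by (simp add: monom_0)
  moreover have "pi powr (- 1/4) * (pi powr (- 1/4) * sqrt pi) = 1"
   by (simp add: powr_half_sqrt[symmetric] powr_add[symmetric])
  ultimately show ?thesis using 0 by (simp add: mult.assoc)
 next
  case (Suc k)
  have "sqrt (2 * real (Suc k)) * gint (hpoly (Suc k) * hpoly 0) = 0"
   unfolding gint_hpoly_Suc by (simp add: gint_def)
  thus ?thesis using Suc by (simp add: mult.commute del: hpoly.simps)
 qed
next
 case (Suc m)
 have "sqrt (2 * real (Suc m)) * gint (hpoly (Suc m) * hpoly n) = sqrt (2 * real (Suc m)) * (if Suc m = n then 1 else 0)"
 proof (cases n)
  case 0
  thus ?thesis unfolding gint_hpoly_Suc by (simp add: gint_def)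
 next
  case (Suc k)
  thus ?thesis unfolding gint_hpoly_Suc Suc pderiv_hpoly
   by (simp add: gint_smult Suc.IH del: hpoly.simps(2))
 qed
 thus ?case by (simp del: hpoly.simps)
qed

definition hfun :: "nat => real => complex" where
 "hfun n x = cor (poly (hpoly n) x * exp (- x\<^sup>2 / 2))"

definition hb :: "nat => real l2" where "hb n = abs_l2 (hfun n)"

lemma hfun_mult: "cnj (hfun m x) * hfun n x = cor (poly (hpoly m * hpoly n) x * exp (- x\<^sup>2))"
proof -
 have "exp (- x\<^sup>2 / 2) * exp (- x\<^sup>2 / 2) = exp (- x\<^sup>2)" by (simp add: exp_add[symmetric])
 thus ?thesis by (simp add: hfun_def mult_ac del: of_real_exp)
   (metis (no_types, opaque_lifting) mult.assoc mult.left_commute of_real_mult)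
qed

lemma hfun_measurable [measurable]: "hfun n:borel_measurable borel"
 unfolding hfun_def by (intro borel_measurable_continuous_onI) (auto intro!: continuous_intros)

lemma hfun_sqi: "sqi (hfun n)"
proof -
 have "(cmod (hfun n x))^2 = poly (hpoly n * hpoly n) x * exp (- x\<^sup>2)" for x
 proof -
  have "cor ((cmod (hfun n x))^2) = cnj (hfun n x) * hfun n x"
   by (simp only: complex_norm_square mult.commute)
  thus ?thesis unfolding hfun_mult of_real_eq_iff .
 qed
 thus ?thesis unfolding square_integrable_def using gint_integrable[of "hpoly n * hpoly n"] by simp
qed

lemma ip_hb: "ip (hb m) (hb n) = (if m = n then 1 else 0)"
proof -
 have "ip (hb m) (hb n) = (LINT x|lborel. cor (poly (hpoly m * hpoly n) x * exp (- x\<^sup>2)))"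
  unfolding hb_def by (subst cinner.abs_eq) (simp_all add: hfun_sqi hfun_mult del: of_real_mult)
 also have "... = cor (gint (hpoly m * hpoly n))"
  unfolding gint_def by (rule integral_complex_of_real)
 finally show ?thesis by (simp add: gint_hpoly)
qed

subsection \<open>Completeness\<close>

lemma power_le_fact_exp:
 fixes y :: real
 assumes "0 <= y" shows "y ^ k <= fact k * exp y"
proof -
 have "y ^ k /\<^sub>R fact k <= exp y"
  using sum_le_suminf[of "%n. y ^ n /\<^sub>R fact n" "{k}"] summable_exp_generic[of y] assms by (simp add: exp_def)
 thus ?thesis by (simp add: field_simps)
qed

lemma integrable_power_mult:
 fixes u :: "real => real"
 assumes [measurable]: "u:borel_measurable borel" and dec: "integrable lborel (%x. exp (abs x) * abs (u x))"
 shows "integrable lborel (%x. x ^ k * u x)"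
proof (rule Bochner_Integration.integrable_bound[OF integrable_mult_right[OF dec, of "fact k"]])
 show "AE x in lborel. norm (x ^ k * u x) <= norm (fact k * (exp (abs x) * abs (u x)))"
  using mult_right_mono[OF power_le_fact_exp[OF abs_ge_zero] abs_ge_zero]
  by (intro AE_I2) (simp add: abs_mult power_abs mult.assoc)
qed measurable

text \<open>If \<open>u\<close> is orthogonal to all polynomials and decays exponentially, the characteristic functions of
 its positive and negative part agree.\<close>

lemma moments_vanish_imp_zero:
 fixes u :: "real => real"
 assumes [measurable]: "u:borel_measurable borel"
  and dec: "!!c. integrable lborel (%x. exp (c * abs x) * abs (u x))"
  and mom: "!!k. (LINT x|lborel. x ^ k * u x) = 0"
 shows "AE x in lborel. u x = 0"
proof -
 have iu: "integrable lborel u"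
  by (rule Bochner_Integration.integrable_bound[OF dec[of 0]]) auto
 note ixk = integrable_power_mult[OF assms(1) dec[of 1, simplified]]
 \<comment> \<open>The exponential series is integrated term by term with majorant
   \<open>exp (abs t * abs x) * abs (u x)\<close>; each term is a vanishing moment.\<close>
 have four: "(CLINT x|lborel. u x *. iexp (t * x)) = 0" for t
 proof -
  let ?s = "%n x. u x *. (\<Sum>k<n. (\<i> * of_real (t * x)) ^ k /\<^sub>R fact k)"
  have "(%n. CLINT x|lborel. ?s n x) ----> (CLINT x|lborel. u x *. iexp (t * x))"
  proof (rule integral_dominated_convergence)
   show "integrable lborel (%x. exp (abs t * abs x) * abs (u x))" by (rule dec)
   show "AE x in lborel. (%n. ?s n x) ----> u x *. iexp (t * x)"
    using exp_converges[of "\<i> * of_real (t * _)"]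
    by (intro AE_I2 tendsto_scaleR tendsto_const) (simp add: sums_def)
   show "AE x in lborel. norm (?s n x) <= exp (abs t * abs x) * abs (u x)" for n
   proof (rule AE_I2)
    fix x
    have "norm (\<Sum>k<n. (\<i> * of_real (t * x)) ^ k /\<^sub>R fact k) <= (\<Sum>k<n. (abs t * abs x) ^ k /\<^sub>R fact k)"
     by (rule order_trans[OF norm_sum]) (simp add: norm_mult norm_power abs_mult)
    also have "... <= exp (abs t * abs x)" unfolding exp_def
     using summable_exp_generic[of "abs t * abs x"] by (intro sum_le_suminf) simp_all
    finally show "norm (?s n x) <= exp (abs t * abs x) * abs (u x)"
     using mult_left_mono[OF _ abs_ge_zero[of "u x"]] by (simp add: mult.commute[of _ "abs (u x)"])
   qed
  qed measurable
  moreover have "(CLINT x|lborel. ?s n x) = 0" for n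
  proof -
   have e: "?s n x = (\<Sum>k<n. ((\<i> * of_real t) ^ k /\<^sub>R fact k) * of_real (x ^ k * u x))" for x
    by (simp add: scaleR_conv_of_real sum_distrib_left power_mult_distrib mult_ac)
   have "(CLINT x|lborel. ?s n x) = (\<Sum>k<n. CLINT x|lborel. ((\<i> * of_real t) ^ k /\<^sub>R fact k) * of_real (x ^ k * u x))"
    unfolding e by (rule Bochner_Integration.integral_sum) (intro integrable_mult_right integrable_of_real ixk)
   also have "... = 0" using mom by (simp del: of_real_mult of_real_power)
   finally show ?thesis .
  qed
  ultimately show ?thesis by (simp add: LIMSEQ_const_iff)
 qed
 define p where "p = (%x. max (u x) 0)"
 define q where "q = (%x. max (- u x) 0)"
 have pq [measurable]: "p:borel_measurable borel" "q:borel_measurable borel" unfolding p_def q_def by measurable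
 have pq0: "0 <= p x" "0 <= q x" for x by (simp_all add: p_def q_def)
 have ip: "integrable lborel p" "integrable lborel q"
  unfolding p_def q_def using iu by (auto intro!: integrable_max)
 have upq: "u x = p x - q x" for x by (simp add: p_def q_def)
 define m where "m = (LINT x|lborel. p x)"
 have "(LINT x|lborel. u x) = 0" using mom[of 0] by simp
 hence mq: "(LINT x|lborel. q x) = m" unfolding upq using ip by (simp add: m_def)
 have m0: "0 <= m" unfolding m_def p_def by (intro integral_nonneg_AE) auto
 show ?thesis
 proof (cases "m = 0")
  case True
  hence "AE x in lborel. p x = 0" "AE x in lborel. q x = 0"
   using integral_nonneg_eq_0_iff_AE[OF ip(1)] integral_nonneg_eq_0_iff_AE[OF ip(2)] mq
   by (auto simp: m_def p_def q_def)
  thus ?thesis by eventually_elim (simp add: upq)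
 next
  case False
  hence m: "0 < m" using m0 by simp
  \<comment> \<open>The moment of order \<open>0\<close> vanishes, so both parts have the same mass
    \<open>m\<close>; division by it gives probability measures, to which Levy's uniqueness theorem
    applies.\<close>
  define D where "D = (%f :: real => real. density lborel (%x. ennreal (f x / m)))"
  have rd: "real_distribution (D f)" if [measurable]: "f:borel_measurable borel" and "integrable lborel f" "!!x. 0 <= f x" "(LINT x|lborel. f x) = m" for f
  proof -
   have "emeasure (D f) (space (D f)) = (\<integral>\<^sup>+x. ennreal (f x / m) \<partial>lborel)"
    unfolding D_def by (subst emeasure_density) auto
   also have "... = ennreal (LINT x|lborel. f x / m)"
    using that m by (intro nn_integral_eq_integral) auto
   also have "... = 1" using that m by simp
   finally have "prob_space (D f)" by (rule prob_spaceI)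
   thus ?thesis unfolding real_distribution_def real_distribution_axioms_def by (simp add: D_def)
  qed
  have ch: "char (D f) t = (CLINT x|lborel. (f x / m) *. iexp (t * x))"
   if [measurable]: "f:borel_measurable borel" and "!!x. 0 <= f x" for f t
   unfolding char_def D_def using that m by (subst integral_density) auto
  have ifi: "integrable lborel (%x. (f x / m) *. iexp (t * x))" if [measurable]: "f:borel_measurable borel" and "integrable lborel f" for f t
   by (rule Bochner_Integration.integrable_bound[OF integrable_divide[OF that(2), of m]]) (auto simp: norm_mult)
  have "char (D p) = char (D q)"
  proof
   fix t
   have "char (D p) t - char (D q) t = (CLINT x|lborel. (p x / m) *. iexp (t * x) - (q x / m) *. iexp (t * x))"
    unfolding ch[OF pq(1) pq0(1)] ch[OF pq(2) pq0(2)]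
    by (rule Bochner_Integration.integral_diff[symmetric]) (intro ifi pq ip)+
   also have "... = (CLINT x|lborel. (1 / m) *. (u x *. iexp (t * x)))"
    by (intro Bochner_Integration.integral_cong refl) (simp add: upq scaleR_left_diff_distrib[symmetric] diff_divide_distrib)
   also have "... = 0" unfolding Bochner_Integration.integral_scaleR_right four by simp
   finally show "char (D p) t = char (D q) t" by simp
  qed
  hence "D p = D q"
   using ip mq by (intro Levy_uniqueness rd) (auto simp: p_def q_def m_def)
  hence "AE x in lborel. ennreal (p x / m) = ennreal (q x / m)"
   unfolding D_def by (subst (asm) sigma_finite_measure.density_unique_iff[OF lborel.sigma_finite_measure_axioms]) auto
  thus ?thesis
  proof eventually_elim
   case (elim x)
   hence "p x / m = q x / m" using m by (subst (asm) ennreal_inj) (auto simp: p_def q_def)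
   thus ?case using m by (simp add: upq)
  qed
 qed
qed

text \<open>Half of the Gaussian exponent pays for the exponential growth; the remaining factor is
  still square integrable.\<close>

lemma gaussian_dominates: "exp (c * abs x) * exp (- x\<^sup>2 / 2) <= exp (c\<^sup>2) * exp (- x\<^sup>2 / 4)" for x c :: real
proof -
 have "0 <= (abs x / 2 - c)^2" by simp
 hence "c * abs x <= x\<^sup>2 / 4 + c\<^sup>2" by (simp add: power2_diff power_divide mult_ac)
 hence "c * abs x + - x\<^sup>2 / 2 <= c\<^sup>2 + - x\<^sup>2 / 4" by argo
 thus ?thesis unfolding exp_add[symmetric] by simp
qed

lemma sqi_gauss4: "sqi (%x::real. cor (exp (- x\<^sup>2 / 4)))"
proof -
 have "integrable lborel (normal_density 0 1)" by (rule integrable_normal_density) simp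
 hence "integrable lborel (%x. sqrt (2 * pi) * normal_density 0 1 x)" by (rule integrable_mult_right)
 moreover have "sqrt (2 * pi) * normal_density 0 1 x = (cmod (cor (exp (- x\<^sup>2 / 4))))^2" for x
  by (simp add: normal_density_def power2_eq_square[of "exp _"] exp_add[symmetric] del: of_real_exp)
 ultimately show ?thesis unfolding square_integrable_def by (auto intro!: borel_measurable_of_real)
qed

text \<open>By the recurrence, multiplication by the variable maps Hermite polynomials into their
  span, so a functional vanishing on them still does after composition with this multiplication;
  hence the induction varies \<open>L\<close>. The constant \<open>hpoly 0\<close> then leads to
  every monomial.\<close>

lemma hpoly_span:
 assumes "!!n. L (hpoly n) = (0::real)" "!!p q. L (p + q) = L p + L q" "!!c p. L (smult c p) = c * L p"
 shows "L (monom 1 k) = 0"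
proof -
 have X: "L ([:0, 1:] * hpoly n) = 0" if "!!n. L (hpoly n) = 0" "!!p q. L (p + q) = L p + L q" "!!c p. L (smult c p) = c * L p"
  for L :: "real poly => real" and n
 proof -
  have "[:0, 2:] * hpoly n = smult (sqrt (2 * real (Suc n))) (hpoly (Suc n)) + pderiv (hpoly n)"
   using hpoly_rec[of n] by (simp add: diff_eq_eq del: hpoly.simps mult_pCons_left)
  moreover have "L (pderiv (hpoly n)) = 0"
  proof (cases n)
   case 0
   thus ?thesis using that(3)[of 0 "hpoly 0"] by simp
  next
   case (Suc m)
   thus ?thesis by (simp add: pderiv_hpoly that del: hpoly.simps(2))
  qed
  ultimately have "L ([:0, 2:] * hpoly n) = 0" by (simp add: that del: hpoly.simps mult_pCons_left)
  moreover have "[:0, 2:] * hpoly n = smult 2 ([:0, 1:] * hpoly n)" by simp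
  ultimately show ?thesis by (simp add: that(3) del: hpoly.simps mult_pCons_left)
 qed
 have "L ([:0, 1:] ^ k * hpoly n) = 0" for n
  using assms
 proof (induction k arbitrary: L)
  case (Suc k)
  have "L ([:0, 1:] * ([:0, 1:] ^ k * hpoly n)) = 0"
   by (rule Suc.IH[of "%p. L ([:0, 1:] * p)"])
    (use X[of L] Suc.prems in "simp_all add: distrib_left del: hpoly.simps mult_pCons_left")
  thus ?case by (simp add: mult.assoc del: hpoly.simps mult_pCons_left)
 qed simp
 from this[of 0] have "L (smult (pi powr (- 1/4)) ([:0, 1:] ^ k)) = 0" by simp
 hence "L ([:0, 1:] ^ k) = 0" unfolding assms(3) by simp
 thus ?thesis by (simp add: monom_altdef)
qed

lemma real_orthogonal_hermite_zero:
 fixes f :: "real => real"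
 assumes f: "sqi (%x. cor (f x))"
  and ortho: "!!n. (LINT x|lborel. poly (hpoly n) x * exp (- x\<^sup>2 / 2) * f x) = 0"
 shows "AE x in lborel. f x = 0"
proof -
 have [measurable]: "(%x. cor (f x)):borel_measurable borel"
  using f by (simp add: square_integrable_def)
 have "(%x. Re (cor (f x))):borel_measurable borel" by measurable
 hence fm [measurable]: "f:borel_measurable borel" by simp
 define u where "u = (%x. exp (- x\<^sup>2 / 2) * f x)"
 have [measurable]: "u:borel_measurable borel" unfolding u_def by measurable
 have "sqi (%x. cor (abs (f x)))" using f by (simp add: square_integrable_def)
 from integrable_Re[OF integrable_cnj_mult[OF sqi_gauss4 this]]
 have i4: "integrable lborel (%x. exp (- x\<^sup>2 / 4) * abs (f x))" by (simp del: of_real_exp)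
 have dec: "integrable lborel (%x. exp (c * abs x) * abs (u x))" for c
 proof (rule Bochner_Integration.integrable_bound[OF integrable_mult_right[OF i4, of "exp (c\<^sup>2)"]])
  show "AE x in lborel. norm (exp (c * abs x) * abs (u x)) <= norm (exp (c\<^sup>2) * (exp (- x\<^sup>2 / 4) * abs (f x)))"
   using mult_right_mono[OF gaussian_dominates abs_ge_zero] by (intro AE_I2) (simp add: u_def abs_mult mult.assoc)
 qed measurable
 have ip: "integrable lborel (%x. poly p x * u x)" for p
 proof -
  have "integrable lborel (%x. x ^ k * u x)" for k using dec[of 1] by (intro integrable_power_mult) simp_all
  thus ?thesis unfolding poly_altdef sum_distrib_right
   by (intro Bochner_Integration.integrable_sum) (simp add: mult.assoc)
 qed
 have "(LINT x|lborel. x ^ k * u x) = 0" for k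
 proof -
  have "(LINT x|lborel. poly (monom 1 k) x * u x) = 0"
  proof (rule hpoly_span[where L="%p. LINT x|lborel. poly p x * u x"])
   show "(LINT x|lborel. poly (hpoly n) x * u x) = 0" for n using ortho[of n] by (simp add: u_def mult.assoc)
   show "(LINT x|lborel. poly (p + q) x * u x) = (LINT x|lborel. poly p x * u x) + (LINT x|lborel. poly q x * u x)" for p q
    by (simp add: distrib_right ip)
   show "(LINT x|lborel. poly (smult c p) x * u x) = c * (LINT x|lborel. poly p x * u x)" for c p
    by (simp add: mult.assoc)
  qed
  thus ?thesis by (simp add: poly_monom)
 qed
 from moments_vanish_imp_zero[OF _ dec this]
 have "AE x in lborel. u x = 0" by simp
 thus ?thesis by eventually_elim (simp add: u_def)
qed

text \<open>Hermite functions are real, so orthogonality passes to the real and the imaginary part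
  separately.\<close>

theorem hb_onb: "onb_on hb UNIV"
 unfolding onb_on_def ortho_on_def
proof (intro conjI allI impI ballI)
 show "ip (hb i) (hb j) = (if i = j then 1 else 0)" for i j by (rule ip_hb)
 fix ps assume ortho: "ALL i:UNIV. ip (hb i) ps = 0"
 obtain f where f: "sqi f" "ps = abs_l2 f" by (rule l2_cases)
 have fm [measurable]: "f:borel_measurable borel" using f by (simp add: square_integrable_def)
 have si: "sqi (%x. cor (Re (f x)))" (is ?A) "sqi (%x. cor (Im (f x)))" (is ?B)
 proof -
  have i: "integrable lborel (%x. (cmod (f x))^2)" using f by (simp add: square_integrable_def)
  have "integrable lborel (%x. (Re (f x))^2)"
   by (rule Bochner_Integration.integrable_bound[OF i]) (auto simp: cmod_power2)
  moreover have "integrable lborel (%x. (Im (f x))^2)"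
   by (rule Bochner_Integration.integrable_bound[OF i]) (auto simp: cmod_power2)
  ultimately show ?A ?B
   by (auto simp: square_integrable_def)
 qed
 have int: "integrable lborel (%x. cnj (hfun n x) * f x)" for n by (rule integrable_cnj_mult[OF hfun_sqi f(1)])
 have z: "(CLINT x|lborel. cnj (hfun n x) * f x) = 0" for n
  using ortho hfun_sqi f(1) by (simp add: hb_def f(2) cinner.abs_eq)
 have "AE x in lborel. Re (f x) = 0"
 proof (rule real_orthogonal_hermite_zero[OF si(1)])
  fix n
  have "(LINT x|lborel. Re (cnj (hfun n x) * f x)) = 0" using integral_Re[OF int[of n]] z[of n] by simp
  thus "(LINT x|lborel. poly (hpoly n) x * exp (- x\<^sup>2 / 2) * Re (f x)) = 0" by (simp add: hfun_def del: of_real_exp)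
 qed
 moreover have "AE x in lborel. Im (f x) = 0"
 proof (rule real_orthogonal_hermite_zero[OF si(2)])
  fix n
  have "(LINT x|lborel. Im (cnj (hfun n x) * f x)) = 0" using integral_Im[OF int[of n]] z[of n] by simp
  thus "(LINT x|lborel. poly (hpoly n) x * exp (- x\<^sup>2 / 2) * Im (f x)) = 0" by (simp add: hfun_def del: of_real_exp)
 qed
 ultimately have "AE x in lborel. f x = 0" by eventually_elim (simp add: complex_eq_iff)
 thus "ps = 0" using abs_l2_eq_iff[OF f(1) square_integrable_zero] by (simp add: f(2) zero_l2_def)
qed

section \<open>Annihilation and creation operators\<close>

text \<open>Local integrals become inner products with this vector and the next, hence continuous in
  the square-integrable function and independent of its representative.\<close>

definition interval_vec :: "real => real => real l2" where
 "interval_vec a b = abs_l2 (%t. cor (indicator {a..b} t))"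

definition moment_vec :: "real => real => real l2" where
 "moment_vec a b = abs_l2 (%t. cor (t * indicator {a..b} t))"

lemma sqi_indicator:
 fixes g :: "real => real"
 assumes "continuous_on UNIV g"
 shows "sqi (%t. cor (g t * indicator {a..b} t))"
proof -
 have "set_integrable lborel {a..b} (%t. (g t)^2)"
  by (intro borel_integrable_atLeastAtMost') (intro continuous_intros continuous_on_subset[OF assms], simp)
 moreover have "indicator {a..b} t *. (g t)^2 = (cmod (cor (g t * indicator {a..b} t)))^2" for t
  by (simp add: indicator_def)
 moreover have [measurable]: "g:borel_measurable borel" using assms by (rule borel_measurable_continuous_onI)
 ultimately show ?thesis unfolding square_integrable_def set_integrable_def by simp
qed

lemma interval_sqi:
 "sqi (%t. cor (indicator {a..b} t))"
 "sqi (%t. cor (t * indicator {a..b} t))"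
 using sqi_indicator[of "%_. 1" a b] sqi_indicator[of "%t. t" a b] by (simp_all add: continuous_on_id)

lemma local_has_integral:
 fixes f g :: "real => complex"
 assumes f: "sqi f" and g: "sqi g"
 shows "((%t. sqrt 2 * g t - of_real t * f t) has_integral
  (sqrt 2 * ip (interval_vec a b) (abs_l2 g) - ip (moment_vec a b) (abs_l2 f))) {a..b}"
proof -
 let ?I = "%t. cor (indicator {a..b} t)" and ?J = "%t. cor (t * indicator {a..b} t)"
 note ig = integrable_cnj_mult[OF interval_sqi(1) g, of a b]
 note jf = integrable_cnj_mult[OF interval_sqi(2) f, of a b]
 have "((%t. cor (sqrt 2) * (cnj (?I t) * g t) - cnj (?J t) * f t) has_integral
   cor (sqrt 2) * (LINT t|lborel. cnj (?I t) * g t) - (LINT t|lborel. cnj (?J t) * f t)) UNIV"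
  by (intro has_integral_diff has_integral_mult_right has_integral_integral_lborel ig jf)
 moreover have "(%t. cor (sqrt 2) * (cnj (?I t) * g t) - cnj (?J t) * f t)
   = (%t. if t:{a..b} then sqrt 2 * g t - of_real t * f t else 0)"
  by (auto simp: indicator_def fun_eq_iff)
 moreover have "ip (interval_vec a b) (abs_l2 g) = (LINT t|lborel. cnj (?I t) * g t)"
  "ip (moment_vec a b) (abs_l2 f) = (LINT t|lborel. cnj (?J t) * f t)"
  unfolding interval_vec_def moment_vec_def
  using f g interval_sqi[of a b] by (simp_all add: cinner.abs_eq l2_eq_def)
 ultimately show ?thesis by (simp only: has_integral_restrict_UNIV)
qed

text \<open>The differential equation in integrated form: the increments of the representative are
  continuous functionals of the pair, which is what closedness and the computation of the kernel
  rest on.\<close>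

lemma ann_iff:
 "(ps, ph):ann \<longleftrightarrow> (EX f. sqi f & ps = abs_l2 f &
  (ALL x y. x <= y --> f y - f x = sqrt 2 * ip (interval_vec x y) ph - ip (moment_vec x y) ps))"
proof
 assume "(ps, ph):ann"
 then obtain f f' where f: "sqi f" "ps = abs_l2 f"
  and g: "sqi (%x. (cor x * f x + f' x) / sqrt 2)" "ph = abs_l2 (%x. (cor x * f x + f' x) / sqrt 2)"
  and ac: "!!x y. x <= y ==> (f' has_integral (f y - f x)) {x..y}"
  unfolding annihilation_def by auto
 have "f y - f x = sqrt 2 * ip (interval_vec x y) ph - ip (moment_vec x y) ps" if "x <= y" for x y
 proof (rule has_integral_unique[OF ac[OF that]])
  have "f' t = sqrt 2 * ((cor t * f t + f' t) / sqrt 2) - of_real t * f t" for t by simp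
  thus "(f' has_integral sqrt 2 * ip (interval_vec x y) ph - ip (moment_vec x y) ps) {x..y}"
   using local_has_integral[OF f(1) g(1), of x y] by (simp add: f(2) g(2))
 qed
 thus "EX f. sqi f & ps = abs_l2 f &
  (ALL x y. x <= y --> f y - f x = sqrt 2 * ip (interval_vec x y) ph - ip (moment_vec x y) ps)"
  using f by blast
next
 assume "EX f. sqi f & ps = abs_l2 f &
  (ALL x y. x <= y --> f y - f x = sqrt 2 * ip (interval_vec x y) ph - ip (moment_vec x y) ps)"
 then obtain f where f: "sqi f" "ps = abs_l2 f"
  and d: "!!x y. x <= y ==> f y - f x = sqrt 2 * ip (interval_vec x y) ph - ip (moment_vec x y) ps" by blast
 obtain g where g: "sqi g" "ph = abs_l2 g" by (rule l2_cases)
 define f' where "f' = (%t. sqrt 2 * g t - cor t * f t)"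
 have "(%x. (cor x * f x + f' x) / sqrt 2) = g" by (simp add: f'_def)
 moreover have "(f' has_integral (f y - f x)) {x..y}" if "x <= y" for x y
  using local_has_integral[OF f(1) g(1), of x y] d[OF that] by (simp add: f'_def f(2) g(2))
 ultimately show "(ps, ph):ann"
  unfolding annihilation_def using f g by (intro CollectI exI[of _ f] exI[of _ f']) auto
qed

section \<open>Complex-linear relations; the annihilation operator as a closed one\<close>

definition clin :: "('a::euclidean_space l2 \<times> 'a l2) set => bool" where
 "clin R \<longleftrightarrow> (0, 0):R & (ALL a b c d. (a, b):R --> (c, d):R --> (a + c, b + d):R) &
  (ALL z a b. (a, b):R --> (z *: a, z *: b):R)"

lemma clinD:
 assumes "clin R"
 shows "(0, 0):R" "(a, b):R ==> (c, d):R ==> (a + c, b + d):R" "(a, b):R ==> (z *: a, z *: b):R"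
 using assms unfolding clin_def by blast+

lemma clin_diff:
 assumes "clin R" "(a, b):R" "(c, d):R" shows "(a - c, b - d):R"
 using clinD(2)[OF assms(1,2) clinD(3)[OF assms(1,3), of "-1"]] by (simp add: scaleC_minus_one_l2)

lemma clin_sum:
 assumes "clin R" "!!i. i:I ==> (f i, g i):R"
 shows "(sum f I, sum g I):R"
 using assms(2) by (induction I rule: infinite_finite_induct) (auto intro: clinD[OF assms(1)])

lemma ann_lin: "clin ann"
 unfolding clin_def
proof (intro conjI allI impI)
 show "(0, 0):ann" unfolding ann_iff
  by (intro exI[of _ "%_. 0"]) (simp add: square_integrable_zero zero_l2_def[symmetric] ip_simps)
next
 fix a b c d assume "(a, b):ann" "(c, d):ann"
 then obtain f g where "sqi f" "a = abs_l2 f" "sqi g" "c = abs_l2 g"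
  "!!x y. x <= y ==> f y - f x = sqrt 2 * ip (interval_vec x y) b - ip (moment_vec x y) a"
  "!!x y. x <= y ==> g y - g x = sqrt 2 * ip (interval_vec x y) d - ip (moment_vec x y) c"
  unfolding ann_iff by auto
 thus "(a + c, b + d):ann" unfolding ann_iff
  by (intro exI[of _ "%x. f x + g x"])
   (auto simp: square_integrable_add abs_l2_add[symmetric] cinner_add_right algebra_simps)
next
 fix z a b assume "(a, b):ann"
 then obtain f where f: "sqi f" "a = abs_l2 f"
  "!!x y. x <= y ==> f y - f x = sqrt 2 * ip (interval_vec x y) b - ip (moment_vec x y) a"
  unfolding ann_iff by auto
 have "z *: a = abs_l2 (%x. z * f x)" using f by (simp add: scaleC_l2.abs_eq)
 thus "(z *: a, z *: b):ann" unfolding ann_iff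
  using f by (intro exI[of _ "%x. z * f x"])
   (auto simp: square_integrable_mult cinner_scaleC_right right_diff_distrib[symmetric] mult.left_commute[of _ z] simp flip: \<open>z *: a = _\<close>)
qed

lemma AE_lborel_exists:
 assumes "AE x in (lborel :: real measure). P x" obtains x where "P x"
proof -
 have "EX x. P x"
 proof (rule ccontr)
  assume "\<nexists>x. P x"
  hence "AE x in (lborel :: real measure). False" using assms by simp
  hence "emeasure (lborel :: real measure) UNIV = 0" by (subst (asm) AE_iff_measurable[where N=UNIV]) auto
  thus False by simp
 qed
 thus ?thesis using that by blast
qed

text \<open>A subsequence of representatives converges at some point \<open>x0\<close>. The
  increments converge everywhere, so the representatives do as well, and the integrated equation
  passes to the limit.\<close>

lemma ann_closed: "closed ann"
 unfolding closed_sequential_limits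
proof (intro allI impI, elim conjE)
 fix s l assume s: "ALL n. s n:ann" and l: "s ----> l"
 obtain ps ph where lp: "l = (ps, ph)" by (cases l)
 define p where "p = (%n. fst (s n))"
 define q where "q = (%n. snd (s n))"
 have p: "p ----> ps" and q: "q ----> ph"
  using tendsto_fst[OF l] tendsto_snd[OF l] by (simp_all add: lp p_def q_def)
 define D where "D = (%a b x y. sqrt 2 * ip (interval_vec x y) b - ip (moment_vec x y) a)"
 have D: "(%n. D (p (r n)) (q (r n)) x y) ----> D ps ph x y" if "strict_mono r" for r :: "nat => nat" and x y
  using LIMSEQ_subseq_LIMSEQ[OF p that] LIMSEQ_subseq_LIMSEQ[OF q that]
  unfolding D_def o_def by (intro tendsto_intros cinner.tendsto)
 have "(p n, q n):ann" for n using s by (simp add: p_def q_def)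
 hence "ALL n. EX f. sqi f & p n = abs_l2 f & (ALL x y. x <= y --> f y - f x = D (p n) (q n) x y)"
  unfolding ann_iff D_def by blast
 then obtain f where f: "!!n. sqi (f n)" "!!n. p n = abs_l2 (f n)"
  "!!n x y. x <= y ==> f n y - f n x = D (p n) (q n) x y" by metis
 obtain g where g: "sqi g" "ps = abs_l2 g" by (rule l2_cases)
 have [measurable]: "f n:borel_measurable borel" "g:borel_measurable borel" for n
  using f(1)[of n] g(1) by (simp_all add: square_integrable_def)
 have "(%n. (norm (p n - ps))^2) ----> 0\<^sup>2"
  using p by (intro tendsto_power tendsto_norm_zero) (simp add: LIM_zero_iff)
 hence "(%n. LINT x|lborel. norm ((cmod (f n x - g x))^2)) ----> 0"
  unfolding f(2) g(2) abs_l2_diff[OF f(1) g(1)] norm_abs_l2[OF sqi_diff[OF f(1) g(1)]] by simp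
 moreover have "integrable lborel (%x. (cmod (f n x - g x))^2)" for n
  using sqi_diff[OF f(1)[of n] g(1)] by (simp add: square_integrable_def)
 ultimately obtain r :: "nat => nat" where r: "strict_mono r" "AE x in lborel. (%n. (cmod (f (r n) x - g x))^2) ----> 0"
  using tendsto_L1_AE_subseq[of lborel "%n x. (cmod (f n x - g x))^2"] by auto
 have ae: "AE x in lborel. (%n. f (r n) x) ----> g x"
  using r(2)
 proof eventually_elim
  case (elim x)
  from tendsto_real_sqrt[OF this] have "(%n. norm (f (r n) x - g x)) ----> 0" by simp
  hence "(%n. f (r n) x - g x) ----> 0" by (rule tendsto_norm_zero_cancel)
  thus ?case by (rule LIM_zero_cancel)
 qed
 then obtain x0 where x0: "(%n. f (r n) x0) ----> g x0" by (rule AE_lborel_exists)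
 define F where "F = (%y. if x0 <= y then g x0 + D ps ph x0 y else g x0 - D ps ph y x0)"
 have F: "(%n. f (r n) y) ----> F y" for y
 proof (cases "x0 <= y")
  case True
  have "f (r n) y = f (r n) x0 + D (p (r n)) (q (r n)) x0 y" for n using f(3)[OF True, of "r n"] by (simp add: algebra_simps)
  thus ?thesis using tendsto_add[OF x0 D[OF r(1), of x0 y]] True by (simp add: F_def)
 next
  case False
  hence "f (r n) y = f (r n) x0 - D (p (r n)) (q (r n)) y x0" for n using f(3)[of y x0 "r n"] by (simp add: algebra_simps)
  thus ?thesis using tendsto_diff[OF x0 D[OF r(1), of y x0]] False by (simp add: F_def)
 qed
 have Fm [measurable]: "F:borel_measurable borel"
  by (rule borel_measurable_LIMSEQ_metric[OF _ F]) measurable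
 have Fg: "AE x in lborel. g x = F x" using ae by eventually_elim (rule LIMSEQ_unique[OF _ F])
 hence iF: "integrable lborel (%x. (cmod (F x))^2)"
  using g(1) by (subst integrable_cong_AE[where g="%x. (cmod (g x))^2"]) (auto simp: square_integrable_def)
 hence Fs: "sqi F" by (simp add: square_integrable_def)
 have "ps = abs_l2 F" unfolding g(2) using Fg by (subst abs_l2_eq_iff) (use g Fs in auto)
 moreover have "F y - F x = D ps ph x y" if "x <= y" for x y
  using LIMSEQ_unique[OF tendsto_diff[OF F F] D[OF r(1), of x y, folded f(3)[OF that]]] .
 ultimately show "l:ann" unfolding lp ann_iff D_def using Fs by blast
qed

text \<open>At \<open>n = 0\<close> the coefficient vanishes, which neutralises the truncated index
  \<open>n - 1\<close>; the same convention recurs for all lowering operators.\<close>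

lemma ann_hb: "(hb n, rt n *: hb (n - 1)):ann"
proof -
 let ?p = "hpoly n"
 define d where "d = (%x. (poly (pderiv ?p) x - x * poly ?p x) * exp (- x\<^sup>2 / 2))"
 have der: "((%x. poly ?p x * exp (- x\<^sup>2 / 2)) has_real_derivative d x) (at x within S)" for x S
  unfolding d_def
  by (rule DERIV_subset[OF _ subset_UNIV]) (auto intro!: derivative_eq_intros poly_DERIV simp: algebra_simps)
 have ft: "((%x. cor (d x)) has_integral (hfun n y - hfun n x)) {x..y}" if "x <= y" for x y
  unfolding hfun_def
  by (intro fundamental_theorem_of_calculus that has_vector_derivative_of_real)
   (use der in "simp add: has_real_derivative_iff_has_vector_derivative")
 have e: "(cor x * hfun n x + cor (d x)) / cor (sqrt 2) = cor (rt n) * hfun (n - 1) x" for x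
 proof -
  have "x * (poly ?p x * exp (- x\<^sup>2 / 2)) + d x = poly (pderiv ?p) x * exp (- x\<^sup>2 / 2)" by (simp add: d_def algebra_simps)
  also have "... = sqrt 2 * (rt n * (poly (hpoly (n - 1)) x * exp (- x\<^sup>2 / 2)))"
   by (cases n) (simp_all add: pderiv_hpoly real_sqrt_mult[symmetric] algebra_simps del: hpoly.simps(2))
  finally show ?thesis unfolding hfun_def of_real_mult[symmetric] of_real_add[symmetric] of_real_divide[symmetric] of_real_eq_iff by simp
 qed
 have "(abs_l2 (hfun n), abs_l2 (%x. cor (rt n) * hfun (n - 1) x)):ann"
  unfolding annihilation_def
  using ft hfun_sqi[of n] square_integrable_mult[OF hfun_sqi, of "cor (rt n)" "n - 1"]
  by (intro CollectI exI[of _ "hfun n"] exI[of _ "%x. cor (d x)"]) (simp only: e, simp)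
 thus ?thesis by (simp add: hb_def scaleC_l2.abs_eq hfun_sqi)
qed

text \<open>The equation \<open>f' = - x f\<close> is known in integrated form only. Integrability
  makes \<open>f\<close> continuous, continuity makes it differentiable, and then its product with
  \<open>exp (y^2 / 2)\<close> is constant.\<close>

lemma ann_kernel:
 assumes "(ps, 0):ann" shows "EX c. ps = c *: hb 0"
proof -
 obtain f where f: "sqi f" "ps = abs_l2 f"
  and d: "!!x y. x <= y ==> f y - f x = - ip (moment_vec x y) ps"
  using assms unfolding ann_iff by auto
 have hi: "((%t. - (of_real t * f t)) has_integral (f y - f x)) {x..y}" if "x <= y" for x y
  using local_has_integral[OF f(1) square_integrable_zero, of x y] d[OF that] by (simp add: f(2) zero_l2_def[symmetric])
 have int: "(%t. - (of_real t * f t)) integrable_on {x..y}" if "x <= y" for x y using hi[OF that] by blast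
 have eq: "f y = f x + integral {x..y} (%t. - (of_real t * f t))" if "x <= y" for x y
  using integral_unique[OF hi[OF that]] by simp
 have cont: "continuous_on {a..b} f" if "a <= b" for a b
 proof (rule continuous_on_eq)
  show "continuous_on {a..b} (%y. f a + integral {a..y} (%t. - (of_real t * f t)))"
   by (intro continuous_intros indefinite_integral_continuous_1 int that)
 qed (use eq in auto)
 have der: "(f has_vector_derivative - (of_real y * f y)) (at y)" for y
 proof -
  let ?a = "y - 1" and ?b = "y + 1"
  have "continuous_on {?a..?b} (%t. - (of_real t * f t))" by (intro continuous_intros cont) auto
  hence i: "((%u. integral {?a..u} (%t. - (of_real t * f t))) has_vector_derivative - (of_real y * f y)) (at y within {?a..?b})"
   by (rule integral_has_vector_derivative) simp
  have "((%u. f ?a + integral {?a..u} (%t. - (of_real t * f t))) has_vector_derivative - (of_real y * f y)) (at y within {?a..?b})"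
   using has_vector_derivative_add[OF has_vector_derivative_const i] by (simp only: add_0)
  hence "(f has_vector_derivative - (of_real y * f y)) (at y within {?a..?b})"
   by (rule has_vector_derivative_transform[rotated 2]) (use eq in auto)
  thus ?thesis by (simp add: at_within_Icc_at)
 qed
 have "EX c. ALL y:UNIV. f y * of_real (exp (y\<^sup>2 / 2)) = c"
 proof (rule has_vector_derivative_zero_constant)
  fix y :: real
  have "((%y. exp (y\<^sup>2 / 2)) has_real_derivative y * exp (y\<^sup>2 / 2)) (at y)"
   by (auto intro!: derivative_eq_intros)
  hence "((%y. cor (exp (y\<^sup>2 / 2))) has_vector_derivative of_real (y * exp (y\<^sup>2 / 2))) (at y)"
   by (intro has_vector_derivative_of_real) (simp add: has_real_derivative_iff_has_vector_derivative)
  from has_vector_derivative_mult[OF der[of y] this]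
  show "((%y. f y * of_real (exp (y\<^sup>2 / 2))) has_vector_derivative 0) (at y within UNIV)"
   by (simp add: algebra_simps)
 qed (simp, blast)
 then obtain c where c: "!!y. f y * of_real (exp (y\<^sup>2 / 2)) = c" by auto
 define k where "k = c / of_real (pi powr (- 1/4))"
 have "f y = k * hfun 0 y" for y
 proof -
  have ee: "cor (exp (y\<^sup>2 / 2)) * of_real (exp (- y\<^sup>2 / 2)) = 1"
   unfolding of_real_mult[symmetric] by (simp add: exp_add[symmetric])
  have "k * hfun 0 y = c * of_real (exp (- y\<^sup>2 / 2))" by (simp add: k_def hfun_def)
  also have "... = f y * (of_real (exp (y\<^sup>2 / 2)) * of_real (exp (- y\<^sup>2 / 2)))" using c[of y] by (simp add: mult.assoc)
  finally show ?thesis unfolding ee by simp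
 qed
 hence "f = (%y. k * hfun 0 y)" by auto
 thus ?thesis by (intro exI[of _ k]) (simp add: f(2) hb_def scaleC_l2.abs_eq hfun_sqi)
qed

lemma hb_sums: "(%n. ip (hb n) ps *: hb n) sums ps"
 by (rule has_sum_imp_sums[OF onb_expand[OF hb_onb]])

text \<open>Partial sums of the Hermite expansion converge in the graph norm, so the Hermite functions span a core.\<close>

lemma ann_core:
 assumes R: "clin R" "closed R" "!!n. (hb n, rt n *: hb (n - 1)):R"
  and w: "!!n. ip (hb n) ph = rt (Suc n) * ip (hb (Suc n)) ps"
 shows "(ps, ph):R"
proof -
 define s where "s = (%N. (\<Sum>n<Suc N. ip (hb n) ps *: hb n, \<Sum>n<Suc N. ip (hb n) ps *: (rt n *: hb (n - 1))))"
 have sR: "s N:R" for N unfolding s_def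
  by (intro clin_sum[OF R(1)] clinD(3)[OF R(1)] R(3))
 have "(\<Sum>n<Suc N. ip (hb n) ps *: (rt n *: hb (n - 1))) = (\<Sum>n<N. ip (hb n) ph *: hb n)" for N
  by (subst sum.lessThan_Suc_shift) (simp add: w scaleC_l2_simps mult.commute)
 hence "s ----> (ps, ph)"
  using LIMSEQ_Suc[OF hb_sums[of ps, unfolded sums_def]] hb_sums[of ph] unfolding s_def sums_def
  by (intro tendsto_Pair) simp_all
 thus ?thesis using R(2) sR unfolding closed_sequential_limits by blast
qed

text \<open>Hermite coefficients describe the maximal domain. From \<open>(ps, ph)\<close> in the
  graph, a vector \<open>et\<close> with the coefficients prescribed by \<open>ph\<close> is built;
  by the core argument \<open>(et, ph)\<close> lies in the graph too, so \<open>ps - et\<close> is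
  in the kernel and affects the coefficient at \<open>0\<close> only.\<close>

lemma ann_weak:
 "(ps, ph):ann \<longleftrightarrow> (ALL n. ip (hb n) ph = rt (Suc n) * ip (hb (Suc n)) ps)"
proof
 assume w: "ALL n. ip (hb n) ph = rt (Suc n) * ip (hb (Suc n)) ps"
 show "(ps, ph):ann"
  by (rule ann_core[OF ann_lin ann_closed ann_hb]) (use w in blast)
next
 assume a: "(ps, ph):ann"
 \<comment> \<open>The coefficient at \<open>0\<close> is left open by \<open>ph\<close> and set to
   \<open>0\<close>.\<close>
 define c where "c = (%n. if n = 0 then 0 else ip (hb (n - 1)) ph / rt n)"
 have "(%n. (cmod (ip (hb n) ph))^2) summable_on UNIV" by (rule has_sum_imp_summable[OF onb_norm[OF hb_onb]])
 hence "summable (%n. (cmod (ip (hb n) ph))^2)" by (rule summable_on_imp_summable)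
 hence "summable (%n. (cmod (c (Suc n)))^2)"
 proof (rule summable_comparison_test'[where N=0])
  fix n
  have "cmod (c (Suc n)) <= cmod (ip (hb n) ph)"
   by (simp add: c_def norm_divide divide_le_eq mult_le_cancel_left1 real_le_rsqrt)
  thus "norm ((cmod (c (Suc n)))^2) <= (cmod (ip (hb n) ph))^2" by (simp add: power_mono)
 qed
 hence "summable (%n. (cmod (c n))^2)" using summable_Suc_iff[of "%n. (cmod (c n))^2"] by blast
 hence cs: "(%n. (cmod (c n))^2) summable_on UNIV" by (simp add: summable_on_UNIV_nonneg_real_iff)
 obtain et where et: "!!n. ip (hb n) et = c n"
  using riesz_fischer[OF onb_ortho[OF hb_onb] cs] by (metis UNIV_I)
 have "(et, ph):ann"
  by (rule ann_core[OF ann_lin ann_closed ann_hb]) (simp add: et c_def)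
 from clin_diff[OF ann_lin a this] have "(ps - et, 0):ann" by simp
 then obtain k where k: "ps - et = k *: hb 0" using ann_kernel by blast
 have "ip (hb (Suc n)) ps = ip (hb (Suc n)) et" for n
  using arg_cong[OF k, of "ip (hb (Suc n))"] by (simp add: ip_simps ip_hb)
 thus "ALL n. ip (hb n) ph = rt (Suc n) * ip (hb (Suc n)) ps" by (simp add: et c_def)
qed

text \<open>One direction tests the adjoint on Hermite functions; the converse is Parseval with an
  index shift, in which the term at \<open>0\<close> drops out.\<close>

lemma cre_weak:
 "(ph, et):cre \<longleftrightarrow> (ALL n. ip (hb n) et = rt n * ip (hb (n - 1)) ph)"
proof
 assume "(ph, et):cre"
 hence "ip ph (rt n *: hb (n - 1)) = ip et (hb n)" for n
  using ann_hb[of n] unfolding uop_adj_def by blast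
 hence "cnj (ip ph (rt n *: hb (n - 1))) = cnj (ip et (hb n))" for n by simp
 thus "ALL n. ip (hb n) et = rt n * ip (hb (n - 1)) ph"
  unfolding cinner_commute[symmetric] ip_scaleCl by simp
next
 assume w: "ALL n. ip (hb n) et = rt n * ip (hb (n - 1)) ph"
 have w': "ip et (hb n) = rt n * ip ph (hb (n - 1))" for n
  using arg_cong[OF w[rule_format, of n], of cnj] cinner_commute[of et "hb n"] cinner_commute[of ph "hb (n - 1)"] by simp
 show "(ph, et):cre" unfolding uop_adj_def
 proof (clarify)
  fix ps xi assume a: "(ps, xi):ann"
  have "(%n. ip ph (hb n) * ip (hb n) xi) sums ip ph xi"
   by (rule has_sum_imp_sums[OF onb_parseval[OF hb_onb]])
  moreover have "ip ph (hb n) * ip (hb n) xi = ip et (hb (Suc n)) * ip (hb (Suc n)) ps" for n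
   using a unfolding ann_weak by (simp add: w' mult_ac)
  ultimately have "(%n. ip et (hb (Suc n)) * ip (hb (Suc n)) ps) sums ip ph xi" by simp
  hence "(%n. ip et (hb n) * ip (hb n) ps) sums (ip ph xi + ip et (hb 0) * ip (hb 0) ps)"
   by (rule sums_Suc)
  hence "(%n. ip et (hb n) * ip (hb n) ps) sums ip ph xi" by (simp add: w'[of 0])
  moreover have "(%n. ip et (hb n) * ip (hb n) ps) sums ip et ps"
   by (rule has_sum_imp_sums[OF onb_parseval[OF hb_onb]])
  ultimately show "ip ph xi = ip et ps" by (rule sums_unique2)
 qed
qed

lemma cre_hb: "(hb n, rt (Suc n) *: hb (Suc n)):cre"
 unfolding cre_weak by (auto simp: cinner_scaleC_right ip_hb)

lemma cre_core:
 assumes R: "clin R" "closed R" "!!n. (hb n, rt (Suc n) *: hb (Suc n)):R"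
  and c: "(ps, ph):cre"
 shows "(ps, ph):R"
proof -
 define s where "s = (%N. (\<Sum>n<N. ip (hb n) ps *: hb n, \<Sum>n<N. ip (hb n) ps *: (rt (Suc n) *: hb (Suc n))))"
 have sR: "s N:R" for N unfolding s_def
  by (intro clin_sum[OF R(1)] clinD(3)[OF R(1)] R(3))
 have "(\<Sum>n<N. ip (hb n) ps *: (rt (Suc n) *: hb (Suc n))) = (\<Sum>n<Suc N. ip (hb n) ph *: hb n)" for N
  using c unfolding cre_weak
  by (subst sum.lessThan_Suc_shift) (simp add: scaleC_l2_simps mult.commute)
 hence "s ----> (ps, ph)"
  using hb_sums[of ps] LIMSEQ_Suc[OF hb_sums[of ph, unfolded sums_def]] unfolding s_def sums_def
  by (intro tendsto_Pair) simp_all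
 thus ?thesis using R(2) sR unfolding closed_sequential_limits by blast
qed

lemma uop_adj_clinear: "clin (uop_adj A)"
 unfolding clin_def uop_adj_def by (fastforce simp: ip_simps)

lemma uop_adj_closed: "closed (uop_adj A)"
proof -
 have "uop_adj A = (\<Inter>(ps, xi)\<in>A. {p. ip (fst p) xi = ip (snd p) ps})"
  unfolding uop_adj_def by auto
 moreover have "closed {p :: 'a l2 \<times> 'a l2. ip (fst p) xi = ip (snd p) ps}" for ps xi
  by (intro closed_Collect_eq cinner.continuous_on continuous_intros)
 ultimately show ?thesis by (auto intro!: closed_INT)
qed

text \<open>The pairs at which a commutator relation holds form a complex subspace, closed when
  \<open>A\<close> is; as Hermite functions span a core, it is enough to verify the relation on
  them.\<close>

lemma comm_rel_clinear:
 assumes "clin A" shows "clin {(ps, ph). (x$$ps, x$$ph + y$$ps):A}"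
 unfolding clin_def
proof (intro conjI allI impI; clarsimp)
 show "(0, 0):A" by (rule clinD[OF assms])
 show "(x$$(a + c), x$$(b + d) + y$$(a + c)):A"
  if "(x$$a, x$$b + y$$a):A" "(x$$c, x$$d + y$$c):A" for a b c d
  using clinD(2)[OF assms that] by (simp add: bop_simps add_ac)
 show "(x$$(z *: a), x$$(z *: b) + y$$(z *: a)):A" if "(x$$a, x$$b + y$$a):A" for z a b
  using clinD(3)[OF assms that, of z] by (simp add: bop_simps scaleC_l2_simps)
qed

lemma comm_rel_closed:
 assumes "closed A" shows "closed {(ps, ph). (x$$ps, x$$ph + y$$ps):A}"
proof -
 have "{(ps, ph). (x$$ps, x$$ph + y$$ps):A} = (%p. (x$$fst p, x$$snd p + y$$fst p)) -` A" by auto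
 moreover have "continuous_on UNIV (%p. (x$$fst p, x$$snd p + y$$fst p))"
  by (intro continuous_intros bounded_linear.continuous_on[OF bounded_linear_bop])
 ultimately show ?thesis using assms by (auto intro: continuous_closed_vimage simp: continuous_on_eq_continuous_at)
qed

lemma has_comm_annI:
 assumes "!!n. (x$$hb n, x$$(rt n *: hb (n - 1)) + y$$hb n):ann"
 shows "has_comm ann x y"
 unfolding has_comm_def
proof clarify
 fix ps ph assume a: "(ps, ph):ann"
 have "(ps, ph):{(ps, ph). (x$$ps, x$$ph + y$$ps):ann}"
  by (rule ann_core[OF comm_rel_clinear[OF ann_lin] comm_rel_closed[OF ann_closed]])
   (use assms a in "auto simp only: ann_weak mem_Collect_eq prod.case")
 thus "(x$$ps, x$$ph + y$$ps):ann" by simp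
qed

lemma has_comm_creI:
 assumes "!!n. (x$$hb n, x$$(rt (Suc n) *: hb (Suc n)) + y$$hb n):cre"
 shows "has_comm cre x y"
 unfolding has_comm_def
proof clarify
 fix ps ph assume a: "(ps, ph):cre"
 have "(ps, ph):{(ps, ph). (x$$ps, x$$ph + y$$ps):cre}"
  by (rule cre_core[OF comm_rel_clinear[OF uop_adj_clinear] comm_rel_closed[OF uop_adj_closed]])
   (use assms a in "simp_all only: mem_Collect_eq prod.case")
 thus "(x$$ps, x$$ph + y$$ps):cre" by simp
qed

lemma ann_single_valued: "(ps, ph):ann ==> (ps, ph'):ann ==> ph = ph'"
 by (rule onb_on_eqI[OF hb_onb]) (simp add: ann_weak)

lemma cre_single_valued: "(ps, ph):cre ==> (ps, ph'):cre ==> ph = ph'"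
 by (rule onb_on_eqI[OF hb_onb]) (simp add: cre_weak)

lemma has_comm_unique:
 assumes "A:{ann, cre}" "has_comm A x y" "has_comm A x y'"
 shows "y = y'"
proof (rule bop_eqI_onb[OF hb_onb])
 fix n
 obtain ph where "(hb n, ph):A" using assms(1) ann_hb[of n] cre_hb[of n] by (elim insertE emptyE) auto
 hence "(x$$hb n, x$$ph + y$$hb n):A" "(x$$hb n, x$$ph + y'$$hb n):A"
  using assms(2,3) unfolding has_comm_def by blast+
 hence "x$$ph + y$$hb n = x$$ph + y'$$hb n"
  using assms(1) ann_single_valued cre_single_valued by (metis insertE singletonD)
 thus "y$$hb n = y'$$hb n" by simp
qed

lemma comm_eq:
 assumes "A:{ann, cre}" "has_comm A x y"
 shows "comm A x = y"
 unfolding comm_def by (rule the_equality) (use assms has_comm_unique in blast)+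

lemma bounded_comm_has_comm:
 assumes "A:{ann, cre}" "bounded_comm A x"
 shows "has_comm A x (comm A x)"
 using assms comm_eq unfolding bounded_comm_def by metis

text \<open>Only countably many members of \<open>E\<close> see some \<open>h n\<close>, so
  \<open>E\<close> is countable. Were it finite, summing the squared coefficients of
  \<open>card E + 1\<close> vectors \<open>h n\<close> in both orders would contradict Bessel's
  inequality.\<close>

lemma onb_equipollent:
 fixes h :: "nat => 'a::euclidean_space l2" and E :: "'a l2 set"
 assumes h: "onb_on h UNIV" and E: "is_onb E"
 obtains e where "bij_betw e (UNIV :: nat set) E"
proof -
 have E': "onb_on (%e. e) E" using E by (simp add: is_onb_iff)
 have "countable {e:E. (cmod (ip e (h n)))^2 ~= 0}" for n
  by (rule summable_countable_real[OF bessel_summ(1)[OF onb_ortho[OF E']]])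
 moreover have "E \<subseteq> (\<Union>n. {e:E. (cmod (ip e (h n)))^2 ~= 0})"
 proof
  fix e assume e: "e:E"
  have "EX n. ip (h n) e ~= 0"
   using onb_on_eqI[OF h, of e 0] norm_ortho[OF onb_ortho[OF E'] e] by fastforce
  then obtain n where "ip (h n) e ~= 0" by blast
  hence "ip e (h n) ~= 0" by (subst cinner_commute) simp
  thus "e:(\<Union>n. {e:E. (cmod (ip e (h n)))^2 ~= 0})" using e by auto
 qed
 ultimately have "countable E" by (elim countable_subset) (simp add: countable_UN)
 moreover have "infinite E"
 proof
  assume fin: "finite E"
  let ?N = "{..card E}"
  have "real (Suc (card E)) = (\<Sum>n\<in>?N. \<Sum>e\<in>E. (cmod (ip e (h n)))^2)"
  proof -
   have "(\<Sum>e\<in>E. (cmod (ip e (h n)))^2) = 1" for n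
    using has_sum_unique[OF onb_norm[OF E', of "h n"] has_sum_finite[OF fin]]
     norm_ortho[OF onb_ortho[OF h], of n] by simp
   thus ?thesis by simp
  qed
  also have "... = (\<Sum>e\<in>E. \<Sum>n\<in>?N. (cmod (ip (h n) e))^2)"
   by (subst sum.swap) (simp add: cmod_ip_commute)
  also have "... <= (\<Sum>e\<in>E. 1)"
   using bessel_finite[OF onb_ortho[OF h], of ?N] norm_ortho[OF onb_ortho[OF E']]
   by (intro sum_mono) (metis finite_atMost one_power2 subset_UNIV)
  finally show False by simp
 qed
 ultimately show thesis using that countableE_infinite bij_betw_inv_into by metis
qed

text \<open>The basis \<open>h\<close> makes the space separable and infinite-dimensional, so that
  the eigenvectors can be numbered by \<open>nat\<close>.\<close>

lemma eigenb_ex: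
 assumes h: "onb_on (h :: nat => 'a::euclidean_space l2) UNIV" and rh: "density_op (rh :: 'a bop)"
 obtains e r where "eigenbasis rh e r"
proof -
 have "has_trace rh 1" using rh by (simp add: density_op_def)
 then obtain E s where E: "is_onb E" "!!e. e:E ==> rh$$e = (s e :: real) *. e"
  by (rule spectral_onb[OF density_op_sa[OF rh] tc_form_compact]) blast
 obtain e where e: "bij_betw e (UNIV :: nat set) E" using onb_equipollent[OF h E(1)] .
 have eE: "e k:E" for k using e by (auto simp: bij_betw_def)
 have "onb_on e UNIV" unfolding onb_on_def ortho_on_def
 proof (intro conjI ballI allI impI)
  show "ip (e i) (e j) = (if i = j then 1 else 0)" for i j
   using E(1) eE e by (auto simp: is_onb_def bij_betw_def inj_eq)
  show "ps = 0" if "ALL i:UNIV. ip (e i) ps = 0" for ps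
  proof -
   have "ip x ps = 0" if "x:E" for x
    using e \<open>ALL i:UNIV. ip (e i) ps = 0\<close> that unfolding bij_betw_def by (metis UNIV_I imageE)
   thus ?thesis using E(1) unfolding is_onb_def by blast
  qed
 qed
 hence "eigenbasis rh e (%k. s (e k))" using rh E(2) eE by (simp add: eigenbasis_def)
 thus thesis by (rule that)
qed

section \<open>Analytic vectors and unitary groups\<close>

text \<open>Minimal distance and the parallelogram law. It is applied to graphs, as real subspaces
  of the space of pairs.\<close>

lemma projection_exists:
 fixes M :: "'v::{real_inner, complete_space} set"
 assumes M: "subspace M" "closed M"
 obtains m where "m:M" "!!y. y:M ==> inner (x - m) y = 0"
proof -
 define d where "d = infdist x M"
 have ne: "M ~= {}" using M(1) subspace_0 by blast
 have d: "d <= dist x y" if "y:M" for y unfolding d_def using infdist_le[OF that] .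
 have d0: "0 <= d" by (simp add: d_def infdist_nonneg)
 have "EX y:M. dist x y < d + inverse (real (Suc n))" for n
 proof (rule ccontr)
  assume "\<not> ?thesis"
  hence "d + inverse (real (Suc n)) <= infdist x M" unfolding infdist_notempty[OF ne] by (intro cINF_greatest ne) auto
  thus False by (simp add: d_def)
 qed
 then obtain y where y: "!!n. y n:M" "!!n. dist x (y n) < d + inverse (real (Suc n))" by metis
 have par: "(dist a b)^2 <= 2 * (dist x a)^2 + 2 * (dist x b)^2 - 4 * d\<^sup>2" if "a:M" "b:M" for a b
 proof -
  have "(1/2) *. (a + b):M" using that M(1) by (simp add: subspace_add subspace_scale)
  hence "d\<^sup>2 <= (dist x ((1/2) *. (a + b)))^2" using d d0 by (intro power_mono) auto
  also have "... = (2 * (dist x a)^2 + 2 * (dist x b)^2 - (dist a b)^2) / 4"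
   unfolding dist_norm power2_norm_eq_inner by (simp add: inner_diff inner_add algebra_simps inner_commute)
  finally show ?thesis by simp
 qed
 have lim: "(%n. dist x (y n)) ----> d"
  by (rule tendsto_sandwich[OF _ _ tendsto_const LIMSEQ_inverse_real_of_nat_add])
   (use y d in "auto intro!: eventuallyI less_imp_le")
 have "Cauchy y"
 proof (rule metric_CauchyI)
  fix e :: real assume e: "0 < e"
  have "(%n. (dist x (y n))^2) ----> d\<^sup>2" by (intro tendsto_power lim)
  hence "eventually (%n. (dist x (y n))^2 < d\<^sup>2 + e\<^sup>2 / 4) sequentially"
   by (rule order_tendstoD) (use e in simp)
  then obtain N where N: "!!n. n >= N ==> (dist x (y n))^2 < d\<^sup>2 + e\<^sup>2 / 4" unfolding eventually_sequentially by blast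
  have "dist (y m) (y n) < e" if "m >= N" "n >= N" for m n
  proof (rule power2_less_imp_less)
   show "(dist (y m) (y n))^2 < e\<^sup>2" using par[OF y(1) y(1), of m n] N[OF that(1)] N[OF that(2)] by (simp add: field_simps)
  qed (use e in simp)
  thus "EX M. ALL m>=M. ALL n>=M. dist (y m) (y n) < e" by blast
 qed
 then obtain m where m: "y ----> m" using Cauchy_convergent convergent_def by blast
 have mM: "m:M" using M(2) y(1) m unfolding closed_sequential_limits by blast
 have "dist x m = d" by (rule LIMSEQ_unique[OF tendsto_dist[OF tendsto_const m] lim])
 hence min: "(norm (x - m))^2 <= (norm (x - m - t *. z))^2" if "z:M" for t z
 proof -
  have "m + t *. z:M" using that mM M(1) by (simp add: subspace_add subspace_scale)
  hence "norm (x - m) <= norm (x - m - t *. z)" using d[of "m + t *. z"] \<open>dist x m = d\<close> by (simp add: dist_norm diff_diff_eq)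
  thus ?thesis by (simp add: power_mono)
 qed
 have "inner (x - m) z = 0" if z: "z:M" for z
 proof (cases "z = 0")
  case False
  define a where "a = inner (x - m) z"
  have "(norm (x - m - t *. z))^2 = (norm (x - m))^2 - 2 * t * a + t\<^sup>2 * (norm z)^2" for t
   unfolding power2_norm_eq_inner a_def by (simp add: inner_diff algebra_simps inner_commute power2_eq_square)
  with min[OF z, of "a / (norm z)^2"] have "2 * (a / (norm z)^2) * a <= (a / (norm z)^2)^2 * (norm z)^2" by simp
  hence "a\<^sup>2 <= 0" using False by (simp add: power2_eq_square field_simps)
  thus ?thesis by (simp add: a_def)
 qed simp
 with mM show thesis by (rule that)
qed

section \<open>Linear maps on finite combinations of basis vectors\<close>

definition fin_vec :: "('i => 'a::euclidean_space l2) => 'a l2 set" where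
 "fin_vec h = {ps. finite {i. ip (h i) ps ~= 0}}"

definition lin_on :: "'a::euclidean_space l2 set => ('a l2 => 'b::euclidean_space l2) => bool" where
 "lin_on D f \<longleftrightarrow> (ALL x:D. ALL y:D. f (x + y) = f x + f y) & (ALL c. ALL x:D. f (c *: x) = c *: f x)"

definition ext :: "('i => 'a::euclidean_space l2) => ('i => 'b::euclidean_space l2) => 'a l2 => 'b l2" where
 "ext h g ps = (\<Sum>i | ip (h i) ps ~= 0. ip (h i) ps *: g i)"

lemma fin_vec_zero: "0:fin_vec h"
 by (simp add: fin_vec_def)

lemma fin_vec_add: "x:fin_vec h ==> y:fin_vec h ==> x + y:fin_vec h"
 unfolding fin_vec_def mem_Collect_eq
 by (rule finite_subset[of _ "{i. ip (h i) x ~= 0} \<union> {i. ip (h i) y ~= 0}"]) (auto simp: ip_simps)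

lemma fin_scaleC: "x:fin_vec h ==> c *: x:fin_vec h"
 unfolding fin_vec_def mem_Collect_eq
 by (rule finite_subset[of _ "{i. ip (h i) x ~= 0}"]) (auto simp: ip_simps)

lemma fin_vec_scaleR: "x:fin_vec h ==> r *. x:fin_vec h"
 by (simp add: scaleR_l2_def fin_scaleC)

lemma fin_vec_sum: "(!!i. i:I ==> f i:fin_vec h) ==> sum f I:fin_vec h"
 by (induction I rule: infinite_finite_induct) (auto intro: fin_vec_add fin_vec_zero)

lemma fin_vec_basis: "onb_on h UNIV ==> h i:fin_vec h"
 unfolding fin_vec_def mem_Collect_eq
 by (rule finite_subset[of _ "{i}"]) (use orthoD[OF onb_ortho] in "fastforce split: if_splits")+

lemma fin_vec_expand:
 assumes h: "onb_on h UNIV" and ps: "ps:fin_vec h"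
 shows "ps = (\<Sum>i | ip (h i) ps ~= 0. ip (h i) ps *: h i)"
proof (rule onb_on_eqI[OF h])
 fix j
 show "ip (h j) ps = ip (h j) (\<Sum>i | ip (h i) ps ~= 0. ip (h i) ps *: h i)"
  using ps by (subst ip_ortho_sum[OF onb_ortho[OF h]]) (auto simp: fin_vec_def)
qed

lemma fin_vec_induct [consumes 2, case_names basis add scale]:
 assumes h: "onb_on h UNIV" and ps: "ps:fin_vec h" and "!!i. P (h i)"
  and add: "!!x y. x:fin_vec h ==> y:fin_vec h ==> P x ==> P y ==> P (x + y)"
  and scale: "!!c x. x:fin_vec h ==> P x ==> P (c *: x)"
 shows "P ps"
proof -
 have P0: "P 0" using scale[OF fin_vec_basis[OF h], of undefined 0] assms(3) by simp
 have "P (\<Sum>i\<in>F. c i *: h i)" for F c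
  by (induction F rule: infinite_finite_induct)
   (auto intro!: P0 add scale assms(3) fin_vec_sum fin_scaleC fin_vec_basis[OF h])
 thus ?thesis by (subst fin_vec_expand[OF h ps])
qed

lemma lin_on_eqI:
 assumes h: "onb_on h UNIV" and "lin_on (fin_vec h) f" "lin_on (fin_vec h) g" "!!i. f (h i) = g (h i)" "ps:fin_vec h"
 shows "f ps = g ps"
 using h assms(5) by (induction rule: fin_vec_induct) (use assms in "auto simp: lin_on_def")

lemma lin_on_ext: "lin_on (fin_vec h) (ext h g)"
proof -
 have sup: "ext h g ps = (\<Sum>i\<in>F. ip (h i) ps *: g i)" if "finite F" "{i. ip (h i) ps ~= 0} \<subseteq> F" for F ps
  unfolding ext_def using that by (intro sum.mono_neutral_left) auto
 have "ext h g (x + y) = ext h g x + ext h g y" if "x:fin_vec h" "y:fin_vec h" for x y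
 proof -
  let ?F = "{i. ip (h i) x ~= 0} \<union> {i. ip (h i) y ~= 0}"
  have "finite ?F" using that by (simp add: fin_vec_def)
  moreover have "{i. ip (h i) (x + y) ~= 0} \<subseteq> ?F" by (auto simp: ip_simps)
  ultimately show ?thesis
   by (simp add: sup[of ?F x] sup[of ?F y] sup[of ?F "x + y"] cinner_add_right scaleC_add_l2 sum.distrib)
 qed
 moreover have "ext h g (c *: x) = c *: ext h g x" if "x:fin_vec h" for c x
 proof -
  let ?F = "{i. ip (h i) x ~= 0}"
  have "finite ?F" using that by (simp add: fin_vec_def)
  thus ?thesis
   using sup[of ?F x] sup[of ?F "c *: x"]
   by (simp_all add: ip_simps scaleC_l2.sum_right scaleC_l2_simps subset_iff)
 qed
 ultimately show ?thesis by (simp add: lin_on_def)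
qed

lemma ext_basis: "onb_on h UNIV ==> ext h g (h i) = g i"
proof -
 assume h: "onb_on h UNIV"
 have "{j. ip (h j) (h i) ~= 0} = {i}" using orthoD[OF onb_ortho[OF h]] by (auto split: if_splits)
 thus ?thesis unfolding ext_def using orthoD[OF onb_ortho[OF h], of i i] by simp
qed

lemma ext_fin_vec: "(!!i. g i:fin_vec h') ==> ext h g ps:fin_vec h'"
 unfolding ext_def by (intro fin_vec_sum fin_scaleC)

lemma lin_on_form_eq:
 assumes h: "onb_on h UNIV" and f: "lin_on (fin_vec h) f" "lin_on (fin_vec h) f'"
  and b: "!!i j. ip (h i) (f (h j)) = ip (f' (h i)) (h j)" and D: "ph:fin_vec h" "ps:fin_vec h"
 shows "ip ph (f ps) = ip (f' ph) ps"
proof -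
 have *: "ip (h i) (f ps) = ip (f' (h i)) ps" for i
  using h D(2) by (induction rule: fin_vec_induct) (use f(1) b in "auto simp: lin_on_def ip_simps")
 from h D(1) show ?thesis
  by (induction rule: fin_vec_induct) (use * f(2) in "auto simp: lin_on_def ip_simps")
qed

lemma fin_vec_dense:
 assumes h: "onb_on h UNIV" shows "closure (fin_vec h) = UNIV"
proof -
 have "ps:closure (fin_vec h)" for ps
 proof (rule Lim_in_closed_set[OF closed_closure])
  show "((%F. \<Sum>i\<in>F. ip (h i) ps *: h i) \<longlongrightarrow> ps) (finite_subsets_at_top UNIV)"
   using onb_expand[OF h] unfolding has_sum_def .
  show "\<forall>\<^sub>F F in finite_subsets_at_top UNIV. (\<Sum>i\<in>F. ip (h i) ps *: h i):closure (fin_vec h)"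
   by (intro always_eventually allI subsetD[OF closure_subset] fin_vec_sum fin_scaleC fin_vec_basis[OF h])
 qed simp
 thus ?thesis by blast
qed

text \<open>Regrouping along \<open>m + n = k\<close> by the binomial theorem. It replaces the
  product of operator exponentials: the generator is unbounded, and only its matrix elements
  \<open>d k\<close> enter.\<close>

lemma exp_double_sum:
 fixes d :: "nat => complex" and s t :: real
 assumes "summable (%k. (abs s + abs t) ^ k / fact k * cmod (d k))"
 shows "((%(m, n). of_real (s ^ m / fact m * (t ^ n / fact n)) * d (m + n)) has_sum
  (\<Sum>k. of_real ((s + t) ^ k / fact k) * d k)) UNIV"
proof -
 define f where "f = (%(m, n). cor (s ^ m / fact m * (t ^ n / fact n)) * d (m + n))"
 let ?S = "Sigma (UNIV :: nat set) (%k. {..k})"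
 let ?\<pi> = "%(k, i). (i, k - i) :: nat \<times> nat"
 have inj: "inj_on ?\<pi> ?S" by (auto simp: inj_on_def)
 have img: "?\<pi> ` ?S = UNIV" by (auto simp: image_iff) (metis add_diff_cancel_left' le_add1)
 have binom: "(\<Sum>i\<le>k. s ^ i / fact i * (t ^ (k - i) / fact (k - i))) = (s + t) ^ k / fact k" for s t :: real and k
  using exp_series_add_commuting[of s t k] by (simp add: divide_inverse mult_ac)
 have n: "(%x. norm ((f \<circ> ?\<pi>) x)) summable_on ?S"
  unfolding Infinite_Sum.abs_summable_on_Sigma_iff
 proof (intro conjI ballI)
  have "(\<Sum>i\<le>k. norm ((f \<circ> ?\<pi>) (k, i))) = (\<Sum>i\<le>k. abs s ^ i / fact i * (abs t ^ (k - i) / fact (k - i)) * cmod (d k))" for k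
   by (simp add: f_def norm_mult norm_divide norm_power)
  hence "(\<Sum>i\<le>k. norm ((f \<circ> ?\<pi>) (k, i))) = (abs s + abs t) ^ k / fact k * cmod (d k)" for k
   by (simp only: sum_distrib_right[symmetric] binom)
  thus "(%k. norm (\<Sum>\<^sub>\<infinity>i\<in>{..k}. norm ((f \<circ> ?\<pi>) (k, i)))) summable_on UNIV"
   using assms by (simp add: summable_on_UNIV_nonneg_real_iff)
 qed simp
 hence sm: "(f \<circ> ?\<pi>) summable_on ?S" by (rule abs_summable_summable)
 have "infsum (f \<circ> ?\<pi>) ?S = (\<Sum>\<^sub>\<infinity>k. \<Sum>\<^sub>\<infinity>i\<in>{..k}. (f \<circ> ?\<pi>) (k, i))"
  by (rule infsum_Sigma_banach[symmetric, OF sm])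
 also have "... = (\<Sum>\<^sub>\<infinity>k. of_real ((s + t) ^ k / fact k) * d k)"
 proof -
  have "(\<Sum>i\<le>k. (f \<circ> ?\<pi>) (k, i)) = of_real ((s + t) ^ k / fact k) * d k" for k
   unfolding binom[symmetric] by (simp add: f_def sum_distrib_right)
  thus ?thesis by simp
 qed
 also have "... = (\<Sum>k. of_real ((s + t) ^ k / fact k) * d k)"
 proof -
  have "summable (%k. norm (of_real ((s + t) ^ k / fact k) * d k))"
   by (rule summable_comparison_test'[OF assms, of 0])
    (auto simp: norm_mult norm_divide norm_power abs_triangle_ineq simp flip: of_real_add intro!: mult_right_mono divide_right_mono power_mono)
  from infsumI[OF norm_summable_imp_has_sum[OF this summable_sums[OF summable_norm_cancel[OF this]]]]
  show ?thesis .
 qed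
 finally have "((f \<circ> ?\<pi>) has_sum (\<Sum>k. of_real ((s + t) ^ k / fact k) * d k)) ?S"
  using has_sum_infsum[OF sm] by simp
 thus ?thesis unfolding has_sum_reindex[OF inj, symmetric] img f_def .
qed

lemma isometry_exists:
 fixes h :: "'i => 'a::euclidean_space l2"
 assumes h: "onb_on h UNIV" and g: "ortho_on g (UNIV :: 'i set)"
 shows "EX T. ALL i. T$$h i = (g i :: 'a l2)"
proof -
 note hb = bessel_summ[OF onb_ortho[OF h]]
 have "EX et. (ALL ph. ((%i. ip ph (g i) * ip (h i) ps) has_sum ip ph et) UNIV) & norm et <= norm ps" for ps
 proof -
  obtain et where et: "!!ph. ((%i. ip ph (g i) * ip (h i) ps) has_sum ip ph et) UNIV"
   "norm et <= sqrt (\<Sum>\<^sub>\<infinity>i. (cmod (ip (h i) ps))^2)"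
   by (rule riesz_fischer[OF g hb(1)[of ps]]) (rule that)
  have "sqrt (\<Sum>\<^sub>\<infinity>i. (cmod (ip (h i) ps))^2) <= norm ps" using real_sqrt_le_mono[OF hb(2)[of ps]] by simp
  thus ?thesis using et by (intro exI[of _ et]) auto
 qed
 then obtain f where f: "!!ps ph. ((%i. ip ph (g i) * ip (h i) ps) has_sum ip ph (f ps)) UNIV"
  and fn: "!!ps. norm (f ps) <= 1 * norm ps" by (metis mult_1)
 have "f (ph + ps) = f ph + f ps" for ph ps
 proof (rule ip_eqI)
  fix et
  show "ip et (f (ph + ps)) = ip et (f ph + f ps)"
   using has_sum_unique[OF f[of et "ph + ps"], of "ip et (f ph + f ps)"] has_sum_add[OF f[of et ph] f[of et ps]]
   by (simp add: ip_simps distrib_left)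
 qed
 moreover have "f (c *: ps) = c *: f ps" for c ps
 proof (rule ip_eqI)
  fix et
  show "ip et (f (c *: ps)) = ip et (c *: f ps)"
   using has_sum_unique[OF f[of et "c *: ps"], of "ip et (c *: f ps)"] has_sum_cmult_right[OF f[of et ps], of c]
   by (simp add: ip_simps mult.left_commute)
 qed
 ultimately obtain T where T: "!!ps. T$$ps = f ps" using bop_exists[of f, OF _ _ fn] by metis
 have "f (h i) = g i" for i
 proof (rule ip_eqI)
  fix et
  have "((%j. ip et (g j) * ip (h j) (h i)) has_sum ip et (g i)) UNIV"
   by (rule has_sum_finite_neutralI[of "{i}"]) (auto simp: orthoD[OF onb_ortho[OF h]])
  thus "ip et (f (h i)) = ip et (g i)" by (rule has_sum_unique[OF f])
 qed
 hence "ALL i. T$$h i = g i" by (simp add: T)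
 thus ?thesis ..
qed

text \<open>Nelson's setting with entire vectors: the exponential series converges on each basis
  vector for all \<open>r\<close>, so the group is defined for all times at once and not continued
  from small times.\<close>

locale skew_series =
 fixes h :: "'i => 'a::euclidean_space l2" and A :: "'a l2 => 'a l2"
 assumes onb: "onb_on h UNIV" and lin: "lin_on (fin_vec h) A"
  and stable: "ps:fin_vec h ==> A ps:fin_vec h"
  and skew: "ph:fin_vec h ==> ps:fin_vec h ==> ip ph (A ps) = - ip (A ph) ps"
  and analytic_basis: "summable (%n. r ^ n / fact n * norm ((A ^^ n) (h i)))"
begin

abbreviation "D \<equiv> fin_vec h"

lemma stable_pow: "ps:D ==> (A ^^ n) ps:D"
 by (induction n) (auto intro: stable)

lemma lin_pow: "lin_on D (A ^^ n)"
proof (induction n)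
 case (Suc n)
 thus ?case using lin stable_pow unfolding lin_on_def by simp
qed (simp add: lin_on_def)

lemma skew_pow: "ph:D ==> ps:D ==> ip ph ((A ^^ n) ps) = (-1) ^ n * ip ((A ^^ n) ph) ps"
proof (induction n arbitrary: ps)
 case (Suc n)
 have "ip ph ((A ^^ Suc n) ps) = - ip (A ph) ((A ^^ n) ps)" using Suc.prems stable_pow by (simp add: skew)
 also have "... = ip ph ((A ^^ n) (A ps))" using Suc.prems stable_pow skew by (simp add: funpow_swap1[symmetric])
 also have "... = (-1) ^ n * ip ((A ^^ n) ph) (A ps)" by (rule Suc.IH) (use Suc.prems stable in auto)
 also have "... = (-1) ^ Suc n * ip ((A ^^ Suc n) ph) ps" using Suc.prems stable_pow by (simp add: skew)
 finally show ?case .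
qed simp

lemma analytic: "ps:D ==> summable (%n. abs r ^ n / fact n * norm ((A ^^ n) ps))"
proof (use onb in "induction rule: fin_vec_induct")
 case (basis i) show ?case by (rule analytic_basis)
next
 case (add x y)
 have "(A ^^ n) (x + y) = (A ^^ n) x + (A ^^ n) y" for n using lin_pow[of n] add unfolding lin_on_def by blast
 moreover have "abs r ^ n / fact n * norm (a + b) <= abs r ^ n / fact n * norm a + abs r ^ n / fact n * norm b" for a b :: "'a l2" and n
  unfolding distrib_left[symmetric] by (intro mult_left_mono norm_triangle_ineq) simp
 ultimately show ?case
  by (intro summable_comparison_test'[OF summable_add[OF add(3,4)], of 0]) simp
next
 case (scale c x)
 have "(A ^^ n) (c *: x) = c *: (A ^^ n) x" for n using lin_pow[of n] scale unfolding lin_on_def by blast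
 thus ?case using summable_mult[OF scale(2), of "cmod c"] by (simp add: norm_scaleC_l2 mult_ac)
qed

definition S :: "real => 'a l2 => 'a l2" where "S t ps = (\<Sum>n. (t ^ n / fact n) *. (A ^^ n) ps)"

lemma S_sums: "ps:D ==> (%n. (t ^ n / fact n) *. (A ^^ n) ps) sums S t ps"
 unfolding S_def
 by (rule summable_sums, rule summable_norm_cancel)
  (use analytic[of ps t] in "simp add: norm_power power_abs[symmetric]")

lemma S_ip_sums: "ps:D ==> (%n. of_real (t ^ n / fact n) * ip et ((A ^^ n) ps)) sums ip et (S t ps)"
 using bounded_linear.sums[OF cinner.bounded_linear_right S_sums] by (simp add: ip_scaleRr)

lemma analytic_ip:
 assumes "ps:D" shows "summable (%n. abs r ^ n / fact n * cmod (ip et ((A ^^ n) ps)))"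
proof (rule summable_comparison_test'[OF summable_mult[OF analytic[OF assms, of r], of "norm et"], of 0])
 fix n
 have "abs r ^ n / fact n * cmod (ip et ((A ^^ n) ps)) <= abs r ^ n / fact n * (norm et * norm ((A ^^ n) ps))"
  by (intro mult_left_mono norm_ip) simp
 thus "norm (abs r ^ n / fact n * cmod (ip et ((A ^^ n) ps))) <= norm et * (abs r ^ n / fact n * norm ((A ^^ n) ps))"
  by (simp add: mult_ac)
qed

text \<open>Skewness moves powers of \<open>A\<close> from one side to the other at the price of a
  sign, and the double series collects the exponents. Isometry, adjoint and group law of the
  extension follow from this one identity.\<close>

lemma S_form:
 assumes "ph:D" "ps:D" shows "ip (S s ph) (S t ps) = ip ph (S (t - s) ps)"
proof -
 define d where "d = (%k. ip ph ((A ^^ k) ps))"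
 let ?f = "%m n. cor ((- s) ^ m / fact m * (t ^ n / fact n)) * d (m + n)"
 have "((%(m, n). ?f m n) has_sum (\<Sum>k. of_real ((- s + t) ^ k / fact k) * d k)) UNIV"
  using analytic_ip[OF assms(2), of "abs (- s) + abs t" ph] by (intro exp_double_sum) (simp add: d_def)
 hence hs: "((%(m, n). ?f m n) has_sum ip ph (S (t - s) ps)) (UNIV \<times> UNIV)"
  using sums_unique[OF S_ip_sums[OF assms(2), of "t - s" ph]] by (simp add: d_def)
 have row: "((%n. ?f m n) has_sum of_real (s ^ m / fact m) * ip ((A ^^ m) ph) (S t ps)) UNIV" for m
 proof -
  have e: "?f m n = of_real (s ^ m / fact m) * (of_real (t ^ n / fact n) * ip ((A ^^ m) ph) ((A ^^ n) ps))" for n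
  proof -
   have "d (m + n) = (- 1) ^ m * ip ((A ^^ m) ph) ((A ^^ n) ps)"
    unfolding d_def funpow_add o_def by (rule skew_pow) (use assms stable_pow in auto)
   moreover have "(- s) ^ m * (- 1) ^ m = s ^ m" unfolding power_mult_distrib[symmetric] by simp
   hence "cor (- s) ^ m * (- 1) ^ m = cor s ^ m" by (metis of_real_1 of_real_minus of_real_mult of_real_power)
   ultimately show ?thesis by (simp add: field_simps)
  qed
  have "((%n. of_real (t ^ n / fact n) * ip ((A ^^ m) ph) ((A ^^ n) ps)) has_sum ip ((A ^^ m) ph) (S t ps)) UNIV"
   using analytic_ip[OF assms(2), of t "(A ^^ m) ph"]
   by (intro norm_summable_imp_has_sum S_ip_sums assms) (simp add: norm_mult norm_divide norm_power)
  thus ?thesis unfolding e by (rule has_sum_cmult_right)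
 qed
 have "((%m. of_real (s ^ m / fact m) * ip ((A ^^ m) ph) (S t ps)) has_sum ip ph (S (t - s) ps)) UNIV"
  by (rule has_sum_SigmaD[OF hs row[THEN has_sum_cong[THEN iffD1, rotated]]]) simp
 hence "(%m. of_real (s ^ m / fact m) * ip ((A ^^ m) ph) (S t ps)) sums ip ph (S (t - s) ps)"
  by (rule has_sum_imp_sums)
 moreover have "(%m. of_real (s ^ m / fact m) * ip ((A ^^ m) ph) (S t ps)) sums ip (S s ph) (S t ps)"
  using bounded_linear.sums[OF cinner.bounded_linear_left S_sums[OF assms(1), of s]] by (simp add: ip_scaleR_left)
 ultimately show ?thesis by (rule sums_unique2[symmetric])
qed

lemma S_zero: "S 0 ps = ps"
 unfolding S_def by (subst suminf_finite[of "{0}"]) (auto simp: power_0_left)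

lemma S_lin: "lin_on D (S t)"
 unfolding lin_on_def
proof (intro conjI ballI allI)
 fix x y assume xy: "x:D" "y:D"
 have "(A ^^ n) (x + y) = (A ^^ n) x + (A ^^ n) y" for n using lin_pow[of n] xy unfolding lin_on_def by blast
 hence "(%n. (t ^ n / fact n) *. (A ^^ n) (x + y)) sums (S t x + S t y)"
  using sums_add[OF S_sums[OF xy(1)] S_sums[OF xy(2)]] by (simp add: scaleR_add_right)
 thus "S t (x + y) = S t x + S t y" by (rule sums_unique2[OF S_sums[OF fin_vec_add[OF xy]]])
next
 fix c x assume x: "x:D"
 have "(A ^^ n) (c *: x) = c *: (A ^^ n) x" for n using lin_pow[of n] x unfolding lin_on_def by blast
 hence "(%n. (t ^ n / fact n) *. (A ^^ n) (c *: x)) sums (c *: S t x)"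
  using bounded_linear.sums[OF scaleC_l2.bounded_linear_right S_sums[OF x]] by (simp add: scaleC_l2.scaleR_right)
 thus "S t (c *: x) = c *: S t x" by (rule sums_unique2[OF S_sums[OF fin_scaleC[OF x]]])
qed

definition U :: "real => 'a bop" where "U t = (SOME T. ALL i. T$$h i = S t (h i))"

lemma U_eq_S: assumes "ps:D" shows "U t$$ps = S t ps"
proof (rule lin_on_eqI[OF onb _ S_lin _ assms])
 have "ortho_on (%i. S t (h i)) UNIV"
  using orthoD[OF onb_ortho[OF onb]]
  by (simp add: ortho_on_def S_form fin_vec_basis[OF onb] S_zero)
 from someI_ex[OF isometry_exists[OF onb this]] show "U t$$h i = S t (h i)" for i unfolding U_def by blast
 show "lin_on D (%ps. U t$$ps)" by (simp add: lin_on_def bop_simps)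
qed

lemma U_form: "bop_adj (U s) * U t = U (t - s)"
proof (rule bop_eqI_onb[OF onb], rule onb_on_eqI[OF onb])
 show "ip (h i) ((bop_adj (U s) * U t)$$h j) = ip (h i) (U (t - s)$$h j)" for i j
  by (simp add: bop_simps ip_adjr U_eq_S fin_vec_basis[OF onb] S_form)
qed

lemma U_zero: "U 0 = 1"
 by (rule bop_eqI_onb[OF onb]) (simp add: U_eq_S fin_vec_basis[OF onb] S_zero)

lemma U_adj: "bop_adj (U s) = U (- s)"
 using U_form[of s 0] by (simp add: U_zero)

lemma U_add: "U (s + t) = U s * U t"
 using U_form[of "- s" t] U_adj[of "- s"] by (simp add: add.commute)

lemma U_ip: "ip (U t$$ph) (U t$$ps) = ip ph ps"
 using U_form[of t t] by (simp add: ip_adjr[symmetric] bop_times[symmetric] U_zero)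

lemma norm_U: "norm (U t$$ps) = norm ps"
 using U_ip[of t ps ps] Re_ip_self by (metis norm_ge_zero power2_eq_iff_nonneg)

text \<open>The part of the series from order two on is bounded by \<open>t^2 * C\<close> once
  \<open>abs t <= 1\<close>.\<close>

lemma U_derivative_zero:
 assumes ps: "ps:D" shows "((%t. (U t$$ps - ps) /\<^sub>R t) \<longlongrightarrow> A ps) (at 0)"
proof -
 define C where "C = (\<Sum>n. norm ((A ^^ (n + 2)) ps) / fact (n + 2))"
 have sC: "summable (%n. norm ((A ^^ (n + 2)) ps) / fact (n + 2))"
  using summable_ignore_initial_segment[OF analytic[OF ps, of 1], of 2] by simp
 have bd: "norm ((U t$$ps - ps) /\<^sub>R t - A ps) <= abs t * C" if t: "abs t <= 1" "t ~= 0" for t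
 proof -
  have "(%n. (t ^ (n + 2) / fact (n + 2)) *. (A ^^ (n + 2)) ps) sums (S t ps - (\<Sum>n<2. (t ^ n / fact n) *. (A ^^ n) ps))"
   by (rule sums_split_initial_segment[OF S_sums[OF ps]])
  hence s: "(%n. (t ^ (n + 2) / fact (n + 2)) *. (A ^^ (n + 2)) ps) sums (S t ps - ps - t *. A ps)"
   by (simp add: numeral_2_eq_2 diff_diff_eq)
  have le: "norm ((t ^ (n + 2) / fact (n + 2)) *. (A ^^ (n + 2)) ps) <= t\<^sup>2 * (norm ((A ^^ (n + 2)) ps) / fact (n + 2))" for n
  proof -
   have "abs t ^ n * (t\<^sup>2 * (norm ((A ^^ (n + 2)) ps) / fact (n + 2))) <= 1 * (t\<^sup>2 * (norm ((A ^^ (n + 2)) ps) / fact (n + 2)))"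
    using t by (intro mult_right_mono power_le_one) auto
   moreover have "norm ((t ^ (n + 2) / fact (n + 2)) *. (A ^^ (n + 2)) ps) = abs t ^ n * (t\<^sup>2 * (norm ((A ^^ (n + 2)) ps) / fact (n + 2)))"
   proof -
    have "abs (t ^ (n + 2) / fact (n + 2)) = abs t ^ n * t\<^sup>2 / fact (n + 2)"
     unfolding abs_divide power_add abs_mult power_abs[symmetric] by (simp add: power_abs)
    thus ?thesis by (simp only: norm_scaleR times_divide_eq_left times_divide_eq_right mult.assoc)
   qed
   ultimately show ?thesis by (simp only: mult_1)
  qed
  have "norm (S t ps - ps - t *. A ps) <= t\<^sup>2 * C"
   unfolding sums_unique[OF s] C_def suminf_mult[OF sC, symmetric]
   using le by (intro norm_suminf_le summable_mult sC)
  hence "norm ((S t ps - ps - t *. A ps) /\<^sub>R t) <= abs t * C"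
   using t by (simp add: divide_simps power2_eq_square mult_ac)
  moreover have "(S t ps - ps - t *. A ps) /\<^sub>R t = (U t$$ps - ps) /\<^sub>R t - A ps" using t by (simp add: scaleR_diff_right U_eq_S[OF ps])
  ultimately show ?thesis by simp
 qed
 have "((%t. (U t$$ps - ps) /\<^sub>R t - A ps) \<longlongrightarrow> 0) (at 0)"
 proof (rule Lim_null_comparison)
  have "eventually (%t::real. dist t 0 < 1 & t ~= 0) (at 0)" by (auto simp: eventually_at intro!: exI[of _ 1])
  thus "\<forall>\<^sub>F t in at 0. norm ((U t$$ps - ps) /\<^sub>R t - A ps) <= abs t * C"
   by eventually_elim (use bd in simp)
  show "((%t. abs t * C) \<longlongrightarrow> 0) (at 0)" by (rule tendsto_eq_intros tendsto_ident_at refl | simp)+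
 qed
 thus ?thesis by (simp add: LIM_zero_iff)
qed

end

lemma c0_group_derivative:
 assumes V: "is_c0_group V" and g: "(ps, ch'):generator V"
 shows "((%t. V t$$ps) has_vector_derivative V t$$ch') (at t)" (is ?A)
  and "(V t$$ps, V t$$ch'):generator V" (is ?B)
proof -
 have add: "V (s + t) = V s * V t" for s t using V by (simp add: is_c0_group_def)
 have l: "((%h. V t$$((V h$$ps - ps) /\<^sub>R h)) \<longlongrightarrow> V t$$ch') (at 0)"
  using g unfolding generator_def by (auto intro: tendsto_bop)
 hence l': "((%h. (V (t + h)$$ps - V t$$ps) /\<^sub>R h) \<longlongrightarrow> V t$$ch') (at 0)"
  by (simp add: bop_simps add)
 show ?A
  unfolding has_vector_derivative_def has_derivative_at
 proof (intro conjI bounded_linear_scaleR_left)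
  have "((%h. norm ((V (t + h)$$ps - V t$$ps) /\<^sub>R h - V t$$ch')) \<longlongrightarrow> 0) (at 0)"
   using l' by (intro tendsto_norm_zero) (simp add: LIM_zero_iff)
  thus "(%h. norm (V (t + h)$$ps - V t$$ps - h *. V t$$ch') / norm h) \<midarrow>0\<rightarrow> 0"
  proof (rule Lim_transform_eventually)
   have "norm ((V (t + h)$$ps - V t$$ps) /\<^sub>R h - V t$$ch') = norm (V (t + h)$$ps - V t$$ps - h *. V t$$ch') / norm h" if "h ~= 0" for h
   proof -
    have "(V (t + h)$$ps - V t$$ps) /\<^sub>R h - V t$$ch' = (V (t + h)$$ps - V t$$ps - h *. V t$$ch') /\<^sub>R h"
     using that by (simp add: scaleR_diff_right)
    thus ?thesis by (simp add: divide_inverse_commute)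
   qed
   thus "\<forall>\<^sub>F h in at 0. norm ((V (t + h)$$ps - V t$$ps) /\<^sub>R h - V t$$ch')
     = norm (V (t + h)$$ps - V t$$ps - h *. V t$$ch') / norm h"
    by (auto simp: eventually_at intro!: exI[of _ 1])
  qed
 qed
 have "V h$$V t$$ps = V t$$V h$$ps" for h
  unfolding bop_times[symmetric] add[symmetric] by (simp add: add.commute)
 thus ?B
  using l unfolding generator_def by (simp add: bop_simps)
qed

lemma subspace_closure_sequential:
 fixes M :: "'v::real_normed_vector set"
 assumes M: "subspace M" shows "subspace (closure M)"
 unfolding subspace_def
proof (intro conjI ballI allI)
 show "0:closure M" using subspace_0[OF M] closure_subset by blast
next
 fix x y assume "x:closure M" "y:closure M"
 then obtain f g where "!!n. f n:M" "f ----> x" "!!n. g n:M" "g ----> y" unfolding closure_sequential by blast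
 thus "x + y:closure M" unfolding closure_sequential
  by (intro exI[of _ "%n. f n + g n"]) (simp add: subspace_add[OF M] tendsto_add)
next
 fix c x assume "x:closure M"
 then obtain f where "!!n. f n:M" "f ----> x" unfolding closure_sequential by blast
 thus "c *. x:closure M" unfolding closure_sequential
  by (intro exI[of _ "%n. c *. f n"]) (simp add: subspace_scale[OF M] tendsto_scaleR)
qed

section \<open>The generator of the group as the closure of the skew operator\<close>

context skew_series
begin

text \<open>The graph of minus the adjoint of \<open>A\<close> restricted to \<open>D\<close>, the
  largest candidate for the generator.\<close>

definition "weak_graph = {(ps, ch'). ALL ph:D. ip (A ph) ps = - ip ph ch'}"

lemma norm_le_dense:
 assumes "!!ph. ph:D ==> cmod (ip ph x) <= K * norm ph" "0 <= K"
 shows "norm x <= K"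
proof (rule norm_le_by_ip[OF _ assms(2)])
 fix ph :: "'a l2"
 obtain f where f: "!!n. f n:D" "f ----> ph" using fin_vec_dense[OF onb] closure_sequential[of ph D] by auto
 show "cmod (ip ph x) <= K * norm ph"
  by (rule LIMSEQ_le[OF tendsto_norm[OF cinner.tendsto[OF f(2) tendsto_const]] tendsto_mult[OF tendsto_const tendsto_norm[OF f(2)]]])
   (use assms(1) f(1) in blast)
qed

lemma eq_zero_dense: "(!!ph. ph:D ==> ip ph x = 0) ==> x = 0"
 using norm_le_dense[of x 0] by simp

lemma U_tendsto_zero: "((%t. U t$$ps) \<longlongrightarrow> ps) (at 0)"
proof (rule tendstoI)
 fix ep :: real assume ep: "0 < ep"
 hence "0 < ep / 3" by simp
 hence "EX ph:D. dist ph ps < ep / 3" using fin_vec_dense[OF onb] closure_approachable[of ps D] by blast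
 then obtain ph where ph: "ph:D" "norm (ph - ps) < ep / 3" by (auto simp: dist_norm)
 have "((%t. t *. ((U t$$ph - ph) /\<^sub>R t)) \<longlongrightarrow> 0 *. A ph) (at 0)"
  by (rule tendsto_scaleR[OF tendsto_ident_at U_derivative_zero[OF ph(1)]])
 hence "((%t. t *. ((U t$$ph - ph) /\<^sub>R t)) \<longlongrightarrow> 0) (at 0)" by simp
 from tendstoD[OF this, of "ep / 3"] ep have "\<forall>\<^sub>F t in at 0. norm (t *. ((U t$$ph - ph) /\<^sub>R t)) < ep / 3" by simp
 moreover have "\<forall>\<^sub>F t::real in at 0. t ~= 0" by (rule eventually_at_ball'[of 1 0 UNIV, THEN eventually_mono]) auto
 ultimately show "\<forall>\<^sub>F t in at 0. dist (U t$$ps) ps < ep"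
 proof eventually_elim
  case (elim t)
  have "U t$$ps - ps = (U t$$ph - ph) + ((ph - ps) - U t$$(ph - ps))" by (simp add: bop_simps)
  hence "norm (U t$$ps - ps) <= norm (U t$$ph - ph) + (norm (ph - ps) + norm (ph - ps))"
   using norm_triangle_mono[OF order_refl norm_triangle_ineq4[of "ph - ps" "U t$$(ph - ps)"]] by (metis norm_U)
  thus ?case using elim ph(2) by (simp add: dist_norm)
 qed
qed

lemma U_c0: "is_c0_group U"
 unfolding is_c0_group_def
proof (intro conjI allI U_zero U_add)
 fix ps :: "'a l2"
 have "((%h. U (s + h)$$ps) \<longlongrightarrow> U s$$ps) (at 0)" for s
  unfolding U_add bop_times by (rule tendsto_bop[OF U_tendsto_zero])
 thus "continuous_on UNIV (%t. U t$$ps)"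
  by (simp add: continuous_on_eq_continuous_at isCont_iff)
qed

lemma graph_sub_generator: "ps:D ==> (ps, A ps):generator U"
 unfolding generator_def using U_derivative_zero by simp

lemma weak_graph_U:
 assumes "(ps, ch'):weak_graph" "ph:D"
 shows "ip (U t$$A ph) ps = - ip (U t$$ph) ch'"
proof -
 have "(%n. ip ((t ^ n / fact n) *. (A ^^ n) (A ph)) ps) sums ip (U t$$A ph) ps"
  using bounded_linear.sums[OF cinner.bounded_linear_left S_sums[OF stable[OF assms(2)]]] U_eq_S[OF stable[OF assms(2)]] by simp
 moreover have "ip ((t ^ n / fact n) *. (A ^^ n) (A ph)) ps = - ip ((t ^ n / fact n) *. (A ^^ n) ph) ch'" for n
  using assms(1) stable_pow[OF assms(2), of n]
  by (simp add: weak_graph_def ip_scaleR_left funpow_swap1[symmetric])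
 moreover have "(%n. - ip ((t ^ n / fact n) *. (A ^^ n) ph) ch') sums - ip (U t$$ph) ch'"
  using bounded_linear.sums[OF cinner.bounded_linear_left S_sums[OF assms(2)]] U_eq_S[OF assms(2)]
  by (intro sums_minus) simp
 ultimately show ?thesis using sums_unique2 by simp
qed

lemma generator_sub_weak: "generator U \<subseteq> weak_graph"
proof (clarsimp simp: weak_graph_def)
 fix ps ch' ph assume g: "(ps, ch'):generator U" and ph: "ph:D"
 have "((%t. ip ((U t$$ph - ph) /\<^sub>R t) ps) \<longlongrightarrow> ip (A ph) ps) (at 0)"
  by (rule cinner.tendsto[OF U_derivative_zero[OF ph] tendsto_const])
 hence "((%t. ip ((U (- t)$$ph - ph) /\<^sub>R (- t)) ps) \<longlongrightarrow> ip (A ph) ps) (at 0)"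
  by (rule filterlim_compose) (auto simp: filterlim_at eventually_at intro!: tendsto_eq_intros exI[of _ 1])
 moreover have "ip ((U (- t)$$ph - ph) /\<^sub>R (- t)) ps = - ip ph ((U t$$ps - ps) /\<^sub>R t)" for t
  by (simp add: U_adj[symmetric] ip_simps ip_adjl)
 moreover have "((%t. - ip ph ((U t$$ps - ps) /\<^sub>R t)) \<longlongrightarrow> - ip ph ch') (at 0)"
  using g by (intro tendsto_minus cinner.tendsto[OF tendsto_const]) (simp add: generator_def)
 ultimately show "ip (A ph) ps = - ip ph ch'" using tendsto_unique[OF trivial_limit_at] by simp
qed

text \<open>Against test vectors in \<open>D\<close> the orbit \<open>U t$$ps\<close> is
  differentiable with derivative \<open>U t$$ch'\<close>. The mean value inequality bounds the
  linearisation error uniformly over test vectors of given norm, which upgrades weak to strong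
  differentiability.\<close>

lemma weak_sub_generator: "weak_graph \<subseteq> generator U"
proof
 fix p assume "p:weak_graph"
 then obtain ps ch' where p: "p = (ps, ch')" and w: "(ps, ch'):weak_graph" by (cases p) auto
 have deriv: "((%t. ip ph (U t$$ps)) has_vector_derivative ip ph (U t$$ch')) (at t)" if "ph:D" for ph t
 proof -
  have "((%s. U s$$ph) \<circ> uminus has_vector_derivative (- 1) *. (U (- t)$$A ph)) (at t)"
   by (rule vector_diff_chain_at) (auto intro!: derivative_eq_intros c0_group_derivative(1)[OF U_c0 graph_sub_generator[OF that]])
  from bounded_linear.has_vector_derivative[OF cinner.bounded_linear_left this, of ps]
  have "((%t. ip (U (- t)$$ph) ps) has_vector_derivative ip (U (- t)$$ph) ch') (at t)"
   using weak_graph_U[OF w that, of "- t"] by (simp add: o_def ip_simps)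
  thus ?thesis by (simp add: U_adj[symmetric] ip_adjl)
 qed
 have "((%t. (U t$$ps - ps) /\<^sub>R t) \<longlongrightarrow> ch') (at 0)"
 proof (rule tendstoI)
  fix ep :: real assume ep: "0 < ep"
  have "\<forall>\<^sub>F t in at 0. dist (U t$$ch') ch' < ep / 2" by (rule tendstoD[OF U_tendsto_zero]) (use ep in simp)
  then obtain d where d: "0 < d" "!!t. t ~= 0 ==> (abs t) < d ==> norm (U t$$ch' - ch') < ep / 2"
   unfolding eventually_at by (auto simp: dist_norm)
  hence d': "norm (U t$$ch' - ch') <= ep / 2" if "abs t < d" for t
   using that ep by (cases "t = 0") (auto simp: U_zero less_imp_le)
  have "dist ((U t$$ps - ps) /\<^sub>R t) ch' < ep" if t: "t ~= 0" "abs t < d" for t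
  proof -
   have "norm (U t$$ps - ps - t *. ch') <= abs t * (ep / 2)"
   proof (rule norm_le_dense)
    fix ph assume ph: "ph:D"
    let ?f = "%t. ip ph (U t$$ps)" and ?f' = "%t. ip ph (U t$$ch')"
    have "norm (?f t - ?f 0 - (t - 0) *. ?f' 0) <= norm (t - 0) * (norm ph * (ep / 2))"
    proof (rule vector_differentiable_bound_linearization[of "closed_segment 0 t"])
     fix x assume "x:closed_segment 0 t"
     hence "abs x < d" using t by (auto simp: closed_segment_eq_real_ivl split: if_splits)
     have "?f' x - ?f' 0 = ip ph (U x$$ch' - ch')" by (simp add: ip_simps U_zero)
     hence "norm (?f' x - ?f' 0) <= norm ph * norm (U x$$ch' - ch')" by (simp add: norm_ip)
     also have "... <= norm ph * (ep / 2)" using d'[OF \<open>abs x < d\<close>] by (intro mult_left_mono) auto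
     finally show "norm (?f' x - ?f' 0) <= norm ph * (ep / 2)" .
    qed (use deriv[OF ph] in "auto intro: has_vector_derivative_at_within")
    moreover have "?f t - ?f 0 - (t - 0) *. ?f' 0 = ip ph (U t$$ps - ps - t *. ch')"
     by (simp add: ip_simps U_zero scaleR_conv_of_real)
    ultimately show "cmod (ip ph (U t$$ps - ps - t *. ch')) <= abs t * (ep / 2) * norm ph" by (simp add: mult_ac)
   qed (use ep in simp)
   moreover have "(U t$$ps - ps) /\<^sub>R t - ch' = (U t$$ps - ps - t *. ch') /\<^sub>R t"
    using t by (simp add: scaleR_diff_right)
   hence "norm ((U t$$ps - ps) /\<^sub>R t - ch') = norm (U t$$ps - ps - t *. ch') / abs t"
    by (simp add: divide_inverse_commute)
   ultimately have "norm ((U t$$ps - ps) /\<^sub>R t - ch') <= ep / 2"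
    using t by (simp add: divide_le_eq mult.commute)
   thus ?thesis using ep by (simp add: dist_norm)
  qed
  thus "\<forall>\<^sub>F t in at 0. dist ((U t$$ps - ps) /\<^sub>R t) ch' < ep"
   unfolding eventually_at using d(1) by (intro exI[of _ d]) (auto simp: dist_norm)
 qed
 thus "p:generator U" by (simp add: generator_def p)
qed

text \<open>The deficiency spaces vanish: an orthogonal vector grows exponentially along the unitary group.\<close>

lemma deficiency:
 assumes "!!ph. ph:D ==> ip (A ph) et = of_real c * ip ph et" and c: "c ~= 0"
 shows "et = 0"
proof (rule eq_zero_dense)
 fix ph assume ph: "ph:D"
 have pow: "ip ((A ^^ n) ph) et = of_real (c ^ n) * ip ph et" for n
  by (induction n) (simp_all add: assms(1)[OF stable_pow[OF ph]])
 have "ip (U t$$ph) et = of_real (exp (t * c)) * ip ph et" for t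
 proof -
  have "(%n. ip ((t ^ n / fact n) *. (A ^^ n) ph) et) sums ip (U t$$ph) et"
   using bounded_linear.sums[OF cinner.bounded_linear_left S_sums[OF ph]] U_eq_S[OF ph] by simp
  moreover have "ip ((t ^ n / fact n) *. (A ^^ n) ph) et = of_real ((t * c) ^ n /\<^sub>R fact n) * ip ph et" for n
   by (simp add: ip_scaleR_left pow power_mult_distrib divide_inverse)
  moreover have "(%n. of_real ((t * c) ^ n /\<^sub>R fact n) * ip ph et) sums (of_real (exp (t * c)) * ip ph et)"
   by (intro sums_mult2 sums_of_real exp_converges)
  ultimately show ?thesis using sums_unique2 by simp
 qed
 hence le: "exp (t * c) * cmod (ip ph et) <= norm ph * norm et" for t
  using norm_ip[of "U t$$ph" et] by (simp add: norm_mult norm_U)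
 show "ip ph et = 0"
 proof (rule ccontr)
  define z where "z = cmod (ip ph et)"
  assume "ip ph et ~= 0"
  hence z: "0 < z" by (simp add: z_def)
  define K where "K = (norm ph * norm et + 1) / z"
  have K: "0 < K" using z by (auto simp: K_def intro!: divide_pos_pos add_nonneg_pos)
  have "K * z <= norm ph * norm et" using le[of "ln K / c"] c K by (simp add: z_def)
  thus False using z by (simp add: K_def)
 qed
qed

lemma closed_weak: "closed weak_graph"
proof -
 have "weak_graph = (\<Inter>ph\<in>D. {p. ip (A ph) (fst p) = - ip ph (snd p)})" by (auto simp: weak_graph_def)
 moreover have "closed {p. ip (A ph) (fst p) = - ip ph (snd p)}" for ph
  by (intro closed_Collect_eq continuous_intros bounded_linear.continuous_on[OF cinner.bounded_linear_right])
 ultimately show ?thesis by (simp add: closed_INT)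
qed

text \<open>Essential skew-adjointness. The component \<open>(d, e)\<close> of a weak graph element
  orthogonal to the closed graph satisfies two dual relations, by which \<open>d + e\<close> and
  \<open>d - e\<close> are deficiency vectors for \<open>- 1\<close> and \<open>1\<close>.\<close>

lemma weak_sub_closure: "weak_graph \<subseteq> closure ((%ph. (ph, A ph)) ` D)"
proof
 fix p assume p: "p:weak_graph"
 let ?G = "(%ph. (ph, A ph)) ` D"
 have A_add: "A (x + y) = A x + A y" if "x:D" "y:D" for x y using lin that unfolding lin_on_def by blast
 have A_scaleC: "A (c *: x) = c *: A x" if "x:D" for c x using lin that unfolding lin_on_def by blast
 have A0: "A 0 = 0" using A_scaleC[OF fin_vec_zero, of 0] by simp
 have G_weak: "?G \<subseteq> weak_graph" using graph_sub_generator generator_sub_weak by blast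
 have "subspace ?G" unfolding subspace_def
 proof (intro conjI ballI allI)
  show "0:?G" using fin_vec_zero A0 by (force simp: zero_prod_def image_iff)
 next
  fix x y assume "x:?G" "y:?G"
  thus "x + y:?G" using fin_vec_add A_add by (force simp: image_iff)
 next
  fix c x assume "x:?G"
  thus "c *. x:?G" using fin_vec_scaleR A_scaleC by (force simp: image_iff scaleR_l2_def)
 qed
 hence "subspace (closure ?G)" by (rule subspace_closure_sequential)
 then obtain m where m: "m:closure ?G" "!!y. y:closure ?G ==> inner (p - m) y = 0"
  by (rule projection_exists[OF _ closed_closure, of ?G p]) (rule that)
 obtain d e where de: "p - m = (d, e)" by (cases "p - m")
 have "m:weak_graph" using m(1) closure_minimal[OF G_weak closed_weak] by blast
 hence w: "ip (A ph) d = - ip ph e" if "ph:D" for ph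
  using p that de unfolding weak_graph_def by (cases p; cases m) (auto simp: ip_simps)
 have re: "Re (ip ph d + ip (A ph) e) = 0" if "ph:D" for ph
  using m(2)[OF subsetD[OF closure_subset], of "(ph, A ph)"] that de
  by (simp add: inner_prod_def inner_commute[of d] inner_commute[of e]) (simp add: inner_l2_def)
 have orth: "ip (A ph) e = - ip ph d" if "ph:D" for ph
 proof -
  \<comment> \<open>Orthogonality in the real inner product gives real parts; replacing
    \<open>ph\<close> by \<open>\<i> *: ph\<close> supplies the imaginary ones.\<close>
  have "Im (ip ph d + ip (A ph) e) = 0"
   using re[OF fin_scaleC[OF that, of \<i>]] A_scaleC[OF that, of \<i>] by (simp add: ip_scaleCl)
  thus ?thesis using re[OF that] by (simp add: complex_eq_iff)
 qed
 have "d + e = 0" by (rule deficiency[of _ "- 1"]) (simp_all add: ip_simps w orth)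
 moreover have "d - e = 0" by (rule deficiency[of _ 1]) (simp_all add: ip_simps w orth)
 ultimately have "d = 0" "e = 0" by (simp_all add: scaleR_2[symmetric])
 hence "p - m = 0" using de by (simp add: zero_prod_def)
 hence "p = m" by simp
 thus "p:closure ?G" using m(1) by simp
qed

text \<open>It suffices to place \<open>B\<close> between the graph of \<open>A\<close> on
  \<open>D\<close> and \<open>weak_graph\<close>, since these have the same closure; the domain of a
  sum or product of unbounded operators thus never has to be computed.\<close>

lemma uop_exp_eq:
 assumes B: "!!ps. ps:D ==> (ps, A ps):B" "B \<subseteq> weak_graph"
 shows "uop_exp B = U 1"
proof -
 let ?G = "(%ph. (ph, A ph)) ` D"
 have gen: "generator U = weak_graph" using generator_sub_weak weak_sub_generator by blast
 have clB: "closure B = weak_graph"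
  using closure_minimal[OF B(2) closed_weak] weak_sub_closure closure_mono[of ?G B] B(1) by blast
 \<comment> \<open>For two groups with this generator the pairing of \<open>U t$$h i\<close> with
   \<open>V t$$h j\<close> has zero derivative and keeps its value at \<open>0\<close>.\<close>
 have uniq: "V 1 = U 1" if V: "is_c0_group V" "generator V = weak_graph" for V
 proof (rule bop_eqI_onb[OF onb])
  fix j
  have "ip (U 1$$h i) (V 1$$h j) = ip (h i) (h j)" for i
  proof -
   have D: "h i:D" "h j:D" by (simp_all add: fin_vec_basis[OF onb])
   have gV: "(h j, A (h j)):generator V" using graph_sub_generator[OF D(2)] gen V(2) by simp
   have "EX c. ALL t:UNIV. ip (U t$$h i) (V t$$h j) = c"
   proof (rule has_vector_derivative_zero_constant)
    fix t
    from cinner.has_vector_derivative[OF c0_group_derivative(1)[OF U_c0 graph_sub_generator[OF D(1)]] c0_group_derivative(1)[OF V(1) gV], of t]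
    show "((%t. ip (U t$$h i) (V t$$h j)) has_vector_derivative 0) (at t within UNIV)"
     using weak_graph_U[OF c0_group_derivative(2)[OF V(1) gV, unfolded V(2)] D(1)] by simp
   qed (simp, blast)
   thus ?thesis using V(1) unfolding is_c0_group_def by (metis U_zero UNIV_I bop_one_apply)
  qed
  hence "ip (h i) ((bop_adj (U 1) * V 1)$$h j) = ip (h i) (h j)" for i
   by (simp add: bop_simps ip_adjr)
  hence "(bop_adj (U 1) * V 1)$$h j = h j" by (rule onb_on_eqI[OF onb])
  hence "U (- 1)$$V 1$$h j = h j" by (simp add: bop_simps U_adj)
  hence "U 1$$U (- 1)$$V 1$$h j = U 1$$h j" by simp
  thus "V 1$$h j = U 1$$h j"
   unfolding bop_times[symmetric] mult.assoc[symmetric] U_add[symmetric] by (simp add: U_zero)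
 qed
 show ?thesis unfolding uop_exp_def clB
 proof (rule the_equality)
  show "EX V. is_c0_group V & generator V = weak_graph & U 1 = V 1" using U_c0 gen by blast
 qed (elim exE conjE, simp add: uniq)
qed

end

section \<open>Passing unbounded operators through the unitary group\<close>

context skew_series
begin

text \<open>For a scalar commutator, commuting \<open>d\<close> with the \<open>n\<close>-th power
  of \<open>A\<close> leaves \<open>ka * n\<close> times the power \<open>n - 1\<close>, which
  shifts the exponential series. \<open>d\<close> appears through its formal adjoint
  \<open>d'\<close> because \<open>U t$$ps\<close> may lie outside \<open>D\<close>.\<close>

lemma intertwine_scalar:
 assumes d: "!!ps. ps:D ==> d ps:D" "!!ps. ps:D ==> d (A ps) = A (d ps) + ka *: ps"
  and adj: "!!ph ps. ph:D ==> ps:D ==> ip ph (d ps) = ip (d' ph) ps" and D: "ph:D" "ps:D"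
 shows "ip (d' ph) (U t$$ps) = ip ph (U t$$d ps) + ka * of_real t * ip ph (U t$$ps)"
proof -
 have A_add: "A (x + y) = A x + A y" "A (c *: x) = c *: A x" if "x:D" "y:D" for x y c using lin that unfolding lin_on_def by blast+
 have pow: "d ((A ^^ n) ps) = (A ^^ n) (d ps) + (ka * of_nat n) *: (A ^^ (n - 1)) ps" for n
 proof (induction n)
  case (Suc n)
  have "d ((A ^^ Suc n) ps) = A ((A ^^ n) (d ps) + (ka * of_nat n) *: (A ^^ (n - 1)) ps) + ka *: (A ^^ n) ps"
   using d(2)[OF stable_pow[OF D(2)], of n] Suc by simp
  also have "... = (A ^^ Suc n) (d ps) + ((ka * of_nat n) *: (A ^^ n) ps + ka *: (A ^^ n) ps)"
   using D d(1) by (cases n) (simp_all add: A_add stable_pow fin_scaleC stable)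
  finally show ?case by (simp add: scaleC_add_l2[symmetric] algebra_simps)
 qed simp
 have "(%n. of_real (t ^ n / fact n) * ip (d' ph) ((A ^^ n) ps)) sums ip (d' ph) (U t$$ps)"
  using S_ip_sums[OF D(2)] by (simp only: U_eq_S[OF D(2)])
 moreover have "of_real (t ^ n / fact n) * ip (d' ph) ((A ^^ n) ps) = of_real (t ^ n / fact n) * ip ph ((A ^^ n) (d ps))
   + ka * (of_real (t ^ n / fact n) * of_nat n * ip ph ((A ^^ (n - 1)) ps))" for n
  unfolding adj[OF D(1) stable_pow[OF D(2)], symmetric] pow by (simp add: ip_simps algebra_simps)
 moreover have "(%n. of_real (t ^ n / fact n) * ip ph ((A ^^ n) (d ps))
   + ka * (of_real (t ^ n / fact n) * of_nat n * ip ph ((A ^^ (n - 1)) ps))) sums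
   (ip ph (U t$$d ps) + ka * (of_real t * ip ph (U t$$ps)))"
 proof (intro sums_add sums_mult)
  show "(%n. of_real (t ^ n / fact n) * ip ph ((A ^^ n) (d ps))) sums ip ph (U t$$d ps)"
   using S_ip_sums[OF d(1)[OF D(2)]] by (simp only: U_eq_S[OF d(1)[OF D(2)]])
  have "(%n. of_real t * (of_real (t ^ n / fact n) * ip ph ((A ^^ n) ps))) sums (of_real t * ip ph (U t$$ps))"
   using S_ip_sums[OF D(2)] by (intro sums_mult) (simp only: U_eq_S[OF D(2)])
  moreover have "cor (t ^ Suc n / fact (Suc n)) * of_nat (Suc n) = of_real t * of_real (t ^ n / fact n)" for n
   by (simp del: of_nat_Suc add: field_simps)
  ultimately have "(%n. of_real (t ^ Suc n / fact (Suc n)) * of_nat (Suc n) * ip ph ((A ^^ n) ps)) sums (of_real t * ip ph (U t$$ps))"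
   by (simp only: mult.assoc)
  hence "(%n. of_real (t ^ Suc n / fact (Suc n)) * of_nat (Suc n) * ip ph ((A ^^ (Suc n - 1)) ps)) sums (of_real t * ip ph (U t$$ps))"
   by (simp only: diff_Suc_1)
  from sums_Suc[OF this]
  show "(%n. of_real (t ^ n / fact n) * of_nat n * ip ph ((A ^^ (n - 1)) ps)) sums (of_real t * ip ph (U t$$ps))" by simp
 qed
 ultimately show ?thesis using sums_unique2 by (simp add: mult.assoc)
qed

text \<open>If the commutator is a multiple of \<open>d\<close> itself, moving \<open>d\<close> past
  the powers of \<open>A\<close> is a binomial expansion, and the result is the Cauchy product of
  two exponential series.\<close>

lemma intertwine_eigen:
 assumes d: "!!ps. ps:D ==> d ps:D" "!!ps. ps:D ==> d (A ps) = A (d ps) + ka *: d ps"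
  and adj: "!!ph ps. ph:D ==> ps:D ==> ip ph (d ps) = ip (d' ph) ps" and D: "ph:D" "ps:D"
 shows "ip (d' ph) (U t$$ps) = exp (of_real t * ka) * ip ph (U t$$d ps)"
proof -
 have A_add: "A (x + y) = A x + A y" "A (c *: x) = c *: A x" if "x:D" "y:D" for x y c using lin that unfolding lin_on_def by blast+
 define a where "a = (%n. (of_real t * ka) ^ n /\<^sub>R fact n)"
 define b where "b = (%n. cor (t ^ n / fact n) * ip ph ((A ^^ n) (d ps)))"
 define g where "g = (%n. \<Sum>i\<le>n. (of_nat (n choose i) * ka ^ i) *: (A ^^ (n - i)) (d ps))"
 have gD: "g n:D" for n unfolding g_def using D d(1) by (intro fin_vec_sum fin_scaleC stable_pow)
 have A_sum: "A (\<Sum>i\<in>I. c i *: (A ^^ k i) (d ps)) = (\<Sum>i\<in>I. c i *: (A ^^ Suc (k i)) (d ps))" if "finite I" for I :: "nat set" and c k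
  using that
 proof (induction I rule: finite_induct)
  case empty
  show ?case using A_add(2)[OF fin_vec_zero fin_vec_zero, of 0] by simp
 next
  case (insert x F)
  thus ?case using D d(1) by (simp add: A_add stable_pow fin_scaleC fin_vec_sum)
 qed
 have pow: "d ((A ^^ n) ps) = g n" for n
 proof (induction n)
  case 0 show ?case by (simp add: g_def)
 next
  case (Suc n)
  let ?v = "%k. (A ^^ k) (d ps)"
  have "d ((A ^^ Suc n) ps) = A (g n) + ka *: g n"
   using d(2)[OF stable_pow[OF D(2)], of n] Suc by simp
  also have "A (g n) = (\<Sum>i\<le>n. (of_nat (n choose i) * ka ^ i) *: ?v (Suc n - i))"
   unfolding g_def by (subst A_sum) (simp_all add: Suc_diff_le)
  also have "... = ?v (Suc n) + (\<Sum>i\<le>n. (of_nat (n choose Suc i) * ka ^ Suc i) *: ?v (n - i))"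
  proof -
   have "(\<Sum>i\<le>n. (of_nat (n choose i) * ka ^ i) *: ?v (Suc n - i)) = (\<Sum>i\<le>Suc n. (of_nat (n choose i) * ka ^ i) *: ?v (Suc n - i))" by (simp add: binomial_eq_0)
   thus ?thesis by (simp add: sum.atMost_Suc_shift binomial_eq_0 del: sum.atMost_Suc funpow.simps power_Suc)
  qed
  also have "ka *: g n = (\<Sum>i\<le>n. (of_nat (n choose i) * ka ^ Suc i) *: ?v (n - i))"
   unfolding g_def scaleC_l2.sum_right by (simp add: scaleC_l2_simps mult.left_commute)
  finally have "d ((A ^^ Suc n) ps) = ?v (Suc n) + (\<Sum>i\<le>n. (of_nat (Suc n choose Suc i) * ka ^ Suc i) *: ?v (n - i))"
   by (simp add: sum.distrib[symmetric] scaleC_add_l2[symmetric] distrib_right add_ac del: funpow.simps power_Suc)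
  thus ?case unfolding g_def by (simp add: sum.atMost_Suc_shift del: sum.atMost_Suc funpow.simps power_Suc binomial_Suc_Suc)
 qed
 have "(\<Sum>i\<le>n. a i * b (n - i)) = of_real (t ^ n / fact n) * ip (d' ph) ((A ^^ n) ps)" for n
 proof -
  have "a i * b (n - i) = of_real (t ^ n / fact n) * (of_nat (n choose i) * ka ^ i * ip ph ((A ^^ (n - i)) (d ps)))" if "i <= n" for i
  proof -
   have "cor t ^ n = of_real t ^ i * of_real t ^ (n - i)" using that by (simp add: power_add[symmetric])
   thus ?thesis using that
    by (simp add: a_def b_def binomial_fact power_mult_distrib scaleR_conv_of_real divide_inverse mult_ac)
  qed
  hence "(\<Sum>i\<le>n. a i * b (n - i)) = of_real (t ^ n / fact n) * (\<Sum>i\<le>n. of_nat (n choose i) * ka ^ i * ip ph ((A ^^ (n - i)) (d ps)))"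
   unfolding sum_distrib_left by (intro sum.cong) auto
  thus ?thesis
   unfolding adj[OF D(1) stable_pow[OF D(2)], symmetric] pow by (simp add: g_def ip_sum_right cinner_scaleC_right)
 qed
 moreover have "(%n. \<Sum>i\<le>n. a i * b (n - i)) sums ((\<Sum>n. a n) * (\<Sum>n. b n))"
 proof (rule Cauchy_product_sums)
  show "summable (%k. norm (a k))" unfolding a_def by (rule summable_norm_exp)
  show "summable (%k. norm (b k))" unfolding b_def
   using analytic_ip[OF d(1)[OF D(2)], of t ph] by (simp add: norm_mult norm_divide norm_power)
 qed
 moreover have "(\<Sum>n. a n) = exp (of_real t * ka)" unfolding a_def exp_def ..
 moreover have "(\<Sum>n. b n) = ip ph (U t$$d ps)"
  unfolding b_def U_eq_S[OF d(1)[OF D(2)]] by (rule sums_unique[symmetric, OF S_ip_sums[OF d(1)[OF D(2)]]])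
 ultimately have "(%n. of_real (t ^ n / fact n) * ip (d' ph) ((A ^^ n) ps)) sums (exp (of_real t * ka) * ip ph (U t$$d ps))" by simp
 moreover have "(%n. of_real (t ^ n / fact n) * ip (d' ph) ((A ^^ n) ps)) sums ip (d' ph) (U t$$ps)"
  using S_ip_sums[OF D(2)] by (simp only: U_eq_S[OF D(2)])
 ultimately show ?thesis using sums_unique2 by blast
qed

end

section \<open>Weyl operators\<close>

abbreviation "fin_hb \<equiv> fin_vec hb"

text \<open>The ladder operators are restricted to finite combinations of Hermite functions, which
  they preserve, so that products and commutators need no domain conditions.\<close>

definition lower :: "real l2 => real l2" where "lower = ext hb (%n. rt n *: hb (n - 1))"
definition raise :: "real l2 => real l2" where "raise = ext hb (%n. rt (Suc n) *: hb (Suc n))"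

lemma lower_hb: "lower (hb n) = rt n *: hb (n - 1)"
 and raise_hb: "raise (hb n) = rt (Suc n) *: hb (Suc n)"
 unfolding lower_def raise_def by (rule ext_basis[OF hb_onb])+

lemma lower_raise_lin: "lin_on fin_hb lower" "lin_on fin_hb raise"
 unfolding lower_def raise_def by (rule lin_on_ext)+

lemma lower_raise_fin: "lower ps:fin_hb" "raise ps:fin_hb"
 unfolding lower_def raise_def by (intro ext_fin_vec fin_scaleC fin_vec_basis[OF hb_onb])+

lemma lower_raise_simps:
 assumes "x:fin_hb" "y:fin_hb"
 shows "lower (x + y) = lower x + lower y" "lower (c *: x) = c *: lower x"
  "raise (x + y) = raise x + raise y" "raise (c *: x) = c *: raise x"
 using assms lower_raise_lin unfolding lin_on_def by blast+

lemma lower_raise_adj: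
 assumes "ph:fin_hb" "ps:fin_hb"
 shows "ip ph (lower ps) = ip (raise ph) ps" (is ?A) "ip ph (raise ps) = ip (lower ph) ps" (is ?B)
proof -
 show ?A
 proof (rule lin_on_form_eq[OF hb_onb lower_raise_lin _ assms])
  show "ip (hb i) (lower (hb j)) = ip (raise (hb i)) (hb j)" for i j
   by (cases j) (auto simp: lower_hb raise_hb ip_simps ip_hb)
 qed
 show ?B
 proof (rule lin_on_form_eq[OF hb_onb lower_raise_lin(2,1) _ assms])
  show "ip (hb i) (raise (hb j)) = ip (lower (hb i)) (hb j)" for i j
   by (cases i) (auto simp: lower_hb raise_hb ip_simps ip_hb)
 qed
qed

lemma ccr:
 assumes "ps:fin_hb" shows "lower (raise ps) = raise (lower ps) + ps"
proof (rule lin_on_eqI[OF hb_onb _ _ _ assms])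
 show "lin_on fin_hb (%ps. lower (raise ps))" "lin_on fin_hb (%ps. raise (lower ps) + ps)"
  by (simp_all add: lin_on_def lower_raise_simps lower_raise_fin scaleC_l2_simps add_ac)
 fix n
 have "lower (raise (hb n)) = of_nat (Suc n) *: hb n"
  unfolding raise_hb lower_raise_simps(2)[OF fin_vec_basis[OF hb_onb] fin_vec_zero] lower_hb
  by (simp add: scaleC_l2_simps del: of_nat_Suc flip: of_real_mult)
 moreover have "raise (lower (hb n)) = of_nat n *: hb n"
  unfolding lower_hb lower_raise_simps(4)[OF fin_vec_basis[OF hb_onb] fin_vec_zero] raise_hb
  by (cases n) (simp_all add: scaleC_l2_simps del: of_nat_Suc flip: of_real_mult)
 ultimately show "lower (raise (hb n)) = raise (lower (hb n)) + hb n"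
  using scaleC_add_l2[of "of_nat n" 1 "hb n"] by (simp add: add.commute)
qed

lemma lower_ann:
 assumes "ps:fin_hb" shows "(ps, lower ps):ann"
 using hb_onb assms
proof (induction rule: fin_vec_induct)
 case (basis i) thus ?case using ann_hb[of i] by (simp add: lower_hb)
next
 case (add x y) thus ?case using clinD(2)[OF ann_lin] by (simp add: lower_raise_simps)
next
 case (scale c x) thus ?case using clinD(3)[OF ann_lin] by (simp add: lower_raise_simps)
qed

lemma raise_cre:
 assumes "ps:fin_hb" shows "(ps, raise ps):cre"
 using hb_onb assms
proof (induction rule: fin_vec_induct)
 case (basis i) thus ?case by (simp add: raise_hb cre_hb del: of_nat_Suc)
next
 case (add x y) thus ?case using clinD(2)[OF uop_adj_clinear] by (simp add: lower_raise_simps)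
next
 case (scale c x) thus ?case using clinD(3)[OF uop_adj_clinear] by (simp add: lower_raise_simps)
qed

definition weyl_gen :: "complex => real l2 => real l2" where
 "weyl_gen z ps = \<i> *: (z *: lower ps + cnj z *: raise ps)"

lemma weyl_gen_lin: "lin_on fin_hb (weyl_gen z)"
 unfolding lin_on_def weyl_gen_def
 by (simp add: lower_raise_simps scaleC_l2_simps algebra_simps)

lemma weyl_gen_fin: "weyl_gen z ps:fin_hb"
 unfolding weyl_gen_def by (intro fin_scaleC fin_vec_add lower_raise_fin)

lemma weyl_gen_pow_lin: "lin_on fin_hb (weyl_gen z ^^ n)"
proof (induction n)
 case (Suc n)
 have "(weyl_gen z ^^ n) ps:fin_hb" if "ps:fin_hb" for ps using that by (induction n) (auto simp: weyl_gen_fin)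
 thus ?case using Suc weyl_gen_lin[of z] unfolding lin_on_def by simp
qed (simp add: lin_on_def)

text \<open>One application yields two terms, raises the level by at most one and costs the square
  root of the level. The product of these roots grows only like the square root of a factorial,
  which \<open>fact n\<close> in the exponential series outweighs.\<close>

lemma weyl_gen_bound: "norm ((weyl_gen z ^^ n) (hb k)) <= (2 * cmod z) ^ n * (\<Prod>j<n. rt (k + j + 1))"
proof (induction n arbitrary: k)
 case 0
 show ?case using norm_ortho[OF onb_ortho[OF hb_onb], of k] by simp
next
 case (Suc n)
 let ?T = "weyl_gen z ^^ n" and ?B = "%k. (2 * cmod z) ^ n * (\<Prod>j<n. rt (k + j + 1))"
 have lin: "?T (x + y) = ?T x + ?T y" "?T (c *: x) = c *: ?T x" if "x:fin_hb" "y:fin_hb" for x y c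
  using weyl_gen_pow_lin[where z=z and n=n] that unfolding lin_on_def by blast+
 note b = fin_vec_basis[OF hb_onb]
 have "(weyl_gen z ^^ Suc n) (hb k) = ?T (weyl_gen z (hb k))" by (simp add: funpow_swap1)
 also have "weyl_gen z (hb k) = (\<i> * z * rt k) *: hb (k - 1) + (\<i> * cnj z * rt (Suc k)) *: hb (Suc k)"
  by (simp add: weyl_gen_def lower_hb raise_hb scaleC_l2_simps mult.assoc del: of_nat_Suc)
 also have "?T ... = (\<i> * z * rt k) *: ?T (hb (k - 1)) + (\<i> * cnj z * rt (Suc k)) *: ?T (hb (Suc k))"
  using lin[OF fin_scaleC[OF b] fin_scaleC[OF b]] lin(2)[OF b b] by simp
 also have "norm ... <= cmod z * rt k * ?B (k - 1) + cmod z * rt (Suc k) * ?B (Suc k)"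
  by (rule order_trans[OF norm_triangle_ineq], rule add_mono)
   (auto simp: norm_scaleC_l2 norm_mult simp del: of_nat_Suc intro!: mult_left_mono Suc.IH[of "k - 1", simplified] Suc.IH[of "Suc k", simplified] Suc.IH)
 also have "... <= cmod z * rt (Suc k) * ?B (Suc k) + cmod z * rt (Suc k) * ?B (Suc k)"
  by (intro add_mono mult_mono mult_left_mono prod_mono order_refl mult_nonneg_nonneg prod_nonneg conjI) auto
 also have "... = (2 * cmod z) ^ Suc n * (rt (Suc k) * (\<Prod>j<n. rt (Suc k + j + 1)))" by simp
 also have "rt (Suc k) * (\<Prod>j<n. rt (Suc k + j + 1)) = (\<Prod>j<Suc n. rt (k + j + 1))"
  by (subst prod.lessThan_Suc_shift) simp
 finally show ?case .
qed

lemma weyl_series: "skew_series hb (weyl_gen z)"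
proof
 show "onb_on hb UNIV" by (rule hb_onb)
 show "lin_on fin_hb (weyl_gen z)" by (rule weyl_gen_lin)
 show "weyl_gen z ps:fin_hb" for ps by (rule weyl_gen_fin)
 show "ip ph (weyl_gen z ps) = - ip (weyl_gen z ph) ps" if "ph:fin_hb" "ps:fin_hb" for ph ps
  using lower_raise_adj[OF that] by (simp add: weyl_gen_def ip_simps algebra_simps)
 fix r :: real and k
 define B where "B = (%n. abs r ^ n / fact n * ((2 * cmod z) ^ n * (\<Prod>j<n. rt (k + j + 1))))"
 have B0: "0 <= B n" for n by (simp add: B_def prod_nonneg)
 define c where "c = 2 * abs r * cmod z"
 \<comment> \<open>Beyond \<open>N\<close> the index \<open>k\<close> is dominated by
   \<open>n\<close> and \<open>4 * c\<close> by the square root of \<open>n + 1\<close>, which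
   brings the ratio of consecutive bounds below \<open>1/2\<close>.\<close>
 obtain N where N: "real N > (4 * c)^2" "N >= k" using reals_Archimedean2[of "max ((4 * c)^2) (real k)"] by (auto intro: less_imp_le)
 have "summable B"
 proof (rule summable_ratio_test[of "1/2" N])
  fix n assume n: "N <= n"
  have "c * rt (k + n + 1) / real (Suc n) <= 1/2"
  proof -
   have "4 * c <= rt (Suc n)" using N n by (intro real_le_rsqrt) simp
   moreover have "rt (k + n + 1) <= 2 * rt (Suc n)"
    using N n by (intro real_le_lsqrt) (auto simp: power_mult_distrib)
   ultimately have "4 * c * rt (k + n + 1) <= rt (Suc n) * (2 * rt (Suc n))"
    by (intro mult_mono) auto
   hence "4 * (c * rt (k + n + 1)) <= 2 * real (Suc n)" by simp
   thus ?thesis by (simp add: field_simps)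
  qed
  hence "(c * rt (k + n + 1) / real (Suc n)) * B n <= 1/2 * B n" using B0 by (intro mult_right_mono)
  moreover have "B (Suc n) = (c * rt (k + n + 1) / real (Suc n)) * B n"
   by (simp add: B_def c_def field_simps)
  ultimately have "B (Suc n) <= 1/2 * B n" by simp
  thus "norm (B (Suc n)) <= 1/2 * norm (B n)" using B0[of n] B0[of "Suc n"] by (simp only: real_norm_def abs_of_nonneg)
 qed simp
 thus "summable (%n. r ^ n / fact n * norm ((weyl_gen z ^^ n) (hb k)))"
 proof (rule summable_comparison_test'[where N=0])
  fix n
  show "norm (r ^ n / fact n * norm ((weyl_gen z ^^ n) (hb k))) <= B n"
   unfolding B_def using weyl_gen_bound[where z=z and n=n and k=k] by (simp add: abs_mult power_abs mult_left_mono divide_right_mono)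
 qed
qed

lemma weyl_eq: "weyl z = skew_series.U hb (weyl_gen z) 1"
 unfolding weyl_def
proof (rule skew_series.uop_exp_eq[OF weyl_series])
 fix ps assume ps: "ps:fin_hb"
 show "(ps, weyl_gen z ps):uop_scale \<i> (uop_add (uop_scale z ann) (uop_scale (cnj z) cre))"
  unfolding uop_scale_def uop_add_def weyl_gen_def using lower_ann[OF ps] raise_cre[OF ps] by blast
next
 show "uop_scale \<i> (uop_add (uop_scale z ann) (uop_scale (cnj z) cre)) \<subseteq> skew_series.weak_graph hb (weyl_gen z)"
  unfolding skew_series.weak_graph_def[OF weyl_series]
 proof (clarsimp simp: uop_scale_def uop_add_def)
  fix ps al ga ph assume a: "(ps, al):ann" and c: "(ps, ga):cre" and ph: "ph:fin_hb"
  have "ip ps (lower ph) = ip ga ph" using c lower_ann[OF ph] unfolding uop_adj_def by blast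
  hence 1: "ip (lower ph) ps = ip ph ga" by (metis cinner_commute)
  have "ip ph al = ip (raise ph) ps" using a raise_cre[OF ph] unfolding uop_adj_def by blast
  with 1 show "ip (weyl_gen z ph) ps = - ip ph (\<i> *: (z *: al + cnj z *: ga))"
   by (simp add: weyl_gen_def ip_simps algebra_simps)
 qed
qed

lemma norm_weyl: "norm (weyl z$$ps) = norm ps"
 unfolding weyl_eq by (rule skew_series.norm_U[OF weyl_series])

text \<open>Weyl operators displace the annihilation operator by \<open>\<i> * cnj z\<close>: by
  \<open>ccr\<close> its commutator with the Weyl generator is this scalar.\<close>

lemma weyl_lower:
 assumes "ph:fin_hb" "ps:fin_hb"
 shows "ip (raise ph) (weyl z$$ps) = ip ph (weyl z$$lower ps) + \<i> * cnj z * ip ph (weyl z$$ps)"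
 unfolding weyl_eq
 using skew_series.intertwine_scalar[OF weyl_series[of z], where d=lower and d'=raise and ka="\<i> * cnj z" and ph=ph and ps=ps and t=1] assms
 by (simp add: lower_raise_fin lower_raise_adj weyl_gen_def lower_raise_simps ccr fin_scaleC fin_vec_add scaleC_l2_simps add_ac)

lemma weyl_raise:
 assumes "ph:fin_hb" "ps:fin_hb"
 shows "ip (lower ph) (weyl z$$ps) = ip ph (weyl z$$raise ps) - \<i> * z * ip ph (weyl z$$ps)"
 unfolding weyl_eq
 using skew_series.intertwine_scalar[OF weyl_series[of z], where d=raise and d'=lower and ka="- (\<i> * z)" and ph=ph and ps=ps and t=1] assms
 by (simp add: lower_raise_fin lower_raise_adj weyl_gen_def lower_raise_simps ccr fin_scaleC fin_vec_add scaleC_l2_simps scaleC_minus_left_l2 add_ac)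

text \<open>Comparison with weighted indicators of the discs of radius \<open>n + 1\<close>: an area
  of order \<open>n^2\<close> against a weight of order \<open>n^-4\<close>.\<close>

lemma integrable_radial_decay: "integrable lborel (%z::complex. inverse ((1 + cmod z) ^ 4))"
proof (rule integrableI_nonneg)
 let ?t = "%n (z::complex). ennreal (inverse (real (Suc n) ^ 4)) * indicator (cball 0 (real (Suc n))) z"
 have le: "ennreal (inverse ((1 + cmod z) ^ 4)) <= (\<Sum>n. ?t n z)" for z
 proof -
  define n where "n = nat \<lfloor>cmod z\<rfloor>"
  have n: "real n <= cmod z" "cmod z <= real (Suc n)" by (simp_all add: n_def) linarith
  have "ennreal (inverse ((1 + cmod z) ^ 4)) <= ?t n z"
   using n by (auto intro!: ennreal_leI le_imp_inverse_le power_mono simp: indicator_def)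
  also have "?t n z <= (\<Sum>k. ?t k z)"
  proof -
   have "t n <= (\<Sum>k. t k)" for t :: "nat => ennreal" using sum_le_suminf[of t "{n}"] by simp
   thus ?thesis .
  qed
  finally show ?thesis .
 qed
 have s: "summable (%n. unit_ball_vol 2 * inverse (real (Suc n) ^ 2))"
  using summable_Suc_iff[of "%n. inverse (real n ^ 2)"] inverse_power_summable[of 2, where ?'a=real] by (intro summable_mult) simp
 have "(\<integral>\<^sup>+z. ennreal (inverse ((1 + cmod z) ^ 4)) \<partial>lborel) <= (\<integral>\<^sup>+z. (\<Sum>n. ?t n z) \<partial>lborel)"
  by (intro nn_integral_mono le)
 also have "... = (\<Sum>n. \<integral>\<^sup>+z. ?t n z \<partial>lborel)" 
  by (rule nn_integral_suminf) (intro borel_measurable_times_ennreal borel_measurable_const borel_measurable_indicator, simp)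
 also have "... = (\<Sum>n. ennreal (unit_ball_vol 2 * inverse (real (Suc n) ^ 2)))"
 proof (rule suminf_cong)
  fix n
  have "(\<integral>\<^sup>+z. ?t n z \<partial>lborel) = ennreal (inverse (real (Suc n) ^ 4)) * emeasure lborel (cball (0::complex) (real (Suc n)))"
   by (simp add: nn_integral_cmult_indicator)
  also have "... = ennreal (inverse (real (Suc n) ^ 4) * (unit_ball_vol 2 * real (Suc n) ^ 2))"
   by (subst emeasure_cball) (simp_all add: ennreal_mult' del: of_nat_Suc)
  also have "inverse (real (Suc n) ^ 4) * (unit_ball_vol 2 * real (Suc n) ^ 2) = unit_ball_vol 2 * inverse (real (Suc n) ^ 2)"
   by (simp add: field_simps power2_eq_square power4_eq_xxxx del: of_nat_Suc)
  finally show "(\<integral>\<^sup>+z. ?t n z \<partial>lborel) = ennreal (unit_ball_vol 2 * inverse (real (Suc n) ^ 2))" .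
 qed
 also have "... = ennreal (\<Sum>n. unit_ball_vol 2 * inverse (real (Suc n) ^ 2))"
  by (rule suminf_ennreal_eq[OF _ summable_sums[OF s]]) (simp del: of_nat_Suc)
 also have "... < \<infinity>" by (simp only: ennreal_less_top infinity_ennreal_def)
 finally show "(\<integral>\<^sup>+z. ennreal (inverse ((1 + cmod z) ^ 4)) \<partial>lborel) < \<infinity>" .
qed simp_all

text \<open>Decay of order five is used: four for integrability over the plane, one for the factor
  \<open>cmod z\<close> that a commutator produces.\<close>

lemma schwartz_fun_decay:
 assumes "schwartz_fun f" obtains C where "0 <= C" "!!z. cmod (f z) * cmod z <= C * inverse ((1 + cmod z) ^ 4)"
proof -
 obtain D where D: "D 0 0 = f" "!!i j k. bounded (range (%z. (1 + cmod z) ^ k *. D i j z))"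
  using assms unfolding schwartz_fun_def by (elim exE conjE) (rule that, auto)
 from D(2)[of 5 0 0] obtain C where C: "!!z. norm ((1 + cmod z) ^ 5 *. f z) <= C" unfolding D(1) bounded_iff by auto
 have "cmod (f z) * cmod z <= C * inverse ((1 + cmod z) ^ 4)" for z
 proof -
  have p: "0 < (1 + cmod z) ^ 4" by (intro zero_less_power add_pos_nonneg) auto
  have "cmod (f z) * cmod z * (1 + cmod z) ^ 4 <= cmod (f z) * (1 + cmod z) * (1 + cmod z) ^ 4"
   by (intro mult_right_mono mult_left_mono) auto
  also have "... = norm ((1 + cmod z) ^ 5 *. f z)" by (simp add: power_abs abs_of_nonneg power_Suc numeral_eq_Suc mult_ac)
  also have "... <= C" by (rule C)
  finally show ?thesis using p by (simp add: field_simps)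
 qed
 moreover have "0 <= C" using C[of 0] norm_ge_zero order_trans by blast
 ultimately show thesis using that by blast
qed

text \<open>Multiplying the symbol by a function bounded by \<open>cmod z\<close> again gives a
  bounded operator. The commutators of a Schwartz operator are of this kind, with multipliers
  \<open>\<i> * cnj z\<close> and \<open>- (\<i> * z)\<close>.\<close>

lemma weyl_moment:
 assumes f: "schwartz_fun f" and x: "!!ph ps. has_bochner_integral lborel (%z. f z * ip ph (weyl z$$ps)) (ip ph (x$$ps))"
  and c: "c:borel_measurable lborel" "!!z. cmod (c z) <= cmod z"
 obtains y where "!!ph ps. has_bochner_integral lborel (%z. c z * (f z * ip ph (weyl z$$ps))) (ip ph (y$$ps))"
proof -
 obtain C where C: "0 <= C" "!!z. cmod (f z) * cmod z <= C * inverse ((1 + cmod z) ^ 4)" by (rule schwartz_fun_decay[OF f]) (rule that)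
 define g where "g = (%ph ps z. c z * (f z * ip ph (weyl z$$ps)))"
 have bd: "norm (g ph ps z) <= C * inverse ((1 + cmod z) ^ 4) * (norm ph * norm ps)" for ph ps z
 proof -
  have "norm (g ph ps z) = cmod (c z) * cmod (f z) * cmod (ip ph (weyl z$$ps))" by (simp add: g_def norm_mult)
  also have "... <= (cmod z * cmod (f z)) * (norm ph * norm (weyl z$$ps))"
   by (intro mult_mono mult_right_mono c(2) norm_ip mult_nonneg_nonneg) auto
  also have "... <= (C * inverse ((1 + cmod z) ^ 4)) * (norm ph * norm (weyl z$$ps))"
   using C(2)[of z] by (intro mult_right_mono) (simp_all add: mult.commute)
  finally show ?thesis by (simp add: norm_weyl)
 qed
 have dom: "integrable lborel (%z. C * inverse ((1 + cmod z) ^ 4) * K)" for K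
  by (intro integrable_mult_left integrable_mult_right integrable_radial_decay)
 have int: "integrable lborel (g ph ps)" for ph ps
 proof (rule Bochner_Integration.integrable_bound[OF dom])
  show "g ph ps:borel_measurable lborel" unfolding g_def
   using x[of ph ps] by (intro borel_measurable_times[OF c(1)] borel_measurable_integrable) (simp add: has_bochner_integral_iff)
  show "AE z in lborel. norm (g ph ps z) <= norm (C * inverse ((1 + cmod z) ^ 4) * (norm ph * norm ps))"
   by (intro AE_I2 order_trans[OF bd]) simp
 qed
 define K where "K = (LINT z|lborel. C * inverse ((1 + cmod z) ^ 4))"
 have "cmod (LINT z|lborel. g ph ps z) <= K * norm ph * norm ps" for ph ps
 proof -
  have "cmod (LINT z|lborel. g ph ps z) <= (LINT z|lborel. norm (g ph ps z))" by (rule integral_norm_bound)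
  also have "... <= (LINT z|lborel. C * inverse ((1 + cmod z) ^ 4) * (norm ph * norm ps))"
   by (rule integral_mono[OF integrable_norm[OF int] dom]) (rule bd)
  finally show ?thesis by (simp add: K_def mult.assoc)
 qed
 moreover have "0 <= K" unfolding K_def using C(1) by (intro integral_nonneg_AE AE_I2) simp
 ultimately have "EX y. (ALL ph ps. ip ph (y$$ps) = (LINT z|lborel. g ph ps z)) & norm y <= K"
 proof (intro bop_of_form)
  fix ph ph' ps and w
  have "g (ph + ph') ps z = g ph ps z + g ph' ps z" "g ps (ph + ph') z = g ps ph z + g ps ph' z"
   "g (w *: ph) ps z = cnj w * g ph ps z" "g ph (w *: ps) z = w * g ph ps z" for z
   by (simp_all add: g_def ip_simps bop_simps algebra_simps)
  thus "(LINT z|lborel. g (ph + ph') ps z) = (LINT z|lborel. g ph ps z) + (LINT z|lborel. g ph' ps z)"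
   "(LINT z|lborel. g ps (ph + ph') z) = (LINT z|lborel. g ps ph z) + (LINT z|lborel. g ps ph' z)"
   "(LINT z|lborel. g (w *: ph) ps z) = cnj w * (LINT z|lborel. g ph ps z)"
   "(LINT z|lborel. g ph (w *: ps) z) = w * (LINT z|lborel. g ph ps z)"
   using int by simp_all
 qed
 then obtain y where "!!ph ps. ip ph (y$$ps) = (LINT z|lborel. g ph ps z)" by blast
 hence "has_bochner_integral lborel (g ph ps) (ip ph (y$$ps))" for ph ps
  using int by (simp add: has_bochner_integral_iff)
 thus thesis unfolding g_def by (rule that)
qed

lemma schwartz_bounded_comm:
 assumes "schwartz_op x" "A:{ann, cre}"
 shows "bounded_comm A x"
proof -
 obtain f where f: "schwartz_fun f"
  and x: "!!ph ps. has_bochner_integral lborel (%z. f z * ip ph (weyl z$$ps)) (ip ph (x$$ps))"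
  using assms(1) unfolding schwartz_op_def by blast
 note b = fin_vec_basis[OF hb_onb]
 have c: "(%z. \<i> * cnj z):borel_measurable lborel" "(%z. - (\<i> * z)):borel_measurable lborel"
  by (auto intro!: borel_measurable_continuous_onI continuous_intros)
 obtain y where y: "!!ph ps. has_bochner_integral lborel (%z. \<i> * cnj z * (f z * ip ph (weyl z$$ps))) (ip ph (y$$ps))"
  by (rule weyl_moment[OF f x c(1)]) (auto simp: norm_mult)
 obtain y' where y': "!!ph ps. has_bochner_integral lborel (%z. - (\<i> * z) * (f z * ip ph (weyl z$$ps))) (ip ph (y'$$ps))"
  by (rule weyl_moment[OF f x c(2)]) (auto simp: norm_mult)
 have "has_comm ann x y"
 proof (rule has_comm_annI, unfold ann_weak, intro allI)
  fix n m
  have "ip (raise (hb m)) (x$$hb n) = ip (hb m) (x$$lower (hb n)) + ip (hb m) (y$$hb n)"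
  proof (rule has_bochner_integral_eq[OF x])
   have "f z * ip (raise (hb m)) (weyl z$$hb n) = f z * ip (hb m) (weyl z$$lower (hb n)) + \<i> * cnj z * (f z * ip (hb m) (weyl z$$hb n))" for z
    by (simp add: weyl_lower[OF b b] algebra_simps)
   thus "has_bochner_integral lborel (%z. f z * ip (raise (hb m)) (weyl z$$hb n)) (ip (hb m) (x$$lower (hb n)) + ip (hb m) (y$$hb n))"
    using has_bochner_integral_add[OF x y] by simp
  qed
  thus "ip (hb m) (x$$(rt n *: hb (n - 1)) + y$$hb n) = rt (Suc m) * ip (hb (Suc m)) (x$$hb n)"
   by (simp add: lower_hb raise_hb ip_simps del: of_nat_Suc)
 qed
 moreover have "has_comm cre x y'"
 proof (rule has_comm_creI, unfold cre_weak, intro allI)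
  fix n m
  have "ip (lower (hb m)) (x$$hb n) = ip (hb m) (x$$raise (hb n)) + ip (hb m) (y'$$hb n)"
  proof (rule has_bochner_integral_eq[OF x])
   have "f z * ip (lower (hb m)) (weyl z$$hb n) = f z * ip (hb m) (weyl z$$raise (hb n)) + - (\<i> * z) * (f z * ip (hb m) (weyl z$$hb n))" for z
    by (simp add: weyl_raise[OF b b] algebra_simps)
   thus "has_bochner_integral lborel (%z. f z * ip (lower (hb m)) (weyl z$$hb n)) (ip (hb m) (x$$raise (hb n)) + ip (hb m) (y'$$hb n))"
    using has_bochner_integral_add[OF x y'] by simp
  qed
  thus "ip (hb m) (x$$(rt (Suc n) *: hb (Suc n)) + y'$$hb n) = rt m * ip (hb (m - 1)) (x$$hb n)"
   by (simp add: lower_hb raise_hb ip_simps del: of_nat_Suc)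
 qed
 ultimately show ?thesis using assms(2) unfolding bounded_comm_def by blast
qed

section \<open>Tensor products\<close>

lemma tensor_add_left: "(ph + ps) \<otimes> ch' = ph \<otimes> ch' + ps \<otimes> ch'"
 by transfer (auto simp: l2_eq_def square_integrable_tensor square_integrable_add case_prod_unfold distrib_right
   intro: square_integrable_tensor[unfolded case_prod_unfold] square_integrable_add)

lemma tensor_add_right: "ch' \<otimes> (ph + ps) = ch' \<otimes> ph + ch' \<otimes> ps"
 by transfer (auto simp: l2_eq_def square_integrable_tensor square_integrable_add case_prod_unfold distrib_left
   intro: square_integrable_tensor[unfolded case_prod_unfold] square_integrable_add)

lemma tensor_scaleCl: "(c *: ph) \<otimes> ps = c *: (ph \<otimes> ps)"
 by transfer (auto simp: l2_eq_def square_integrable_mult case_prod_unfold mult.assoc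
   intro: square_integrable_tensor[unfolded case_prod_unfold] square_integrable_mult)

lemma tensor_scaleCr: "ph \<otimes> (c *: ps) = c *: (ph \<otimes> ps)"
 by transfer (auto simp: l2_eq_def square_integrable_mult case_prod_unfold mult_ac
   intro: square_integrable_tensor[unfolded case_prod_unfold] square_integrable_mult)

lemma ip_tensor: "ip (ph \<otimes> ps) (ph' \<otimes> ps') = ip ph ph' * ip ps ps'"
proof (transfer, clarsimp simp: l2_eq_def)
 fix f f' :: "'a => complex" and g g' :: "'b => complex"
 assume si: "sqi f" "sqi g" "sqi f'" "sqi g'"
 let ?F = "%(x, y). cnj (f x * g y) * (f' x * g' y)"
 have int: "integrable (lborel \<Otimes>\<^sub>M lborel) ?F"
  using integrable_cnj_mult[OF square_integrable_tensor[OF si(1,2)] square_integrable_tensor[OF si(3,4)]]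
  by (simp add: lborel_prod case_prod_unfold)
 have "(LINT z|lborel. ?F z) = (LINT z|(lborel \<Otimes>\<^sub>M lborel). ?F z)" by (simp add: lborel_prod)
 also have "... = (LINT x|lborel. LINT y|lborel. cnj (f x * g y) * (f' x * g' y))"
  by (rule lborel_pair.integral_fst[OF int, symmetric])
 also have "... = (LINT x|lborel. cnj (f x) * f' x * (LINT y|lborel. cnj (g y) * g' y))"
  by (intro Bochner_Integration.integral_cong refl, subst integral_mult_right_zero[symmetric]) (simp add: mult_ac)
 finally show "(LINT z|lborel. cnj (case z of (x, y) => f x * g y) * (case z of (x, y) => f' x * g' y)) =
   (LINT x|lborel. cnj (f x) * f' x) * (LINT y|lborel. cnj (g y) * g' y)"
  by (simp add: case_prod_unfold)
qed

lemma norm_tensor: "norm (ph \<otimes> ps) = norm ph * norm ps"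
proof -
 have "(norm (ph \<otimes> ps))^2 = (norm ph * norm ps)^2"
  using ip_tensor[of ph ps ph ps] by (simp add: ip_self power_mult_distrib del: of_real_power flip: of_real_mult)
 thus ?thesis by simp
qed

text \<open>If \<open>F\<close> is orthogonal to all products, the function pairing
  \<open>e m\<close> with \<open>F\<close> in the first variable is orthogonal to every
  \<open>f n\<close>, hence zero almost everywhere. There are countably many \<open>m\<close>, so
  almost every section of \<open>F\<close> is orthogonal to the whole basis
  \<open>e\<close>.\<close>

lemma tensor_onb:
 fixes e :: "nat => 'a::euclidean_space l2" and f :: "nat => 'b::euclidean_space l2"
 assumes e: "onb_on e UNIV" and f: "onb_on f UNIV"
 shows "onb_on (%(m, n). e m \<otimes> f n) UNIV"
 unfolding onb_on_def ortho_on_def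
proof (intro conjI ballI allI impI)
 show "ip (case i of (m, n) => e m \<otimes> f n) (case j of (m, n) => e m \<otimes> f n) = (if i = j then 1 else 0)" for i j
  using orthoD[OF onb_ortho[OF e]] orthoD[OF onb_ortho[OF f]]
  by (auto simp: ip_tensor split: prod.splits)
next
 fix T :: "('a \<times> 'b) l2" assume z: "ALL i:UNIV. ip (case i of (m, n) => e m \<otimes> f n) T = 0"
 obtain F where F: "sqi F" "T = abs_l2 F" by (rule l2_cases)
 have "EX u. sqi u & e m = abs_l2 u" for m by (rule l2_cases[of "e m"]) blast
 then obtain u where u: "!!m. sqi (u m)" "!!m. e m = abs_l2 (u m)" by metis
 have "EX v. sqi v & f m = abs_l2 v" for m by (rule l2_cases[of "f m"]) blast
 then obtain v where v: "!!m. sqi (v m)" "!!m. f m = abs_l2 (v m)" by metis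
 have Fm [measurable]: "F:borel_measurable (lborel \<Otimes>\<^sub>M lborel)"
  using F(1) by (simp add: square_integrable_def lborel_prod)
 have um [measurable]: "u m:borel_measurable lborel" and vm [measurable]: "v m:borel_measurable lborel" for m
  using u(1)[of m] v(1)[of m] by (simp_all add: square_integrable_def)
 have Fy [measurable]: "(%x. F (x, y)):borel_measurable lborel" for y by measurable
 define N where "N = (%y. \<integral>\<^sup>+x. ennreal ((cmod (F (x, y)))^2) \<partial>lborel)"
 have Nm [measurable]: "N:borel_measurable lborel" unfolding N_def by measurable
 have NF: "(\<integral>\<^sup>+y. N y \<partial>lborel) = ennreal ((norm T)^2)"
 proof -
  have "(\<integral>\<^sup>+y. N y \<partial>lborel) = (\<integral>\<^sup>+z. ennreal ((cmod (F z))^2) \<partial>(lborel \<Otimes>\<^sub>M lborel))"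
   unfolding N_def by (rule lborel_pair.nn_integral_snd) measurable
  also have "... = ennreal ((norm T)^2)" unfolding F(2) by (simp add: lborel_prod nn_integral_l2[OF F(1)])
  finally show ?thesis .
 qed
 have Nfin: "AE y in lborel. N y ~= \<infinity>" using NF by (intro nn_integral_PInf_AE) auto
 have si: "sqi (%x. F (x, y))" if "N y ~= \<infinity>" for y
  using that by (intro sqiI Fy) (simp add: N_def less_top)
 define G where "G = (%m y. LINT x|lborel. cnj (u m x) * F (x, y))"
 have G_cinner: "G m y = ip (e m) (abs_l2 (%x. F (x, y)))" if "N y ~= \<infinity>" for m y
  unfolding G_def u(2) using u(1) si[OF that] by (simp add: cinner.abs_eq)
 have Gm: "G m:borel_measurable lborel" for m
  unfolding G_def
 proof (rule lborel.borel_measurable_lebesgue_integral)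
  have "(%z :: 'b \<times> 'a. cnj (u m (snd z))):borel_measurable (lborel \<Otimes>\<^sub>M lborel)"
   by (rule measurable_compose[OF measurable_snd borel_measurable_continuous_on[OF continuous_on_cnj[OF continuous_on_id] um]])
  thus "(%(y, x). cnj (u m x) * F (x, y)):borel_measurable (lborel \<Otimes>\<^sub>M lborel)"
   unfolding case_prod_unfold using measurable_pair_swap[OF Fm]
   by (intro borel_measurable_times) (simp_all only: case_prod_unfold)
 qed
 have Gsi: "sqi (G m)" for m
 proof (rule sqiI[OF Gm])
  have "AE y in lborel. ennreal ((cmod (G m y))^2) <= N y"
   using Nfin
  proof eventually_elim
   case (elim y)
   have "cmod (G m y) <= norm (abs_l2 (%x. F (x, y)))"
    using norm_ip[of "e m" "abs_l2 (%x. F (x, y))"] norm_ortho[OF onb_ortho[OF e], of m] G_cinner[OF elim, of m] by simp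
   hence "ennreal ((cmod (G m y))^2) <= ennreal ((norm (abs_l2 (%x. F (x, y))))^2)" by (intro ennreal_leI power_mono) auto
   thus ?case unfolding N_def nn_integral_l2[OF si[OF elim]] .
  qed
  hence "(\<integral>\<^sup>+y. ennreal ((cmod (G m y))^2) \<partial>lborel) <= (\<integral>\<^sup>+y. N y \<partial>lborel)" by (rule nn_integral_mono_AE)
  thus "(\<integral>\<^sup>+y. ennreal ((cmod (G m y))^2) \<partial>lborel) < \<infinity>" unfolding NF by (rule order_le_less_trans) simp
 qed
 have "abs_l2 (G m) = 0" for m
 proof (rule onb_on_eqI[OF f])
  fix n
  have int: "integrable (lborel \<Otimes>\<^sub>M lborel) (%(x, y). cnj (u m x * v n y) * F (x, y))"
   using integrable_cnj_mult[OF square_integrable_tensor[OF u(1)[of m] v(1)[of n]] F(1)]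
   by (simp add: lborel_prod case_prod_unfold)
  have "e m \<otimes> f n = abs_l2 (%(x, y). u m x * v n y)"
   unfolding u(2) v(2) using u(1) v(1) by (simp add: tensor.abs_eq)
  hence "ip (e m \<otimes> f n) T = (LINT z|lborel. cnj (case z of (x, y) => u m x * v n y) * F z)"
   unfolding F(2) using F(1) square_integrable_tensor[OF u(1)[of m] v(1)[of n]] by (simp add: cinner.abs_eq)
  hence "0 = (LINT z|(lborel \<Otimes>\<^sub>M lborel). (%(x, y). cnj (u m x * v n y) * F (x, y)) z)"
   using bspec[OF z, of "(m, n)"] by (simp add: lborel_prod case_prod_unfold)
  also have "... = (LINT y|lborel. LINT x|lborel. cnj (u m x * v n y) * F (x, y))"
   by (rule lborel_pair.integral_snd[OF int, symmetric])
  also have "... = (LINT y|lborel. cnj (v n y) * G m y)"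
   unfolding G_def by (intro Bochner_Integration.integral_cong refl, subst integral_mult_right_zero[symmetric]) (simp add: mult_ac)
  also have "... = ip (f n) (abs_l2 (G m))" unfolding v(2) using v(1) Gsi by (simp add: cinner.abs_eq)
  finally show "ip (f n) (abs_l2 (G m)) = ip (f n) 0" by simp
 qed
 hence "AE y in lborel. G m y = 0" for m
  using abs_l2_eq_iff[OF Gsi[of m] square_integrable_zero] by (simp add: zero_l2_def)
 hence "AE y in lborel. ALL m. G m y = 0" by (simp add: AE_all_countable)
 hence "AE y in lborel. N y = 0"
  using Nfin
 proof eventually_elim
  case (elim y)
  have "abs_l2 (%x. F (x, y)) = 0" by (rule onb_on_eqI[OF e]) (use elim G_cinner in simp)
  thus ?case unfolding N_def nn_integral_l2[OF si[OF elim(2)]] by simp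
 qed
 hence "(\<integral>\<^sup>+y. N y \<partial>lborel) = (\<integral>\<^sup>+y. 0 \<partial>(lborel :: 'b measure))" by (rule nn_integral_cong_AE)
 thus "T = 0" unfolding NF by (simp add: ennreal_eq_0_iff)
qed

lemma tensor_bop_eqI:
 assumes "!!m n. R$$(hb m \<otimes> hb n) = R'$$(hb m \<otimes> hb n)" shows "R = R'"
 by (rule bop_eqI_onb[OF tensor_onb[OF hb_onb hb_onb]]) (use assms in auto)

lemma slice_ex1: "EX et. (ALL ph. ip ph et = ip (ph \<otimes> ch') Ps) & norm et <= norm ch' * norm Ps"
proof (rule riesz_l2)
 show "cmod (ip (ph \<otimes> ch') Ps) <= norm ch' * norm Ps * norm ph" for ph
  using norm_ip[of "ph \<otimes> ch'" Ps] by (simp add: norm_tensor mult_ac)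
qed (simp_all add: tensor_add_left tensor_scaleCl ip_simps)

text \<open>The adjoint of tensoring with \<open>ch'\<close>, that is, the partial inner product in
  the second factor; it gives coordinates in the second mode without choosing any in the
  first.\<close>

definition slice :: "'b::euclidean_space l2 => ('a::euclidean_space \<times> 'b) l2 => 'a l2" where
 "slice ch' Ps = (SOME et. (ALL ph. ip ph et = ip (ph \<otimes> ch') Ps) & norm et <= norm ch' * norm Ps)"

lemma slice: "ip ph (slice ch' Ps) = ip (ph \<otimes> ch') Ps" "norm (slice ch' Ps) <= norm ch' * norm Ps"
 using someI_ex[OF slice_ex1[of ch' Ps]] unfolding slice_def by auto

lemma slice_left: "ip (slice ch' Ps) ph = ip Ps (ph \<otimes> ch')"
 using slice(1)[of ph ch' Ps] by (metis cinner_commute)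

lemma slice_add: "slice ch' (Ph + Ps) = slice ch' Ph + slice ch' Ps"
 and slice_scaleC: "slice ch' (c *: Ps) = c *: slice ch' Ps"
 by (rule ip_eqI, simp add: slice ip_simps)+

lemma slice_tensor: "slice ch' (ph \<otimes> ps) = ip ch' ps *: ph"
 by (rule ip_eqI) (simp add: slice ip_tensor ip_simps)

lemma slice_parseval:
 fixes f :: "nat => 'b::euclidean_space l2" and Ph Ps :: "(real \<times> 'b) l2"
 assumes f: "onb_on f UNIV"
 shows "((%n. ip (slice (f n) Ph) (slice (f n) Ps)) has_sum ip Ph Ps) UNIV"
proof -
 have "((%(m, n). ip Ph (hb m \<otimes> f n) * ip (hb m \<otimes> f n) Ps) has_sum ip Ph Ps) (UNIV \<times> UNIV)"
  using onb_parseval[OF tensor_onb[OF hb_onb f], of Ph Ps] by (simp add: case_prod_unfold)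
 hence "((%(n, m). ip Ph (hb m \<otimes> f n) * ip (hb m \<otimes> f n) Ps) has_sum ip Ph Ps) (UNIV \<times> UNIV)"
  by (subst (asm) has_sum_swap) simp
 thus ?thesis
 proof (rule has_sum_SigmaD)
  show "((%m. case (n, m) of (n, m) => ip Ph (hb m \<otimes> f n) * ip (hb m \<otimes> f n) Ps) has_sum ip (slice (f n) Ph) (slice (f n) Ps)) UNIV" for n
   using onb_parseval[OF hb_onb, of "slice (f n) Ph" "slice (f n) Ps"] by (simp add: slice slice_left)
 qed
qed

lemma slice_norm:
 fixes f :: "nat => 'b::euclidean_space l2" and Ps :: "(real \<times> 'b) l2"
 assumes f: "onb_on f UNIV"
 shows "((%n. (norm (slice (f n) Ps))^2) has_sum (norm Ps)^2) UNIV"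
 using has_sum_Re[OF slice_parseval[OF f, of Ps Ps]] by (simp add: Re_ip_self)

lemma tensor_op_unique:
 assumes "!!ph ps. R$$(ph \<otimes> ps) = (S$$ph) \<otimes> (T$$ps)"
 shows "tensor_op S T = (R :: (real \<times> real) bop)"
 unfolding tensor_op_def by (rule the_equality) (auto intro!: tensor_bop_eqI simp: assms)

text \<open>The operator is built from its action on the slices along one basis and then acts in the
  same way on slices along any other; this is how \<open>x\<close> is separated from the second
  mode.\<close>

lemma tensor_op_one_right:
 fixes x :: "real bop" and f :: "nat => real l2" and ph ps :: "real l2"
 shows "tensor_op x 1$$(ph \<otimes> ps) = (x$$ph) \<otimes> ps" (is ?A)
  and "onb_on f UNIV ==> slice (f n) (tensor_op x 1$$Ps) = x$$slice (f n) Ps"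
proof -
 let ?s = "%n. slice (hb n) :: (real \<times> real) l2 => real l2"
 define B where "B = (%Ph Ps :: (real \<times> real) l2. \<Sum>\<^sub>\<infinity>n. ip (?s n Ph) (x$$?s n Ps))"
 have dom: "norm (ip (?s n Ph) (x$$?s n Ps)) <= norm x * (abs (norm (?s n Ph) * norm (?s n Ps)))" for n Ph Ps
  using order_trans[OF norm_ip mult_left_mono[OF norm_bop_apply[of x "?s n Ps"] norm_ge_zero[of "?s n Ph"]]]
  by (simp add: abs_mult mult_ac)
 have s: "(%n. (norm (?s n Ps))^2) summable_on UNIV" "(\<Sum>\<^sub>\<infinity>n. (norm (?s n Ps))^2) <= (norm Ps)^2" for Ps :: "(real \<times> real) l2"
  using has_sum_imp_summable[OF slice_norm[OF hb_onb]] infsumI[OF slice_norm[OF hb_onb, of Ps]] by simp_all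
 have cs: "(%n. (abs (norm (?s n Ph) * norm (?s n Ps)))) summable_on UNIV"
  "(\<Sum>\<^sub>\<infinity>n. (abs (norm (?s n Ph) * norm (?s n Ps)))) <= norm Ph * norm Ps" for Ph Ps :: "(real \<times> real) l2"
  by (rule cs_summ[OF s s norm_ge_zero norm_ge_zero])+
 note sn = norm_sum_comp[OF summable_on_cmult_right[OF cs(1), of "norm x"] dom]
 note hs = has_sum_infsum[OF abs_summable_summable[OF sn]]
 have hsB: "((%n. ip (?s n Ph) (x$$?s n Ps)) has_sum B Ph Ps) UNIV" for Ph Ps
  unfolding B_def by (rule hs)
 have "EX R. (ALL Ph Ps. ip Ph (R$$Ps) = B Ph Ps) & norm R <= norm x"
 proof (rule bop_of_form)
  fix Ph Ph' Ps :: "(real \<times> real) l2" and c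
  show "B (Ph + Ph') Ps = B Ph Ps + B Ph' Ps"
   using has_sum_add[OF hsB[of Ph Ps] hsB[of Ph' Ps]] by (intro has_sum_unique[OF hsB]) (simp add: slice_add ip_simps)
  show "B Ph (Ph' + Ps) = B Ph Ph' + B Ph Ps"
   using has_sum_add[OF hsB[of Ph Ph'] hsB[of Ph Ps]] by (intro has_sum_unique[OF hsB]) (simp add: slice_add ip_simps bop_simps)
  show "B (c *: Ph) Ps = cnj c * B Ph Ps"
   using has_sum_cmult_right[OF hsB[of Ph Ps], of "cnj c"] by (intro has_sum_unique[OF hsB]) (simp add: slice_scaleC ip_simps)
  show "B Ph (c *: Ps) = c * B Ph Ps"
   using has_sum_cmult_right[OF hsB[of Ph Ps], of c] by (intro has_sum_unique[OF hsB]) (simp add: slice_scaleC ip_simps bop_simps)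
  have "cmod (B Ph Ps) <= (\<Sum>\<^sub>\<infinity>n. norm (ip (?s n Ph) (x$$?s n Ps)))"
   unfolding B_def by (rule norm_infsum_bound[OF sn])
  also have "... <= (\<Sum>\<^sub>\<infinity>n. norm x * (abs (norm (?s n Ph) * norm (?s n Ps))))"
   by (rule infsum_mono[OF sn summable_on_cmult_right[OF cs(1)] dom])
  also have "... <= norm x * (norm Ph * norm Ps)"
   using mult_left_mono[OF cs(2) norm_ge_zero[of x]] by (simp add: infsum_cmult_right' abs_mult)
  finally show "cmod (B Ph Ps) <= norm x * norm Ph * norm Ps" by (simp add: mult.assoc)
 qed simp
 then obtain R where R: "!!Ph Ps. ip Ph (R$$Ps) = B Ph Ps" by blast
 have R_tensor: "R$$(ph \<otimes> ps) = (x$$ph) \<otimes> ps" for ph ps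
 proof (rule ip_eqI)
  fix Ph :: "(real \<times> real) l2"
  have "((%n. ip (?s n Ph) (x$$?s n (ph \<otimes> ps))) has_sum ip Ph ((x$$ph) \<otimes> ps)) UNIV"
   using slice_parseval[OF hb_onb, of Ph "(x$$ph) \<otimes> ps"] by (simp add: slice_tensor bop_simps)
  thus "ip Ph (R$$(ph \<otimes> ps)) = ip Ph ((x$$ph) \<otimes> ps)"
   unfolding R by (rule has_sum_unique[OF hsB])
 qed
 have TR: "tensor_op x 1 = R" by (rule tensor_op_unique) (simp add: R_tensor)
 show ?A by (simp add: TR R_tensor)
 have adj: "bop_adj R$$(ph \<otimes> ps) = (bop_adj x$$ph) \<otimes> ps" for ph ps
 proof (rule onb_on_eqI[OF tensor_onb[OF hb_onb hb_onb]], clarsimp)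
  fix m n
  show "ip (hb m \<otimes> hb n) (bop_adj R$$(ph \<otimes> ps)) = ip (hb m \<otimes> hb n) ((bop_adj x$$ph) \<otimes> ps)"
   by (simp add: ip_adjr R_tensor ip_tensor)
 qed
 show "slice (f n) (tensor_op x 1$$Ps) = x$$slice (f n) Ps"
 proof (rule ip_eqI)
  fix ph
  have "ip ph (slice (f n) (R$$Ps)) = ip (bop_adj R$$(ph \<otimes> f n)) Ps" by (simp add: slice ip_adjl)
  also have "... = ip ph (x$$slice (f n) Ps)" by (simp add: adj slice(1)[symmetric] ip_adjl)
  finally show "ip ph (slice (f n) (tensor_op x 1$$Ps)) = ip ph (x$$slice (f n) Ps)" by (simp add: TR)
 qed
qed

lemma tensor_op_one_left:
 fixes ph ps :: "real l2"
 assumes eb: "eigenbasis sg f p"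
 shows "tensor_op 1 sg$$(ph \<otimes> ps) = ph \<otimes> (sg$$ps)"
proof -
 have f: "onb_on f UNIV" using eb by (simp add: eigenbasis_def)
 note ft = tensor_onb[OF hb_onb f]
 have "cmod (cor (p (snd i))) <= 1" for i :: "nat \<times> nat" using eigenb(1,3)[OF eb] by simp
 from diagonal_op_exists[OF ft, of "%i. cor (p (snd i))" 1, OF this]
 obtain R where "ALL i Ps. ip (case i of (m, n) => hb m \<otimes> f n) (R$$Ps) = cor (p (snd i)) * ip (case i of (m, n) => hb m \<otimes> f n) Ps" by blast
 hence R: "ip (hb m \<otimes> f n) (R$$Ps) = of_real (p n) * ip (hb m \<otimes> f n) Ps" for m n Ps by (metis case_prod_conv snd_conv)
 have R_tensor: "R$$(ph \<otimes> ps) = ph \<otimes> (sg$$ps)" for ph ps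
  by (rule onb_on_eqI[OF ft]) (auto simp: R ip_tensor eigenb(4)[OF eb])
 have "tensor_op 1 sg = R" by (rule tensor_op_unique) (simp add: R_tensor)
 thus ?thesis by (simp add: R_tensor)
qed

lemma fin_vec_diff: "x:fin_vec h ==> y:fin_vec h ==> x - y:fin_vec h"
 using fin_vec_add[of x h "(- 1) *: y"] fin_scaleC[of y h "- 1"] by (simp add: scaleC_minus_one_l2)

lemma lin_on_diff:
 assumes "lin_on (fin_vec h) f" "x:fin_vec h" "y:fin_vec h"
 shows "f (x - y) = f x - f y"
proof -
 have "f (x + (- 1) *: y) = f x + (- 1) *: f y"
  using assms fin_scaleC[OF assms(3)] unfolding lin_on_def by metis
 thus ?thesis by (simp add: scaleC_minus_one_l2)
qed

context skew_series
begin

text \<open>The combinations \<open>d1 + w d2\<close> with \<open>w\<close> equal to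
  \<open>\<i>\<close> or \<open>- \<i>\<close> diagonalise the commutator with \<open>A\<close>.
  Each picks up an exponential phase, and adding or subtracting the two results gives cosine and
  sine.\<close>

lemma intertwine_rotation:
 fixes th t :: real
 assumes d: "!!ps. ps:D ==> d1 ps:D" "!!ps. ps:D ==> d2 ps:D"
  and comm: "!!ps. ps:D ==> d1 (A ps) = A (d1 ps) + th *: d2 ps" "!!ps. ps:D ==> d2 (A ps) = A (d2 ps) - th *: d1 ps"
  and adj: "!!ph ps. ph:D ==> ps:D ==> ip ph (d1 ps) = ip (e1 ph) ps"
   "!!ph ps. ph:D ==> ps:D ==> ip ph (d2 ps) = ip (e2 ph) ps"
  and D: "ph:D" "ps:D"
 shows "ip (e1 ph) (U t$$ps) = cos (t * th) * ip ph (U t$$d1 ps) + sin (t * th) * ip ph (U t$$d2 ps)" (is ?A)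
  and "ip (e2 ph) (U t$$ps) = cos (t * th) * ip ph (U t$$d2 ps) - sin (t * th) * ip ph (U t$$d1 ps)" (is ?B)
proof -
 have A_lin: "A (x + y) = A x + A y" "A (c *: x) = c *: A x" if "x:D" "y:D" for x y c using lin that unfolding lin_on_def by blast+
 have eig: "ip (e1 ph) (U t$$ps) + w * ip (e2 ph) (U t$$ps)
   = exp (of_real t * (- w * th)) * (ip ph (U t$$d1 ps) + w * ip ph (U t$$d2 ps))" if w: "w * w = - 1" "cnj w = - w" for w
 proof -
  have "ip (e1 ph - w *: e2 ph) (U t$$ps) = exp (of_real t * (- w * th)) * ip ph (U t$$(d1 ps + w *: d2 ps))"
  proof (rule intertwine_eigen[where d="%ps. d1 ps + w *: d2 ps" and d'="%ph. e1 ph - w *: e2 ph"])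
   show "d1 ps + w *: d2 ps:D" if "ps:D" for ps using that d by (intro fin_vec_add fin_scaleC) auto
   show "d1 (A ps) + w *: d2 (A ps) = A (d1 ps + w *: d2 ps) + (- w * th) *: (d1 ps + w *: d2 ps)" if "ps:D" for ps
   proof -
    have "- w * th * w = - (w * w) * th" by (simp add: mult_ac)
    hence "- w * th * w = th" using w(1) by simp
    with that d show ?thesis
     by (simp add: comm A_lin fin_scaleC scaleC_l2_simps scaleC_l2_diff scaleC_minus_left_l2 add_ac)
   qed
   show "ip ph (d1 ps + w *: d2 ps) = ip (e1 ph - w *: e2 ph) ps" if "ph:D" "ps:D" for ph ps
    using w(2) by (simp add: ip_simps adj[OF that])
  qed (use D in auto)
  thus ?thesis using w(2) by (simp add: ip_simps bop_simps)
 qed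
 have ex: "exp (cor t * (- \<i> * cor th)) = cos (t * th) - \<i> * sin (t * th)"
  "exp (cor t * (- (- \<i>) * cor th)) = cos (t * th) + \<i> * sin (t * th)"
  using cis_conv_exp[of "- (t * th)"] cis_conv_exp[of "t * th"] by (simp_all add: complex_eq_iff mult_ac)
 note e1 = eig[of \<i>, unfolded ex] and e2 = eig[of "- \<i>", unfolded ex]
 define X Y u v where "X = ip (e1 ph) (U t$$ps)" and "Y = ip (e2 ph) (U t$$ps)"
  and "u = ip ph (U t$$d1 ps)" and "v = ip ph (U t$$d2 ps)"
 define c s where "c = cor (cos (t * th))" and "s = cor (sin (t * th))"
 have 1: "X + \<i> * Y = (c - \<i> * s) * (u + \<i> * v)" using e1 by (simp add: X_def Y_def u_def v_def c_def s_def)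
 have 2: "X - \<i> * Y = (c + \<i> * s) * (u - \<i> * v)" using e2 by (simp add: X_def Y_def u_def v_def c_def s_def)
 have "2 * X = 2 * (c * u + s * v)" using arg_cong2[OF 1 2, of "(+)"] by (simp add: algebra_simps)
 hence "X = c * u + s * v" by (rule mult_left_cancel[THEN iffD1, rotated]) simp
 moreover from this 1 have "\<i> * Y = \<i> * (c * v - s * u)" by (simp add: algebra_simps)
 hence "Y = c * v - s * u" by (rule mult_left_cancel[THEN iffD1, rotated]) simp
 ultimately show ?A ?B
  by (simp_all add: X_def Y_def u_def v_def c_def s_def)
qed

end

section \<open>The beam splitter unitary\<close>

definition hb2 :: "nat \<times> nat => (real \<times> real) l2" where "hb2 = (%(m, n). hb m \<otimes> hb n)"

abbreviation "fin_hb2 \<equiv> fin_vec hb2"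

definition "lower1 = ext hb2 (%(m, n). rt m *: hb2 (m - 1, n))"
definition "raise1 = ext hb2 (%(m, n). rt (Suc m) *: hb2 (Suc m, n))"
definition "lower2 = ext hb2 (%(m, n). rt n *: hb2 (m, n - 1))"
definition "raise2 = ext hb2 (%(m, n). rt (Suc n) *: hb2 (m, Suc n))"

lemmas ladder_defs = lower1_def raise1_def lower2_def raise2_def

lemma hb2_onb: "onb_on hb2 UNIV"
 unfolding hb2_def by (rule tensor_onb[OF hb_onb hb_onb])

lemma hb2_fin [simp]: "hb2 i:fin_hb2"
 by (rule fin_vec_basis[OF hb2_onb])

lemma ip_hb2: "ip (hb2 i) (hb2 j) = (if i = j then 1 else 0)"
 using orthoD[OF onb_ortho[OF hb2_onb]] by simp

lemma ladder_hb2: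
 "lower1 (hb2 (m, n)) = rt m *: hb2 (m - 1, n)" "raise1 (hb2 (m, n)) = rt (Suc m) *: hb2 (Suc m, n)"
 "lower2 (hb2 (m, n)) = rt n *: hb2 (m, n - 1)" "raise2 (hb2 (m, n)) = rt (Suc n) *: hb2 (m, Suc n)"
 unfolding ladder_defs by (simp_all add: ext_basis[OF hb2_onb])

lemma ladder_lin: "lin_on fin_hb2 lower1" "lin_on fin_hb2 raise1" "lin_on fin_hb2 lower2" "lin_on fin_hb2 raise2"
 unfolding ladder_defs by (rule lin_on_ext)+

lemma ladder_fin [simp]: "lower1 ps:fin_hb2" "raise1 ps:fin_hb2" "lower2 ps:fin_hb2" "raise2 ps:fin_hb2"
 unfolding ladder_defs by (auto intro!: ext_fin_vec fin_scaleC)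

lemma ladder_scaleC:
 assumes "x:fin_hb2"
 shows "lower1 (c *: x) = c *: lower1 x" "raise1 (c *: x) = c *: raise1 x"
  "lower2 (c *: x) = c *: lower2 x" "raise2 (c *: x) = c *: raise2 x"
 using assms ladder_lin unfolding lin_on_def by blast+

lemma ladder_add:
 assumes "x:fin_hb2" "y:fin_hb2"
 shows "lower1 (x + y) = lower1 x + lower1 y" "raise1 (x + y) = raise1 x + raise1 y"
  "lower2 (x + y) = lower2 x + lower2 y" "raise2 (x + y) = raise2 x + raise2 y"
 using assms ladder_lin unfolding lin_on_def by blast+

lemma ladder_zero [simp]: "lower1 0 = 0" "raise1 0 = 0" "lower2 0 = 0" "raise2 0 = 0"
 using ladder_scaleC[OF fin_vec_zero, of 0] by simp_all

lemmas ladder_diff = ladder_lin[THEN lin_on_diff]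

lemma ladder_comm:
 assumes "ps:fin_hb2"
 shows "lower1 (raise1 ps) = raise1 (lower1 ps) + ps" (is ?A) "lower2 (raise2 ps) = raise2 (lower2 ps) + ps" (is ?B)
  "lower1 (lower2 ps) = lower2 (lower1 ps)" (is ?C) "raise1 (raise2 ps) = raise2 (raise1 ps)" (is ?E)
  "lower1 (raise2 ps) = raise2 (lower1 ps)" (is ?F) "lower2 (raise1 ps) = raise1 (lower2 ps)" (is ?G)
proof -
 note L = lin_on_eqI[OF hb2_onb _ _ _ assms]
 have sq: "cor (rt k) * cor (rt k) = of_nat k" for k
  by (simp flip: of_real_mult)
 have one: "of_nat (Suc k) *: x = of_nat k *: x + x" for k and x :: "(real \<times> real) l2"
  using scaleC_add_l2[of "of_nat k" 1 x] by (simp add: add.commute)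
 show ?A
 proof (rule L, (simp add: lin_on_def ladder_add ladder_scaleC scaleC_l2_simps add_ac; fail)+)
  fix i show "lower1 (raise1 (hb2 i)) = raise1 (lower1 (hb2 i)) + hb2 i"
  proof (cases i)
   case (Pair m n)
   show ?thesis unfolding Pair
    by (cases m) (simp_all add: ladder_hb2 ladder_scaleC scaleC_l2_simps sq del: of_nat_Suc, simp_all only: one of_nat_0 scaleC_zero_left_l2 add_0)
  qed
 qed
 show ?B
 proof (rule L, (simp add: lin_on_def ladder_add ladder_scaleC scaleC_l2_simps add_ac; fail)+)
  fix i show "lower2 (raise2 (hb2 i)) = raise2 (lower2 (hb2 i)) + hb2 i"
  proof (cases i)
   case (Pair m n)
   show ?thesis unfolding Pair
    by (cases n) (simp_all add: ladder_hb2 ladder_scaleC scaleC_l2_simps sq del: of_nat_Suc, simp_all only: one of_nat_0 scaleC_zero_left_l2 add_0)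
  qed
 qed
 show ?C ?E ?F ?G
  by (rule L, (simp add: lin_on_def ladder_add ladder_scaleC scaleC_l2_simps add_ac; fail)+, (auto simp: ladder_hb2 ladder_scaleC scaleC_l2_simps mult.commute)[1])+
qed

lemma ladder_adj:
 assumes "ph:fin_hb2" "ps:fin_hb2"
 shows "ip ph (lower1 ps) = ip (raise1 ph) ps" (is ?A) "ip ph (raise1 ps) = ip (lower1 ph) ps" (is ?B)
  "ip ph (lower2 ps) = ip (raise2 ph) ps" (is ?C) "ip ph (raise2 ps) = ip (lower2 ph) ps" (is ?E)
proof -
 have b: "ip (hb2 i) (lower1 (hb2 j)) = ip (raise1 (hb2 i)) (hb2 j)"
  "ip (hb2 i) (lower2 (hb2 j)) = ip (raise2 (hb2 i)) (hb2 j)" for i j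
  by (cases i; cases j; cases "fst j"; cases "snd j"; auto simp: ladder_hb2 ip_simps ip_hb2)+
 have b': "ip (hb2 i) (raise1 (hb2 j)) = ip (lower1 (hb2 i)) (hb2 j)"
  "ip (hb2 i) (raise2 (hb2 j)) = ip (lower2 (hb2 i)) (hb2 j)" for i j
  using arg_cong[OF b(1)[of j i], of cnj] arg_cong[OF b(2)[of j i], of cnj] unfolding cinner_commute[symmetric] by simp_all
 show ?A ?B ?C ?E
  by (rule lin_on_form_eq[OF hb2_onb ladder_lin(1,2) b(1) assms] lin_on_form_eq[OF hb2_onb ladder_lin(2,1) b'(1) assms]
    lin_on_form_eq[OF hb2_onb ladder_lin(3,4) b(2) assms] lin_on_form_eq[OF hb2_onb ladder_lin(4,3) b'(2) assms])+
qed

definition beam_gen :: "real => (real \<times> real) l2 => (real \<times> real) l2" where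
 "beam_gen th ps = th *: (raise1 (lower2 ps) - raise2 (lower1 ps))"

lemma beam_gen_fin [simp]: "beam_gen th ps:fin_hb2"
 unfolding beam_gen_def by (simp add: fin_scaleC fin_vec_diff)

lemma beam_gen_lin: "lin_on fin_hb2 (beam_gen th)"
 using ladder_lin unfolding lin_on_def beam_gen_def by (simp add: scaleC_l2_simps scaleC_l2_diff algebra_simps)

lemma beam_gen_comm:
 assumes "ps:fin_hb2"
 shows "lower1 (beam_gen th ps) = beam_gen th (lower1 ps) + th *: lower2 ps"
  "lower2 (beam_gen th ps) = beam_gen th (lower2 ps) - th *: lower1 ps"
  "raise1 (beam_gen th ps) = beam_gen th (raise1 ps) + th *: raise2 ps"
  "raise2 (beam_gen th ps) = beam_gen th (raise2 ps) - th *: raise1 ps"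
 using assms
 by (simp_all add: beam_gen_def ladder_scaleC ladder_diff fin_vec_diff ladder_comm ladder_add)
  (simp_all add: scaleC_l2_simps scaleC_l2_diff algebra_simps)

lemma beam_gen_pow_lin: "lin_on fin_hb2 (beam_gen th ^^ n)"
proof (induction n)
 case (Suc n)
 have "(beam_gen th ^^ n) ps:fin_hb2" if "ps:fin_hb2" for ps using that by (induction n) auto
 thus ?case using Suc beam_gen_lin[of th] unfolding lin_on_def by simp
qed (simp add: lin_on_def)

lemma beam_gen_hb2: "beam_gen th (hb2 (m, n)) = (th * (rt (Suc m) * rt n)) *: hb2 (Suc m, n - 1)
  - (th * (rt m * rt (Suc n))) *: hb2 (m - 1, Suc n)"
 by (simp add: beam_gen_def ladder_hb2 ladder_scaleC scaleC_l2_simps scaleC_l2_diff mult_ac del: of_nat_Suc)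

text \<open>The generator preserves the total number \<open>m + n\<close>, so every application
  costs the same factor and the exponential series converges as for a bounded operator.\<close>

lemma beam_gen_bound: "norm ((beam_gen th ^^ k) (hb2 (m, n))) <= (2 * abs th * real (Suc (m + n))) ^ k"
proof (induction k arbitrary: m n)
 case 0
 show ?case using norm_ortho[OF onb_ortho[OF hb2_onb], of "(m, n)"] by simp
next
 case (Suc k)
 let ?T = "beam_gen th ^^ k" and ?M = "real (Suc (m + n))"
 have lin: "?T (x - y) = ?T x - ?T y" "?T (c *: x) = c *: ?T x" if "x:fin_hb2" "y:fin_hb2" for x y c
  using beam_gen_pow_lin[where th=th and n=k] that lin_on_diff unfolding lin_on_def by blast+
 \<comment> \<open>The truncated indices \<open>n - 1\<close> and \<open>m - 1\<close> violate
   number conservation only when the coefficient is zero, hence the alternatives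
   \<open>a = 0\<close> and \<open>b = 0\<close>.\<close>
 have bound: "cmod (cor (th * (rt a * rt b))) * norm (?T (hb2 i)) <= abs th * ?M * (2 * abs th * ?M) ^ k"
  if "real a <= ?M" "real b <= ?M" "a = 0 \<or> b = 0 \<or> fst i + snd i = m + n" for a b :: nat and i
 proof (cases "a = 0 \<or> b = 0")
  case True
  thus ?thesis by auto
 next
  case False
  have "rt a * rt b <= sqrt ?M * sqrt ?M" using that by (intro mult_mono) auto
  hence "abs th * (rt a * rt b) <= abs th * ?M" by (intro mult_left_mono) auto
  hence "cmod (cor (th * (rt a * rt b))) <= abs th * ?M" unfolding norm_of_real by (simp add: abs_mult)
  moreover have "fst i + snd i = m + n" using that(3) False by blast
  hence "norm (?T (hb2 i)) <= (2 * abs th * ?M) ^ k" using Suc.IH[of "fst i" "snd i"] by (simp only: prod.collapse)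
  ultimately show ?thesis by (rule mult_mono) auto
 qed
 have "(beam_gen th ^^ Suc k) (hb2 (m, n)) = ?T (beam_gen th (hb2 (m, n)))" by (simp add: funpow_swap1)
 also have "... = (th * (rt (Suc m) * rt n)) *: ?T (hb2 (Suc m, n - 1))
  - (th * (rt m * rt (Suc n))) *: ?T (hb2 (m - 1, Suc n))"
  unfolding beam_gen_hb2 by (simp only: lin(1) lin(2)[OF hb2_fin hb2_fin] hb2_fin fin_scaleC)
 also have "norm ... <= abs th * ?M * (2 * abs th * ?M) ^ k + abs th * ?M * (2 * abs th * ?M) ^ k"
  by (rule order_trans[OF norm_triangle_ineq4], unfold norm_scaleC_l2, intro add_mono bound) auto
 finally show ?case by simp
qed

lemma beam_series: "skew_series hb2 (beam_gen th)"
proof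
 show "onb_on hb2 UNIV" by (rule hb2_onb)
 show "lin_on fin_hb2 (beam_gen th)" by (rule beam_gen_lin)
 show "beam_gen th ps:fin_hb2" for ps by simp
 show "ip ph (beam_gen th ps) = - ip (beam_gen th ph) ps" if "ph:fin_hb2" "ps:fin_hb2" for ph ps
  using that by (simp add: beam_gen_def ip_simps ladder_adj ladder_comm algebra_simps)
 fix r :: real and i :: "nat \<times> nat"
 obtain m n where i: "i = (m, n)" by (cases i)
 have s: "summable (%k. (abs r * (2 * abs th * real (Suc (m + n)))) ^ k /\<^sub>R fact k)" by (rule summable_exp_generic)
 show "summable (%k. r ^ k / fact k * norm ((beam_gen th ^^ k) (hb2 i)))"
 proof (rule summable_comparison_test'[OF s, of 0])
  fix k
  have "abs r ^ k / fact k * norm ((beam_gen th ^^ k) (hb2 i)) <= abs r ^ k / fact k * (2 * abs th * real (Suc (m + n))) ^ k"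
   unfolding i by (intro mult_left_mono beam_gen_bound) simp
  also have "... = (abs r * (2 * abs th * real (Suc (m + n)))) ^ k /\<^sub>R fact k"
   by (simp only: power_mult_distrib) (simp add: field_simps)
  finally show "norm (r ^ k / fact k * norm ((beam_gen th ^^ k) (hb2 i))) <= (abs r * (2 * abs th * real (Suc (m + n)))) ^ k /\<^sub>R fact k"
   by (simp add: abs_mult power_abs)
 qed
qed

lemma mode_graph:
 assumes "ps:fin_hb2" shows "(ps, lower1 ps):mode1" "(ps, lower2 ps):mode2"
proof -
 let ?F = "{i. ip (hb2 i) ps ~= 0}" and ?c = "%i. ip (hb2 i) ps"
 have e: "(ps, ext hb2 g ps) = (\<Sum>i\<in>?F. (?c i *: hb2 i, ?c i *: g i))" for g
  using fin_vec_expand[OF hb2_onb assms] by (simp add: ext_def sum_prod)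
 have a: "(c *: hb n, c *: (rt n *: hb (n - 1))):ann" for c n
  by (rule clinD(3)[OF ann_lin ann_hb])
 show "(ps, lower1 ps):mode1" unfolding lower1_def e mode1_def
 proof (intro subsetD[OF closure_subset] span_sum span_base)
  fix i :: "nat \<times> nat"
  obtain m n where i: "i = (m, n)" by (cases i)
  show "(?c i *: hb2 i, ?c i *: (case i of (m, n) => rt m *: hb2 (m - 1, n))):{(ps \<otimes> ph, et \<otimes> ph) |ps ph et. (ps, et):ann}"
   using a[of "?c i" m] by (force simp: i hb2_def tensor_scaleCl)
 qed
 show "(ps, lower2 ps):mode2" unfolding lower2_def e mode2_def
 proof (intro subsetD[OF closure_subset] span_sum span_base)
  fix i :: "nat \<times> nat"
  obtain m n where i: "i = (m, n)" by (cases i)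
  show "(?c i *: hb2 i, ?c i *: (case i of (m, n) => rt n *: hb2 (m, n - 1))):{(ph \<otimes> ps, ph \<otimes> et) |ps ph et. (ps, et):ann}"
   using a[of "?c i" n] by (force simp: i hb2_def tensor_scaleCr)
 qed
qed

lemma closed_form_rel:
 fixes u v :: "'a::euclidean_space l2"
 shows "closed {(Ps, X). ip u X = ip v Ps}"
proof -
 have "{(Ps, X). ip u X = ip v Ps} = {p. ip u (snd p) = ip v (fst p)}" by auto
 thus ?thesis
  by (simp, intro closed_Collect_eq continuous_intros bounded_linear.continuous_on[OF cinner.bounded_linear_right])
qed

lemma subspace_form_rel:
 fixes u v :: "'a::euclidean_space l2"
 shows "subspace {(Ps, X). ip u X = ip v Ps}"
 unfolding subspace_def by (auto simp: ip_simps zero_prod_def)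

text \<open>The modes are closures of spans, and for a fixed test vector the relation is a closed
  subspace; so it is checked on elementary tensors, and by linearity on basis test vectors.\<close>

lemma mode_weak:
 assumes "ph:fin_hb2"
 shows "(Ps, X):mode1 ==> ip ph X = ip (raise1 ph) Ps" "(Ps, X):mode2 ==> ip ph X = ip (raise2 ph) Ps"
proof -
 have *: "(Ps, X):closure (span S) ==> ip ph X = ip (d ph) Ps"
  if d: "lin_on fin_hb2 d" "!!i. S \<subseteq> {(Ps, X). ip (hb2 i) X = ip (d (hb2 i)) Ps}" for S d
  using hb2_onb assms
 proof (induction rule: fin_vec_induct)
  case (basis i)
  have "closure (span S) \<subseteq> {(Ps, X). ip (hb2 i) X = ip (d (hb2 i)) Ps}"
   by (intro closure_minimal closed_form_rel span_minimal subspace_form_rel d(2))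
  thus ?case using basis by auto
 qed (use d(1) in "auto simp: lin_on_def ip_simps")
 show "(Ps, X):mode1 ==> ip ph X = ip (raise1 ph) Ps" "(Ps, X):mode2 ==> ip ph X = ip (raise2 ph) Ps"
  unfolding mode1_def mode2_def
  by (erule *[rotated 2]; (rule ladder_lin)?; case_tac i; simp add: ladder_hb2 ip_simps del: of_nat_Suc; auto simp: hb2_def ann_weak ip_tensor)+
qed

lemma mode_adj_graph:
 assumes "ps:fin_hb2" shows "(ps, raise1 ps):uop_adj mode1" "(ps, raise2 ps):uop_adj mode2"
 unfolding uop_adj_def using mode_weak[OF assms] by auto

lemma beam_unitary_eq: "BU lam = skew_series.U hb2 (beam_gen (arccos (sqrt lam))) 1"
 unfolding beam_unitary_def
proof (rule skew_series.uop_exp_eq[OF beam_series])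
 let ?th = "arccos (sqrt lam)"
 let ?B = "uop_scale (cor ?th) (uop_add (uop_comp (uop_adj mode1) mode2) (uop_scale (- 1) (uop_comp (uop_adj mode2) mode1)))"
 show "(ps, beam_gen ?th ps):?B" if "ps:fin_hb2" for ps
 proof -
  have "(ps, raise1 (lower2 ps)):uop_comp (uop_adj mode1) mode2"
   unfolding uop_comp_def by (rule relcompI[OF mode_graph(2)[OF that] mode_adj_graph(1)]) simp
  moreover have "(ps, raise2 (lower1 ps)):uop_comp (uop_adj mode2) mode1"
   unfolding uop_comp_def by (rule relcompI[OF mode_graph(1)[OF that] mode_adj_graph(2)]) simp
  ultimately show ?thesis
   unfolding uop_scale_def uop_add_def beam_gen_def by (force simp: scaleC_minus_one_l2)
 qed
 show "?B \<subseteq> skew_series.weak_graph hb2 (beam_gen ?th)"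
  unfolding skew_series.weak_graph_def[OF beam_series]
 proof (clarsimp simp: uop_scale_def uop_add_def uop_comp_def)
  fix Ps al ga bt1 bt2 ph
  assume a: "(Ps, bt2):mode2" "(bt2, al):uop_adj mode1" and c: "(Ps, bt1):mode1" "(bt1, ga):uop_adj mode2" and ph: "ph:fin_hb2"
  have "ip bt2 (lower1 ph) = ip al ph" "ip bt1 (lower2 ph) = ip ga ph"
   using a(2) c(2) mode_graph[OF ph] unfolding uop_adj_def by auto
  hence "ip ph al = ip (lower1 ph) bt2" "ip ph ga = ip (lower2 ph) bt1"
   by (metis cinner_commute)+
  moreover have "ip (lower1 ph) bt2 = ip (raise2 (lower1 ph)) Ps" "ip (lower2 ph) bt1 = ip (raise1 (lower2 ph)) Ps"
   using mode_weak(2)[OF ladder_fin(1) a(1)] mode_weak(1)[OF ladder_fin(3) c(1)] by simp_all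
  ultimately show "ip (beam_gen ?th ph) Ps = - ip ph (cor ?th *: (al + (- 1) *: ga))"
   by (simp add: beam_gen_def ip_simps algebra_simps)
 qed
qed

lemma beam_unitary_adj: "bop_adj (BU lam) * BU lam = 1"
 unfolding beam_unitary_eq skew_series.U_form[OF beam_series] by (simp add: skew_series.U_zero[OF beam_series])

lemma beam_unitary_rotation:
 assumes lam: "0 <= lam" "lam <= 1" and D: "ph:fin_hb2" "ps:fin_hb2"
 shows "ip (raise1 ph) (BU lam$$ps) = ip ph (BU lam$$(sqrt lam *: lower1 ps + sqrt (1 - lam) *: lower2 ps))" (is ?A)
  "ip (raise2 ph) (BU lam$$ps) = ip ph (BU lam$$(sqrt lam *: lower2 ps - sqrt (1 - lam) *: lower1 ps))" (is ?B)
  "ip (lower1 ph) (BU lam$$ps) = ip ph (BU lam$$(sqrt lam *: raise1 ps + sqrt (1 - lam) *: raise2 ps))" (is ?C)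
  "ip (lower2 ph) (BU lam$$ps) = ip ph (BU lam$$(sqrt lam *: raise2 ps - sqrt (1 - lam) *: raise1 ps))" (is ?E)
proof -
 have "sqrt lam <= 1" using lam by simp
 hence cs: "cos (1 * arccos (sqrt lam)) = sqrt lam" "sin (1 * arccos (sqrt lam)) = sqrt (1 - lam)"
  using lam order_trans[of "-1" 0 "sqrt lam"] by (simp_all add: cos_arccos sin_arccos)
 note R = skew_series.intertwine_rotation[OF beam_series[of "arccos (sqrt lam)"], where th="arccos (sqrt lam)" and t=1 and ph=ph and ps=ps, unfolded cs]
 note L = R[where ?d1.0=lower1 and ?d2.0=lower2 and ?e1.0=raise1 and ?e2.0=raise2] and L' = R[where ?d1.0=raise1 and ?d2.0=raise2 and ?e1.0=lower1 and ?e2.0=lower2]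
 show ?A ?B
  using L D unfolding beam_unitary_eq by (simp_all add: beam_gen_comm ladder_adj ip_simps bop_simps)
 show ?C ?E
  using L' D unfolding beam_unitary_eq by (simp_all add: beam_gen_comm ladder_adj ip_simps bop_simps)
qed

section \<open>The beam splitter channel\<close>

definition sandwich :: "real => real bop => (real \<times> real) bop" where
 "sandwich lam x = bop_adj (BU lam) * tensor_op x 1 * BU lam"

lemma sandwich_form: "ip Ph (sandwich lam x$$Ps) = ip (BU lam$$Ph) (tensor_op x 1$$BU lam$$Ps)"
 by (simp add: sandwich_def bop_simps ip_adjr)

lemma norm_beam_unitary: "norm (BU lam$$Ps) = norm Ps"
proof -
 have "ip (BU lam$$Ps) (BU lam$$Ps) = ip Ps ((bop_adj (BU lam) * BU lam)$$Ps)"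
  by (simp add: bop_simps ip_adjr)
 hence "(norm (BU lam$$Ps))^2 = (norm Ps)^2"
  unfolding Re_ip_self[symmetric] by (simp add: beam_unitary_adj)
 thus ?thesis by simp
qed

text \<open>The partial matrix element of \<open>Y\<close> in the first mode, an operator on the
  second. Its trace against \<open>sg\<close> is the corresponding matrix element of the partial
  trace.\<close>

definition block :: "(real \<times> real) bop => real l2 => real l2 => real bop" where
 "block Y ph ps = (SOME T. ALL ch1 ch2. ip ch1 (T$$ch2) = ip (ph \<otimes> ch1) (Y$$(ps \<otimes> ch2)))"

lemma block_form: "ip ch1 (block Y ph ps$$ch2) = ip (ph \<otimes> ch1) (Y$$(ps \<otimes> ch2))"
proof -
 have "EX T. (ALL ch1 ch2. ip ch1 (T$$ch2) = ip (ph \<otimes> ch1) (Y$$(ps \<otimes> ch2))) & norm T <= norm ph * norm Y * norm ps"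
 proof (rule bop_of_form)
  show "cmod (ip (ph \<otimes> ch1) (Y$$(ps \<otimes> ch2))) <= norm ph * norm Y * norm ps * norm ch1 * norm ch2" for ch1 ch2
   using order_trans[OF norm_ip mult_left_mono[OF norm_bop_apply norm_ge_zero], of "ph \<otimes> ch1" Y "ps \<otimes> ch2"]
   by (simp add: norm_tensor mult_ac)
 qed (simp_all add: tensor_add_right tensor_scaleCr bop_simps ip_simps)
 hence "EX T. ALL ch1 ch2. ip ch1 (T$$ch2) = ip (ph \<otimes> ch1) (Y$$(ps \<otimes> ch2))" by blast
 from someI_ex[OF this] show ?thesis unfolding block_def by blast
qed

text \<open>With the state of the second mode diagonalised by \<open>f\<close> with weights
  \<open>p\<close>, the environment enters in \<open>f j\<close> and is found in
  \<open>hb n\<close>; each such pair gives one Kraus operator.\<close>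

definition beam_kraus :: "real => (nat => real l2) => (nat => real) => nat \<times> nat => real bop" where
 "beam_kraus lam f p = (%(j, n). SOME T. ALL ps. T$$ps = sqrt (p j) *. slice (hb n) (BU lam$$(ps \<otimes> f j)))"

context
 fixes sg :: "real bop" and f :: "nat => real l2" and p :: "nat => real" and lam :: real
 assumes eb: "eigenbasis sg f p"
begin

lemma f_onb: "onb_on f UNIV" using eb by (simp add: eigenbasis_def)

lemma norm_f: "norm (f j) = 1" by (rule norm_ortho[OF onb_ortho[OF f_onb]]) simp

lemma beam_kraus_apply: "beam_kraus lam f p (j, n)$$ps = sqrt (p j) *. slice (hb n) (BU lam$$(ps \<otimes> f j))"
proof -
 have "EX T. ALL ps. T$$ps = sqrt (p j) *. slice (hb n) (BU lam$$(ps \<otimes> f j))"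
 proof (rule bop_exists)
  fix ps :: "real l2"
  have "norm (slice (hb n) (BU lam$$(ps \<otimes> f j))) <= norm ps"
   using slice(2)[of "hb n" "BU lam$$(ps \<otimes> f j)"] norm_ortho[OF onb_ortho[OF hb_onb], of n]
   by (simp add: norm_beam_unitary norm_tensor norm_f)
  thus "norm (sqrt (p j) *. slice (hb n) (BU lam$$(ps \<otimes> f j))) <= sqrt (p j) * norm ps"
   using eigenb(1)[OF eb, of j] by (simp add: mult_left_mono)
 qed (simp_all add: tensor_add_left tensor_scaleCl bop_simps slice_add slice_scaleC scaleR_add_right scaleC_l2_simps)
 from someI_ex[OF this] show ?thesis unfolding beam_kraus_def by simp
qed

lemma beam_kraus_family: "kraus_family (beam_kraus lam f p)"
 unfolding kraus_family_def
proof
 fix ps :: "real l2"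
 define F where "F = (%i. (norm (beam_kraus lam f p i$$ps))^2)"
 have row: "((%n. F (j, n)) has_sum p j * (norm ps)^2) UNIV" for j
  using has_sum_cmult_right[OF slice_norm[OF hb_onb, of "BU lam$$(ps \<otimes> f j)"], of "p j"] eigenb(1)[OF eb, of j]
  by (simp add: F_def beam_kraus_apply power_mult_distrib norm_beam_unitary norm_tensor norm_f)
 have tot: "((%j. p j * (norm ps)^2) has_sum (norm ps)^2) UNIV"
  using has_sum_cmult_left[OF eigenb(2)[OF eb], of "(norm ps)^2"] by simp
 have nF: "norm (F i) = F i" for i by (simp add: F_def)
 have "(%i. norm (F i)) summable_on UNIV \<times> UNIV"
  by (rule SigmaI_norm[where g="%j. p j * (norm ps)^2"])
   (simp_all only: nF has_sum_imp_summable[OF row] has_sum_imp_summable[OF tot] infsumI[OF row] order_refl)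
 hence "F summable_on UNIV \<times> UNIV" by (rule abs_summable_summable)
 from has_sum_infsum[OF this] have "(F has_sum infsum F (UNIV \<times> UNIV)) (UNIV \<times> UNIV)" .
 moreover from has_sum_SigmaD[OF this row] have "infsum F (UNIV \<times> UNIV) = (norm ps)^2" by (rule has_sum_unique[OF _ tot])
 ultimately show "((%i. (norm (beam_kraus lam f p i$$ps))^2) has_sum (norm ps)^2) UNIV" by (simp add: F_def)
qed

text \<open>Summing over the outgoing index \<open>n\<close> is Parseval on slices; summing over
  \<open>j\<close> is the trace against \<open>sg\<close> in its eigenbasis.\<close>

lemma beam_kraus_form: "ip ph (kraus (beam_kraus lam f p) x$$ps) = trace (sg * block (sandwich lam x) ph ps)"
proof -
 let ?K = "beam_kraus lam f p" and ?V = "%ps j. BU lam$$(ps \<otimes> f j)"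
 have 1: "((%i. ip (?K i$$ph) (x$$?K i$$ps)) has_sum ip ph (kraus ?K x$$ps)) (UNIV \<times> UNIV)"
  using kraus_form(1)[OF beam_kraus_family] by simp
 have row: "((%n. ip (?K (j, n)$$ph) (x$$?K (j, n)$$ps)) has_sum of_real (p j) * ip (f j) (block (sandwich lam x) ph ps$$f j)) UNIV" for j
 proof -
  have "((%n. of_real (p j) * ip (slice (hb n) (?V ph j)) (slice (hb n) (tensor_op x 1$$?V ps j))) has_sum
    of_real (p j) * ip (?V ph j) (tensor_op x 1$$?V ps j)) UNIV"
   by (intro has_sum_cmult_right slice_parseval hb_onb)
  moreover have sq: "cor (sqrt (p j)) * cor (sqrt (p j)) = of_real (p j)"
   using eigenb(1)[OF eb, of j] by (simp flip: of_real_mult)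
  have "ip (?K (j, n)$$ph) (x$$?K (j, n)$$ps) = of_real (p j) * ip (slice (hb n) (?V ph j)) (slice (hb n) (tensor_op x 1$$?V ps j))" for n
   unfolding sq[symmetric] by (simp add: beam_kraus_apply tensor_op_one_right(2)[OF hb_onb] ip_simps bop_simps)
  ultimately show ?thesis by (simp add: block_form sandwich_form)
 qed
 show ?thesis by (rule has_sum_unique[OF has_sum_SigmaD[OF 1 row] eb_trace_mult[OF eb]])
qed

text \<open>\<open>partial_trace2\<close> demands the same diagonal sum in every basis of the second
  mode; the sum is the trace of the nuclear operator \<open>sg * block\<close>, so all bases
  agree.\<close>

lemma beam_splitter_kraus: "beam_splitter lam sg x = kraus (beam_kraus lam f p) x"
proof -
 have sg: "density_op sg" using eb by (simp add: eigenbasis_def)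
 have sa: "ip (sg$$ph) ps = ip ph (sg$$ps)" for ph ps using ip_adjl[of sg ph ps] by (simp add: density_op_sa[OF sg])
 let ?Z = "tensor_op 1 sg * bop_adj (BU lam) * tensor_op x 1 * BU lam"
 have adj: "bop_adj (tensor_op 1 sg)$$(ph \<otimes> ch1) = ph \<otimes> (sg$$ch1)" for ph ch1 :: "real l2"
  by (rule onb_on_eqI[OF tensor_onb[OF hb_onb hb_onb]])
   (auto simp: ip_adjr tensor_op_one_left[OF eb] ip_tensor sa)
 have Z: "ip (ph \<otimes> ch1) (?Z$$(ps \<otimes> ch1)) = ip ch1 ((sg * block (sandwich lam x) ph ps)$$ch1)" for ph ps ch1
 proof -
  have "?Z = tensor_op 1 sg * sandwich lam x" by (simp add: sandwich_def mult.assoc)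
  hence "ip (ph \<otimes> ch1) (?Z$$(ps \<otimes> ch1)) = ip (bop_adj (tensor_op 1 sg)$$(ph \<otimes> ch1)) (sandwich lam x$$(ps \<otimes> ch1))"
   by (simp add: bop_times ip_adjl)
  thus ?thesis by (simp add: adj block_form[symmetric] bop_times sa)
 qed
 have sum: "((%e. ip (ph \<otimes> e) (?Z$$(ps \<otimes> e))) has_sum ip ph (kraus (beam_kraus lam f p) x$$ps)) E" if "is_onb E" for ph ps E
  using nuclear_has_trace[OF nuclear_mult_right[OF density_nuc[OF sg]]] that
  unfolding Z beam_kraus_form has_trace_def by blast
 obtain E where E: "is_onb (E :: real l2 set)" by (rule onb_exists)
 show ?thesis unfolding beam_splitter_def partial_trace2_def
 proof (rule the_equality)
  show "ALL ph ps E. is_onb E --> ((%e. ip (ph \<otimes> e) (?Z$$(ps \<otimes> e))) has_sum ip ph (kraus (beam_kraus lam f p) x$$ps)) E"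
   using sum by blast
  fix T assume "ALL ph ps E. is_onb E --> ((%e. ip (ph \<otimes> e) (?Z$$(ps \<otimes> e))) has_sum ip ph (T$$ps)) E"
  hence "ip ph (T$$ps) = ip ph (kraus (beam_kraus lam f p) x$$ps)" for ph ps
   using has_sum_unique[OF _ sum[OF E]] E by blast
  thus "T = kraus (beam_kraus lam f p) x" by (rule bop_eqI_form)
 qed
qed

end

section \<open>Ladder operators of the two modes in terms of slices\<close>

lemma slice_hb2: "ip (hb m) (slice (hb k) Ps) = ip (hb2 (m, k)) Ps"
 by (simp add: slice hb2_def)

text \<open>The commutator with \<open>x\<close> is applied on each slice and the results are summed
  by Parseval. The relations \<open>A\<close> and \<open>A'\<close> stand for annihilation and
  creation in either order.\<close>

lemma tensor_op_pairing:
 fixes x y :: "real bop"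
 assumes A: "!!k. (slice (hb k) Ps, slice (hb k) Ps1):A" "!!k. (slice (hb k) Om, slice (hb k) Om1):A'"
  and pair: "!!u u1 v v1. (u, u1):A' ==> (v, v1):A ==> ip u1 v = ip u v1" and comm: "has_comm A x y"
 shows "ip Om1 (tensor_op x 1$$Ps) = ip Om (tensor_op x 1$$Ps1) + ip Om (tensor_op y 1$$Ps)"
proof -
 have "ip (slice (hb k) Om1) (x$$slice (hb k) Ps) = ip (slice (hb k) Om) (x$$slice (hb k) Ps1) + ip (slice (hb k) Om) (y$$slice (hb k) Ps)" for k
  unfolding cinner_add_right[symmetric] using bspec[OF comm[unfolded has_comm_def] A(1)[of k]] by (intro pair[OF A(2)]) simp
 hence "((%k. ip (slice (hb k) Om1) (slice (hb k) (tensor_op x 1$$Ps))) has_sum (ip Om (tensor_op x 1$$Ps1) + ip Om (tensor_op y 1$$Ps))) UNIV"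
  using has_sum_add[OF slice_parseval[OF hb_onb, of Om "tensor_op x 1$$Ps1"] slice_parseval[OF hb_onb, of Om "tensor_op y 1$$Ps"]]
  by (simp add: tensor_op_one_right(2)[OF hb_onb])
 thus ?thesis by (rule has_sum_unique[OF slice_parseval[OF hb_onb]])
qed

text \<open>On slices the ladder operators of the second mode are weighted index shifts, and
  \<open>tensor_op x 1\<close> acts slice by slice. This is the weak form of their
  commuting.\<close>

lemma tensor_op_shift:
 fixes x :: "real bop"
 assumes u: "!!k. slice (hb k) Ph' = rt k *: slice (hb (k - 1)) Ph"
  and v: "!!k. slice (hb k) Ps' = rt (Suc k) *: slice (hb (Suc k)) Ps"
 shows "ip Ph' (tensor_op x 1$$Ps) = ip Ph (tensor_op x 1$$Ps')" (is ?A) "ip Ps' (tensor_op x 1$$Ph) = ip Ps (tensor_op x 1$$Ph')" (is ?B)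
proof -
 note P = has_sum_imp_sums[OF slice_parseval[OF hb_onb]]
 have "(%k. ip (slice (hb k) Ph') (slice (hb k) (tensor_op x 1$$Ps))) sums ip Ph' (tensor_op x 1$$Ps)" by (rule P)
 moreover have "(%k. ip (slice (hb k) Ph') (slice (hb k) (tensor_op x 1$$Ps))) sums ip Ph (tensor_op x 1$$Ps')"
 proof -
  have "(%k. ip (slice (hb (Suc k)) Ph') (slice (hb (Suc k)) (tensor_op x 1$$Ps))) sums ip Ph (tensor_op x 1$$Ps')"
   using P[of Ph "tensor_op x 1$$Ps'"] by (simp add: u v tensor_op_one_right(2)[OF hb_onb] ip_simps bop_simps)
  from sums_Suc[OF this] show ?thesis by (simp add: u)
 qed
 ultimately show ?A by (rule sums_unique2)
 have "(%k. ip (slice (hb k) Ps) (slice (hb k) (tensor_op x 1$$Ph'))) sums ip Ps (tensor_op x 1$$Ph')" by (rule P)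
 moreover have "(%k. ip (slice (hb k) Ps) (slice (hb k) (tensor_op x 1$$Ph'))) sums ip Ps' (tensor_op x 1$$Ph)"
 proof -
  have "(%k. ip (slice (hb (Suc k)) Ps) (slice (hb (Suc k)) (tensor_op x 1$$Ph'))) sums ip Ps' (tensor_op x 1$$Ph)"
   using P[of Ps' "tensor_op x 1$$Ph"] by (simp add: u v tensor_op_one_right(2)[OF hb_onb] ip_simps bop_simps)
  from sums_Suc[OF this] show ?thesis by (simp add: u tensor_op_one_right(2)[OF hb_onb])
 qed
 ultimately show ?B by (rule sums_unique2[symmetric])
qed

text \<open>Vectors such as \<open>BU lam$$ps\<close> may lie outside \<open>fin_hb2\<close>; a
  ladder relation tested on \<open>hb2\<close> still puts their slices into the domain of
  \<open>annihilation\<close>.\<close>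

lemma ladder_slices:
 assumes "!!i. ip (raise1 (hb2 i)) Ps = ip (hb2 i) Ps1" shows "(slice (hb k) Ps, slice (hb k) Ps1):ann"
 using assms[of "(_, k)"] unfolding ann_weak by (simp add: slice_hb2 ladder_hb2 ip_simps del: of_nat_Suc)

lemma ladder_slices':
 assumes "!!i. ip (lower1 (hb2 i)) Ps = ip (hb2 i) Ps1" shows "(slice (hb k) Ps, slice (hb k) Ps1):cre"
 using assms[of "(_, k)"] unfolding cre_weak by (simp add: slice_hb2 ladder_hb2 ip_simps)

lemma ladder_shifts:
 assumes "!!i. ip (raise2 (hb2 i)) Ps = ip (hb2 i) Ps2" shows "slice (hb k) Ps2 = rt (Suc k) *: slice (hb (Suc k)) Ps"
 by (rule onb_on_eqI[OF hb_onb]) (use assms[of "(_, k)"] in "simp add: slice_hb2 ladder_hb2 ip_simps del: of_nat_Suc")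

lemma ladder_shifts':
 assumes "!!i. ip (lower2 (hb2 i)) Ps = ip (hb2 i) Ps2" shows "slice (hb k) Ps2 = rt k *: slice (hb (k - 1)) Ps"
 by (rule onb_on_eqI[OF hb_onb]) (use assms[of "(_, k)"] in "simp add: slice_hb2 ladder_hb2 ip_simps")

text \<open>Behind the unitary, a first-mode ladder operator is \<open>sqrt lam\<close> times the
  first mode minus \<open>sqrt (1 - lam)\<close> times the second. The second mode passes through
  \<open>tensor_op x 1\<close> freely, the first leaves \<open>tensor_op y 1\<close>; the cross
  terms recombine because the coefficients form a rotation.\<close>

lemma sandwich_comm:
 assumes lam: "0 <= lam" "lam <= 1" and D: "ph:fin_hb2" "ps:fin_hb2"
 shows "has_comm ann x y ==> ip (raise1 ph) (sandwich lam x$$ps)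
   = ip ph (sandwich lam x$$lower1 ps) + sqrt lam * ip ph (sandwich lam y$$ps)"
  and "has_comm cre x y ==> ip (lower1 ph) (sandwich lam x$$ps)
   = ip ph (sandwich lam x$$raise1 ps) + sqrt lam * ip ph (sandwich lam y$$ps)"
proof -
 let ?U = "BU lam" and ?c = "cor (sqrt lam)" and ?s = "cor (sqrt (1 - lam))"
 \<comment> \<open>By \<open>beam_unitary_rotation\<close> these are the first and second mode
   applied after the unitary; \<open>unrot\<close> inverts the rotation.\<close>
 define rot1 rot2 where "rot1 = (%d1 d2 (xi :: (real \<times> real) l2). ?U$$(?c *: d1 xi + ?s *: d2 xi))"
  and "rot2 = (%d1 d2 (xi :: (real \<times> real) l2). ?U$$(?c *: d2 xi - ?s *: d1 xi))"
 have "sqrt lam * sqrt lam + sqrt (1 - lam) * sqrt (1 - lam) = 1" using lam by simp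
 hence cs: "?c * ?c + ?s * ?s = 1" unfolding of_real_mult[symmetric] of_real_add[symmetric] by simp
 have unrot: "?U$$d1 xi = ?c *: rot1 d1 d2 xi - ?s *: rot2 d1 d2 xi" for d1 d2 xi
 proof -
  have "?c *: rot1 d1 d2 xi - ?s *: rot2 d1 d2 xi = (?c * ?c + ?s * ?s) *: (?U$$d1 xi)"
   unfolding rot1_def rot2_def scaleC_add_l2 by (simp add: bop_simps scaleC_l2_simps scaleC_l2_diff mult.commute)
  thus ?thesis by (simp add: cs)
 qed
 note R = beam_unitary_rotation[OF lam hb2_fin]
 have core: "ip (?U$$e1 ph) (tensor_op x 1$$?U$$ps) = ip (?U$$ph) (tensor_op x 1$$?U$$d1 ps) + ?c * ip (?U$$ph) (tensor_op y 1$$?U$$ps)"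
  if "ip (rot1 e1 e2 ph) (tensor_op x 1$$?U$$ps) = ip (?U$$ph) (tensor_op x 1$$rot1 d1 d2 ps) + ip (?U$$ph) (tensor_op y 1$$?U$$ps)"
   "ip (rot2 e1 e2 ph) (tensor_op x 1$$?U$$ps) = ip (?U$$ph) (tensor_op x 1$$rot2 d1 d2 ps)" for d1 d2 e1 e2
  unfolding unrot[of e1 ph e2] unrot[of d1 ps d2] using that by (simp add: ip_simps bop_simps algebra_simps)
 have low: "ip (raise1 (hb2 i)) (?U$$xi) = ip (hb2 i) (rot1 lower1 lower2 xi)" "ip (raise2 (hb2 i)) (?U$$xi) = ip (hb2 i) (rot2 lower1 lower2 xi)"
  "ip (lower1 (hb2 i)) (?U$$xi) = ip (hb2 i) (rot1 raise1 raise2 xi)" "ip (lower2 (hb2 i)) (?U$$xi) = ip (hb2 i) (rot2 raise1 raise2 xi)"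
  if "xi:fin_hb2" for i xi
  unfolding rot1_def rot2_def using R[OF that] by simp_all
 have pairing: "ip u1 v = ip u v1" if "(u, u1):cre" "(v, v1):ann" for u u1 v v1
  using that unfolding uop_adj_def by auto
 have pairing': "ip u1 v = ip u v1" if "(u, u1):ann" "(v, v1):cre" for u u1 v v1
  using arg_cong[OF pairing[OF that(2,1)], of cnj] unfolding cinner_commute[symmetric] by simp
 show "ip (raise1 ph) (sandwich lam x$$ps) = ip ph (sandwich lam x$$lower1 ps) + sqrt lam * ip ph (sandwich lam y$$ps)"
  if "has_comm ann x y"
  unfolding sandwich_form
 proof (rule core)
  show "ip (rot1 raise1 raise2 ph) (tensor_op x 1$$?U$$ps) = ip (?U$$ph) (tensor_op x 1$$rot1 lower1 lower2 ps) + ip (?U$$ph) (tensor_op y 1$$?U$$ps)"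
   by (rule tensor_op_pairing[OF ladder_slices[OF low(1)[OF D(2)]] ladder_slices'[OF low(3)[OF D(1)]] pairing that])
  show "ip (rot2 raise1 raise2 ph) (tensor_op x 1$$?U$$ps) = ip (?U$$ph) (tensor_op x 1$$rot2 lower1 lower2 ps)"
   by (rule tensor_op_shift(1)[OF ladder_shifts'[OF low(4)[OF D(1)]] ladder_shifts[OF low(2)[OF D(2)]]])
 qed
 show "ip (lower1 ph) (sandwich lam x$$ps) = ip ph (sandwich lam x$$raise1 ps) + sqrt lam * ip ph (sandwich lam y$$ps)"
  if "has_comm cre x y"
  unfolding sandwich_form
 proof (rule core)
  show "ip (rot1 lower1 lower2 ph) (tensor_op x 1$$?U$$ps) = ip (?U$$ph) (tensor_op x 1$$rot1 raise1 raise2 ps) + ip (?U$$ph) (tensor_op y 1$$?U$$ps)"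
   by (rule tensor_op_pairing[OF ladder_slices'[OF low(3)[OF D(2)]] ladder_slices[OF low(1)[OF D(1)]] pairing' that])
  show "ip (rot2 lower1 lower2 ph) (tensor_op x 1$$?U$$ps) = ip (?U$$ph) (tensor_op x 1$$rot2 raise1 raise2 ps)"
   by (rule tensor_op_shift(2)[OF ladder_shifts'[OF low(4)[OF D(2)]] ladder_shifts[OF low(2)[OF D(1)]]])
 qed
qed

text \<open>The form identity on products of Hermite functions becomes one between blocks, whose
  traces against \<open>sg\<close> are matrix elements of the channel; Hermite functions then
  suffice to establish the commutator.\<close>

theorem beam_splitter_comm:
 assumes lam: "0 <= lam" "lam <= 1" and sg: "density_op sg" and A: "A:{ann, cre}" and comm: "has_comm A x y"
 shows "has_comm A (beam_splitter lam sg x) (sqrt lam *. beam_splitter lam sg y)"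
proof -
 obtain f p where eb: "eigenbasis sg f p" by (rule eigenb_ex[OF hb_onb sg])
 note nsg = density_nuc[OF sg]
 have bs: "ip ph (beam_splitter lam sg x$$ps) = trace (sg * block (sandwich lam x) ph ps)" for x ph ps
  by (simp add: beam_splitter_kraus[OF eb] beam_kraus_form[OF eb])
 have tr: "trace (sg * (S + sqrt lam *. T)) = trace (sg * S) + sqrt lam * trace (sg * T)" for S T
  by (simp add: distrib_left trace_add trace_scaleR nuclear_mult_right[OF nsg] nuclear_scaleR)
 have eq: "ip (e (hb m)) (beam_splitter lam sg x$$hb n) = ip (hb m) (beam_splitter lam sg x$$d (hb n)) + sqrt lam * ip (hb m) (beam_splitter lam sg y$$hb n)"
  if "!!k l. ip (e (hb m) \<otimes> hb k) (sandwich lam x$$(hb n \<otimes> hb l)) = ip (hb m \<otimes> hb k) (sandwich lam x$$(d (hb n) \<otimes> hb l))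
   + sqrt lam * ip (hb m \<otimes> hb k) (sandwich lam y$$(hb n \<otimes> hb l))" for e d m n
 proof -
  have "block (sandwich lam x) (e (hb m)) (hb n) = block (sandwich lam x) (hb m) (d (hb n)) + sqrt lam *. block (sandwich lam y) (hb m) (hb n)"
   by (rule bop_eqI_onb[OF hb_onb], rule onb_on_eqI[OF hb_onb]) (simp add: block_form bop_simps ip_simps that)
  thus ?thesis by (simp only: bs tr)
 qed
 have t: "hb m \<otimes> hb k = hb2 (m, k)" "raise (hb m) \<otimes> hb k = raise1 (hb2 (m, k))" "lower (hb m) \<otimes> hb k = lower1 (hb2 (m, k))" for m k
  by (simp_all add: hb2_def raise_hb lower_hb ladder_hb2[unfolded hb2_def prod.case] ladder_hb2[simplified hb2_def] tensor_scaleCl)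
 consider "A = ann" | "A = cre" using A by blast
 thus ?thesis
 proof cases
  case 1
  have "ip (raise (hb m)) (beam_splitter lam sg x$$hb n) = ip (hb m) (beam_splitter lam sg x$$lower (hb n)) + sqrt lam * ip (hb m) (beam_splitter lam sg y$$hb n)" for m n
   by (rule eq) (use comm 1 in "simp add: t sandwich_comm[OF lam hb2_fin hb2_fin]")
  thus ?thesis unfolding 1
   by (intro has_comm_annI, unfold ann_weak) (simp add: raise_hb lower_hb ip_simps bop_simps del: of_nat_Suc)
 next
  case 2
  have "ip (lower (hb m)) (beam_splitter lam sg x$$hb n) = ip (hb m) (beam_splitter lam sg x$$raise (hb n)) + sqrt lam * ip (hb m) (beam_splitter lam sg y$$hb n)" for m n
   by (rule eq) (use comm 2 in "simp add: t sandwich_comm[OF lam hb2_fin hb2_fin]")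
  thus ?thesis unfolding 2
   by (intro has_comm_creI, unfold cre_weak) (simp add: raise_hb lower_hb ip_simps bop_simps del: of_nat_Suc)
 qed
qed

section \<open>Gradient estimates\<close>

context
 fixes rh :: "'a::euclidean_space bop" and e :: "nat => 'a l2" and r :: "nat => real"
 assumes eb: "eigenbasis rh e r"
begin

lemma mean_form_add_right: "mean_form c rh X (V + W) = mean_form c rh X V + mean_form c rh X W"
proof (rule has_sum_unique[OF mean_form_eigen[OF eb]])
 show "((%(i, j). of_real (mean_kernel c (r i) (r j)) * (cnj (ip (e i) (X$$e j)) * ip (e i) ((V + W)$$e j)))
   has_sum mean_form c rh X V + mean_form c rh X W) UNIV"
  using has_sum_add[OF mean_form_eigen[OF eb, of c X V] mean_form_eigen[OF eb, of c X W]]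
  by (simp add: case_prod_unfold bop_simps ip_simps algebra_simps)
qed

lemma mean_form_scaleCr: "mean_form c rh X (z *: V) = z * mean_form c rh X V"
proof (rule has_sum_unique[OF mean_form_eigen[OF eb]])
 show "((%(i, j). of_real (mean_kernel c (r i) (r j)) * (cnj (ip (e i) (X$$e j)) * ip (e i) ((z *: V)$$e j)))
   has_sum z * mean_form c rh X V) UNIV"
  using has_sum_cmult_right[OF mean_form_eigen[OF eb, of c X V], of z]
  by (simp add: case_prod_unfold bop_simps ip_simps mult_ac)
qed

lemma mean_form_cnj: "mean_form c rh V X = cnj (mean_form c rh X V)"
proof (rule has_sum_unique[OF mean_form_eigen[OF eb]])
 show "((%(i, j). of_real (mean_kernel c (r i) (r j)) * (cnj (ip (e i) (V$$e j)) * ip (e i) (X$$e j)))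
   has_sum cnj (mean_form c rh X V)) UNIV"
  using mean_form_eigen[OF eb, of c X V, THEN has_sum_cnj_iff[THEN iffD2]]
  by (simp add: case_prod_unfold mult_ac)
qed

lemma mean_form_scaleR_right: "mean_form c rh X (s *. V) = of_real s * mean_form c rh X V"
 by (simp add: bop_scaleR_scaleC mean_form_scaleCr)

lemma mean_form_scaleR_left: "mean_form c rh (s *. X) V = of_real s * mean_form c rh X V"
 by (subst (1 2) mean_form_cnj) (simp add: mean_form_scaleR_right)

lemma mean_form_add_left: "mean_form c rh (X + Y) V = mean_form c rh X V + mean_form c rh Y V"
 by (subst (1 2 3) mean_form_cnj) (simp add: mean_form_add_right)

lemma mean_form_nonneg: "0 <= Re (mean_form c rh V V)"
proof -
 have "((%p. Re ((%(i, j). of_real (mean_kernel c (r i) (r j)) * (cnj (ip (e i) (V$$e j)) * ip (e i) (V$$e j))) p))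
   has_sum Re (mean_form c rh V V)) UNIV"
  by (rule has_sum_Re[OF mean_form_eigen[OF eb]])
 thus ?thesis
 proof (rule has_sum_nonneg)
  fix p :: "nat \<times> nat"
  obtain i j where p: "p = (i, j)" by (cases p)
  have "cnj z * z = cor ((cmod z)^2)" for z by (metis complex_norm_square mult.commute)
  thus "0 <= Re ((%(i, j). of_real (mean_kernel c (r i) (r j)) * (cnj (ip (e i) (V$$e j)) * ip (e i) (V$$e j))) p)"
   using mean_kernel_bounds(1)[OF eigenb(1)[OF eb, of i] eigenb(1)[OF eb, of j], of c]
   by (simp add: p del: of_real_power)
 qed
qed

end

lemma lnorm_mean_form:
 "local_norm_sq bt rh V = Re (mean_form (- bt) rh (fst V) (fst V)) + Re (mean_form bt rh (snd V) (snd V))"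
 by (simp add: local_norm_sq_def hs_inner_def Lam_def mean_form_def)

lemma has_comm_scaleR:
 assumes "clin A" "has_comm A x y" shows "has_comm A (t *. x) (t *. y)"
 unfolding has_comm_def
proof clarify
 fix ps ph assume "(ps, ph):A"
 hence "(x$$ps, x$$ph + y$$ps):A" using assms(2) unfolding has_comm_def by blast
 from clinD(3)[OF assms(1) this, of "of_real t"]
 show "((t *. x)$$ps, (t *. x)$$ph + (t *. y)$$ps):A"
  by (simp add: bop_simps scaleR_add_right scaleR_l2_def scaleC_l2_simps)
qed

lemma lip_norm_eq:
 assumes "has_comm ann x y" "has_comm cre x y'"
 shows "lip_norm x = ereal (max (norm y) (norm y'))"
 using assms comm_eq[of ann x y] comm_eq[of cre x y'] unfolding lip_norm_def bounded_comm_def by auto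

lemma lip_norm_finite:
 assumes "lip_norm x < \<infinity>" obtains y y' where "has_comm ann x y" "has_comm cre x y'"
 using assms unfolding lip_norm_def bounded_comm_def by (auto split: if_splits)

lemma state_of_linear:
 assumes "density_op rh"
 shows "state_of rh (t *. x) = of_real t * state_of rh x" "state_of rh (x - y) = state_of rh x - state_of rh y"
 unfolding state_of_def using nuclear_mult_right[OF density_nuc[OF assms]]
 by (simp_all add: trace_scaleR trace_diff right_diff_distrib)

section \<open>The channel: commutators, Lipschitz cost and local norms\<close>

locale beam_splitter_channel =
 fixes lam :: real and sg :: "real bop"
 assumes lam: "0 <= lam" "lam <= 1" and sg: "density_op sg"
begin

abbreviation "P \<equiv> beam_splitter lam sg"

lemma P_kraus: obtains K :: "nat \<times> nat => real bop" where "kraus_family K" "P = kraus K"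
proof -
 obtain f p where eb: "eigenbasis sg f p" by (rule eigenb_ex[OF hb_onb sg])
 show thesis by (rule that[OF beam_kraus_family[OF eb, of lam]]) (simp add: fun_eq_iff beam_splitter_kraus[OF eb])
qed

lemma P_norm: "norm (P x) <= norm x"
 by (rule P_kraus) (simp add: kraus_form(2))

lemma P_adj: "P (bop_adj x) = bop_adj (P x)"
 by (rule P_kraus) (simp add: kraus_adj)

lemmas P_comm = beam_splitter_comm[OF lam sg]

lemma comm_P:
 assumes "A:{ann, cre}" "bounded_comm A x"
 shows "bounded_comm A (P x)" "comm A (P x) = sqrt lam *. P (comm A x)"
 using P_comm[OF assms(1) bounded_comm_has_comm[OF assms]] comm_eq[OF assms(1)] by (auto simp: bounded_comm_def)

text \<open>The factor \<open>t\<close> is carried along because the dual estimate tests with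
  rescaled images \<open>t *. P x\<close>.\<close>

lemma lip_norm_P_scaleR:
 assumes y: "has_comm ann x y" "has_comm cre x y'" and t: "0 <= t"
 shows "lip_norm (t *. P x) <= ereal (t * sqrt lam * max (norm y) (norm y'))"
proof -
 have "lip_norm (t *. P x) = ereal (max (norm (t *. sqrt lam *. P y)) (norm (t *. sqrt lam *. P y')))"
  by (rule lip_norm_eq; rule has_comm_scaleR[OF _ P_comm])
   (use y in "simp_all add: ann_lin uop_adj_clinear")
 also have "... = ereal (t * sqrt lam * max (norm (P y)) (norm (P y')))"
  using t lam by (simp add: max_mult_distrib_left mult.assoc)
 also have "... <= ereal (t * sqrt lam * max (norm y) (norm y'))"
  using t lam P_norm[of y] P_norm[of y'] by (auto intro!: mult_left_mono max.mono)
 finally show ?thesis .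
qed

lemma lip_norm_P:
 assumes "lip_norm x < \<infinity>" shows "lip_norm (P x) <= ereal (sqrt lam) * lip_norm x"
proof -
 obtain y y' where y: "has_comm ann x y" "has_comm cre x y'" using lip_norm_finite[OF assms] .
 show ?thesis using lip_norm_P_scaleR[OF y, of 1] by (simp only: scaleR_one mult_1 lip_norm_eq[OF y] times_ereal.simps zero_le_one)
qed

text \<open>If \<open>x\<close> is admissible, so is \<open>P x\<close> divided by
  \<open>sqrt lam\<close>; testing the cost with it gives the contraction.\<close>

lemma cost_lip_contr: "coarse_ricci_ge cost_lip P (1 - sqrt lam)"
 unfolding coarse_ricci_ge_def
proof (intro allI impI, elim conjE)
 fix om1 om2 :: "real bop => complex"
 assume n: "normal_state om1" "normal_state om2" and fin: "cost_lip om1 om2 < \<infinity>"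
 have lin: "Re (om1 (t *. x) - om2 (t *. x)) = t * Re (om1 x - om2 x)" for t x
  using n unfolding normal_state_def by (auto simp: state_of_linear right_diff_distrib)
 have le: "ereal (Re (om1 x - om2 x)) <= cost_lip om1 om2" if "bop_adj x = x" "lip_norm x <= 1" for x
  unfolding cost_lip_def by (rule SUP_upper) (use that in simp)
 have c0: "has_comm A 0 0" if "clin A" for A using clinD(1)[OF that] by (auto simp: has_comm_def)
 have "0 <= cost_lip om1 om2"
  using le[of 0] lin[of 0 0] lip_norm_eq[OF c0[OF ann_lin] c0[OF uop_adj_clinear]] by (simp add: bop_adj_simps zero_ereal_def)
 then obtain c where c: "cost_lip om1 om2 = ereal c" "0 <= c" using fin by (cases "cost_lip om1 om2") auto
 have "Re (om1 (P x) - om2 (P x)) <= sqrt lam * c" if x: "bop_adj x = x" "lip_norm x <= 1" for x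
 proof -
  have "lip_norm x < \<infinity>" using x(2) by (rule order_le_less_trans) simp
  then obtain y y' where y: "has_comm ann x y" "has_comm cre x y'" by (rule lip_norm_finite)
  have y1: "max (norm y) (norm y') <= 1" using x(2) by (simp add: lip_norm_eq[OF y])
  let ?v = "Re (om1 (P x) - om2 (P x))"
  have t: "t * ?v <= c" if "0 <= t" "t * sqrt lam <= 1" for t
  proof -
   have "t * sqrt lam * max (norm y) (norm y') <= 1 * 1"
    using that y1 lam by (intro mult_mono) (auto simp: le_max_iff_disj)
   hence "ereal (t * sqrt lam * max (norm y) (norm y')) <= 1" by (simp only: one_ereal_def ereal_less_eq mult_1)
   with lip_norm_P_scaleR[OF y that(1)] have "lip_norm (t *. P x) <= 1" by (rule order_trans)
   moreover have "bop_adj (t *. P x) = t *. P x" unfolding bop_adj_simps P_adj[symmetric] x(1) ..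
   ultimately show ?thesis using le[of "t *. P x"] unfolding lin c(1) by simp
  qed
  show ?thesis
  proof (cases "lam = 0")
   case True
   \<comment> \<open>At \<open>lam = 0\<close> every nonnegative multiple of \<open>P x\<close> is
     admissible, so a positive value could be scaled beyond the finite cost
     \<open>c\<close>.\<close>
   have "?v <= 0"
   proof (rule ccontr)
    assume v: "\<not> ?v <= 0"
    hence "(c + 1) / ?v * ?v <= c" using c(2) True by (intro t) auto
    thus False using v by simp
   qed
   thus ?thesis using True by simp
  next
   case False
   hence s: "0 < sqrt lam" using lam by simp
   hence "inverse (sqrt lam) * ?v <= c" by (intro t) auto
   thus ?thesis using s by (simp add: field_simps)
  qed
 qed
 thus "cost_lip (om1 \<circ> P) (om2 \<circ> P) <= ereal (1 - (1 - sqrt lam)) * cost_lip om1 om2"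
  unfolding c(1) cost_lip_def[of "om1 \<circ> P"] by (intro SUP_least) auto
qed

lemma lnorm_contr:
 assumes rh: "density_op rh"
 shows "local_norm_sq bt rh (P V1, P V2) <= local_norm_sq bt (predual P rh) (V1, V2)"
proof -
 obtain K :: "nat \<times> nat => real bop" where K: "kraus_family K" "P = kraus K" by (rule P_kraus)
 obtain e r where eb: "eigenbasis rh e r" by (rule eigenb_ex[OF hb_onb rh])
 obtain e' r' where eb': "eigenbasis (kdual K rh) e' r'" by (rule eigenb_ex[OF hb_onb kdual_density[OF K(1) rh]])
 show ?thesis
  unfolding lnorm_mean_form K(2) predual_kraus[OF K(1) rh] fst_conv snd_conv
  by (intro add_mono mean_form_mono[OF K(1) eb eb'])
qed

lemma lnorm_grad:
 assumes rh: "density_op rh" and x: "bounded_comm ann x" "bounded_comm cre x"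
 shows "local_norm_sq bt rh (grad (P x)) <= lam * local_norm_sq bt (predual P rh) (grad x)"
proof -
 obtain e r where eb: "eigenbasis rh e r" by (rule eigenb_ex[OF hb_onb rh])
 let ?a = "comm ann x" and ?c = "comm cre x"
 have "grad (P x) = (sqrt lam *. P ?a, sqrt lam *. P ?c)"
  using x by (simp add: grad_def comm_P)
 hence "local_norm_sq bt rh (grad (P x)) = lam * local_norm_sq bt rh (P ?a, P ?c)"
  using lam by (simp add: lnorm_mean_form mean_form_scaleR_left[OF eb] mean_form_scaleR_right[OF eb] distrib_left mult.assoc[symmetric] flip: of_real_mult)
 also have "... <= lam * local_norm_sq bt (predual P rh) (?a, ?c)"
  by (intro mult_left_mono lnorm_contr rh lam)
 finally show ?thesis by (simp add: grad_def)
qed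

end

section \<open>The local inner product\<close>

definition lform :: "real => 'a::euclidean_space bop => 'a bop \<times> 'a bop => 'a bop \<times> 'a bop => real" where
 "lform bt rh X V = Re (hs_inner X (Lam bt rh V))"

lemma lnorm_form: "local_norm_sq bt rh V = lform bt rh V V"
 by (simp add: local_norm_sq_def lform_def)

lemma lform_mean_form:
 "lform bt rh X V = Re (mean_form (- bt) rh (fst X) (fst V)) + Re (mean_form bt rh (snd X) (snd V))"
 by (simp add: lform_def hs_inner_def Lam_def mean_form_def)

text \<open>The form may be degenerate; a null vector \<open>y\<close> pairing nontrivially with
  \<open>x\<close> would make the quadratic in \<open>t\<close> linear and hence negative
  somewhere.\<close>

lemma semi_inner_cs:
 fixes b :: "'v::real_vector => 'v => real"
 assumes add: "!!x y z. b (x + y) z = b x z + b y z" and scale: "!!r x z. b (r *. x) z = r * b x z"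
  and sym: "!!x y. b x y = b y x" and pos: "!!x. 0 <= b x x"
 shows "abs (b x y) <= sqrt (b x x) * sqrt (b y y)"
proof -
 have q: "0 <= b x x + 2 * t * b x y + t\<^sup>2 * b y y" for t
 proof -
  have "b z (x + t *. y) = b z x + t * b z y" for z using add[of x "t *. y" z] scale[of t y z] sym by metis
  hence "b (x + t *. y) (x + t *. y) = b x x + 2 * t * b x y + t\<^sup>2 * b y y"
   by (simp add: add scale sym[of y x] power2_eq_square algebra_simps)
  thus ?thesis using pos[of "x + t *. y"] by simp
 qed
 have "(b x y)^2 <= b x x * b y y"
 proof (cases "b y y = 0")
  case True
  have "b x y = 0"
  proof (rule ccontr)
   assume "b x y ~= 0"
   thus False using q[of "- (b x x + 1) / (2 * b x y)"] True by (simp add: field_simps)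
  qed
  thus ?thesis using True by simp
 next
  case False
  hence p: "0 < b y y" using pos[of y] by simp
  have "0 <= b y y * (b x x + 2 * (- b x y / b y y) * b x y + (- b x y / b y y)^2 * b y y)"
   by (rule mult_nonneg_nonneg[OF less_imp_le[OF p] q])
  also have "... = b x x * b y y - (b x y)^2" using p by (simp add: field_simps power2_eq_square)
  finally show ?thesis by simp
 qed
 hence "sqrt ((b x y)^2) <= sqrt (b x x * b y y)" by (rule real_sqrt_le_mono)
 thus ?thesis by (simp add: real_sqrt_mult)
qed

context
 fixes rh :: "real bop" and bt :: real
 assumes rh: "density_op rh"
begin

lemma lform_add: "lform bt rh (X + Y) V = lform bt rh X V + lform bt rh Y V"
proof -
 obtain e r where eb: "eigenbasis rh e r" by (rule eigenb_ex[OF hb_onb rh])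
 show ?thesis by (simp add: lform_mean_form mean_form_add_left[OF eb])
qed

lemma lform_scaleR: "lform bt rh (t *. X) V = t * lform bt rh X V"
proof -
 obtain e r where eb: "eigenbasis rh e r" by (rule eigenb_ex[OF hb_onb rh])
 show ?thesis by (simp add: lform_mean_form mean_form_scaleR_left[OF eb] distrib_left)
qed

lemma lform_sym: "lform bt rh X V = lform bt rh V X"
proof -
 obtain e r where eb: "eigenbasis rh e r" by (rule eigenb_ex[OF hb_onb rh])
 show ?thesis using mean_form_cnj[OF eb, of _ "fst V" "fst X"] mean_form_cnj[OF eb, of _ "snd V" "snd X"]
  by (simp add: lform_mean_form)
qed

lemma lform_nonneg: "0 <= lform bt rh X X"
proof -
 obtain e r where eb: "eigenbasis rh e r" by (rule eigenb_ex[OF hb_onb rh])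
 show ?thesis by (simp add: lform_mean_form mean_form_nonneg[OF eb])
qed

lemma lform_diff: "lform bt rh (X - Y) V = lform bt rh X V - lform bt rh Y V"
 using lform_add[of X "(- 1) *. Y" V] lform_scaleR[of "- 1" Y V] by simp

lemma lform_zero: "lform bt rh 0 V = 0"
 using lform_scaleR[of 0 0 V] by simp

lemma lform_sum: "lform bt rh (sum X I) V = (\<Sum>i\<in>I. lform bt rh (X i) V)"
 by (induction I rule: infinite_finite_induct) (simp_all add: lform_zero lform_add)

lemmas lform_cs =
 semi_inner_cs[of "lform bt rh", OF lform_add lform_scaleR lform_sym lform_nonneg]

end

lemma tannery:
 fixes a :: "nat => nat => real"
 assumes "!!k j. abs (a k j) <= M j" "summable M" "!!j. (%k. a k j) ----> b j"
 shows "(%k. \<Sum>j. a k j) ----> (\<Sum>j. b j)"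
 using tannerys_theorem[of "%j k. a k j" b sequentially M] assms by (simp add: always_eventually case_prod_unfold)

text \<open>The kernel is at most \<open>exp (abs c)\<close> times \<open>r i + r j\<close>, which
  bounds the form by the traces of \<open>rh\<close> against both Gram operators. These tend to zero
  by dominated convergence, once for \<open>X k\<close> and once for its adjoint.\<close>

lemma mean_form_null:
 assumes eb: "eigenbasis rh e r"
  and X: "!!ps. (%k. X k$$ps) ----> 0" "!!ps. (%k. bop_adj (X k)$$ps) ----> 0" "!!k. norm (X k) <= B"
 shows "(%k. Re (mean_form c rh (X k) (X k))) ----> 0"
proof -
 have e: "onb_on e UNIV" using eb by (simp add: eigenbasis_def)
 note r = eigenb(1)[OF eb]
 let ?T = "%Y. Re (trace (rh * (bop_adj Y * Y)))"
 have T0: "(%k. ?T (Y k)) ----> 0" if Y: "!!ps. (%k. Y k$$ps) ----> 0" "!!k. norm (Y k) <= B" for Y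
 proof -
  have "(%k. \<Sum>j. r j * (norm (Y k$$e j))^2) ----> (\<Sum>j. 0)"
  proof (rule tannery[where M="%j. r j * B\<^sup>2"])
   show "(abs (r j * (norm (Y k$$e j))^2)) <= r j * B\<^sup>2" for k j
    using r[of j] norm_bop_onb[OF e, of "Y k" j] Y(2)[of k] by (auto simp: abs_mult intro!: mult_left_mono power_mono)
   show "summable (%j. r j * B\<^sup>2)"
    using sums_summable[OF has_sum_imp_sums[OF eigenb(2)[OF eb]]] by (rule summable_mult2)
   show "(%k. r j * (norm (Y k$$e j))^2) ----> 0" for j
    using tendsto_mult[OF tendsto_const[of "r j"] tendsto_power[OF tendsto_norm_zero[OF Y(1)[of "e j"]], of 2]] by simp
  qed
  moreover have "?T (Y k) = (\<Sum>j. r j * (norm (Y k$$e j))^2)" for k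
   by (rule sums_unique[OF has_sum_imp_sums[OF trace_gram[OF eb]]])
  ultimately show ?thesis by simp
 qed
 have le: "Re (mean_form c rh Y Y) <= exp (abs c) * (?T Y + ?T (bop_adj Y))" for Y
 proof (rule has_sum_mono)
  show "((%p. Re ((%(i, j). of_real (mean_kernel c (r i) (r j)) * (cnj (ip (e i) (Y$$e j)) * ip (e i) (Y$$e j))) p))
    has_sum Re (mean_form c rh Y Y)) UNIV"
   by (rule has_sum_Re[OF mean_form_eigen[OF eb]])
  show "((%p. exp (abs c) * ((%(i, j). r j * ent e Y i j) p + (%(i, j). r i * ent e Y i j) p))
    has_sum exp (abs c) * (?T Y + ?T (bop_adj Y))) UNIV"
   using trace_gram_pairs[OF eb, of Y] by (intro has_sum_cmult_right has_sum_add) simp_all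
  fix p :: "nat \<times> nat"
  obtain i j where p: "p = (i, j)" by (cases p)
  have "cnj z * z = cor ((cmod z)^2)" for z by (metis complex_norm_square mult.commute)
  moreover have "mean_kernel c (r i) (r j) <= exp (abs c) * (r j + r i)"
   using r[of i] r[of j] by (intro order_trans[OF mean_kernel_bounds(2)] mult_left_mono) auto
  ultimately show "Re ((%(i, j). of_real (mean_kernel c (r i) (r j)) * (cnj (ip (e i) (Y$$e j)) * ip (e i) (Y$$e j))) p)
   <= exp (abs c) * ((%(i, j). r j * ent e Y i j) p + (%(i, j). r i * ent e Y i j) p)"
   by (simp add: p distrib_right[symmetric] mult.assoc[symmetric] mult_right_mono del: of_real_power)
 qed
 have up: "(%k. exp (abs c) * (?T (X k) + ?T (bop_adj (X k)))) ----> 0"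
  using tendsto_mult_right_zero[OF tendsto_add_zero[OF T0[of X] T0[of "%k. bop_adj (X k)"]], of "exp (abs c)"] X by simp
 show ?thesis
  by (rule tendsto_sandwich[OF _ _ tendsto_const up]; intro always_eventually allI; rule mean_form_nonneg[OF eb] le)
qed

section \<open>Commutators of cut-off operators\<close>

lemma has_comm_mult: "has_comm A x y ==> has_comm A x' y' ==> has_comm A (x * x') (y * x' + x * y')"
 unfolding has_comm_def by (fastforce simp: bop_simps add_ac)

lemma has_comm_sum:
 assumes A: "clin A" and "!!i. i:I ==> has_comm A (x i) (y i)"
 shows "has_comm A (sum x I) (sum y I)"
 unfolding has_comm_def
proof clarify
 fix ps ph assume p: "(ps, ph):A"
 have "(\<Sum>i\<in>I. x i$$ps, \<Sum>i\<in>I. x i$$ph + y i$$ps):A"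
  using assms(2) p unfolding has_comm_def by (intro clin_sum[OF A]) auto
 thus "(sum x I$$ps, sum x I$$ph + sum y I$$ps):A"
  by (simp add: bop_sum_apply sum.distrib)
qed

lemma cre_pairing: "(ps, ph):ann ==> (et, xi):cre ==> ip et ph = ip xi ps"
 unfolding uop_adj_def by auto

lemma has_comm_adj:
 assumes "has_comm ann x y" shows "has_comm cre (bop_adj x) (- bop_adj y)"
 unfolding has_comm_def
proof clarify
 fix et xi assume c: "(et, xi):cre"
 show "(bop_adj x$$et, bop_adj x$$xi + - bop_adj y$$et):cre"
  unfolding uop_adj_def
 proof clarify
  fix ps ph assume "(ps, ph):ann"
  hence "(x$$ps, x$$ph + y$$ps):ann" using assms unfolding has_comm_def by blast
  from cre_pairing[OF this c]
  show "ip (bop_adj x$$et) ph = ip (bop_adj x$$xi + - bop_adj y$$et) ps"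
   by (simp add: ip_simps bop_simps ip_adjl algebra_simps)
 qed
qed

lemma has_comm_rank1:
 assumes "(ph, pha):ann" "(ph, phc):cre" "(ps, psa):ann" "(ps, psc):cre"
 shows "has_comm ann (rank1 ph ps) (rank1 pha ps - rank1 ph psc)" (is ?A)
  and "has_comm cre (rank1 ph ps) (rank1 phc ps - rank1 ph psa)" (is ?B)
proof -
 show ?A
  unfolding has_comm_def
 proof clarify
  fix u v assume "(u, v):ann"
  hence "ip ps v = ip psc u" using assms(4) by (rule cre_pairing)
  thus "(rank1 ph ps$$u, rank1 ph ps$$v + (rank1 pha ps - rank1 ph psc)$$u):ann"
   using clinD(3)[OF ann_lin assms(1)] by (simp add: rank1_apply bop_simps)
 qed
 show ?B
  unfolding has_comm_def
 proof clarify
  fix u v assume "(u, v):cre"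
  from arg_cong[OF cre_pairing[OF assms(3) this], of cnj] have "ip ps v = ip psa u"
   unfolding cinner_commute[symmetric] by simp
  thus "(rank1 ph ps$$u, rank1 ph ps$$v + (rank1 phc ps - rank1 ph psa)$$u):cre"
   using clinD(3)[OF uop_adj_clinear assms(2)] by (simp add: rank1_apply bop_simps)
 qed
qed

text \<open>The cut-off is linear because ladder coefficients grow like the square root of the
  level: with slope \<open>1 / (k + 1)\<close> the commutator has norm of order
  \<open>1 / sqrt k\<close>, whereas for a sharp cut-off it would grow.\<close>

definition cut :: "nat => nat => real" where "cut k n = max 0 (1 - real n / real (Suc k))"

lemma cut_bounds: "0 <= cut k n" "cut k n <= 1" "Suc k <= n ==> cut k n = 0"
 by (auto simp: cut_def max_def divide_simps)

lemma cut_tendsto: "(%k. cut k n) ----> 1"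
proof -
 have "(%k. max 0 (1 - real n * inverse (real (Suc k)))) ----> max 0 (1 - real n * 0)"
  by (intro tendsto_intros LIMSEQ_inverse_real_of_nat)
 thus ?thesis unfolding cut_def by (simp add: divide_inverse del: of_nat_Suc)
qed

lemma cut_step: "(abs (rt (Suc n) * (cut k (Suc n) - cut k n))) <= 1 / rt (Suc k)"
proof (cases "n <= k")
 case True
 have "cut k (Suc n) - cut k n = - (1 / real (Suc k))"
 proof -
  have "real (Suc n) / real (Suc k) <= 1" "real n / real (Suc k) <= 1" using True by (simp_all add: divide_le_eq)
  hence "cut k (Suc n) - cut k n = 1 - real (Suc n) / real (Suc k) - (1 - real n / real (Suc k))" unfolding cut_def by simp
  thus ?thesis by (simp add: add_divide_distrib)
 qed
 hence "(abs (rt (Suc n) * (cut k (Suc n) - cut k n))) = rt (Suc n) / real (Suc k)"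
  by (simp add: abs_mult)
 also have "... <= rt (Suc k) / real (Suc k)" using True by (intro divide_right_mono) auto
 also have "... = 1 / rt (Suc k)"
  using real_sqrt_mult_self[of "real (Suc k)"] by (simp add: field_simps del: of_nat_Suc real_sqrt_mult_self)
 finally show ?thesis .
next
 case False
 thus ?thesis by (simp add: cut_bounds(3))
qed

definition cut_op :: "nat => real bop" where
 "cut_op k = (\<Sum>n<Suc k. cut k n *. rank1 (hb n) (hb n))"

definition cut_comm :: "nat => real bop" where
 "cut_comm k = (\<Sum>n<Suc k. (rt (Suc n) * (cut k (Suc n) - cut k n)) *. rank1 (hb n) (hb (Suc n)))"

lemma ip_hb_sum:
 assumes "!!n. Suc k <= n ==> c n = 0"
 shows "ip (hb m) ((\<Sum>n<Suc k. c n *. rank1 (hb n) (u n))$$ps) = of_real (c m) * ip (u m) ps"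
proof -
 have "ip (hb m) ((\<Sum>n<Suc k. c n *. rank1 (hb n) (u n))$$ps) = (\<Sum>n<Suc k. if n = m then of_real (c n) * ip (u n) ps else 0)"
  unfolding bop_sum_apply ip_sum_right
  by (intro sum.cong) (auto simp: bop_simps rank1_apply ip_simps ip_hb)
 also have "... = of_real (c m) * ip (u m) ps" using assms[of m] by (subst sum.delta) auto
 finally show ?thesis .
qed

lemma ip_cut_op: "ip (hb m) (cut_op k$$ps) = of_real (cut k m) * ip (hb m) ps"
 unfolding cut_op_def by (rule ip_hb_sum) (rule cut_bounds(3))

lemma ip_cut_comm: "ip (hb m) (cut_comm k$$ps) = of_real (rt (Suc m) * (cut k (Suc m) - cut k m)) * ip (hb (Suc m)) ps"
 unfolding cut_comm_def by (rule ip_hb_sum) (simp add: cut_bounds(3))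

lemma norm_by_shift:
 assumes "!!m. cmod (ip (hb m) et) <= K * cmod (ip (hb (s m)) ps)" "inj s" "0 <= K"
 shows "norm et <= K * norm ps"
proof -
 have o: "ortho_on (%m. hb (s m)) UNIV" using assms(2) by (simp add: ortho_on_def ip_hb inj_eq)
 have "(norm et)^2 <= K\<^sup>2 * (\<Sum>\<^sub>\<infinity>m. (cmod (ip (hb (s m)) ps))^2)"
 proof (rule has_sum_mono[OF onb_norm[OF hb_onb]])
  show "((%m. K\<^sup>2 * (cmod (ip (hb (s m)) ps))^2) has_sum K\<^sup>2 * (\<Sum>\<^sub>\<infinity>m. (cmod (ip (hb (s m)) ps))^2)) UNIV"
   by (intro has_sum_cmult_right has_sum_infsum bessel_summ(1)[OF o])
  show "(cmod (ip (hb m) et))^2 <= K\<^sup>2 * (cmod (ip (hb (s m)) ps))^2" for m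
   unfolding power_mult_distrib[symmetric] by (rule power_mono[OF assms(1)]) simp
 qed
 also have "... <= K\<^sup>2 * (norm ps)^2" by (intro mult_left_mono bessel_summ(2)[OF o]) simp
 finally have "(norm et)^2 <= (K * norm ps)^2" by (simp add: power_mult_distrib)
 thus ?thesis by (rule power2_le_imp_le) (simp add: assms(3))
qed

lemma norm_cut_op: "norm (cut_op k) <= 1"
proof (rule norm_bop_leI)
 show "norm (cut_op k$$ps) <= 1 * norm ps" for ps
  by (rule norm_by_shift[where s="%m. m"]) (auto simp: ip_cut_op norm_mult cut_bounds mult_left_le_one_le)
qed simp

lemma norm_cut_comm: "norm (cut_comm k) <= 1 / rt (Suc k)"
proof (rule norm_bop_leI)
 show "norm (cut_comm k$$ps) <= 1 / rt (Suc k) * norm ps" for ps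
 proof (rule norm_by_shift[where s=Suc])
  show "cmod (ip (hb m) (cut_comm k$$ps)) <= 1 / rt (Suc k) * cmod (ip (hb (Suc m)) ps)" for m
   unfolding ip_cut_comm norm_mult norm_of_real by (intro mult_right_mono cut_step) simp
 qed auto
qed simp

lemma cut_op_adj: "bop_adj (cut_op k) = cut_op k"
proof (rule bop_adj_eqI)
 fix ph ps
 have "ip (cut_op k$$ph) (hb n) = of_real (cut k n) * ip ph (hb n)" for n
  by (subst (1 2) cinner_commute) (simp add: ip_cut_op)
 hence "((%n. ip ph (hb n) * ip (hb n) (cut_op k$$ps)) has_sum ip (cut_op k$$ph) ps) UNIV"
  using onb_parseval[OF hb_onb, of "cut_op k$$ph" ps] by (simp add: ip_cut_op mult.left_commute mult.assoc)
 thus "ip ph (cut_op k$$ps) = ip (cut_op k$$ph) ps"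
  by (rule has_sum_unique[OF onb_parseval[OF hb_onb]])
qed

lemma cut_op_tendsto: "(%k. cut_op k$$ps) ----> ps"
proof -
 have n: "(norm (cut_op k$$ps - ps))^2 = (\<Sum>n. (cut k n - 1)^2 * (cmod (ip (hb n) ps))^2)" for k
 proof -
  have "ip (hb n) (cut_op k$$ps - ps) = of_real (cut k n - 1) * ip (hb n) ps" for n
   by (simp add: ip_simps ip_cut_op algebra_simps)
  hence "(%n. (cut k n - 1)^2 * (cmod (ip (hb n) ps))^2) = (%n. (cmod (ip (hb n) (cut_op k$$ps - ps)))^2)"
   by (simp add: norm_mult power_mult_distrib del: of_real_diff)
  thus ?thesis using sums_unique[OF has_sum_imp_sums[OF onb_norm[OF hb_onb, of "cut_op k$$ps - ps"]]] by simp
 qed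
 have "(%k. \<Sum>n. (cut k n - 1)^2 * (cmod (ip (hb n) ps))^2) ----> (\<Sum>n. 0)"
 proof (rule tannery[where M="%n. (cmod (ip (hb n) ps))^2"])
  have "(cut k n - 1)^2 <= 1" for k n using cut_bounds(1,2)[of k n] by (simp add: abs_square_le_1)
  thus "(abs ((cut k n - 1)^2 * (cmod (ip (hb n) ps))^2)) <= (cmod (ip (hb n) ps))^2" for k n
   by (simp add: abs_mult mult_left_le_one_le)
  show "summable (%n. (cmod (ip (hb n) ps))^2)" by (rule sums_summable[OF has_sum_imp_sums[OF onb_norm[OF hb_onb]]])
  show "(%k. (cut k n - 1)^2 * (cmod (ip (hb n) ps))^2) ----> 0" for n
   using tendsto_mult[OF tendsto_power[OF LIM_zero[OF cut_tendsto[of n]], of 2] tendsto_const[of "(cmod (ip (hb n) ps))^2"]] by simp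
 qed
 hence "(%k. (norm (cut_op k$$ps - ps))^2) ----> 0" by (simp add: n)
 from tendsto_real_sqrt[OF this] have "(%k. norm (cut_op k$$ps - ps)) ----> 0" by simp
 thus ?thesis by (rule LIM_zero_cancel[OF tendsto_norm_zero_cancel])
qed

lemma cut_op_comm: "has_comm ann (cut_op k) (cut_comm k)" (is ?A) "has_comm cre (cut_op k) (- bop_adj (cut_comm k))" (is ?B)
proof -
 show 1: ?A
 proof (rule has_comm_annI, unfold ann_weak, intro allI)
  show "ip (hb m) (cut_op k$$(rt n *: hb (n - 1)) + cut_comm k$$hb n) = rt (Suc m) * ip (hb (Suc m)) (cut_op k$$hb n)" for n m
   by (cases n) (auto simp: ip_simps ip_cut_op ip_cut_comm ip_hb algebra_simps simp del: of_nat_Suc)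
 qed
 show ?B using has_comm_adj[OF 1] by (simp add: cut_op_adj)
qed

lemma weighted_mean_nuclear:
 fixes rh :: "real bop" assumes "density_op rh" shows "nuclear (weighted_mean c rh V)"
 by (rule eigenb_ex[OF hb_onb assms]) (rule weighted_mean_eigen(1))

lemma weighted_mean_zero:
 fixes rh :: "real bop" assumes "density_op rh" shows "weighted_mean c rh 0 = 0"
proof -
 obtain e r where eb: "eigenbasis rh e r" by (rule eigenb_ex[OF hb_onb assms])
 hence e: "onb_on e UNIV" by (simp add: eigenbasis_def)
 show ?thesis
  by (rule bop_eqI_onb[OF e], rule onb_on_eqI[OF e]) (simp add: weighted_mean_eigen(2)[OF eb])
qed

text \<open>Pairing with the commutators of a rank one operator reproduces
  \<open>dstar_form\<close>, so the weak equation in \<open>tangent_norm\<close> concerns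
  \<open>lform\<close> tested on such gradients.\<close>

lemma lform_rank1:
 fixes rh :: "real bop"
 assumes rh: "density_op rh"
 shows "lform bt rh (rank1 pha ps - rank1 ph psc, rank1 phc ps - rank1 ph psa) V = Re (dstar_form (Lam bt rh V) ph pha phc ps psa psc)"
proof -
 have t: "trace (bop_adj (rank1 u v - rank1 u' v') * Y) = ip u (Y$$v) - ip u' (Y$$v')"
  if Y: "nuclear Y" for Y :: "real bop" and u v u' v'
 proof -
  have "trace (bop_adj (rank1 u v - rank1 u' v') * Y) = trace (Y * (rank1 v u - rank1 v' u'))"
   by (simp add: trace_commute[OF Y, symmetric] bop_adj_simps rank1_adj)
  also have "... = trace (Y * rank1 v u) - trace (Y * rank1 v' u')"
   by (simp add: right_diff_distrib trace_diff nuclear_mult_right Y)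
  finally show ?thesis by (simp add: trace_rank1 Y)
 qed
 show ?thesis
  unfolding lform_def hs_inner_def dstar_form_def Lam_def fst_conv snd_conv
  by (simp add: t weighted_mean_nuclear[OF rh])
qed

text \<open>The defining identity of the tangent norm extends from operators of rank one to bounded operators
 with bounded commutators, because \<open>W * cut_op k\<close> and its commutators converge strongly.\<close>

lemma commutator_pairing:
 fixes rh :: "real bop"
 assumes rh: "density_op rh" and y: "nuclear y" and B: "!!i. sqrt (local_norm_sq bt rh (V i)) <= B"
  and V: "!!ph pha phc ps psa psc. (ph, pha):ann ==> (ph, phc):cre ==> (ps, psa):ann ==> (ps, psc):cre ==>
    (%i. dstar_form (Lam bt rh (V i)) ph pha phc ps psa psc) ----> ip ph (y$$ps)"
  and W: "has_comm ann W Wa" "has_comm cre W Wc"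
 shows "(%i. lform bt rh (Wa, Wc) (V i)) ----> Re (trace (bop_adj W * y))"
proof -
 \<comment> \<open>The commutators of \<open>W * cut_op k\<close> by the Leibniz rule.\<close>
 define R where "R = (%k. (Wa * cut_op k + W * cut_comm k, Wc * cut_op k + W * (- bop_adj (cut_comm k))))"
 define t where "t = (%n. Re (ip (W$$hb n) (y$$hb n)))"
 define a where "a = (%n. W$$(rt n *: hb (n - 1)) + Wa$$hb n)"
 define c where "c = (%n. W$$(rt (Suc n) *: hb (Suc n)) + Wc$$hb n)"
 define Q where "Q = (%n. (rank1 (a n) (hb n) - rank1 (W$$hb n) (rt (Suc n) *: hb (Suc n)),
  rank1 (c n) (hb n) - rank1 (W$$hb n) (rt n *: hb (n - 1))))"
 have dom: "(W$$hb n, a n):ann" "(W$$hb n, c n):cre" for n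
  using bspec[OF W(1)[unfolded has_comm_def] ann_hb[of n]] bspec[OF W(2)[unfolded has_comm_def] cre_hb[of n]]
  by (simp_all add: a_def c_def)
 have Wcut: "W * cut_op k = (\<Sum>n<Suc k. cut k n *. rank1 (W$$hb n) (hb n))" for k
  by (rule bop_eqI) (simp only: cut_op_def bop_times bop_sum_apply bop_apply_sum bop_scaleR_apply rank1_apply bop_apply_scaleR bop_apply_scaleC)
 \<comment> \<open>Both sides are commutators of the same operator \<open>W * cut_op k\<close>, and
   bounded commutators are unique.\<close>
 have R_sum: "R k = (\<Sum>n<Suc k. cut k n *. Q n)" for k
 proof (rule prod_eqI)
  have "has_comm ann (W * cut_op k) (fst (R k))" "has_comm cre (W * cut_op k) (snd (R k))"
   unfolding R_def fst_conv snd_conv by (intro has_comm_mult W cut_op_comm)+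
  moreover have "has_comm ann (W * cut_op k) (\<Sum>n<Suc k. cut k n *. fst (Q n))"
   unfolding Wcut Q_def fst_conv
   by (intro has_comm_sum has_comm_scaleR ann_lin has_comm_rank1(1)[OF dom ann_hb cre_hb])
  moreover have "has_comm cre (W * cut_op k) (\<Sum>n<Suc k. cut k n *. snd (Q n))"
   unfolding Wcut Q_def snd_conv
   by (intro has_comm_sum has_comm_scaleR uop_adj_clinear has_comm_rank1(2)[OF dom ann_hb cre_hb])
  ultimately show "fst (R k) = fst (\<Sum>n<Suc k. cut k n *. Q n)" "snd (R k) = snd (\<Sum>n<Suc k. cut k n *. Q n)"
   using has_comm_unique[of ann] has_comm_unique[of cre] by (simp_all only: fst_sum snd_sum fst_scaleR snd_scaleR) blast+
 qed
 have A: "(%i. lform bt rh (R k) (V i)) ----> (\<Sum>n<Suc k. cut k n * t n)" for k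
 proof -
  have "lform bt rh (R k) (V i) = (\<Sum>n<Suc k. cut k n * Re (dstar_form (Lam bt rh (V i)) (W$$hb n) (a n) (c n) (hb n)
    (rt n *: hb (n - 1)) (rt (Suc n) *: hb (Suc n))))" for i
   unfolding R_sum lform_sum[OF rh] lform_scaleR[OF rh] Q_def lform_rank1[OF rh] ..
  thus ?thesis unfolding t_def
   by (simp only:) (intro tendsto_sum tendsto_mult tendsto_const tendsto_Re V dom ann_hb cre_hb)
 qed
 have T: "(%k. \<Sum>n<Suc k. cut k n * t n) ----> Re (trace (bop_adj W * y))"
 proof -
  have n: "nuclear (bop_adj W * y)" by (rule nuclear_mult_left[OF y])
  have s: "((%n. ip (W$$hb n) (y$$hb n)) has_sum trace (bop_adj W * y)) UNIV"
   using nuclear_trace_onb[OF n hb_onb] by (simp add: bop_times ip_adjr)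
  have "(%k. \<Sum>n. cut k n * t n) ----> (\<Sum>n. t n)"
  proof (rule tannery[where M="%n. cmod (ip (W$$hb n) (y$$hb n))"])
   show "abs (cut k n * t n) <= cmod (ip (W$$hb n) (y$$hb n))" for k n
   proof -
    have "abs (cut k n * t n) <= 1 * cmod (ip (W$$hb n) (y$$hb n))"
     unfolding abs_mult t_def by (intro mult_mono abs_Re_le_cmod) (simp_all add: cut_bounds)
    thus ?thesis by simp
   qed
   show "summable (%n. cmod (ip (W$$hb n) (y$$hb n)))"
    using has_sum_imp_summable[OF s] unfolding summable_on_iff_abs_summable_on_complex
    by (rule summable_on_imp_summable)
   show "(%k. cut k n * t n) ----> t n" for n using tendsto_mult[OF cut_tendsto tendsto_const, of n "t n"] by simp
  qed
  moreover have "(\<Sum>n. cut k n * t n) = (\<Sum>n<Suc k. cut k n * t n)" for k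
   by (rule suminf_finite) (auto simp: cut_bounds(3))
  moreover have "(\<Sum>n. t n) = Re (trace (bop_adj W * y))"
   unfolding t_def by (rule sums_unique[symmetric, OF has_sum_imp_sums[OF has_sum_Re[OF s]]])
  ultimately show ?thesis by simp
 qed
 \<comment> \<open>The defect tends to \<open>0\<close> in the local norm, and the norms of all
   \<open>V i\<close> are bounded by \<open>B\<close>; the resulting uniformity in \<open>i\<close>
   permits the exchange of the limits in \<open>k\<close> and \<open>i\<close>.\<close>
 define E where "E = (%k. (Wa, Wc) - R k)"
 have C: "(%k. sqrt (local_norm_sq bt rh (E k))) ----> 0"
 proof -
  obtain e r where eb: "eigenbasis rh e r" by (rule eigenb_ex[OF hb_onb rh])
  have inv: "(%k. M * (1 / rt (Suc k))) ----> 0" for M :: real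
   using tendsto_mult[OF tendsto_const tendsto_real_sqrt[OF LIMSEQ_inverse_real_of_nat], of M]
   by (simp add: real_sqrt_divide inverse_eq_divide del: of_nat_Suc)
  have S_le: "norm S <= 1" if "norm S <= 1 / rt (Suc k)" for S :: "real bop" and k
   using that by (rule order_trans) (simp add: divide_le_eq)
  have S_null: "(%k. S k$$ps) ----> 0" if "!!k. norm (S k) <= 1 / rt (Suc k)" for S :: "nat => real bop" and ps
  proof (rule Lim_null_comparison[OF always_eventually inv], intro allI)
   show "norm (S k$$ps) <= norm ps * (1 / rt (Suc k))" for k
    using order_trans[OF norm_bop_apply mult_right_mono[OF that norm_ge_zero]] by (simp add: mult.commute)
  qed
  have null: "(%k. Re (mean_form b rh (X - (X * cut_op k + W * S k)) (X - (X * cut_op k + W * S k)))) ----> 0"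
   if S: "!!k. norm (S k) <= 1 / rt (Suc k)" for X S b
  proof (rule mean_form_null[OF eb])
   fix ps
   have "(%k. X$$ps - (X$$cut_op k$$ps + W$$S k$$ps)) ----> X$$ps - (X$$ps + W$$0)"
    by (intro tendsto_diff tendsto_add tendsto_const tendsto_bop cut_op_tendsto S_null S)
   thus "(%k. (X - (X * cut_op k + W * S k))$$ps) ----> 0" by (simp add: bop_simps)
   have "(%k. bop_adj X$$ps - (cut_op k$$bop_adj X$$ps + bop_adj (S k)$$bop_adj W$$ps)) ----> bop_adj X$$ps - (bop_adj X$$ps + 0)"
    by (intro tendsto_diff tendsto_add tendsto_const cut_op_tendsto S_null) (simp add: S del: of_nat_Suc)
   thus "(%k. bop_adj (X - (X * cut_op k + W * S k))$$ps) ----> 0" by (simp add: bop_adj_simps bop_simps cut_op_adj)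
   have "norm (X * cut_op k + W * S k) <= norm X * 1 + norm W * 1" for k
    by (intro norm_triangle_mono order_trans[OF norm_mult_ineq] mult_left_mono norm_cut_op S_le[OF S]) auto
   thus "norm (X - (X * cut_op k + W * S k)) <= norm X + (norm X * 1 + norm W * 1)" for k
    by (intro order_trans[OF norm_triangle_ineq4] add_left_mono)
  qed
  have "(%k. local_norm_sq bt rh (E k)) ----> 0"
   unfolding lnorm_mean_form E_def R_def fst_diff snd_diff fst_conv snd_conv
   by (intro tendsto_add_zero null) (simp_all only: norm_minus_cancel norm_bop_adj norm_cut_comm)
  from tendsto_real_sqrt[OF this] show ?thesis by simp
 qed
 have B0: "0 <= B" using B[of 0] lform_nonneg[OF rh, of bt "V 0"] by (simp add: lnorm_form order_trans[rotated])
 show ?thesis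
 proof (rule LIMSEQ_I)
  fix ep :: real assume ep: "0 < ep"
  have "(%k. sqrt (local_norm_sq bt rh (E k)) * B) ----> 0" using tendsto_mult[OF C tendsto_const, of B] by simp
  hence "\<forall>\<^sub>F k in sequentially. sqrt (local_norm_sq bt rh (E k)) * B < ep / 3" by (rule order_tendstoD) (use ep in simp)
  moreover have "\<forall>\<^sub>F k in sequentially. dist (\<Sum>n<Suc k. cut k n * t n) (Re (trace (bop_adj W * y))) < ep / 3"
   by (rule tendstoD[OF T]) (use ep in simp)
  ultimately have "\<forall>\<^sub>F k in sequentially. sqrt (local_norm_sq bt rh (E k)) * B < ep / 3
    & dist (\<Sum>n<Suc k. cut k n * t n) (Re (trace (bop_adj W * y))) < ep / 3" by eventually_elim simp
  then obtain k where k: "sqrt (local_norm_sq bt rh (E k)) * B < ep / 3" "\<bar>(\<Sum>n<Suc k. cut k n * t n) - Re (trace (bop_adj W * y))\<bar> < ep / 3"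
   by (auto simp: eventually_sequentially dist_real_def)
  have "\<forall>\<^sub>F i in sequentially. dist (lform bt rh (R k) (V i)) (\<Sum>n<Suc k. cut k n * t n) < ep / 3"
   by (rule tendstoD[OF A]) (use ep in simp)
  then obtain N where N: "!!i. i >= N ==> \<bar>lform bt rh (R k) (V i) - (\<Sum>n<Suc k. cut k n * t n)\<bar> < ep / 3"
   by (auto simp: eventually_sequentially dist_real_def)
  have "norm (lform bt rh (Wa, Wc) (V i) - Re (trace (bop_adj W * y))) < ep" if "i >= N" for i
  proof -
   have "lform bt rh (Wa, Wc) (V i) - lform bt rh (R k) (V i) = lform bt rh (E k) (V i)"
    by (simp only: E_def lform_diff[OF rh])
   moreover have "abs (lform bt rh (E k) (V i)) <= sqrt (local_norm_sq bt rh (E k)) * B"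
    unfolding lnorm_form
    by (rule order_trans[OF lform_cs[OF rh] mult_left_mono]) (use B lform_nonneg[OF rh] in "auto simp: lnorm_form")
   ultimately show ?thesis using k N[OF that] unfolding real_norm_def by linarith
  qed
  thus "EX N. ALL i>=N. norm (lform bt rh (Wa, Wc) (V i) - Re (trace (bop_adj W * y))) < ep" by blast
 qed
qed

section \<open>The Wasserstein distance\<close>

lemma ennreal_le_cmult_Inf:
 assumes c: "0 < c" and le: "!!q. q:S ==> x <= ennreal c * q"
 shows "x <= ennreal c * Inf S"
proof -
 have one: "ennreal c * ennreal (1 / c) = 1" using c by (simp flip: ennreal_mult)
 hence one': "ennreal (1 / c) * ennreal c = 1" by (simp only: mult.commute)
 have "ennreal (1 / c) * x <= Inf S"
 proof (rule Inf_greatest)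
  fix q assume "q:S"
  hence "ennreal (1 / c) * x <= ennreal (1 / c) * (ennreal c * q)" by (intro mult_left_mono le) simp_all
  also have "... = q" by (simp only: mult.assoc[symmetric] one' mult_1)
  finally show "ennreal (1 / c) * x <= q" .
 qed
 hence "ennreal c * (ennreal (1 / c) * x) <= ennreal c * Inf S" by (rule mult_left_mono) simp
 thus ?thesis by (simp only: mult.assoc[symmetric] one mult_1)
qed

text \<open>No measurability is assumed: the integral of a non-measurable function is a lower integral.\<close>

lemma nn_integral_cmult_le:
 assumes c: "0 < c" shows "(\<integral>\<^sup>+x. ennreal c * f x \<partial>M) <= ennreal c * (\<integral>\<^sup>+x. f x \<partial>M)"
 unfolding nn_integral_def[of M "%x. ennreal c * f x"]
proof (rule SUP_least, clarify)
 fix g assume g: "simple_function M g" "g <= (%x. ennreal c * f x)"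
 have one: "ennreal c * ennreal (1 / c) = 1" using c by (simp flip: ennreal_mult)
 hence one': "ennreal (1 / c) * ennreal c = 1" by (simp only: mult.commute)
 have "ennreal (1 / c) * g x <= f x" for x
 proof -
  have "ennreal (1 / c) * g x <= ennreal (1 / c) * (ennreal c * f x)" using g(2) by (intro mult_left_mono) (auto simp: le_fun_def)
  thus ?thesis by (simp only: mult.assoc[symmetric] one' mult_1)
 qed
 hence "(\<integral>\<^sup>+x. ennreal (1 / c) * g x \<partial>M) <= (\<integral>\<^sup>+x. f x \<partial>M)" by (intro nn_integral_mono)
 hence "ennreal (1 / c) * (\<integral>\<^sup>+x. g x \<partial>M) <= (\<integral>\<^sup>+x. f x \<partial>M)"
  using borel_measurable_simple_function[OF g(1)] by (simp add: nn_integral_cmult)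
 hence "ennreal c * (ennreal (1 / c) * (\<integral>\<^sup>+x. g x \<partial>M)) <= ennreal c * (\<integral>\<^sup>+x. f x \<partial>M)" by (rule mult_left_mono) simp
 thus "integral\<^sup>S M g <= ennreal c * (\<integral>\<^sup>+x. f x \<partial>M)"
  by (simp only: mult.assoc[symmetric] one mult_1 nn_integral_eq_simple_integral[OF g(1)])
qed

section \<open>Push-forward of tangent vectors and curves\<close>

context beam_splitter_channel
begin

text \<open>A Cauchy sequence stands for an element of the completion; by Cauchy-Schwarz the pairing
  with a fixed \<open>X\<close> extends to it.\<close>

lemma lform_P_limit:
 fixes rh :: "real bop"
 assumes rh: "density_op rh"
  and cauchy: "ALL e>0. EX N. ALL m>=N. ALL n>=N. local_norm_sq bt rh (V m - V n) < e"
 shows "convergent (%i. lform bt rh X (V i))"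
proof (rule Cauchy_convergent, rule metric_CauchyI)
 fix e :: real assume e: "0 < e"
 define K where "K = sqrt (lform bt rh X X) + 1"
 have K: "0 < K" using lform_nonneg[OF rh, of bt X] by (simp add: K_def add_nonneg_pos)
 obtain N where N: "!!m n. m >= N ==> n >= N ==> local_norm_sq bt rh (V m - V n) < (e / K)^2"
  using cauchy[rule_format, of "(e / K)^2"] e K by auto
 have "dist (lform bt rh X (V m)) (lform bt rh X (V n)) < e" if "m >= N" "n >= N" for m n
 proof -
  have "lform bt rh X (V m) - lform bt rh X (V n) = lform bt rh X (V m - V n)"
   using lform_diff[OF rh, of bt "V m" "V n" X] by (simp only: lform_sym[OF rh, of bt X])
  hence "dist (lform bt rh X (V m)) (lform bt rh X (V n)) <= sqrt (lform bt rh X X) * sqrt (local_norm_sq bt rh (V m - V n))"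
   using lform_cs[OF rh, of bt X "V m - V n"] by (simp add: dist_real_def lnorm_form)
  also have "... <= K * sqrt (local_norm_sq bt rh (V m - V n))"
   using lform_nonneg[OF rh, of bt "V m - V n"] by (intro mult_right_mono) (simp_all add: K_def lnorm_form)
  also have "... < K * (e / K)"
   using N[OF that] e K real_sqrt_less_mono[of _ "(e / K)^2"] by (intro mult_strict_left_mono) (auto simp: real_less_lsqrt)
  finally show ?thesis using K by simp
 qed
 thus "EX N. ALL m>=N. ALL n>=N. dist (lform bt rh X (V m)) (lform bt rh X (V n)) < e" by blast
qed

text \<open>The image tangent vector is specified by its pairings: \<open>X\<close> goes to
  \<open>sqrt lam\<close> times the limit of the pairings of \<open>Q X\<close> with
  \<open>V i\<close>. By \<open>lnorm_contr\<close> this functional is bounded by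
  \<open>sqrt lam * r\<close> in the local norm at the image state, so a representing Cauchy
  sequence exists with that bound on its limit norm.\<close>

lemma tangent_norm_P:
 assumes lam0: "0 < lam" and rh: "density_op rh" and y: "nuclear y" and K: "kraus_family (K :: nat \<times> nat => real bop)" "P = kraus K"
 shows "tangent_norm bt (kdual K rh) (kdual K y) <= ennreal (sqrt lam) * tangent_norm bt rh y"
 unfolding tangent_norm_def[of bt rh]
proof (rule ennreal_le_cmult_Inf)
 show "0 < sqrt lam" using lam0 by simp
 let ?rh' = "kdual K rh" and ?y' = "kdual K y"
 have rh': "density_op ?rh'" by (rule kdual_density[OF K(1) rh])
 fix q assume "q:{ennreal r |r V.
  (ALL e>0. EX N. ALL m>=N. ALL n>=N. local_norm_sq bt rh (V m - V n) < e) &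
  (%n. sqrt (local_norm_sq bt rh (V n))) ----> r &
  (ALL ph pha phc ps psa psc. (ph, pha):ann & (ph, phc):cre &
    (ps, psa):ann & (ps, psc):cre -->
    (%n. dstar_form (Lam bt rh (V n)) ph pha phc ps psa psc) ----> ip ph (y$$ps))}"
 then obtain r V where q: "q = ennreal r"
  and cauchy: "ALL e>0. EX N. ALL m>=N. ALL n>=N. local_norm_sq bt rh (V m - V n) < e"
  and lim: "(%n. sqrt (local_norm_sq bt rh (V n))) ----> r"
  and V: "!!ph pha phc ps psa psc. (ph, pha):ann ==> (ph, phc):cre ==> (ps, psa):ann ==> (ps, psc):cre ==>
    (%i. dstar_form (Lam bt rh (V i)) ph pha phc ps psa psc) ----> ip ph (y$$ps)"
  by blast
 have r0: "0 <= r" by (rule LIMSEQ_le_const[OF lim]) (use lform_nonneg[OF rh] in "auto simp: lnorm_form")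
 obtain B where B: "!!i. sqrt (local_norm_sq bt rh (V i)) <= B"
  using Bseq_eq_bounded convergentI[OF lim, THEN convergent_imp_Bseq] unfolding Bseq_def by (metis abs_le_iff real_norm_def)
 define Q where "Q = (%X :: real bop \<times> real bop. (P (fst X), P (snd X)))"
 have Q: "Q (X + Y) = Q X + Q Y" "Q (t *. X) = t *. Q X" for X Y t
  by (simp_all add: Q_def K(2) kraus_add[OF K(1)] kraus_scaleR[OF K(1)] prod_eq_iff)
 define L where "L = (%X. lim (%i. lform bt rh (Q X) (V i)))"
 have L: "(%i. lform bt rh (Q X) (V i)) ----> L X" for X
  unfolding L_def using lform_P_limit[OF rh cauchy] by (simp add: convergent_LIMSEQ_iff)
 have bound: "abs (L X) <= sqrt (lform bt ?rh' X X) * r" for X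
 proof (rule LIMSEQ_le[OF tendsto_rabs[OF L] tendsto_mult[OF tendsto_const lim]], intro exI allI impI)
  fix n
  have "sqrt (lform bt rh (Q X) (Q X)) <= sqrt (lform bt ?rh' X X)"
   using lnorm_contr[OF rh, of bt "fst X" "snd X"]
   by (simp add: Q_def lnorm_form K(2) predual_kraus[OF K(1) rh])
  thus "abs (lform bt rh (Q X) (V n)) <= sqrt (lform bt ?rh' X X) * sqrt (local_norm_sq bt rh (V n))"
   unfolding lnorm_form using lform_nonneg[OF rh]
   by (intro order_trans[OF lform_cs[OF rh]] mult_right_mono) auto
 qed
 define l where "l = (%X. sqrt lam * L X)"
 have l_add: "l (X + Y) = l X + l Y" for X Y
  using LIMSEQ_unique[OF L[of "X + Y"], of "L X + L Y"] tendsto_add[OF L[of X] L[of Y]]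
  by (simp add: l_def Q lform_add[OF rh] distrib_left)
 have l_scale: "l (t *. X) = t * l X" for X t
  using LIMSEQ_unique[OF L[of "t *. X"], of "t * L X"] tendsto_mult[OF tendsto_const L[of X], of t]
  by (simp add: l_def Q lform_scaleR[OF rh])
 have l_bound: "abs (l X) <= sqrt lam * r * sqrt (lform bt ?rh' X X)" for X
  using mult_left_mono[OF bound[of X], of "sqrt lam"] lam by (simp add: l_def abs_mult mult_ac)
 obtain w r' where w: "ALL e>0. EX N. ALL m>=N. ALL n>=N. lform bt ?rh' (w m - w n) (w m - w n) < e"
  "!!X. (%n. lform bt ?rh' (w n) X) ----> l X"
  "(%n. sqrt (lform bt ?rh' (w n) (w n))) ----> r'" "0 <= r'" "r' <= sqrt lam * r"
  by (rule semi_inner_riesz[of "lform bt ?rh'" l "sqrt lam * r", OF lform_add[OF rh'] lform_scaleR[OF rh']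
    lform_sym[OF rh'] lform_nonneg[OF rh'] l_add l_scale l_bound]) (use lam r0 in "auto intro: that")
 have re: "(%n. Re (dstar_form (Lam bt ?rh' (w n)) ph pha phc ps psa psc)) ----> Re (ip ph (?y'$$ps))"
  if d: "(ph, pha):ann" "(ph, phc):cre" "(ps, psa):ann" "(ps, psc):cre" for ph pha phc ps psa psc
 proof -
  define Z where "Z = (rank1 pha ps - rank1 ph psc, rank1 phc ps - rank1 ph psa)"
  \<comment> \<open>The gradient of \<open>P (rank1 ph ps)\<close> is \<open>sqrt lam\<close> times
    the image of the gradient \<open>Z\<close>; this matches the factor in \<open>l\<close>.\<close>
  have comm: "has_comm ann (P (rank1 ph ps)) (sqrt lam *. P (fst Z))" "has_comm cre (P (rank1 ph ps)) (sqrt lam *. P (snd Z))"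
   unfolding Z_def fst_conv snd_conv by (intro P_comm has_comm_rank1[OF d]; simp)+
  have "(%i. lform bt rh (sqrt lam *. Q Z) (V i)) ----> Re (trace (bop_adj (P (rank1 ph ps)) * y))"
   using commutator_pairing[OF rh y B V comm] by (simp add: Q_def)
  hence "(%i. sqrt lam * lform bt rh (Q Z) (V i)) ----> Re (trace (bop_adj (P (rank1 ph ps)) * y))"
   by (simp only: lform_scaleR[OF rh])
  hence lZ: "l Z = Re (trace (bop_adj (P (rank1 ph ps)) * y))"
   unfolding l_def by (rule LIMSEQ_unique[OF tendsto_mult[OF tendsto_const L]])
  have "trace (bop_adj (P (rank1 ph ps)) * y) = trace (y * kraus K (rank1 ps ph))"
   by (simp add: K(2) kraus_adj[OF K(1), symmetric] rank1_adj trace_commute[OF y])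
  also have "... = ip ph (?y'$$ps)"
   by (simp add: trace_kdual[OF K(1) y, symmetric] trace_rank1 kdual_nuclear[OF K(1) y])
  finally have "l Z = Re (ip ph (?y'$$ps))" by (simp add: lZ)
  thus ?thesis using w(2)[of Z] unfolding lform_sym[OF rh', of bt "w _"] Z_def lform_rank1[OF rh'] by simp
 qed
 have id: "(%n. dstar_form (Lam bt ?rh' (w n)) ph pha phc ps psa psc) ----> ip ph (?y'$$ps)"
  if d: "(ph, pha):ann" "(ph, phc):cre" "(ps, psa):ann" "(ps, psc):cre" for ph pha phc ps psa psc
 proof -
  \<comment> \<open>Only real parts are known so far; rotating \<open>ph\<close> by
    \<open>\<i>\<close> yields the imaginary part.\<close>
  have i: "dstar_form Y (\<i> *: ph) (\<i> *: pha) (\<i> *: phc) ps psa psc = - \<i> * dstar_form Y ph pha phc ps psa psc" for Y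
   by (simp add: dstar_form_def ip_simps algebra_simps)
  have "(%n. Re (dstar_form (Lam bt ?rh' (w n)) (\<i> *: ph) (\<i> *: pha) (\<i> *: phc) ps psa psc)) ----> Re (ip (\<i> *: ph) (?y'$$ps))"
   by (rule re[OF clinD(3)[OF ann_lin d(1)] clinD(3)[OF uop_adj_clinear d(2)] d(3,4)])
  hence "(%n. Im (dstar_form (Lam bt ?rh' (w n)) ph pha phc ps psa psc)) ----> Im (ip ph (?y'$$ps))"
   unfolding i ip_scaleCl by simp
  with re[OF d] show ?thesis unfolding tendsto_complex_iff ..
 qed
 have "tangent_norm bt ?rh' ?y' <= ennreal r'"
  unfolding tangent_norm_def
  by (rule Inf_lower, intro CollectI exI[of _ r'] exI[of _ w] conjI refl) (use w(1,3) id in "simp_all add: lnorm_form")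
 also have "... <= ennreal (sqrt lam) * q"
  using w(5) lam r0 by (simp add: q ennreal_leI flip: ennreal_mult)
 finally show "tangent_norm bt ?rh' ?y' <= ennreal (sqrt lam) * q" .
qed

lemma abs_continuous_curve_P:
 assumes K: "kraus_family (K :: nat \<times> nat => real bop)"
  and ga: "!!t. t:{0..1} ==> density_op (ga t)" "abs_continuous_curve ga"
 shows "abs_continuous_curve (%t. kdual K (ga t))"
 unfolding abs_continuous_curve_def
proof (intro allI impI)
 fix e :: real assume "0 < e"
 then obtain d where d0: "0 < d" and d: "ALL (n::nat) s t.
  (ALL i<n. 0 <= s i & s i <= t i & t i <= 1) &
  (ALL i<n. ALL j<n. i ~= j --> {s i<..<t i} \<inter> {s j<..<t j} = {}) & (\<Sum>i<n. t i - s i) < d -->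
  (\<Sum>i<n. trace_norm (ga (t i) - ga (s i))) < e"
  using ga(2)[unfolded abs_continuous_curve_def, rule_format, of e] by blast
 have "(\<Sum>i<n. trace_norm (kdual K (ga (t i)) - kdual K (ga (s i)))) < e"
  if st: "ALL i<n. 0 <= s i & s i <= t i & t i <= 1" "ALL i<n. ALL j<n. i ~= j --> {s i<..<t i} \<inter> {s j<..<t j} = {}"
   "(\<Sum>i<n. t i - s i) < d" for n :: nat and s t
 proof (rule order_le_less_trans[OF sum_mono d[rule_format, OF conjI[OF st(1) conjI[OF st(2,3)]]]])
  fix i assume "i:{..<n}"
  hence "0 <= s i" "s i <= t i" "t i <= 1" using st(1) by auto
  hence n: "nuclear (ga (t i))" "nuclear (ga (s i))" using ga(1) by (auto intro!: density_nuc)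
  show "trace_norm (kdual K (ga (t i)) - kdual K (ga (s i))) <= trace_norm (ga (t i) - ga (s i))"
   unfolding kdual_diff[OF K n, symmetric] by (rule trace_norm_kdual[OF K nuclear_diff[OF n]])
 qed
 thus "EX d>0. ALL (n::nat) s t. (ALL i<n. 0 <= s i & s i <= t i & t i <= 1) &
  (ALL i<n. ALL j<n. i ~= j --> {s i<..<t i} \<inter> {s j<..<t j} = {}) & (\<Sum>i<n. t i - s i) < d -->
  (\<Sum>i<n. trace_norm (kdual K (ga (t i)) - kdual K (ga (s i)))) < e"
  using d0 by (intro exI[of _ d]) simp
qed

lemma has_tangent_P:
 assumes K: "kraus_family (K :: nat \<times> nat => real bop)"
  and ga: "!!t. t:{0..1} ==> density_op (ga t)" "has_tangent ga t y" and t: "t:{0..1}"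
 shows "has_tangent (%t. kdual K (ga t)) t (kdual K y)"
proof -
 have y: "nuclear y" and lim: "((%s. trace_norm ((ga s - ga t) /\<^sub>R (s - t) - y)) \<longlongrightarrow> 0) (at t within {0..1})"
  using ga(2) by (auto simp: has_tangent_def tc_iff_nuclear)
 have le: "0 <= trace_norm ((kdual K (ga s) - kdual K (ga t)) /\<^sub>R (s - t) - kdual K y)
   & trace_norm ((kdual K (ga s) - kdual K (ga t)) /\<^sub>R (s - t) - kdual K y) <= trace_norm ((ga s - ga t) /\<^sub>R (s - t) - y)"
  if "s:{0..1}" for s
 proof -
  have n: "nuclear (ga s)" "nuclear (ga t)" using ga(1) that t by (auto intro!: density_nuc)
  hence n': "nuclear ((ga s - ga t) /\<^sub>R (s - t) - y)" using y by (intro nuclear_diff nuclear_scaleR)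
  have "(kdual K (ga s) - kdual K (ga t)) /\<^sub>R (s - t) - kdual K y = kdual K ((ga s - ga t) /\<^sub>R (s - t) - y)"
   using n y by (simp add: kdual_diff[OF K] kdual_scaleR[OF K] nuclear_diff nuclear_scaleR)
  thus ?thesis
   using trace_norm_kdual[OF K n'] trace_norm_nonneg[OF kdual_nuclear[OF K n']] by simp
 qed
 have "((%s. trace_norm ((kdual K (ga s) - kdual K (ga t)) /\<^sub>R (s - t) - kdual K y)) \<longlongrightarrow> 0) (at t within {0..1})"
  by (rule tendsto_sandwich[OF _ _ tendsto_const lim]) (use le in "auto simp: eventually_at intro!: exI[of _ 1]")
 thus ?thesis by (simp add: has_tangent_def tc_iff_nuclear kdual_nuclear[OF K y])
qed

text \<open>Every competing curve is pushed forward by \<open>kdual K\<close> together with its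
  tangents. Absolute continuity and differentiability survive because this map is linear and
  contracts the trace norm.\<close>

lemma W2_P:
 assumes lam0: "0 < lam" and K: "kraus_family (K :: nat \<times> nat => real bop)" "P = kraus K"
 shows "W2 bt (kdual K rh1) (kdual K rh2) <= ennreal (sqrt lam) * W2 bt rh1 rh2"
 unfolding W2_def[of bt rh1]
proof (rule ennreal_le_cmult_Inf)
 show s0: "0 < sqrt lam" using lam0 by simp
 fix q assume "q:{\<integral>\<^sup>+t\<in>{0..1}. tangent_norm bt (ga t) (y t) \<partial>lborel |ga y.
  (ALL t:{0..1}. density_op (ga t)) & ga 0 = rh1 & ga 1 = rh2 & abs_continuous_curve ga &
  (AE t in lborel. t:{0..1} --> has_tangent ga t (y t))}"
 then obtain ga y where q: "q = (\<integral>\<^sup>+t\<in>{0..1}. tangent_norm bt (ga t) (y t) \<partial>lborel)"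
  and ga: "!!t. t:{0..1} ==> density_op (ga t)" "ga 0 = rh1" "ga 1 = rh2" "abs_continuous_curve ga"
  and y: "AE t in lborel. t:{0..1} --> has_tangent ga t (y t)" by blast
 let ?ga = "%t. kdual K (ga t)" and ?y = "%t. kdual K (y t)"
 have "AE t in lborel. t:{0..1} --> has_tangent ?ga t (?y t)"
  using y by eventually_elim (auto intro: has_tangent_P[OF K(1) ga(1)])
 hence "W2 bt (kdual K rh1) (kdual K rh2) <= (\<integral>\<^sup>+t\<in>{0..1}. tangent_norm bt (?ga t) (?y t) \<partial>lborel)"
  unfolding W2_def using ga kdual_density[OF K(1)] abs_continuous_curve_P[OF K(1) ga(1,4)]
  by (intro Inf_lower CollectI exI[of _ ?ga] exI[of _ ?y]) auto
 also have "... <= (\<integral>\<^sup>+t. ennreal (sqrt lam) * (tangent_norm bt (ga t) (y t) * indicator {0..1} t) \<partial>lborel)"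
 proof (rule nn_integral_mono_AE, use y in eventually_elim)
  case (elim t)
  thus ?case using tangent_norm_P[OF lam0 ga(1) _ K, of t "y t" bt]
   by (cases "t:{0..1}") (auto simp: has_tangent_def tc_iff_nuclear)
 qed
 also have "... <= ennreal (sqrt lam) * q" unfolding q by (rule nn_integral_cmult_le[OF s0])
 finally show "W2 bt (kdual K rh1) (kdual K rh2) <= ennreal (sqrt lam) * q" .
qed

lemma W2_same:
 fixes ta :: "real bop"
 assumes ta: "density_op ta" shows "W2 bt ta ta = 0"
proof -
 have n0: "nuclear (0 :: real bop)" by (rule nuclear_zero)
 have tn: "trace_norm (0 :: real bop) = 0"
  using trace_norm_le[of "0 :: real bop" "%_. 0" "%_. 0" "{}"] trace_norm_nonneg[OF n0] by (simp add: nuclear_on_def)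
 have "tangent_norm bt ta 0 <= ennreal 0"
  unfolding tangent_norm_def
 proof (rule Inf_lower, intro CollectI exI[of _ 0] exI[of _ "%_. (0, 0)"] conjI)
  show "ALL e>0. EX N. ALL m>=N. ALL n>=N. local_norm_sq bt ta ((0, 0) - (0, 0)) < e"
   "(%n. sqrt (local_norm_sq bt ta (0, 0))) ----> 0"
   using lform_zero[OF ta, of bt "(0, 0)"] by (simp_all add: lnorm_form zero_prod_def)
 qed (simp_all add: dstar_form_def Lam_def weighted_mean_zero[OF ta])
 hence t0: "tangent_norm bt ta 0 = 0" by simp
 have ac: "abs_continuous_curve (%_. ta)" by (auto simp: abs_continuous_curve_def tn intro!: exI[of _ 1])
 have ht: "has_tangent (%_. ta) t 0" for t by (simp add: has_tangent_def tn tc_iff_nuclear n0)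
 have "W2 bt ta ta <= (\<integral>\<^sup>+t\<in>{0..1}. tangent_norm bt ta 0 \<partial>(lborel :: real measure))"
  unfolding W2_def
  by (rule Inf_lower, intro CollectI exI[of _ "%_. ta"] exI[of _ "%_. 0"] conjI refl) (use ta ac ht in auto)
 thus ?thesis by (simp add: t0)
qed

text \<open>At \<open>lam = 0\<close> the operators \<open>P (rank1 _ _)\<close> commute with \<open>a\<close> and \<open>a\<^sup>*\<close>, hence are scalar.\<close>

lemma P_dual_constant:
 assumes lam0: "lam = 0" and K: "kraus_family (K :: nat \<times> nat => real bop)" "P = kraus K" and rh: "density_op rh1" "density_op rh2"
 shows "kdual K rh1 = kdual K rh2"
proof (rule bop_eqI_onb[OF hb_onb], rule onb_on_eqI[OF hb_onb])
 fix m n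
 let ?Z = "rank1 (hb n) (hb m)"
 note d = ann_hb cre_hb ann_hb cre_hb
 have comm: "has_comm ann (P ?Z) 0" "has_comm cre (P ?Z) 0"
  using P_comm[OF _ has_comm_rank1(1)[OF d, of n m]] P_comm[OF _ has_comm_rank1(2)[OF d, of n m]] by (simp_all add: lam0)
 define M where "M = (%i j. ip (hb i) (P ?Z$$hb j))"
 \<comment> \<open>Commuting with \<open>ann\<close> determines each diagonal from its first entry
   and, at \<open>j = 0\<close>, makes the first column vanish below \<open>M 0 0\<close>.\<close>
 have low: "M i (j - 1) * rt j = rt (Suc i) * M (Suc i) j" for i j
  using bspec[OF comm(1)[unfolded has_comm_def] ann_hb[of j]]
  by (simp add: ann_weak M_def bop_simps ip_simps mult.commute del: of_nat_Suc)
 \<comment> \<open>Commuting with \<open>cre\<close> removes the first row beyond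
   \<open>M 0 0\<close>, since a vector in the range of \<open>cre\<close> has no coefficient at
   \<open>0\<close>.\<close>
 have up: "M 0 (Suc j) = 0" for j
 proof -
  have "(P ?Z$$hb j, P ?Z$$(rt (Suc j) *: hb (Suc j)) + 0$$hb j):cre"
   using bspec[OF comm(2)[unfolded has_comm_def] cre_hb[of j]] by simp
  hence "ip (hb 0) (P ?Z$$(rt (Suc j) *: hb (Suc j)) + 0$$hb j) = rt 0 * ip (hb (0 - 1)) (P ?Z$$hb j)"
   unfolding cre_weak by blast
  thus ?thesis by (simp add: M_def bop_simps ip_simps del: of_nat_Suc)
 qed
 have "M i j = (if i = j then M 0 0 else 0)" for i j
 proof (induction i arbitrary: j)
  case 0
  show ?case using up by (cases j) auto
 next
  case (Suc i)
  show ?case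
  proof (cases j)
   case 0
   thus ?thesis using low[of i 0] by (simp del: of_nat_Suc)
  next
   case (Suc j')
   have "of_real (rt (Suc i)) * M (Suc i) j = of_real (rt j) * (if i = j' then M 0 0 else 0)"
    using low[of i j] Suc.IH[of j'] Suc by (simp add: mult.commute del: of_nat_Suc)
   thus ?thesis using Suc by (auto simp del: of_nat_Suc split: if_splits)
  qed
 qed
 hence M: "ip (hb i) (P ?Z$$hb j) = (if i = j then M 0 0 else 0)" for i j unfolding M_def .
 have PZ: "P ?Z = M 0 0 *: 1"
  by (rule bop_eqI_onb[OF hb_onb], rule onb_on_eqI[OF hb_onb]) (simp add: M bop_simps ip_simps ip_hb)
 have "ip (hb m) (kdual K rh$$hb n) = M 0 0" if rh: "density_op rh" for rh
 proof -
  note nrh = density_nuc[OF rh]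
  have "ip (hb m) (kdual K rh$$hb n) = trace (kdual K rh * ?Z)"
   by (simp add: trace_rank1 kdual_nuclear[OF K(1) nrh])
  also have "... = trace (rh * (M 0 0 *: 1))" by (simp add: trace_kdual[OF K(1) nrh] PZ flip: K(2))
  also have "rh * (M 0 0 *: 1) = M 0 0 *: rh" by (rule bop_eqI) (simp add: bop_simps)
  finally show ?thesis by (simp add: trace_scaleC[OF nrh] density_op_trace[OF rh])
 qed
 thus "ip (hb m) (kdual K rh1$$hb n) = ip (hb m) (kdual K rh2$$hb n)" using rh by simp
qed

text \<open>Squaring the distance turns \<open>sqrt lam\<close> into \<open>lam\<close>. At
  \<open>lam = 0\<close> the two image states coincide, so both sides are \<open>0\<close>.\<close>

lemma cost_W2_contr: "coarse_ricci_ge (cost_W2 bt) P (1 - lam)"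
 unfolding coarse_ricci_ge_def
proof (intro allI impI, elim conjE)
 fix om1 om2 :: "real bop => complex"
 assume n: "normal_state om1" "normal_state om2" and fin: "cost_W2 bt om1 om2 < \<infinity>"
 obtain rh1 rh2 where rh: "density_op rh1" "om1 = state_of rh1" "density_op rh2" "om2 = state_of rh2"
  using n unfolding normal_state_def by blast
 obtain K :: "nat \<times> nat => real bop" where K: "kraus_family K" "P = kraus K" by (rule P_kraus)
 have cost: "cost_W2 bt om1 om2 = ereal (1/2) * (enn2ereal (W2 bt rh1 rh2))^2"
  by (simp add: cost_W2_def rh density_of_state_of)
 have "om1 \<circ> P = state_of (kdual K rh1)" "om2 \<circ> P = state_of (kdual K rh2)"
  unfolding rh(2,4) K(2) by (rule state_of_kraus[OF K(1)], rule rh)+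
 hence costP: "cost_W2 bt (om1 \<circ> P) (om2 \<circ> P) = ereal (1/2) * (enn2ereal (W2 bt (kdual K rh1) (kdual K rh2)))^2"
  by (simp add: cost_W2_def density_of_state_of kdual_density[OF K(1)] rh)
 show "cost_W2 bt (om1 \<circ> P) (om2 \<circ> P) <= ereal (1 - (1 - lam)) * cost_W2 bt om1 om2"
 proof (cases "lam = 0")
  case True
  have "W2 bt (kdual K rh1) (kdual K rh2) = 0"
   unfolding P_dual_constant[OF True K rh(1,3)] by (rule W2_same[OF kdual_density[OF K(1) rh(3)]])
  hence "cost_W2 bt (om1 \<circ> P) (om2 \<circ> P) = 0" by (simp add: costP zero_ennreal.rep_eq power2_eq_square)
  moreover have "ereal (1 - (1 - lam)) = 0" by (simp add: True zero_ereal_def)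
  ultimately show ?thesis by (simp only: ereal_zero_mult order_refl)
 next
  case False
  hence lam0: "0 < lam" using lam by simp
  have "W2 bt rh1 rh2 ~= \<infinity>" using fin by (auto simp: cost power2_eq_square)
  then obtain w where w: "W2 bt rh1 rh2 = ennreal w" "0 <= w" by (cases "W2 bt rh1 rh2") auto
  have "W2 bt (kdual K rh1) (kdual K rh2) <= ennreal (sqrt lam * w)"
   using W2_P[OF lam0 K, of bt rh1 rh2] w lam by (simp add: ennreal_mult)
  then obtain v where v: "W2 bt (kdual K rh1) (kdual K rh2) = ennreal v" "0 <= v"
   by (cases "W2 bt (kdual K rh1) (kdual K rh2)") (auto simp: top_unique)
  have "v <= sqrt lam * w" using \<open>_ <= ennreal (sqrt lam * w)\<close> v lam w(2) by simp
  hence "v\<^sup>2 <= (sqrt lam * w)^2" using v(2) by (intro power_mono)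
  hence "v\<^sup>2 <= lam * w\<^sup>2" using lam by (simp add: power_mult_distrib)
  thus ?thesis using v(2) w(2) by (simp add: cost costP v(1) w(1))
 qed
qed

end

theorem proposition6p2:
  fixes lam \<beta> :: real and \<sigma> :: "real bop"
  assumes "0 \<le> lam" and "lam \<le> 1" and "density_op \<sigma>" and "0 < \<beta>"
  shows
    "(\<forall>x. schwartz_op x \<longrightarrow>
        (\<forall>A\<in>{annihilation, creation}.
           bounded_comm A x \<and> bounded_comm A (beam_splitter lam \<sigma> x) \<and>
           comm A (beam_splitter lam \<sigma> x) = sqrt lam *\<^sub>R beam_splitter lam \<sigma> (comm A x))) \<and>
     (\<forall>x. schwartz_op x \<longrightarrow> lip_norm (beam_splitter lam \<sigma> x) \<le> ereal (sqrt lam) * lip_norm x) \<and>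
     coarse_ricci_ge cost_lip (beam_splitter lam \<sigma>) (1 - sqrt lam) \<and>
     (\<forall>\<rho> x. density_op \<rho> \<and> schwartz_op x \<longrightarrow>
        local_norm_sq \<beta> \<rho> (grad (beam_splitter lam \<sigma> x))
          \<le> lam * local_norm_sq \<beta> (predual (beam_splitter lam \<sigma>) \<rho>) (grad x)) \<and>
     coarse_ricci_ge (cost_W2 \<beta>) (beam_splitter lam \<sigma>) (1 - lam)"
proof -
  interpret beam_splitter_channel lam \<sigma> by unfold_locales (fact assms)+
  have lip: "lip_norm x < \<infinity>" if "schwartz_op x" for x
    using schwartz_bounded_comm[OF that] by (auto simp: lip_norm_def max_def)
  show ?thesis
  proof (intro conjI allI impI ballI; (elim conjE)?)
    fix x A assume x: "schwartz_op x" and A: "A \<in> {annihilation, creation}"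
    note b = schwartz_bounded_comm[OF x A]
    show "bounded_comm A x" by (rule b)
    show "bounded_comm A (P x)" "comm A (P x) = sqrt lam *\<^sub>R P (comm A x)" by (rule comm_P[OF A b])+
  next
    fix x assume "schwartz_op x"
    then show "lip_norm (P x) \<le> ereal (sqrt lam) * lip_norm x" by (intro lip_norm_P lip)
  next
    fix \<rho> :: "real bop" and x assume "density_op \<rho>" "schwartz_op x"
    then show "local_norm_sq \<beta> \<rho> (grad (P x)) \<le> lam * local_norm_sq \<beta> (predual P \<rho>) (grad x)"
      using schwartz_bounded_comm[of x] by (intro lnorm_grad) simp_all
  qed (rule cost_lip_contr cost_W2_contr)+
qed

end
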